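(* Let $\Delta$ be a $(d-1)$-dimensional simplicial complex with homologically isolated singularities. Then for any l.s.o.p. $\Theta$ of $k[\Delta]$, the Hilbert series of $k(\Delta,\Theta)=k[\Delta]/(\Theta)$ is equal to $\sum_{i=0}^d h'_i(\Delta)\lambda^i$, where (for $0\leq i \leq d$) $$h'_i(\Delta)=h_i(\Delta) + \binom{d}{i}\sum_{j=1}^{i-1}(-1)^{i-j-1}\beta_{j-1}(\Delta) +\binom{d-1}{i}\left[\mathcal{K}_{i-1}(\Delta)- \sum_{v\in V} \sum_{j=1}^{i-2}(-1)^{i-j}\beta_{j-1}(\operatorname{lk} v)\right].$$
   Context: Fix an infinite field $k$. $\Delta$ is a simplicial complex on vertex set $V$, $h_i$ its $h$-vector, $\beta_i(\cdot)=\dim_k\tilde H_i(\cdot;k)$ the reduced Betti numbers, and $\operatorname{lk} v$ the vertex link. $k[\Delta]$ is the Stanley–Reisner ring; an l.s.o.p. is a set of $d$ linear forms $\Theta$ with $k[\Delta]/(\Theta)$ finite-dimensional. A pure complex is $k$-CM if every face link (including of $\emptyset$) has vanishing reduced homology below its top dimension, $k$-Buchsbaum if all vertex links are $k$-CM, and a space with isolated singularities if all vertex links are $k$-Buchsbaum. For $v\in V$ let $\operatorname{cost} v=\{F\in\Delta: v\notin F\}$, $H^i_{\{v\}}(\Delta)=H^i(\Delta,\operatorname{cost}v;k)\cong\tilde H^{i-1}(\operatorname{lk}v;k)$, $H^i_\emptyset(\Delta)=\tilde H^i(\Delta;k)$, and $\iota^*:H^i_{\{v\}}(\Delta)\to H^i_\emptyset(\Delta)$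 the map induced by inclusion. For $\theta=\sum_v a_vx_v$ with all $a_v\neq0$ let $f^{i,\theta}=\sum_v a_v\iota^*:\bigoplus_v H^i_{\{v\}}(\Delta)\to H^i_\emptyset(\Delta)$. $\Delta$ has homologically isolated singularities if it is a space with isolated singularities and for all $0\le i\le d-2$ the images $\iota^*(H^i_{\{v\}}(\Delta))$, $v\in V$, are linearly independent subspaces of $H^i_\emptyset(\Delta)$; then $\mathcal{K}_i(\Delta):=\dim_k\ker f^{i,\theta}$ is independent of $\theta$. *)

theory Defs
  imports
    "HOL-Library.Poly_Mapping"
    "HOL-Computational_Algebra.Formal_Power_Series"
    "HOL-Algebra.QuotRing"
    "Jordan_Normal_Form.VS_Connect"
begin

section \<open>Vector spaces over the field type \<open>'k\<close>\<close>

text \<open>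
  Vector spaces are module records over \<^term>\<open>class_ring :: 'k::field ring\<close>, the type \<open>'k\<close>
  seen as a field record. The fields \<^const>\<open>mult\<close> and \<^const>\<open>one\<close> of a module record are
  irrelevant unless the record is meant as an algebra.
\<close>

abbreviation vdim :: "('k::field, 'a, 'm) module_scheme \<Rightarrow> nat"
  where "vdim M \<equiv> vectorspace.dim class_ring M"

text \<open>
  The quotient of a module by a submodule, or of an algebra by an ideal: this is
  \<^term>\<open>M Quot N\<close> with the induced scalar multiplication.
\<close>

definition quot_mod :: "('k, 'a, 'm) module_scheme \<Rightarrow> 'a set \<Rightarrow> ('k, 'a set) module"
  where "quot_mod M N =
    \<lparr>carrier = a_rcosets\<^bsub>M\<^esub> N, mult = rcoset_mult M N,
      one = N +>\<^bsub>M\<^esub> \<one>\<^bsub>M\<^esub>, zero = N, add = set_add M,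
      smult = (\<lambda>c X. \<Union>x\<in>X. N +>\<^bsub>M\<^esub> (c \<odot>\<^bsub>M\<^esub> x))\<rparr>"

definition direct_sum_mod ::
    "'i set \<Rightarrow> ('i \<Rightarrow> ('k, 'a, 'm) module_scheme) \<Rightarrow> ('k, 'i \<Rightarrow> 'a) module"
  \<comment> \<open>only used for finite index sets, where direct sum and direct product coincide\<close>
  where "direct_sum_mod I M =
    \<lparr>carrier = (\<Pi>\<^sub>E i\<in>I. carrier (M i)), mult = undefined, one = undefined,
      zero = (\<lambda>i\<in>I. \<zero>\<^bsub>M i\<^esub>), add = (\<lambda>x y. \<lambda>i\<in>I. x i \<oplus>\<^bsub>M i\<^esub> y i),
      smult = (\<lambda>c x. \<lambda>i\<in>I. c \<odot>\<^bsub>M i\<^esub> x i)\<rparr>"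

definition indep_subspaces :: "('k, 'a, 'm) module_scheme \<Rightarrow> 'i set \<Rightarrow> ('i \<Rightarrow> 'a set) \<Rightarrow> bool"
  where "indep_subspaces M I W \<longleftrightarrow>
    (\<forall>w\<in>(\<Pi> i\<in>I. W i). finsum M w I = \<zero>\<^bsub>M\<^esub> \<longrightarrow> (\<forall>i\<in>I. w i = \<zero>\<^bsub>M\<^esub>))"

definition fun_mod :: "('x \<Rightarrow> 'k::field) set \<Rightarrow> ('k, 'x \<Rightarrow> 'k) module"
  where "fun_mod S =
    \<lparr>carrier = S, mult = undefined, one = undefined, zero = (\<lambda>_. 0),
      add = (\<lambda>f g x. f x + g x), smult = (\<lambda>c f x. c * f x)\<rparr>"


section \<open>Simplicial complexes\<close>

text \<open>
  The vertex set \<open>V\<close> of a complex \<open>\<Delta>\<close> is \<open>\<Union>\<Delta>\<close>. A complex contains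
  the empty face, so \<open>{{}}\<close> is the complex of dimension \<open>-1\<close>.
\<close>

definition simplicial_complex :: "'v set set \<Rightarrow> bool"
  where "simplicial_complex \<Delta> \<longleftrightarrow>
    finite (\<Union>\<Delta>) \<and> {} \<in> \<Delta> \<and> (\<forall>F\<in>\<Delta>. \<forall>G. G \<subseteq> F \<longrightarrow> G \<in> \<Delta>)"

definition sc_dim :: "'v set set \<Rightarrow> int"
  where "sc_dim \<Delta> = int (Max (card ` \<Delta>)) - 1"

definition pure_complex :: "'v set set \<Rightarrow> bool"
  where "pure_complex \<Delta> \<longleftrightarrow>
    (\<forall>F\<in>\<Delta>. (\<forall>G\<in>\<Delta>. F \<subseteq> G \<longrightarrow> G = F) \<longrightarrow> int (card F) = sc_dim \<Delta> + 1)"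

definition link :: "'v set set \<Rightarrow> 'v set \<Rightarrow> 'v set set"
  where "link \<Delta> F = {G \<in> \<Delta>. F \<inter> G = {} \<and> F \<union> G \<in> \<Delta>}"

abbreviation vlink :: "'v set set \<Rightarrow> 'v \<Rightarrow> 'v set set"
  where "vlink \<Delta> v \<equiv> link \<Delta> {v}"

definition cost :: "'v set set \<Rightarrow> 'v \<Rightarrow> 'v set set"
  where "cost \<Delta> v = {F \<in> \<Delta>. v \<notin> F}"

text \<open>
  From \<open>(\<Sum>i. h\<^sub>i t\<^sup>i) = (\<Sum>j. f\<^sub>j\<^sub>-\<^sub>1 t\<^sup>j (1 - t)\<^bsup>d-j\<^esup>)\<close> with \<open>d = dim \<Delta> + 1\<close>;
  only meaningful for \<open>i \<le> d\<close>, where the natural-number subtractions do not truncate.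
\<close>

definition h_vec :: "'v set set \<Rightarrow> nat \<Rightarrow> int"
  where "h_vec \<Delta> i = (let d = nat (sc_dim \<Delta> + 1) in
    \<Sum>j=0..i. (-1) ^ (i - j) * int ((d - j) choose (i - j)) * int (card {F \<in> \<Delta>. card F = j}))"


section \<open>Reduced simplicial homology and relative cohomology\<close>

text \<open>
  Faces are oriented by the linear order on the vertex type: \<open>orient F v\<close> is \<open>(-1)\<^sup>p\<close> where
  \<open>p\<close> is the position of \<open>v\<close> in the increasing enumeration of \<open>F\<close>, counting from \<open>0\<close>.
  An \<open>i\<close>-chain or \<open>i\<close>-cochain is a function on all vertex sets supported on the
  \<open>i\<close>-dimensional faces; degrees are integers, and the empty face has degree \<open>-1\<close>.
\<close>

definition orient :: "'v::linorder set \<Rightarrow> 'v \<Rightarrow> 'k::field"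
  where "orient F v = (-1) ^ card {u \<in> F. u < v}"

text \<open>
  \<open>rel_chains \<Delta> \<Gamma> i\<close> is the space of functions on the \<open>i\<close>-faces of \<open>\<Delta>\<close> that
  are not in \<open>\<Gamma>\<close>. As cochains these are the cochains of \<open>\<Delta>\<close> vanishing on \<open>\<Gamma>\<close>.
  The void family \<open>\<Gamma> = {}\<close> gives the (augmented) chains and cochains of \<open>\<Delta>\<close>.
\<close>

definition rel_chains :: "'v set set \<Rightarrow> 'v set set \<Rightarrow> int \<Rightarrow> ('v set \<Rightarrow> 'k::field) set"
  where "rel_chains \<Delta> \<Gamma> i = {c. \<forall>F. c F \<noteq> 0 \<longrightarrow> F \<in> \<Delta> - \<Gamma> \<and> int (card F) = i + 1}"

definition boundary :: "'v::linorder set set \<Rightarrow> ('v set \<Rightarrow> 'k::field) \<Rightarrow> ('v set \<Rightarrow> 'k)"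
  where "boundary \<Delta> c = (\<lambda>G. \<Sum>v\<in>\<Union>\<Delta> - G. orient (insert v G) v * c (insert v G))"

definition cycles :: "'v::linorder set set \<Rightarrow> int \<Rightarrow> ('v set \<Rightarrow> 'k::field) set"
  where "cycles \<Delta> i = {c \<in> rel_chains \<Delta> {} i. boundary \<Delta> c = (\<lambda>_. 0)}"

definition boundaries :: "'v::linorder set set \<Rightarrow> int \<Rightarrow> ('v set \<Rightarrow> 'k::field) set"
  where "boundaries \<Delta> i = boundary \<Delta> ` rel_chains \<Delta> {} (i + 1)"

definition red_homology :: "'v::linorder set set \<Rightarrow> int \<Rightarrow> ('k::field, ('v set \<Rightarrow> 'k) set) module"
  where "red_homology \<Delta> i = quot_mod (fun_mod (cycles \<Delta> i)) (boundaries \<Delta> i)"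

definition betti :: "'k::field itself \<Rightarrow> 'v::linorder set set \<Rightarrow> int \<Rightarrow> nat"
  where "betti k \<Delta> i = vdim (red_homology \<Delta> i :: ('k, ('v set \<Rightarrow> 'k) set) module)"

definition coboundary :: "'v::linorder set set \<Rightarrow> ('v set \<Rightarrow> 'k::field) \<Rightarrow> ('v set \<Rightarrow> 'k)"
  where "coboundary \<Delta> c = (\<lambda>F. if F \<in> \<Delta> then \<Sum>v\<in>F. orient F v * c (F - {v}) else 0)"

definition cocycles ::
    "'v::linorder set set \<Rightarrow> 'v set set \<Rightarrow> int \<Rightarrow> ('v set \<Rightarrow> 'k::field) set"
  where "cocycles \<Delta> \<Gamma> i = {c \<in> rel_chains \<Delta> \<Gamma> i. coboundary \<Delta> c = (\<lambda>_. 0)}"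

definition coboundaries ::
    "'v::linorder set set \<Rightarrow> 'v set set \<Rightarrow> int \<Rightarrow> ('v set \<Rightarrow> 'k::field) set"
  where "coboundaries \<Delta> \<Gamma> i = coboundary \<Delta> ` rel_chains \<Delta> \<Gamma> (i - 1)"

definition rel_cohomology ::
    "'v::linorder set set \<Rightarrow> 'v set set \<Rightarrow> int \<Rightarrow> ('k::field, ('v set \<Rightarrow> 'k) set) module"
  where "rel_cohomology \<Delta> \<Gamma> i = quot_mod (fun_mod (cocycles \<Delta> \<Gamma> i)) (coboundaries \<Delta> \<Gamma> i)"

abbreviation H_empty ::
    "'v::linorder set set \<Rightarrow> int \<Rightarrow> ('k::field, ('v set \<Rightarrow> 'k) set) module"
  where "H_empty \<Delta> i \<equiv> rel_cohomology \<Delta> {} i"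

abbreviation H_vertex ::
    "'v::linorder set set \<Rightarrow> 'v \<Rightarrow> int \<Rightarrow> ('k::field, ('v set \<Rightarrow> 'k) set) module"
  where "H_vertex \<Delta> v i \<equiv> rel_cohomology \<Delta> (cost \<Delta> v) i"


section \<open>Singularities\<close>

definition cohen_macaulay :: "'k::field itself \<Rightarrow> 'v::linorder set set \<Rightarrow> bool"
  where "cohen_macaulay k \<Delta> \<longleftrightarrow> pure_complex \<Delta> \<and>
    (\<forall>F\<in>\<Delta>. \<forall>i < sc_dim (link \<Delta> F).
      let H = (red_homology (link \<Delta> F) i :: ('k, ('v set \<Rightarrow> 'k) set) module)
      in carrier H = {\<zero>\<^bsub>H\<^esub>})"

definition buchsbaum :: "'k::field itself \<Rightarrow> 'v::linorder set set \<Rightarrow> bool"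
  where "buchsbaum k \<Delta> \<longleftrightarrow> pure_complex \<Delta> \<and> (\<forall>v\<in>\<Union>\<Delta>. cohen_macaulay k (vlink \<Delta> v))"

definition isolated_singularities :: "'k::field itself \<Rightarrow> 'v::linorder set set \<Rightarrow> bool"
  where "isolated_singularities k \<Delta> \<longleftrightarrow>
    pure_complex \<Delta> \<and> (\<forall>v\<in>\<Union>\<Delta>. buchsbaum k (vlink \<Delta> v))"

text \<open>
  The map \<open>\<iota>\<^sup>*\<close> from \<^term>\<open>H_vertex \<Delta> v i\<close> to \<^term>\<open>H_empty \<Delta> i\<close> sends the class of a
  relative cocycle \<open>z\<close> to the class of \<open>z\<close>; as a map on cosets it does not mention \<open>v\<close>.
\<close>

definition iota_star ::
    "'v::linorder set set \<Rightarrow> int \<Rightarrow> ('v set \<Rightarrow> 'k::field) set \<Rightarrow> ('v set \<Rightarrow> 'k) set"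
  where "iota_star \<Delta> i X =
    (\<Union>z\<in>X. coboundaries \<Delta> {} i +>\<^bsub>fun_mod (cocycles \<Delta> {} i)\<^esub> z)"

definition hom_isolated_singularities :: "'k::field itself \<Rightarrow> 'v::linorder set set \<Rightarrow> bool"
  where "hom_isolated_singularities k \<Delta> \<longleftrightarrow> isolated_singularities k \<Delta> \<and>
    (\<forall>i. 0 \<le> i \<and> i \<le> sc_dim \<Delta> - 1 \<longrightarrow>
      indep_subspaces (H_empty \<Delta> i :: ('k, ('v set \<Rightarrow> 'k) set) module) (\<Union>\<Delta>)
        (\<lambda>v. iota_star \<Delta> i ` carrier (H_vertex \<Delta> v i)))"

text \<open>The linear form \<open>\<theta> = (\<Sum>v. a v * x\<^sub>v)\<close> is given by its coefficients \<open>a\<close>.\<close>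

definition f_theta ::
    "('v::linorder \<Rightarrow> 'k::field) \<Rightarrow> 'v set set \<Rightarrow> int \<Rightarrow>
      ('v \<Rightarrow> ('v set \<Rightarrow> 'k) set) \<Rightarrow> ('v set \<Rightarrow> 'k) set"
  where "f_theta a \<Delta> i X =
    finsum (H_empty \<Delta> i) (\<lambda>v. a v \<odot>\<^bsub>H_empty \<Delta> i\<^esub> iota_star \<Delta> i (X v)) (\<Union>\<Delta>)"

definition ker_f_theta ::
    "('v::linorder \<Rightarrow> 'k::field) \<Rightarrow> 'v set set \<Rightarrow> int \<Rightarrow>
      ('k, 'v \<Rightarrow> ('v set \<Rightarrow> 'k) set) module"
  where "ker_f_theta a \<Delta> i = (let D = direct_sum_mod (\<Union>\<Delta>) (\<lambda>v. H_vertex \<Delta> v i) in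
    D\<lparr>carrier := {X \<in> carrier D. f_theta a \<Delta> i X = \<zero>\<^bsub>H_empty \<Delta> i\<^esub>}\<rparr>)"

text \<open>
  \<open>sing_K\<close> is the common value of \<open>dim (ker f\<^sup>i\<^sup>,\<^sup>\<theta>)\<close> over all \<open>\<theta>\<close> with nonzero
  coefficients. It exists for \<open>0 \<le> i \<le> d - 2\<close> if the singularities are homologically
  isolated, since then \<open>X\<close> is in the kernel iff \<open>\<iota>\<^sup>* (X v)\<close> vanishes for all \<open>v\<close>; for
  \<open>i < 0\<close> it is \<open>0\<close>.
\<close>

definition sing_K :: "'k::field itself \<Rightarrow> 'v::linorder set set \<Rightarrow> int \<Rightarrow> nat"
  where "sing_K k \<Delta> i =
    (THE n. \<forall>a :: 'v \<Rightarrow> 'k. (\<forall>v\<in>\<Union>\<Delta>. a v \<noteq> 0) \<longrightarrow> vdim (ker_f_theta a \<Delta> i) = n)"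


section \<open>Stanley--Reisner rings\<close>

definition poly_alg :: "'v set \<Rightarrow> ('k::field, ('v \<Rightarrow>\<^sub>0 nat) \<Rightarrow>\<^sub>0 'k) module"
  where "poly_alg V =
    \<lparr>carrier = {p. \<forall>m\<in>Poly_Mapping.keys p. Poly_Mapping.keys m \<subseteq> V}, mult = (*), one = 1, zero = 0, add = (+),
      smult = (\<lambda>c p. Poly_Mapping.single 0 c * p)\<rparr>"

definition homogeneous :: "'v set \<Rightarrow> nat \<Rightarrow> (('v \<Rightarrow>\<^sub>0 nat) \<Rightarrow>\<^sub>0 'k::field) set"
  where "homogeneous V i =
    {p \<in> carrier (poly_alg V). \<forall>m\<in>Poly_Mapping.keys p. (\<Sum>v\<in>Poly_Mapping.keys m. Poly_Mapping.lookup m v) = i}"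

definition PVar :: "'v \<Rightarrow> (('v \<Rightarrow>\<^sub>0 nat) \<Rightarrow>\<^sub>0 'k::field)"
  where "PVar v = Poly_Mapping.single (Poly_Mapping.single v 1) 1"

definition SR_ideal :: "'v set set \<Rightarrow> (('v \<Rightarrow>\<^sub>0 nat) \<Rightarrow>\<^sub>0 'k::field) set"
  where "SR_ideal \<Delta> =
    Idl\<^bsub>poly_alg (\<Union>\<Delta>)\<^esub> {\<Prod>v\<in>F. PVar v | F. F \<subseteq> \<Union>\<Delta> \<and> F \<notin> \<Delta>}"

definition SR_ring :: "'v set set \<Rightarrow> ('k::field, (('v \<Rightarrow>\<^sub>0 nat) \<Rightarrow>\<^sub>0 'k) set) module"
  where "SR_ring \<Delta> = quot_mod (poly_alg (\<Union>\<Delta>)) (SR_ideal \<Delta>)"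

definition SR_part :: "'v set set \<Rightarrow> nat \<Rightarrow> (('v \<Rightarrow>\<^sub>0 nat) \<Rightarrow>\<^sub>0 'k::field) set set"
  where "SR_part \<Delta> i =
    (\<lambda>p. SR_ideal \<Delta> +>\<^bsub>poly_alg (\<Union>\<Delta>)\<^esub> p) ` homogeneous (\<Union>\<Delta>) i"

definition SR_quot ::
    "'v set set \<Rightarrow> (('v \<Rightarrow>\<^sub>0 nat) \<Rightarrow>\<^sub>0 'k::field) set set \<Rightarrow>
      ('k, (('v \<Rightarrow>\<^sub>0 nat) \<Rightarrow>\<^sub>0 'k) set set) module"
  where "SR_quot \<Delta> \<Theta> = quot_mod (SR_ring \<Delta>) (Idl\<^bsub>SR_ring \<Delta>\<^esub> \<Theta>)"

definition SR_quot_part ::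
    "'v set set \<Rightarrow> (('v \<Rightarrow>\<^sub>0 nat) \<Rightarrow>\<^sub>0 'k::field) set set \<Rightarrow> nat \<Rightarrow>
      (('v \<Rightarrow>\<^sub>0 nat) \<Rightarrow>\<^sub>0 'k) set set set"
  where "SR_quot_part \<Delta> \<Theta> i =
    (\<lambda>x. Idl\<^bsub>SR_ring \<Delta>\<^esub> \<Theta> +>\<^bsub>SR_ring \<Delta>\<^esub> x) ` SR_part \<Delta> i"

definition lsop :: "'v set set \<Rightarrow> (('v \<Rightarrow>\<^sub>0 nat) \<Rightarrow>\<^sub>0 'k::field) set set \<Rightarrow> bool"
  where "lsop \<Delta> \<Theta> \<longleftrightarrow>
    \<Theta> \<subseteq> SR_part \<Delta> 1 \<and> finite \<Theta> \<and> int (card \<Theta>) = sc_dim \<Delta> + 1 \<and>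
    vectorspace.fin_dim class_ring (SR_quot \<Delta> \<Theta>)"

definition hilbert_series ::
    "'v set set \<Rightarrow> (('v \<Rightarrow>\<^sub>0 nat) \<Rightarrow>\<^sub>0 'k::field) set set \<Rightarrow> int fps"
  where "hilbert_series \<Delta> \<Theta> =
    Abs_fps (\<lambda>i. int (vdim ((SR_quot \<Delta> \<Theta>)\<lparr>carrier := SR_quot_part \<Delta> \<Theta> i\<rparr>)))"

end

theory Submission
  imports Defs "HOL-Library.Function_Algebras"
begin

text \<open>
  For a fixed internal degree \<open>i\<close>, consider the double complex spanned by triples of a face \<open>G\<close>, a
  monomial \<open>m\<close> and a set \<open>\<sigma>\<close> of linear forms with \<open>G \<union> supp m \<in> \<Delta>\<close> and \<open>|\<sigma>| + deg m = i\<close>, with the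
  simplicial coboundary in \<open>G\<close> and the Koszul differential in \<open>m\<close> and \<open>\<sigma>\<close>. Its column at \<open>G = {}\<close> is
  the degree \<open>i\<close> strand of the Koszul complex of \<open>k[\<Delta>]\<close>, so \<open>dim k(\<Delta>,\<Theta>)\<^sub>i\<close> is the codimension of the last
  boundaries in that column; its Euler characteristic is \<open>h\<^sub>i\<close>.

  For fixed \<open>m \<noteq> 1\<close> the faces \<open>G\<close> with \<open>G \<union> supp m \<in> \<Delta>\<close> form a cone, so the total cohomology is that of
  \<open>\<Delta>\<close> tensored with the \<open>i\<close>-th exterior power of \<open>k\<^sup>d\<close>. The same argument applies to the faces
  containing a vertex \<open>v\<close>, where one of the \<open>d\<close> forms is used up by the regular element \<open>x\<^sub>v\<close>; the faces with at
  least two vertices do not contribute, since their links are Cohen--Macaulay and \<open>\<Theta>\<close> restricts to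
  independent forms on every face. Hence the nonempty faces contribute the local cohomology of the
  vertices tensored with the \<open>i\<close>-th exterior power of \<open>k\<^sup>d\<^sup>-\<^sup>1\<close>. The long exact sequence of the column
  \<open>G = {}\<close> then gives the alternating sums, and homological isolation identifies the rank of its last
  map with the kernel dimension \<open>\<K>\<^sub>i\<^sub>-\<^sub>1\<close>.
\<close>

section \<open>Vector spaces and their dimensions\<close>

text \<open>The column at a face \<open>G\<close> is the Koszul complex of the face ring of the star
  of \<open>G\<close>; the rows restrict from stars to smaller stars. Which pairs of a face and a
  monomial support are admissible is a parameter of the differential, so that one operator serves
  both the complex of stars and its quotient in which only monomials supported in a fixed face
  \<open>G\<close> remain; in that quotient every column is the Koszul complex of a polynomial ring.

  The obstacle is that the maps of the long exact sequence are not known one by one. In an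
  alternating count of dimensions their ranks cancel, except for the one in total degree 0 from the
  nonempty faces to all faces, which has to be computed by itself. For this count a cohomology group
  is kept as a pair of cocycles and coboundaries inside a space of functions, and an isomorphism is
  an equation between dimensions. Faces with at least two vertices are acyclic only in total degrees
  below their size.

  The l.s.o.p. enters through the linear independence of the coefficient vectors of the vertices of
  each face, obtained by evaluating polynomials at a point.\<close>

definition coset_of :: "'b::ab_group_add set \<Rightarrow> 'b \<Rightarrow> 'b set"
  where "coset_of B z = {b + z | b. b \<in> B}"

lemma coset_of_0: "coset_of B 0 = B"
  by (auto simp: coset_of_def)

text \<open>
  A copy of \<^locale>\<open>vector_space\<close>, so that constants defined here are not
  captured by the global interpretation for real vector spaces.
\<close>

locale kspace = vector_space scale for scale :: "'k::field \<Rightarrow> 'b::ab_group_add \<Rightarrow> 'b"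
begin

text \<open>The value \<open>dim S\<close> is meaningful only for finite-dimensional
  \<open>S\<close>, so finiteness is tracked as a predicate on subsets of an ambient space that may
  have infinite dimension.\<close>

definition fdim :: "'b set \<Rightarrow> bool"
  where "fdim S \<longleftrightarrow> (\<exists>B. finite B \<and> S \<subseteq> span B)"

lemma coset_mem: "subspace B \<Longrightarrow> z \<in> coset_of B z"
  unfolding coset_of_def using subspace_0[of B] by force

lemma coset_eq_iff:
  assumes B: "subspace B"
  shows "coset_of B z = coset_of B z' \<longleftrightarrow> z - z' \<in> B"
proof
  assume "coset_of B z = coset_of B z'"
  then have "z \<in> coset_of B z'" using coset_mem[OF B] by blast
  then show "z - z' \<in> B" by (auto simp: coset_of_def)
next
  assume zz: "z - z' \<in> B"
  show "coset_of B z = coset_of B z'"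
    unfolding coset_of_def
  proof (intro subset_antisym subsetI; clarify)
    fix b assume b: "b \<in> B"
    show "\<exists>b'. b + z = b' + z' \<and> b' \<in> B"
      by (rule exI[of _ "b + (z - z')"]) (use subspace_add[OF B b zz] in \<open>simp add: algebra_simps\<close>)
    show "\<exists>b'. b + z' = b' + z \<and> b' \<in> B"
      by (rule exI[of _ "b - (z - z')"]) (use subspace_diff[OF B b zz] in \<open>simp add: algebra_simps\<close>)
  qed
qed

lemma coset_eq_self_iff: "subspace B \<Longrightarrow> coset_of B z = B \<longleftrightarrow> z \<in> B"
  using coset_eq_iff[of B z 0] by (simp add: coset_of_0)

lemma coset_add:
  assumes B: "subspace B"
  shows "{u + w | u w. u \<in> coset_of B x \<and> w \<in> coset_of B y} = coset_of B (x + y)"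
proof (intro subset_antisym subsetI)
  fix t assume "t \<in> {u + w | u w. u \<in> coset_of B x \<and> w \<in> coset_of B y}"
  then obtain b b' where t: "b \<in> B" "b' \<in> B" "t = b + x + (b' + y)" unfolding coset_of_def by blast
  then have "t = (b + b') + (x + y)" by (simp add: algebra_simps)
  then show "t \<in> coset_of B (x + y)" unfolding coset_of_def using subspace_add[OF B t(1,2)] by blast
next
  fix t assume "t \<in> coset_of B (x + y)"
  then obtain b where b: "b \<in> B" "t = b + (x + y)" unfolding coset_of_def by blast
  then have "t = (b + x) + (0 + y)" by (simp add: algebra_simps)
  then show "t \<in> {u + w | u w. u \<in> coset_of B x \<and> w \<in> coset_of B y}"
    unfolding coset_of_def using b(1) subspace_0[OF B] by blast
qed

lemma coset_scale:
  assumes B: "subspace B"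
  shows "(\<Union>z\<in>coset_of B x. coset_of B (scale c z)) = coset_of B (scale c x)"
proof -
  have "coset_of B (scale c z) = coset_of B (scale c x)" if "z \<in> coset_of B x" for z
  proof -
    have "z - x \<in> B" using that by (auto simp: coset_of_def)
    then have "scale c (z - x) \<in> B" by (rule subspace_scale[OF B])
    then show ?thesis unfolding coset_eq_iff[OF B] by (simp add: scale_right_diff_distrib)
  qed
  then have "(\<Union>z\<in>coset_of B x. coset_of B (scale c z)) = (\<Union>z\<in>coset_of B x. coset_of B (scale c x))"
    by (intro SUP_cong) auto
  also have "\<dots> = coset_of B (scale c x)" using coset_mem[OF B, of x] by auto
  finally show ?thesis .
qed

lemma fdim_mono: "fdim T \<Longrightarrow> S \<subseteq> T \<Longrightarrow> fdim S"
  unfolding fdim_def by blast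

lemma fdim_indep_finite:
  assumes "fdim S" "B \<subseteq> S" "independent B"
  shows "finite B"
  using assms independent_span_bound unfolding fdim_def by (meson subset_trans)

lemma fdim_extend_basis:
  assumes S: "subspace S" "fdim S" and B: "B \<subseteq> S" "independent B"
  obtains C where "finite B" "finite C" "B \<inter> C = {}" "C \<subseteq> S" "independent (B \<union> C)"
    "span (B \<union> C) = S" "dim S = card B + card C"
proof -
  from B obtain A where A: "B \<subseteq> A" "A \<subseteq> S" "independent A" "S \<subseteq> span A"
    by (rule maximal_independent_subset_extend)
  have fin: "finite A"
    using fdim_indep_finite[OF S(2) A(2,3)] .
  have sp: "span A = S"
    using A S(1) by (meson span_minimal subset_antisym)
  show thesis
  proof (rule that[of "A - B"])
    show "dim S = card B + card (A - B)"
      using A fin basis_card_eq_dim[OF A(2,4,3)]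
      by (metis card_Diff_subset card_mono finite_subset le_add_diff_inverse)
    have "B \<union> (A - B) = A" using A(1) by blast
    then show "independent (B \<union> (A - B))" "span (B \<union> (A - B)) = S"
      using A(3) sp by simp_all
  qed (use A fin in \<open>auto intro: finite_subset\<close>)
qed

lemma fdim_basis:
  assumes "subspace S" "fdim S"
  obtains B where "finite B" "B \<subseteq> S" "independent B" "span B = S" "dim S = card B"
  using fdim_extend_basis[OF assms, of "{}"] by (auto simp: independent_empty)

lemma subspace_dim_equal_fdim:
  assumes "S \<subseteq> T" "subspace S" "subspace T" "fdim T" "dim S = dim T"
  shows "S = T"
proof -
  obtain B where B: "finite B" "B \<subseteq> S" "independent B" "span B = S" "dim S = card B"
    using fdim_basis[OF assms(2) fdim_mono[OF assms(4,1)]] by blast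
  obtain C where C: "finite C" "B \<inter> C = {}" "span (B \<union> C) = T" "dim T = card B + card C"
    using fdim_extend_basis[OF assms(3,4), of B] B assms(1) by (metis subset_trans)
  then have "C = {}" using assms(5) B(5) by simp
  then show ?thesis using B C by simp
qed

end

section \<open>Module records as linear images of subspaces\<close>

lemma vectorspace_image:
  fixes M :: "('k::field, 'c, 'm) module_scheme" and scale :: "'k \<Rightarrow> 'b::ab_group_add \<Rightarrow> 'b"
  assumes "kspace scale"
    and S: "module.subspace scale S"
    and im: "f ` S = carrier M"
    and zero: "f 0 = \<zero>\<^bsub>M\<^esub>"
    and add: "\<And>x y. x \<in> S \<Longrightarrow> y \<in> S \<Longrightarrow> f (x + y) = f x \<oplus>\<^bsub>M\<^esub> f y"
    and smult: "\<And>c x. x \<in> S \<Longrightarrow> f (scale c x) = c \<odot>\<^bsub>M\<^esub> f x"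
  shows "vectorspace class_ring M"
proof -
  interpret kspace scale by fact
  note sc = subspace_0[OF S] subspace_add[OF S] subspace_scale[OF S] subspace_neg[OF S]
  have mem: "f x \<in> carrier M" if "x \<in> S" for x using that im by blast
  have ex: "\<exists>x\<in>S. X = f x" if "X \<in> carrier M" for X using that im by blast
  have "abelian_group M"
  proof (rule abelian_groupI)
    fix x assume "x \<in> carrier M"
    then obtain x' where x': "x' \<in> S" "x = f x'" using ex by blast
    have "f (- x') \<oplus>\<^bsub>M\<^esub> f x' = \<zero>\<^bsub>M\<^esub>"
      using add[of "- x'" x'] zero sc x' by simp
    then show "\<exists>y\<in>carrier M. y \<oplus>\<^bsub>M\<^esub> x = \<zero>\<^bsub>M\<^esub>"
      using mem sc x' by blast
  next
    show "\<zero>\<^bsub>M\<^esub> \<in> carrier M" using mem[OF sc(1)] zero by simp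
  next
    fix x y assume "x \<in> carrier M" "y \<in> carrier M"
    then obtain x' y' where *: "x' \<in> S" "x = f x'" "y' \<in> S" "y = f y'" using ex by metis
    show "x \<oplus>\<^bsub>M\<^esub> y \<in> carrier M" using * mem[OF sc(2)] add by simp
    show "x \<oplus>\<^bsub>M\<^esub> y = y \<oplus>\<^bsub>M\<^esub> x" using * add by (metis add.commute)
  next
    fix x y z assume "x \<in> carrier M" "y \<in> carrier M" "z \<in> carrier M"
    then obtain x' y' z' where *: "x' \<in> S" "x = f x'" "y' \<in> S" "y = f y'" "z' \<in> S" "z = f z'"
      using ex by metis
    show "x \<oplus>\<^bsub>M\<^esub> y \<oplus>\<^bsub>M\<^esub> z = x \<oplus>\<^bsub>M\<^esub> (y \<oplus>\<^bsub>M\<^esub> z)"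
      using * add[of "x' + y'" z'] add[of x' "y' + z'"] add[of x' y'] add[of y' z'] sc(2)
      by (simp add: add.assoc)
  next
    fix x assume "x \<in> carrier M"
    then obtain x' where *: "x' \<in> S" "x = f x'" using ex by metis
    show "\<zero>\<^bsub>M\<^esub> \<oplus>\<^bsub>M\<^esub> x = x" using * add[of 0 x'] zero sc by simp
  qed
  moreover have "module_axioms (class_ring :: 'k ring) M"
  proof
    fix a :: 'k and x assume "a \<in> carrier class_ring" "x \<in> carrier M"
    then obtain x' where *: "x' \<in> S" "x = f x'" using ex by metis
    show "a \<odot>\<^bsub>M\<^esub> x \<in> carrier M" using * smult mem sc by metis
  next
    fix a b :: 'k and x assume "a \<in> carrier class_ring" "b \<in> carrier class_ring" "x \<in> carrier M"
    then obtain x' where *: "x' \<in> S" "x = f x'" using ex by metis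
    show "(a \<oplus>\<^bsub>class_ring\<^esub> b) \<odot>\<^bsub>M\<^esub> x = a \<odot>\<^bsub>M\<^esub> x \<oplus>\<^bsub>M\<^esub> b \<odot>\<^bsub>M\<^esub> x"
      using * smult[OF *(1)] add[of "scale a x'" "scale b x'"] sc(3)
      by (simp add: scale_left_distrib[symmetric] del: scale_left_distrib)
    show "(a \<otimes>\<^bsub>class_ring\<^esub> b) \<odot>\<^bsub>M\<^esub> x = a \<odot>\<^bsub>M\<^esub> (b \<odot>\<^bsub>M\<^esub> x)"
      using * smult[OF *(1)] smult[OF sc(3)[OF *(1)], of a b]
      by (metis scale_scale monoid.simps(1))
  next
    fix a :: 'k and x y assume "a \<in> carrier class_ring" "x \<in> carrier M" "y \<in> carrier M"
    then obtain x' y' where *: "x' \<in> S" "x = f x'" "y' \<in> S" "y = f y'" using ex by metis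
    show "a \<odot>\<^bsub>M\<^esub> (x \<oplus>\<^bsub>M\<^esub> y) = a \<odot>\<^bsub>M\<^esub> x \<oplus>\<^bsub>M\<^esub> a \<odot>\<^bsub>M\<^esub> y"
      using * smult[of "x' + y'" a] smult[of x' a] smult[of y' a] add[of x' y']
        add[of "scale a x'" "scale a y'"] sc
      by (simp add: scale_right_distrib)
  next
    fix x assume "x \<in> carrier M"
    then obtain x' where *: "x' \<in> S" "x = f x'" using ex by metis
    show "\<one>\<^bsub>class_ring\<^esub> \<odot>\<^bsub>M\<^esub> x = x" using * smult[of x' 1] by simp
  qed
  moreover have "field (class_ring :: 'k ring)" by (rule class_field.field_axioms)
  ultimately show ?thesis
    unfolding vectorspace_def module_def using field.axioms(1) domain.axioms(1) by blast
qed

lemma finsum_image: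
  fixes M :: "('k::field, 'c, 'm) module_scheme" and scale :: "'k \<Rightarrow> 'b::ab_group_add \<Rightarrow> 'b"
  assumes "kspace scale"
    and S: "module.subspace scale S"
    and im: "f ` S = carrier M"
    and zero: "f 0 = \<zero>\<^bsub>M\<^esub>"
    and add: "\<And>x y. x \<in> S \<Longrightarrow> y \<in> S \<Longrightarrow> f (x + y) = f x \<oplus>\<^bsub>M\<^esub> f y"
    and smult: "\<And>c x. x \<in> S \<Longrightarrow> f (scale c x) = c \<odot>\<^bsub>M\<^esub> f x"
    and "finite I" "\<And>i. i \<in> I \<Longrightarrow> g i \<in> S"
  shows "finsum M (\<lambda>i. f (g i)) I = f (sum g I)"
proof -
  interpret kspace scale by fact
  interpret V: vectorspace class_ring M using vectorspace_image[OF assms(1-6)] .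
  have mem: "f x \<in> carrier M" if "x \<in> S" for x using that im by blast
  show ?thesis using assms(7,8)
  proof (induction I rule: finite_induct)
    case empty
    then show ?case using zero by simp
  next
    case (insert i I)
    have "sum g I \<in> S" using insert by (intro subspace_sum[OF S]) auto
    then show ?case using insert mem add
      by (subst V.M.finsum_insert) (auto simp: Pi_def)
  qed
qed

text \<open>A basis of the kernel is extended to a basis of \<open>S\<close>, and the images of the
  added vectors form a basis of \<open>M\<close>. This is the bridge between \<open>vdim\<close> of
  module records and \<open>dim\<close> of sets of vectors: the quotients and kernels occurring in
  the theorem are all measured through it.\<close>

lemma vdim_image:
  fixes M :: "('k::field, 'c, 'm) module_scheme" and scale :: "'k \<Rightarrow> 'b::ab_group_add \<Rightarrow> 'b"
  assumes vs: "kspace scale"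
    and S: "module.subspace scale S"
    and im: "f ` S = carrier M"
    and zero: "f 0 = \<zero>\<^bsub>M\<^esub>"
    and add: "\<And>x y. x \<in> S \<Longrightarrow> y \<in> S \<Longrightarrow> f (x + y) = f x \<oplus>\<^bsub>M\<^esub> f y"
    and smult: "\<And>c x. x \<in> S \<Longrightarrow> f (scale c x) = c \<odot>\<^bsub>M\<^esub> f x"
    and fin: "kspace.fdim scale S"
  shows "vdim M + vector_space.dim scale {x\<in>S. f x = \<zero>\<^bsub>M\<^esub>} = vector_space.dim scale S"
proof -
  interpret kspace scale by fact
  note V = vectorspace_image[OF assms(1-6)]
  interpret V: vectorspace class_ring M using V .
  let ?N = "{x\<in>S. f x = \<zero>\<^bsub>M\<^esub>}"
  have sN: "subspace ?N"
    unfolding subspace_def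
    using zero add smult subspace_0[OF S] subspace_add[OF S] subspace_scale[OF S]
    by (auto simp: V.M.r_zero V.smult_r_null)
  have mem: "f x \<in> carrier M" if "x \<in> S" for x using that im by blast
  obtain B where B: "finite B" "B \<subseteq> ?N" "independent B" "span B = ?N" "dim ?N = card B"
    using fdim_basis[OF sN fdim_mono[OF fin]] by blast
  have "B \<subseteq> S" using B(2) by blast
  then obtain C where C: "finite C" "B \<inter> C = {}" "C \<subseteq> S" "independent (B \<union> C)"
    "span (B \<union> C) = S" "dim S = card B + card C"
    by (rule fdim_extend_basis[OF S fin _ B(3)])
  have comb: "f (\<Sum>x\<in>C. scale (u x) x) = finsum M (\<lambda>x. u x \<odot>\<^bsub>M\<^esub> f x) C" for u
  proof -
    have "finsum M (\<lambda>x. f (scale (u x) x)) C = f (\<Sum>x\<in>C. scale (u x) x)"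
      using C subspace_scale[OF S] by (intro finsum_image[OF assms(1-6)]) auto
    moreover have "finsum M (\<lambda>x. f (scale (u x) x)) C = finsum M (\<lambda>x. u x \<odot>\<^bsub>M\<^esub> f x) C"
      using smult C(3) mem by (intro V.M.finsum_cong') (auto intro!: V.smult_closed)
    ultimately show ?thesis by simp
  qed
  have Ck: "\<forall>x\<in>C. u x = 0" if "f (\<Sum>x\<in>C. scale (u x) x) = \<zero>\<^bsub>M\<^esub>" for u
  proof -
    have "(\<Sum>x\<in>C. scale (u x) x) \<in> ?N"
      using that C(3) subspace_scale[OF S] by (blast intro: subspace_sum[OF S])
    then have "(\<Sum>x\<in>C. scale (u x) x) \<in> span B" using B by simp
    then obtain w where w: "(\<Sum>x\<in>C. scale (u x) x) = (\<Sum>x\<in>B. scale (w x) x)"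
      using B(1) span_finite by auto
    define z where "z x = (if x \<in> B then - w x else u x)" for x
    have "(\<Sum>x\<in>B \<union> C. scale (z x) x) = (\<Sum>x\<in>B. scale (z x) x) + (\<Sum>x\<in>C. scale (z x) x)"
      using B(1) C(1,2) by (rule sum.union_disjoint)
    also have "(\<Sum>x\<in>B. scale (z x) x) = - (\<Sum>x\<in>B. scale (w x) x)"
      by (simp add: z_def sum_negf)
    also have "(\<Sum>x\<in>C. scale (z x) x) = (\<Sum>x\<in>C. scale (u x) x)"
      using C(2) by (intro sum.cong) (auto simp: z_def)
    finally have "(\<Sum>x\<in>B \<union> C. scale (z x) x) = 0" using w by simp
    then have "\<forall>x\<in>B \<union> C. z x = 0"
      using independentD[OF C(4) finite_UnI[OF B(1) C(1)] subset_refl] by blast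
    then show ?thesis using C(2) by (auto simp: z_def split: if_splits)
  qed
  have inj: "inj_on f C"
  proof (rule inj_onI, rule ccontr)
    fix x y assume xy: "x \<in> C" "y \<in> C" "f x = f y" "x \<noteq> y"
    define u where "u = (\<lambda>t. if t = x then 1 else if t = y then - 1 else (0::'k))"
    have xyS: "x \<in> S" "y \<in> S" using C xy by auto
    have "(\<Sum>t\<in>C. scale (u t) t) = (\<Sum>t\<in>{x,y}. scale (u t) t)"
      using xy C(1) by (intro sum.mono_neutral_right) (auto simp: u_def)
    also have "\<dots> = x + scale (- 1) y" using xy by (simp add: u_def)
    finally have "f (\<Sum>t\<in>C. scale (u t) t) = f x \<oplus>\<^bsub>M\<^esub> (- 1) \<odot>\<^bsub>M\<^esub> f y"
      using add[of x "scale (-1) y"] smult[of y "-1"] xyS subspace_neg[OF S] by simp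
    also have "\<dots> = f (x + scale (-1) x)"
      using xy(3) add[of x "scale (-1) x"] smult[of x "-1"] xyS subspace_neg[OF S] by simp
    also have "\<dots> = \<zero>\<^bsub>M\<^esub>" using zero by simp
    finally have "u x = 0" using Ck xy by blast
    then show False by (simp add: u_def)
  qed
  have lc: "V.lincomb a (f ` C) = f (\<Sum>x\<in>C. scale (a (f x)) x)" for a
    unfolding V.lincomb_def comb
    using C(3) mem inj by (subst V.M.finsum_reindex) (auto intro!: V.smult_closed)
  have fC: "finite (f ` C)" "f ` C \<subseteq> carrier M" using C mem by auto
  have "V.basis (f ` C)"
    unfolding V.basis_def
  proof (intro conjI)
    show "\<not> V.lin_dep (f ` C)"
    proof
      assume "V.lin_dep (f ` C)"
      then obtain a v where "V.lincomb a (f ` C) = \<zero>\<^bsub>M\<^esub>" "v \<in> f ` C" "a v \<noteq> 0"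
        using V.finite_lin_dep[OF fC(1) _ fC(2)] by auto
      then show False using lc Ck[of "\<lambda>x. a (f x)"] by auto
    qed
    show "V.span (f ` C) = carrier M"
    proof
      show "V.span (f ` C) \<subseteq> carrier M" using V.span_is_subset2[OF fC(2)] .
      show "carrier M \<subseteq> V.span (f ` C)"
      proof
        fix X assume "X \<in> carrier M"
        then obtain x where x: "x \<in> S" "X = f x" using im by blast
        then obtain w where w: "x = (\<Sum>t\<in>B \<union> C. scale (w t) t)"
          using C(5) span_finite[of "B \<union> C"] B(1) C(1) by auto
        define b where "b = (\<Sum>t\<in>B. scale (w t) t)"
        have b: "b \<in> ?N" unfolding b_def using B(2)
          by (intro subspace_sum[OF sN] subspace_scale[OF sN]) auto
        have cS: "(\<Sum>t\<in>C. scale (w t) t) \<in> S"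
          using C(3) by (intro subspace_sum[OF S] subspace_scale[OF S]) auto
        have "x = b + (\<Sum>t\<in>C. scale (w t) t)"
          unfolding w b_def using B(1) C(1,2) by (rule sum.union_disjoint)
        then have "X = f (\<Sum>t\<in>C. scale (w t) t)"
          using x add b cS mem by simp
        also have "\<dots> = f (\<Sum>t\<in>C. scale (w (inv_into C f (f t))) t)"
          using inj by (intro arg_cong[where f=f] sum.cong) auto
        also have "\<dots> = V.lincomb (\<lambda>y. w (inv_into C f y)) (f ` C)"
          by (rule lc[symmetric])
        finally show "X \<in> V.span (f ` C)"
          unfolding V.finite_span[OF fC] by (intro CollectI exI conjI) auto
      qed
    qed
    show "f ` C \<subseteq> carrier M" by (rule fC)
  qed
  then have "vdim M = card (f ` C)" by (rule V.dim_basis[OF fC(1)])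
  then show ?thesis using C(6) B(5) inj by (simp add: card_image)
qed


section \<open>Linear maps on subspaces, ranks and kernels\<close>

lemma kspace_linear_iff:
  "kspace s1 \<Longrightarrow> kspace s2 \<Longrightarrow> Vector_Spaces.linear s1 s2 f \<longleftrightarrow>
    (\<forall>x y. f (x + y) = f x + f y) \<and> (\<forall>c x. f (s1 c x) = s2 c (f x))"
  by (auto simp: Vector_Spaces.linear_iff kspace_def)

lemma linear_image_subspace:
  assumes "Vector_Spaces.linear s1 s2 f" "module.subspace s1 S"
  shows "module.subspace s2 (f ` S)"
proof -
  interpret Vector_Spaces.linear s1 s2 f by fact
  show ?thesis using assms(2) by (rule subspace_image)
qed

lemma linear_vimage_subspace:
  assumes "Vector_Spaces.linear s1 s2 f" "module.subspace s1 S" "module.subspace s2 T"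
  shows "module.subspace s1 {x\<in>S. f x \<in> T}"
proof -
  interpret Vector_Spaces.linear s1 s2 f by fact
  show ?thesis
    using assms(2,3) by (auto simp: vs1.subspace_def vs2.subspace_def zero add scale)
qed

lemma linear_ker_subspace:
  assumes "Vector_Spaces.linear s1 s2 f" "module.subspace s1 S"
  shows "module.subspace s1 {x\<in>S. f x = 0}"
proof -
  interpret Vector_Spaces.linear s1 s2 f by fact
  show ?thesis
    using linear_vimage_subspace[OF assms, of "{0}"] vs2.subspace_single_0 by simp
qed

lemma linear_image_fdim:
  assumes "kspace s1" "kspace s2" "Vector_Spaces.linear s1 s2 f" "kspace.fdim s1 S"
  shows "kspace.fdim s2 (f ` S)"
proof -
  interpret Vector_Spaces.linear s1 s2 f by fact
  interpret k1: kspace s1 by fact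
  interpret k2: kspace s2 by fact
  obtain B where "finite B" "S \<subseteq> vs1.span B" using assms(4) k1.fdim_def by auto
  then have "finite (f ` B)" "f ` S \<subseteq> vs2.span (f ` B)" by (auto simp: span_image)
  then show ?thesis unfolding k2.fdim_def by blast
qed

text \<open>The image is turned into a module record \<open>M\<close>, and \<open>vdim_image\<close>
  computes \<open>vdim M\<close> twice: once through \<open>f\<close> and once through the identity
  of the image.\<close>

lemma dim_image_kernel:
  fixes s1 :: "'k::field \<Rightarrow> 'b::ab_group_add \<Rightarrow> 'b" and s2 :: "'k \<Rightarrow> 'c::ab_group_add \<Rightarrow> 'c"
  assumes "kspace s1" "kspace s2" "Vector_Spaces.linear s1 s2 f"
    and S: "module.subspace s1 S" "kspace.fdim s1 S"
  shows "vector_space.dim s2 (f ` S) + vector_space.dim s1 {x\<in>S. f x = 0} = vector_space.dim s1 S"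
proof -
  interpret Vector_Spaces.linear s1 s2 f by fact
  interpret k1: kspace s1 by fact
  interpret k2: kspace s2 by fact
  define M :: "('k, 'c) module" where "M = \<lparr>carrier = f ` S, mult = undefined, one = undefined, zero = 0,
    add = (+), smult = s2\<rparr>"
  have 1: "vdim M + vector_space.dim s1 {x\<in>S. f x = \<zero>\<^bsub>M\<^esub>} = vector_space.dim s1 S"
    by (rule vdim_image[OF assms(1) S(1)])
      (use S in \<open>auto simp: M_def zero add scale\<close>)
  have 2: "vdim M + vector_space.dim s2 {x\<in>f ` S. x = \<zero>\<^bsub>M\<^esub>} = vector_space.dim s2 (f ` S)"
    by (rule vdim_image[OF assms(2) linear_image_subspace[OF assms(3) S(1)]])
      (use linear_image_fdim[OF assms(1-3) S(2)] in \<open>auto simp: M_def\<close>)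
  have "vs2.dim {x\<in>f ` S. x = 0} \<le> card ({} :: 'c set)"
    by (rule vs2.dim_le_card) auto
  then show ?thesis using 1 2 by (simp add: M_def)
qed

lemma dim_image_inj:
  fixes s1 :: "'k::field \<Rightarrow> 'b::ab_group_add \<Rightarrow> 'b" and s2 :: "'k \<Rightarrow> 'c::ab_group_add \<Rightarrow> 'c"
  assumes "kspace s1" "kspace s2" "Vector_Spaces.linear s1 s2 f"
    and S: "module.subspace s1 S" "kspace.fdim s1 S" and inj: "\<And>x. x \<in> S \<Longrightarrow> f x = 0 \<Longrightarrow> x = 0"
  shows "vector_space.dim s2 (f ` S) = vector_space.dim s1 S"
proof -
  interpret k1: kspace s1 by fact
  have "k1.dim {x\<in>S. f x = 0} \<le> card ({} :: 'b set)"
    by (rule k1.dim_le_card) (use inj in auto)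
  then show ?thesis using dim_image_kernel[OF assms(1-5)] by simp
qed

context kspace
begin

text \<open>A basis of \<open>T\<close> is extended to the whole space; \<open>p\<close> kills the
  basis vectors in \<open>T\<close> and fixes the others. Such an endomorphism stands in for the
  quotient by \<open>T\<close> without changing the type.\<close>

lemma quotient_map_exists:
  assumes T: "subspace T"
  obtains p where "Vector_Spaces.linear scale scale p" "\<And>x. p x = 0 \<longleftrightarrow> x \<in> T"
proof -
  interpret vp: vector_space_pair scale scale ..
  obtain B where B: "B \<subseteq> T" "independent B" "T \<subseteq> span B"
    by (rule maximal_independent_subset)
  have spB: "span B = T" using B T by (meson span_minimal subset_antisym)
  define E where "E = extend_basis B"
  have E: "B \<subseteq> E" "independent E" "span E = UNIV"
    unfolding E_def using B(2) extend_basis_superset independent_extend_basis span_extend_basis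
    by auto
  define p where "p = vp.construct E (\<lambda>e. if e \<in> B then 0 else e)"
  have lp: "Vector_Spaces.linear scale scale p"
    unfolding p_def by (rule vp.linear_construct[OF E(2)])
  interpret p: Vector_Spaces.linear scale scale p by fact
  have pb: "p e = (if e \<in> B then 0 else e)" if "e \<in> E" for e
    unfolding p_def by (rule vp.construct_basis[OF E(2) that])
  have "x - p x \<in> span B" for x
  proof -
    have "x \<in> span E" using E by simp
    then show ?thesis
    proof (induction rule: span_induct_alt)
      case base
      then show ?case by (simp add: p.zero span_zero)
    next
      case (step c e y)
      have "e - p e \<in> span B" using pb step(1) by (auto simp: span_zero span_base)
      then have "scale c (e - p e) + (y - p y) \<in> span B"
        using step(2) by (intro span_add span_scale)
      then show ?case by (simp add: p.add p.scale algebra_simps)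
    qed
  qed
  moreover have "p x = 0" if "x \<in> span B" for x
    using that
  proof (induction rule: span_induct_alt)
    case base
    then show ?case by (simp add: p.zero)
  next
    case (step c e y)
    then show ?case using pb E(1) by (auto simp: p.add p.scale)
  qed
  ultimately have "p x = 0 \<longleftrightarrow> x \<in> T" for x using spB by (metis diff_zero)
  then show thesis using that lp by blast
qed

section \<open>Sums of subspaces, and sums independent modulo a subspace\<close>

definition ssum :: "'b set \<Rightarrow> 'b set \<Rightarrow> 'b set"
  where "ssum S T = {x + y | x y. x \<in> S \<and> y \<in> T}"

lemma subspace_ssum: "subspace S \<Longrightarrow> subspace T \<Longrightarrow> subspace (ssum S T)"
  unfolding ssum_def by (rule subspace_sums)

lemma fdim_ssum:
  assumes "fdim S" "fdim T"
  shows "fdim (ssum S T)"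
proof -
  obtain A B where "finite A" "S \<subseteq> span A" "finite B" "T \<subseteq> span B"
    using assms unfolding fdim_def by blast
  then have "finite (A \<union> B)" "ssum S T \<subseteq> span (A \<union> B)"
    unfolding ssum_def span_Un by blast+
  then show ?thesis unfolding fdim_def by blast
qed

lemma dim_ssum:
  assumes S: "subspace S" "fdim S" and T: "subspace T" "fdim T"
  shows "dim (ssum S T) + dim (S \<inter> T) = dim S + dim T"
proof -
  have k: "kspace scale" ..
  obtain p where p: "Vector_Spaces.linear scale scale p" "\<And>x. p x = 0 \<longleftrightarrow> x \<in> T"
    using quotient_map_exists[OF T(1)] by blast
  interpret p: Vector_Spaces.linear scale scale p by fact
  have *: "p ` (ssum S T) = p ` S"
  proof
    show "p ` ssum S T \<subseteq> p ` S"
      unfolding ssum_def using p(2)[THEN iffD2] by (auto simp: p.add)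
    show "p ` S \<subseteq> p ` ssum S T"
      unfolding ssum_def using subspace_0[OF T(1)] by (metis (mono_tags, lifting)
          add.right_neutral image_mono mem_Collect_eq subsetI)
  qed
  have "{x \<in> ssum S T. p x = 0} = T"
  proof -
    have "x \<in> ssum S T" if "x \<in> T" for x
      unfolding ssum_def using that subspace_0[OF S(1)] by force
    then show ?thesis using p(2) by auto
  qed
  moreover have "{x \<in> S. p x = 0} = S \<inter> T" using p(2) by auto
  ultimately show ?thesis
    using dim_image_kernel[OF k k p(1) S] * T
      dim_image_kernel[OF k k p(1) subspace_ssum[OF S(1) T(1)] fdim_ssum[OF S(2) T(2)]]
    by simp
qed

text \<open>Adding one \<open>Z j\<close> at a time, independence modulo \<open>B\<close> forces the
  new summand to meet the sum built so far in \<open>Z j \<inter> B\<close> only. With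
  \<open>B\<close> the coboundaries and \<open>Z i\<close> spaces of local cocycles, this is the
  dimension of a direct sum of cohomology groups.\<close>

lemma dim_independent_sum:
  assumes "finite I" and B: "subspace B" "fdim B"
    and Z: "\<And>i. i \<in> I \<Longrightarrow> subspace (Z i)" "\<And>i. i \<in> I \<Longrightarrow> fdim (Z i)"
    and ind: "\<And>\<zeta>. (\<And>i. i \<in> I \<Longrightarrow> \<zeta> i \<in> Z i) \<Longrightarrow> (\<Sum>i\<in>I. \<zeta> i) \<in> B \<Longrightarrow> \<forall>i\<in>I. \<zeta> i \<in> B"
  defines "T \<equiv> \<lambda>I. {b + (\<Sum>i\<in>I. \<zeta> i) | b \<zeta>. b \<in> B \<and> (\<forall>i\<in>I. \<zeta> i \<in> Z i)}"
  shows "subspace (T I)" "fdim (T I)"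
    "dim (T I) + (\<Sum>i\<in>I. dim (Z i \<inter> B)) = dim B + (\<Sum>i\<in>I. dim (Z i))"
proof -
  have "subspace (T I) \<and> fdim (T I) \<and>
    dim (T I) + (\<Sum>i\<in>I. dim (Z i \<inter> B)) = dim B + (\<Sum>i\<in>I. dim (Z i))"
    using assms(1) Z ind
  proof (induction I rule: finite_induct)
    case empty
    have "T {} = B" by (auto simp: T_def)
    then show ?case using B by simp
  next
    case (insert j I)
    note IH = insert
    have ind': "\<forall>i\<in>I. \<zeta> i \<in> B" if h: "\<And>i. i \<in> I \<Longrightarrow> \<zeta> i \<in> Z i" "(\<Sum>i\<in>I. \<zeta> i) \<in> B" for \<zeta>
    proof -
      have "\<forall>i\<in>insert j I. (\<zeta>(j := 0)) i \<in> B"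
      proof (rule insert.prems(3))
        fix i assume "i \<in> insert j I"
        then show "(\<zeta>(j := 0)) i \<in> Z i" using h subspace_0 insert.prems(1) by auto
      next
        have "(\<Sum>i\<in>I. (\<zeta>(j := 0)) i) = (\<Sum>i\<in>I. \<zeta> i)"
          using insert(2) by (intro sum.cong) auto
        then show "(\<Sum>i\<in>insert j I. (\<zeta>(j := 0)) i) \<in> B"
          using h insert by simp
      qed
      then show ?thesis using insert(2) by (metis fun_upd_apply insertI2)
    qed
    have T: "subspace (T I)" "fdim (T I)"
      "dim (T I) + (\<Sum>i\<in>I. dim (Z i \<inter> B)) = dim B + (\<Sum>i\<in>I. dim (Z i))"
      using insert.IH[OF insert.prems(1,2) ind'] by auto
    have Zj: "subspace (Z j)" "fdim (Z j)" using insert.prems by auto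
    have eq: "T (insert j I) = ssum (T I) (Z j)"
    proof
      show "T (insert j I) \<subseteq> ssum (T I) (Z j)"
      proof
        fix x assume "x \<in> T (insert j I)"
        then obtain b \<zeta> where x: "x = b + (\<Sum>i\<in>insert j I. \<zeta> i)" "b \<in> B"
          "\<forall>i\<in>insert j I. \<zeta> i \<in> Z i" unfolding T_def by blast
        have "x = (b + (\<Sum>i\<in>I. \<zeta> i)) + \<zeta> j" using x(1) insert(1,2) by (simp add: algebra_simps)
        moreover have "b + (\<Sum>i\<in>I. \<zeta> i) \<in> T I" unfolding T_def using x by blast
        ultimately show "x \<in> ssum (T I) (Z j)" unfolding ssum_def using x(3) by blast
      qed
      show "ssum (T I) (Z j) \<subseteq> T (insert j I)"
      proof
        fix x assume "x \<in> ssum (T I) (Z j)"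
        then obtain b \<zeta> y where x: "x = b + (\<Sum>i\<in>I. \<zeta> i) + y" "b \<in> B" "\<forall>i\<in>I. \<zeta> i \<in> Z i" "y \<in> Z j"
          unfolding ssum_def T_def by blast
        have "(\<Sum>i\<in>I. (\<zeta>(j := y)) i) = (\<Sum>i\<in>I. \<zeta> i)"
          using insert(2) by (intro sum.cong) auto
        then have "x = b + (\<Sum>i\<in>insert j I. (\<zeta>(j := y)) i)"
          using x(1) insert(1,2) by (simp add: algebra_simps)
        moreover have "\<forall>i\<in>insert j I. (\<zeta>(j := y)) i \<in> Z i" using x by auto
        ultimately show "x \<in> T (insert j I)" unfolding T_def using x(2) by blast
      qed
    qed
    have int: "T I \<inter> Z j = Z j \<inter> B"
    proof
      show "T I \<inter> Z j \<subseteq> Z j \<inter> B"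
      proof
        fix x assume "x \<in> T I \<inter> Z j"
        then obtain b \<zeta> where x: "x = b + (\<Sum>i\<in>I. \<zeta> i)" "b \<in> B" "\<forall>i\<in>I. \<zeta> i \<in> Z i" "x \<in> Z j"
          unfolding T_def by blast
        \<comment> \<open>Moving \<open>x\<close> to the other side gives a family with
          \<open>- x\<close> at \<open>j\<close> whose sum lies in \<open>B\<close>, so independence
          applies to \<open>x\<close> itself.\<close>
        have "\<forall>i\<in>insert j I. (\<zeta>(j := - x)) i \<in> B"
        proof (rule insert.prems(3))
          fix i assume "i \<in> insert j I"
          then show "(\<zeta>(j := - x)) i \<in> Z i"
            using x(3,4) subspace_neg[OF insert.prems(1)] by auto
        next
          have "(\<Sum>i\<in>I. (\<zeta>(j := - x)) i) = (\<Sum>i\<in>I. \<zeta> i)"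
            using insert(2) by (intro sum.cong) auto
          then have "(\<Sum>i\<in>insert j I. (\<zeta>(j := - x)) i) = - b"
            using x(1) insert(1,2) by simp
          then show "(\<Sum>i\<in>insert j I. (\<zeta>(j := - x)) i) \<in> B"
            using x(2) subspace_neg[OF B(1)] by simp
        qed
        then have "- x \<in> B" by auto
        then have "x \<in> B" using subspace_neg[OF B(1)] by fastforce
        then show "x \<in> Z j \<inter> B" using x by blast
      qed
      show "Z j \<inter> B \<subseteq> T I \<inter> Z j"
      proof
        fix x assume x: "x \<in> Z j \<inter> B"
        have "x = x + (\<Sum>i\<in>I. (\<lambda>_. 0) i)" by simp
        moreover have "\<forall>i\<in>I. (\<lambda>_. 0) i \<in> Z i" using insert.prems(1) subspace_0 by auto
        ultimately show "x \<in> T I \<inter> Z j" unfolding T_def using x by blast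
      qed
    qed
    show ?case
      using dim_ssum[OF T(1,2) Zj] T(3) subspace_ssum[OF T(1) Zj(1)] fdim_ssum[OF T(2) Zj(2)]
        insert(1,2) unfolding eq int by simp
  qed
  then show "subspace (T I)" "fdim (T I)"
    "dim (T I) + (\<Sum>i\<in>I. dim (Z i \<inter> B)) = dim B + (\<Sum>i\<in>I. dim (Z i))" by auto
qed

end

text \<open>Modulo \<open>Y\<close> the maps \<open>f\<close> and \<open>g\<close> have the same
  image, so \<open>Z1\<close> and \<open>Z2\<close> have isomorphic quotients by the preimages of
  \<open>Y\<close>. This compares two cohomology groups through a third space when no map leads
  directly from one to the other.\<close>

lemma dim_correspondence:
  assumes k: "kspace s1" "kspace s2" "kspace s"
    and f: "Vector_Spaces.linear s1 s f" and g: "Vector_Spaces.linear s2 s g"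
    and Z1: "module.subspace s1 Z1" "kspace.fdim s1 Z1"
    and Z2: "module.subspace s2 Z2" "kspace.fdim s2 Z2"
    and Y: "module.subspace s Y"
    and 1: "\<And>z. z \<in> Z1 \<Longrightarrow> \<exists>w\<in>Z2. f z - g w \<in> Y"
    and 2: "\<And>w. w \<in> Z2 \<Longrightarrow> \<exists>z\<in>Z1. f z - g w \<in> Y"
  shows "vector_space.dim s1 Z1 + vector_space.dim s2 {w\<in>Z2. g w \<in> Y} =
    vector_space.dim s2 Z2 + vector_space.dim s1 {z\<in>Z1. f z \<in> Y}"
proof -
  interpret k: kspace s by fact
  obtain p where p: "Vector_Spaces.linear s s p" "\<And>x. p x = 0 \<longleftrightarrow> x \<in> Y"
    using k.quotient_map_exists[OF Y] by blast
  interpret p: Vector_Spaces.linear s s p by fact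
  have pf: "Vector_Spaces.linear s1 s (p \<circ> f)" "Vector_Spaces.linear s2 s (p \<circ> g)"
    using f g p(1) Vector_Spaces.linear_compose by blast+
  have eq: "p x = p y" if "x - y \<in> Y" for x y
    using p(2)[of "x - y"] that by (simp add: p.diff)
  have "(p \<circ> f) ` Z1 = (p \<circ> g) ` Z2"
  proof (intro subset_antisym image_subsetI)
    fix z assume "z \<in> Z1"
    then obtain w where "w \<in> Z2" "f z - g w \<in> Y" using 1 by blast
    then show "(p \<circ> f) z \<in> (p \<circ> g) ` Z2" using eq by auto
  next
    fix w assume "w \<in> Z2"
    then obtain z where "z \<in> Z1" "f z - g w \<in> Y" using 2 by blast
    then show "(p \<circ> g) w \<in> (p \<circ> f) ` Z1" using eq[of "f z" "g w"] by (metis comp_apply image_eqI)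
  qed
  then show ?thesis
    using dim_image_kernel[OF k(1,3) pf(1) Z1] dim_image_kernel[OF k(2,3) pf(2) Z2] p(2)
    by simp
qed

section \<open>Spaces of functions\<close>

definition fscale :: "'k::field \<Rightarrow> ('x \<Rightarrow> 'k) \<Rightarrow> 'x \<Rightarrow> 'k"
  where "fscale c f = (\<lambda>x. c * f x)"

text \<open>Addition lifts to functions of two arguments by itself, but \<open>fscale\<close> covers
  only one argument, hence a second scalar multiplication.\<close>

definition tscale :: "'k::field \<Rightarrow> ('x \<Rightarrow> 'y \<Rightarrow> 'k) \<Rightarrow> 'x \<Rightarrow> 'y \<Rightarrow> 'k"
  where "tscale c f = (\<lambda>x y. c * f x y)"

lemma fscale_apply [simp]: "fscale c f x = c * f x"
  by (simp add: fscale_def)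

lemma tscale_apply [simp]: "tscale c f x y = c * f x y"
  by (simp add: tscale_def)

lemma kspace_fscale: "kspace fscale"
  by unfold_locales (auto simp: fun_eq_iff algebra_simps)

lemma kspace_tscale: "kspace tscale"
  by unfold_locales (auto simp: fun_eq_iff algebra_simps)

lemma kspace_times: "kspace ((*) :: 'k::field \<Rightarrow> 'k \<Rightarrow> 'k)"
  by unfold_locales (auto simp: algebra_simps)

interpretation fs: kspace fscale by (rule kspace_fscale)
interpretation ts: kspace tscale by (rule kspace_tscale)

lemma linear_ff_iff:
  "Vector_Spaces.linear fscale fscale f \<longleftrightarrow>
    (\<forall>x y. f (x + y) = f x + f y) \<and> (\<forall>c x. f (fscale c x) = fscale c (f x))"
  by (rule kspace_linear_iff[OF kspace_fscale kspace_fscale])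

lemma linear_tt_iff:
  "Vector_Spaces.linear tscale tscale f \<longleftrightarrow>
    (\<forall>x y. f (x + y) = f x + f y) \<and> (\<forall>c x. f (tscale c x) = tscale c (f x))"
  by (rule kspace_linear_iff[OF kspace_tscale kspace_tscale])

lemma sum_apply [simp]: "(\<Sum>i\<in>I. f i) x = (\<Sum>i\<in>I. f i x)" for f :: "'i \<Rightarrow> 'x \<Rightarrow> 'b::comm_monoid_add"
  by (induction I rule: infinite_finite_induct) auto

definition fsup :: "'x set \<Rightarrow> ('x \<Rightarrow> 'k::field) set"
  where "fsup J = {f. \<forall>x. f x \<noteq> 0 \<longrightarrow> x \<in> J}"

lemma subspace_fsup: "fs.subspace (fsup J)"
  unfolding fs.subspace_def fsup_def by auto (metis add_0)

definition fun_unit :: "'x \<Rightarrow> 'x \<Rightarrow> 'k::field"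
  where "fun_unit a = (\<lambda>x. if x = a then 1 else 0)"

lemma fsup_expand:
  assumes "finite J" "f \<in> fsup J"
  shows "f = (\<Sum>a\<in>J. fscale (f a) (fun_unit a))"
proof
  fix x
  have "(\<Sum>a\<in>J. f a * fun_unit a x) = (\<Sum>a\<in>J. if x = a then f a else 0)"
    by (intro sum.cong) (auto simp: fun_unit_def)
  also have "\<dots> = f x"
    using assms by (auto simp: fsup_def)
  finally show "f x = (\<Sum>a\<in>J. fscale (f a) (fun_unit a)) x" by simp
qed

lemma inj_fun_unit: "inj (fun_unit :: 'x \<Rightarrow> 'x \<Rightarrow> 'k::field)"
  by (rule injI) (metis fun_unit_def zero_neq_one)

lemma
  assumes "finite J"
  shows fdim_fsup: "fs.fdim (fsup J :: ('x \<Rightarrow> 'k::field) set)"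
    and dim_fsup: "fs.dim (fsup J :: ('x \<Rightarrow> 'k) set) = card J"
proof -
  let ?U = "fun_unit ` J :: ('x \<Rightarrow> 'k) set"
  have sub: "fsup J \<subseteq> fs.span ?U"
  proof
    fix f :: "'x \<Rightarrow> 'k" assume "f \<in> fsup J"
    then have "f = (\<Sum>a\<in>J. fscale (f a) (fun_unit a))" by (rule fsup_expand[OF assms])
    also have "\<dots> \<in> fs.span ?U"
      by (intro fs.span_sum fs.span_scale fs.span_base) auto
    finally show "f \<in> fs.span ?U" .
  qed
  then show "fs.fdim (fsup J :: ('x \<Rightarrow> 'k) set)"
    unfolding fs.fdim_def using assms by blast
  have U: "?U \<subseteq> fsup J" by (auto simp: fsup_def fun_unit_def split: if_splits)
  have "fs.independent ?U"
  proof (rule fs.independent_if_scalars_zero)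
    show "finite ?U" using assms by simp
    fix u :: "('x \<Rightarrow> 'k) \<Rightarrow> 'k" and x assume s: "(\<Sum>x\<in>?U. fscale (u x) x) = 0" and "x \<in> ?U"
    then obtain a where a: "a \<in> J" "x = fun_unit a" by blast
    have "0 = (\<Sum>x\<in>?U. fscale (u x) x) a" using s by simp
    also have "\<dots> = (\<Sum>b\<in>J. fscale (u (fun_unit b)) (fun_unit b) a)"
      unfolding sum_apply by (rule sum.reindex_cong[OF inj_on_subset[OF inj_fun_unit]]) auto
    also have "\<dots> = (\<Sum>b\<in>J. if b = a then u (fun_unit b) else 0)"
      by (intro sum.cong) (auto simp: fun_unit_def)
    also have "\<dots> = u x" using a assms by simp
    finally show "u x = 0" by simp
  qed
  then have "fs.dim (fsup J :: ('x \<Rightarrow> 'k) set) = card ?U"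
    using fs.basis_card_eq_dim[OF U sub] by simp
  also have "\<dots> = card J" by (intro card_image inj_on_subset[OF inj_fun_unit]) auto
  finally show "fs.dim (fsup J :: ('x \<Rightarrow> 'k) set) = card J" .
qed

section \<open>Functions of two arguments and tensor products\<close>

definition tsup :: "('x \<times> 'y) set \<Rightarrow> ('x \<Rightarrow> 'y \<Rightarrow> 'k::field) set"
  where "tsup J = {f. \<forall>x y. f x y \<noteq> 0 \<longrightarrow> (x, y) \<in> J}"

lemma subspace_tsup: "ts.subspace (tsup J)"
  unfolding ts.subspace_def tsup_def by auto (metis add_0)

lemma curry_linear: "Vector_Spaces.linear fscale tscale curry"
  by (simp add: kspace_linear_iff[OF kspace_fscale kspace_tscale] fun_eq_iff)

lemma tsup_curry: "tsup J = curry ` fsup J"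
proof -
  have "f \<in> curry ` fsup J" if "f \<in> tsup J" for f :: "'a \<Rightarrow> 'b \<Rightarrow> 'c"
  proof (rule image_eqI)
    show "f = curry (case_prod f)" by simp
    show "case_prod f \<in> fsup J" using that by (auto simp: tsup_def fsup_def)
  qed
  then show ?thesis by (auto simp: tsup_def fsup_def)
qed

lemma
  assumes "finite J"
  shows fdim_tsup: "ts.fdim (tsup J :: ('x \<Rightarrow> 'y \<Rightarrow> 'k::field) set)"
    and dim_tsup: "ts.dim (tsup J :: ('x \<Rightarrow> 'y \<Rightarrow> 'k) set) = card J"
proof -
  show "ts.fdim (tsup J :: ('x \<Rightarrow> 'y \<Rightarrow> 'k::field) set)"
    unfolding tsup_curry
    by (rule linear_image_fdim[OF kspace_fscale kspace_tscale curry_linear fdim_fsup[OF assms]])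
  show "ts.dim (tsup J :: ('x \<Rightarrow> 'y \<Rightarrow> 'k) set) = card J"
    unfolding tsup_curry
    by (subst dim_image_inj[OF kspace_fscale kspace_tscale curry_linear subspace_fsup
          fdim_fsup[OF assms]]) (auto simp: dim_fsup[OF assms] fun_eq_iff)
qed

text \<open>Each coordinate functional on the independent set \<open>B\<close> extends to the whole
  function space; on functions supported in the finite set \<open>Y\<close> it is given by its
  values \<open>c\<close> on the unit functions.\<close>

lemma dual_family_exists:
  fixes B :: "('y \<Rightarrow> 'k::field) set"
  assumes "finite Y" "B \<subseteq> fsup Y" "fs.independent B"
  obtains c where "\<And>b b'. b \<in> B \<Longrightarrow> b' \<in> B \<Longrightarrow> (\<Sum>z\<in>Y. c b z * b' z) = (if b = b' then 1 else 0)"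
proof -
  interpret kt: kspace "(*) :: 'k \<Rightarrow> 'k \<Rightarrow> 'k" by (rule kspace_times)
  interpret vp: vector_space_pair fscale "(*) :: 'k \<Rightarrow> 'k \<Rightarrow> 'k" ..
  have "\<exists>g. Vector_Spaces.linear fscale (*) g \<and> (\<forall>x\<in>B. g x = (if b = x then 1 else 0))" for b
    using vp.linear_independent_extend[OF assms(3), of "\<lambda>x. if b = x then 1 else 0"] by auto
  then obtain g where g: "\<And>b. Vector_Spaces.linear fscale (*) (g b)"
    "\<And>b x. x \<in> B \<Longrightarrow> g b x = (if b = x then 1 else (0::'k))" by metis
  have "(\<Sum>z\<in>Y. g b (fun_unit z) * b' z) = (if b = b' then 1 else 0)" if "b' \<in> B" for b b'
  proof -
    interpret gl: Vector_Spaces.linear fscale "(*)" "g b" by (rule g)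
    have "g b b' = g b (\<Sum>z\<in>Y. fscale (b' z) (fun_unit z))"
      using fsup_expand[OF assms(1)] that assms(2) by (metis subsetD)
    also have "\<dots> = (\<Sum>z\<in>Y. b' z * g b (fun_unit z))"
      by (simp add: gl.sum gl.scale)
    finally show ?thesis using g(2)[OF that] by (simp add: mult.commute)
  qed
  then show thesis by (intro that[of "\<lambda>b z. g b (fun_unit z)"])
qed

text \<open>The coordinates in a basis of \<open>W\<close> appear as explicit sums over
  \<open>Y\<close>, so that they can be taken in the second argument of a function of two arguments
  while the first one is kept as a parameter.\<close>

lemma dual_basis_exists:
  fixes W :: "('y \<Rightarrow> 'k::field) set"
  assumes "finite Y" "W \<subseteq> fsup Y" "fs.subspace W"
  obtains B c where "finite B" "B \<subseteq> W" "fs.dim W = card B" "0 \<notin> B"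
    "\<And>b b'. b \<in> B \<Longrightarrow> b' \<in> B \<Longrightarrow> (\<Sum>z\<in>Y. c b z * b' z) = (if b = b' then 1 else 0)"
    "\<And>w y. w \<in> W \<Longrightarrow> w y = (\<Sum>b\<in>B. (\<Sum>z\<in>Y. c b z * w z) * b y)"
proof -
  have "fs.fdim W" using fs.fdim_mono[OF fdim_fsup[OF assms(1)] assms(2)] .
  then obtain B where B: "finite B" "B \<subseteq> W" "fs.independent B" "fs.span B = W" "fs.dim W = card B"
    using fs.fdim_basis[OF assms(3)] by metis
  obtain c where c: "\<And>b b'. b \<in> B \<Longrightarrow> b' \<in> B \<Longrightarrow>
      (\<Sum>z\<in>Y. c b z * b' z) = (if b = b' then 1 else 0)"
    using dual_family_exists[OF assms(1) _ B(3)] B(2) assms(2) by (metis subset_trans)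
  have "w y = (\<Sum>b\<in>B. (\<Sum>z\<in>Y. c b z * w z) * b y)" if "w \<in> W" for w y
  proof -
    have "w \<in> range (\<lambda>u. \<Sum>b\<in>B. fscale (u b) b)"
      using that unfolding B(4)[symmetric] fs.span_finite[OF B(1)] .
    then obtain u where u: "w = (\<Sum>b\<in>B. fscale (u b) b)" by blast
    have "(\<Sum>z\<in>Y. c b z * w z) = u b" if "b \<in> B" for b
    proof -
      have "(\<Sum>z\<in>Y. c b z * w z) = (\<Sum>z\<in>Y. \<Sum>b'\<in>B. u b' * (c b z * b' z))"
        unfolding u by (simp add: sum_distrib_left algebra_simps)
      also have "\<dots> = (\<Sum>b'\<in>B. u b' * (\<Sum>z\<in>Y. c b z * b' z))"
        by (subst sum.swap) (simp add: sum_distrib_left)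
      also have "\<dots> = (\<Sum>b'\<in>B. if b = b' then u b' else 0)"
        using c that by (intro sum.cong) auto
      also have "\<dots> = u b" using that B(1) by simp
      finally show ?thesis .
    qed
    then show ?thesis by (subst u) (simp cong: sum.cong)
  qed
  moreover have "0 \<notin> B" using B(3) fs.dependent_zero by blast
  ultimately show thesis using B c by (intro that[of B c])
qed

text \<open>The tensor product of \<open>S\<close> and \<open>W\<close>, encoded by the matrices
  with all columns in \<open>S\<close> and all rows in \<open>W\<close>.\<close>

definition Ten :: "('x \<Rightarrow> 'k::field) set \<Rightarrow> ('y \<Rightarrow> 'k) set \<Rightarrow> ('x \<Rightarrow> 'y \<Rightarrow> 'k) set"
  where "Ten S W = {x. (\<forall>y. (\<lambda>a. x a y) \<in> S) \<and> (\<forall>a. x a \<in> W)}"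

lemma subspace_Ten:
  assumes "fs.subspace S" "fs.subspace W"
  shows "ts.subspace (Ten S W)"
  unfolding ts.subspace_def
proof (intro conjI ballI allI)
  show "0 \<in> Ten S W"
    using fs.subspace_0[OF assms(1)] fs.subspace_0[OF assms(2)]
    by (simp add: Ten_def zero_fun_def)
  fix x y assume xy: "x \<in> Ten S W" "y \<in> Ten S W"
  have "(\<lambda>a. (x + y) a z) = (\<lambda>a. x a z) + (\<lambda>a. y a z)" for z by (simp add: fun_eq_iff)
  then show "x + y \<in> Ten S W"
    using xy fs.subspace_add[OF assms(1)] fs.subspace_add[OF assms(2)] unfolding Ten_def by auto
next
  fix c x assume x: "x \<in> Ten S W"
  have "(\<lambda>a. tscale c x a z) = fscale c (\<lambda>a. x a z)" "tscale c x a = fscale c (x a)" for a z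
    by (simp_all add: fun_eq_iff)
  then show "tscale c x \<in> Ten S W"
    using x fs.subspace_scale[OF assms(1)] fs.subspace_scale[OF assms(2)] unfolding Ten_def by auto
qed

lemma Ten_fsup: "Ten (fsup X) (fsup Y) = tsup (X \<times> Y)"
  by (auto simp: Ten_def fsup_def tsup_def)

lemma Ten_mono: "S \<subseteq> S' \<Longrightarrow> W \<subseteq> W' \<Longrightarrow> Ten S W \<subseteq> Ten S' W'"
  by (auto simp: Ten_def)

lemma Ten_coefficients:
  assumes "finite Y" "fs.subspace S" "x \<in> Ten S W"
  shows "(\<lambda>a. \<Sum>z\<in>Y. c z * x a z) \<in> S"
proof -
  have "(\<lambda>a. \<Sum>z\<in>Y. c z * x a z) = (\<Sum>z\<in>Y. fscale (c z) (\<lambda>a. x a z))"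
    by (simp add: fun_eq_iff)
  also have "\<dots> \<in> S"
    using assms(3) by (intro fs.subspace_sum fs.subspace_scale assms) (auto simp: Ten_def)
  finally show ?thesis .
qed

text \<open>Expanding the rows in a basis of \<open>W\<close> gives coefficient functions that lie
  in \<open>S\<close>, because they are combinations of columns. So the space is a direct sum of
  copies of \<open>S\<close>, one for each basis vector.\<close>

lemma
  fixes S :: "('x \<Rightarrow> 'k::field) set" and W :: "('y \<Rightarrow> 'k) set"
  assumes "finite X" "S \<subseteq> fsup X" "fs.subspace S" and "finite Y" "W \<subseteq> fsup Y" "fs.subspace W"
  shows fdim_Ten: "ts.fdim (Ten S W)" and dim_Ten: "ts.dim (Ten S W) = fs.dim S * fs.dim W"
proof -
  show "ts.fdim (Ten S W)"
    by (rule ts.fdim_mono[OF fdim_tsup[of "X \<times> Y"]])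
      (use assms Ten_mono[of S "fsup X" W "fsup Y"] Ten_fsup[of X Y] in auto)
  obtain B c where B: "finite B" "B \<subseteq> W" "fs.dim W = card B" "0 \<notin> B"
    and c: "\<And>b b'. b \<in> B \<Longrightarrow> b' \<in> B \<Longrightarrow> (\<Sum>z\<in>Y. c b z * b' z) = (if b = b' then 1 else 0)"
    and ex: "\<And>w y. w \<in> W \<Longrightarrow> w y = (\<Sum>b\<in>B. (\<Sum>z\<in>Y. c b z * w z) * b y)"
    by (rule dual_basis_exists[OF assms(4-6)]) blast
  have fdS: "fs.fdim S" using fs.fdim_mono[OF fdim_fsup[OF assms(1)] assms(2)] .
  define h where "h b s = (\<lambda>a y. s a * b y)" for b :: "'y \<Rightarrow> 'k" and s :: "'x \<Rightarrow> 'k"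
  have lin: "Vector_Spaces.linear fscale tscale (h b)" for b
    by (simp add: kspace_linear_iff[OF kspace_fscale kspace_tscale] fun_eq_iff h_def algebra_simps)
  have Z: "ts.subspace (h b ` S)" "ts.fdim (h b ` S)" for b
    using linear_image_subspace[OF lin assms(3)]
      linear_image_fdim[OF kspace_fscale kspace_tscale lin fdS] by auto
  have dimZ: "ts.dim (h b ` S) = fs.dim S" if "b \<in> B" for b
  proof (rule dim_image_inj[OF kspace_fscale kspace_tscale lin assms(3) fdS])
    fix s assume s: "h b s = 0"
    have "b \<noteq> 0" using B(4) that by metis
    then obtain y where "b y \<noteq> 0" by (auto simp: fun_eq_iff)
    moreover have "s a * b y = 0" for a using fun_cong[OF fun_cong[OF s, of a], of y] by (simp add: h_def)
    ultimately show "s = 0" by (simp add: fun_eq_iff)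
  qed
  have ind: "\<forall>b\<in>B. \<zeta> b \<in> {0}"
    if z: "\<And>b. b \<in> B \<Longrightarrow> \<zeta> b \<in> h b ` S" and s: "(\<Sum>b\<in>B. \<zeta> b) \<in> {0}" for \<zeta>
  proof
    fix b assume b: "b \<in> B"
    have "\<forall>b\<in>B. \<exists>s. \<zeta> b = h b s" using z by blast
    from bchoice[OF this] obtain s' where s': "\<And>b. b \<in> B \<Longrightarrow> \<zeta> b = h b (s' b)" by blast
    have "s' b a = 0" for a
    proof -
      have "0 = (\<Sum>y\<in>Y. c b y * (\<Sum>b'\<in>B. \<zeta> b') a y)" using s by simp
      also have "\<dots> = (\<Sum>y\<in>Y. \<Sum>b'\<in>B. s' b' a * (c b y * b' y))"
        using s' by (simp add: h_def sum_distrib_left algebra_simps)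
      also have "\<dots> = (\<Sum>b'\<in>B. s' b' a * (\<Sum>y\<in>Y. c b y * b' y))"
        by (subst sum.swap) (simp add: sum_distrib_left)
      also have "\<dots> = (\<Sum>b'\<in>B. if b = b' then s' b' a else 0)"
        using c b by (intro sum.cong) auto
      also have "\<dots> = s' b a" using b B(1) by simp
      finally show ?thesis by simp
    qed
    then show "\<zeta> b \<in> {0}" using s' b by (simp add: h_def fun_eq_iff)
  qed
  have fd0: "ts.fdim {0}" unfolding ts.fdim_def using ts.span_zero by blast
  note sumdim = ts.dim_independent_sum(3)[where Z = "\<lambda>b. h b ` S", OF B(1) ts.subspace_single_0 fd0 Z ind]
  have "{b0 + (\<Sum>b\<in>B. \<zeta> b) | b0 \<zeta>. b0 \<in> {0} \<and> (\<forall>b\<in>B. \<zeta> b \<in> h b ` S)} = Ten S W" (is "?T = _")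
  proof
    show "?T \<subseteq> Ten S W"
    proof
      fix x assume "x \<in> ?T"
      then obtain \<zeta> where z: "x = (\<Sum>b\<in>B. \<zeta> b)" "\<forall>b\<in>B. \<zeta> b \<in> h b ` S" by auto
      have "\<zeta> b \<in> Ten S W" if b: "b \<in> B" for b
      proof -
        obtain s where s: "s \<in> S" "\<zeta> b = h b s" using z(2) b by blast
        have e: "(\<lambda>a. \<zeta> b a y) = fscale (b y) s" "\<zeta> b a = fscale (s a) b" for a y
          by (auto simp: s h_def fun_eq_iff)
        have "(\<lambda>a. \<zeta> b a y) \<in> S" for y
          unfolding e(1) by (rule fs.subspace_scale[OF assms(3) s(1)])
        moreover have "\<zeta> b a \<in> W" for a
          unfolding e(2) using B(2) b by (intro fs.subspace_scale assms) auto
        ultimately show ?thesis by (simp add: Ten_def)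
      qed
      then show "x \<in> Ten S W" unfolding z(1)
        by (intro ts.subspace_sum subspace_Ten assms) auto
    qed
    show "Ten S W \<subseteq> ?T"
    proof
      fix x assume x: "x \<in> Ten S W"
      define \<zeta> where "\<zeta> b = h b (\<lambda>a. \<Sum>z\<in>Y. c b z * x a z)" for b
      have "\<zeta> b \<in> h b ` S" for b
        unfolding \<zeta>_def using Ten_coefficients[OF assms(4,3) x] by blast
      moreover have "x = 0 + (\<Sum>b\<in>B. \<zeta> b)"
      proof -
        have eq: "x a y = (\<Sum>b\<in>B. (\<Sum>z\<in>Y. c b z * x a z) * b y)" for a y
          by (rule ex) (use x in \<open>simp add: Ten_def\<close>)
        have "x a y = (0 + (\<Sum>b\<in>B. \<zeta> b)) a y" for a y
          using eq[of a y] unfolding \<zeta>_def h_def plus_fun_def zero_fun_def sum_apply by simp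
        then show ?thesis by (intro ext)
      qed
      ultimately show "x \<in> ?T" by blast
    qed
  qed
  moreover have "(\<Sum>b\<in>B. ts.dim (h b ` S \<inter> {0})) = 0"
  proof (rule sum.neutral, rule ballI)
    fix b
    have "ts.dim (h b ` S \<inter> {0}) \<le> card ({} :: ('x \<Rightarrow> 'y \<Rightarrow> 'k) set)"
      by (rule ts.dim_le_card) auto
    then show "ts.dim (h b ` S \<inter> {0}) = 0" by simp
  qed
  moreover have "ts.dim ({0} :: ('x \<Rightarrow> 'y \<Rightarrow> 'k) set) = 0"
    using ts.dim_le_card[of "{0}" "{} :: ('x \<Rightarrow> 'y \<Rightarrow> 'k) set"] by simp
  ultimately show "ts.dim (Ten S W) = fs.dim S * fs.dim W"
    using sumdim dimZ B(3) by (simp add: mult.commute)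
qed

text \<open>Lifting column by column would lose the condition that the rows lie in \<open>W\<close>.
  Lifting the coefficient functions in a basis of \<open>W\<close> preserves it.\<close>

lemma Ten_lift:
  assumes f: "Vector_Spaces.linear fscale fscale f"
    and "fs.subspace S" "finite Y" "W \<subseteq> fsup Y" "fs.subspace W" and x: "x \<in> Ten (f ` S) W"
  obtains x' where "x' \<in> Ten S W" "\<And>y. (\<lambda>a. x a y) = f (\<lambda>a. x' a y)"
proof -
  interpret f: Vector_Spaces.linear fscale fscale f by fact
  obtain B c where B: "finite B" "B \<subseteq> W" "fs.dim W = card B" "0 \<notin> B"
    and c: "\<And>b b'. b \<in> B \<Longrightarrow> b' \<in> B \<Longrightarrow> (\<Sum>z\<in>Y. c b z * b' z) = (if b = b' then 1 else 0)"
    and ex: "\<And>w y. w \<in> W \<Longrightarrow> w y = (\<Sum>b\<in>B. (\<Sum>z\<in>Y. c b z * w z) * b y)"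
    by (rule dual_basis_exists[OF assms(3-5)]) blast
  have "(\<lambda>a. \<Sum>z\<in>Y. c b z * x a z) \<in> f ` S" for b
    by (rule Ten_coefficients[OF assms(3) linear_image_subspace[OF f assms(2)] x])
  then have "\<forall>b. \<exists>s. s \<in> S \<and> (\<lambda>a. \<Sum>z\<in>Y. c b z * x a z) = f s" by blast
  from choice[OF this] obtain s
    where s: "\<And>b. s b \<in> S" "\<And>b. (\<lambda>a. \<Sum>z\<in>Y. c b z * x a z) = f (s b)" by blast
  define x' where "x' = (\<lambda>a y. \<Sum>b\<in>B. s b a * b y)"
  have col: "(\<lambda>a. x' a y) = (\<Sum>b\<in>B. fscale (b y) (s b))" for y
    by (simp add: x'_def fun_eq_iff mult.commute)
  have row: "x' a = (\<Sum>b\<in>B. fscale (s b a) b)" for a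
    by (simp add: x'_def fun_eq_iff)
  show thesis
  proof (rule that)
    have "(\<lambda>a. x' a y) \<in> S" for y
      unfolding col using s(1) by (intro fs.subspace_sum fs.subspace_scale assms)
    moreover have "x' a \<in> W" for a
      unfolding row using B(2) by (intro fs.subspace_sum fs.subspace_scale assms) auto
    ultimately show "x' \<in> Ten S W" by (simp add: Ten_def)
    fix y
    have "(\<lambda>a. x a y) = (\<lambda>a. \<Sum>b\<in>B. (\<Sum>z\<in>Y. c b z * x a z) * b y)"
      by (rule ext, rule ex) (use x in \<open>simp add: Ten_def\<close>)
    also have "\<dots> = (\<Sum>b\<in>B. fscale (b y) (f (s b)))"
      by (simp add: s(2)[symmetric] fun_eq_iff mult.commute)
    also have "\<dots> = f (\<lambda>a. x' a y)" unfolding col by (simp add: f.sum f.scale)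
    finally show "(\<lambda>a. x a y) = f (\<lambda>a. x' a y)" .
  qed
qed

section \<open>Rank of a matrix and of its transpose\<close>

definition mat_map :: "'x set \<Rightarrow> 'y set \<Rightarrow> ('x \<Rightarrow> 'y \<Rightarrow> 'k::field) \<Rightarrow> ('x \<Rightarrow> 'k) \<Rightarrow> 'y \<Rightarrow> 'k"
  where "mat_map X Y A c = (\<lambda>y. if y \<in> Y then \<Sum>x\<in>X. A x y * c x else 0)"

lemma mat_map_linear: "Vector_Spaces.linear fscale fscale (mat_map X Y A)"
  by (auto simp: linear_ff_iff mat_map_def fun_eq_iff sum.distrib sum_distrib_left algebra_simps)

text \<open>A basis \<open>B\<close> of the image factors the matrix as
  \<open>A x y = (\<Sum>b\<in>B. q b x * b y)\<close>, and the image of the transpose is then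
  spanned by the functions \<open>q b\<close>.\<close>

lemma mat_map_rank_le:
  fixes A :: "'x \<Rightarrow> 'y \<Rightarrow> 'k::field"
  assumes "finite X" "finite Y"
  shows "fs.dim (mat_map Y X (\<lambda>y x. A x y) ` fsup Y) \<le> fs.dim (mat_map X Y A ` fsup X)"
proof -
  let ?W = "mat_map X Y A ` fsup X"
  have W: "?W \<subseteq> fsup Y" "fs.subspace ?W"
    using linear_image_subspace[OF mat_map_linear subspace_fsup]
    by (auto simp: mat_map_def fsup_def split: if_splits)
  obtain B c where B: "finite B" "B \<subseteq> ?W" "fs.dim ?W = card B" "0 \<notin> B"
    and c: "\<And>b b'. b \<in> B \<Longrightarrow> b' \<in> B \<Longrightarrow> (\<Sum>z\<in>Y. c b z * b' z) = (if b = b' then 1 else 0)"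
    and ex: "\<And>w y. w \<in> ?W \<Longrightarrow> w y = (\<Sum>b\<in>B. (\<Sum>z\<in>Y. c b z * w z) * b y)"
    by (rule dual_basis_exists[OF assms(2) W]) blast
  define q where "q b = (\<lambda>x. if x \<in> X then \<Sum>z\<in>Y. c b z * A x z else 0)" for b
  have Aeq: "A x y = (\<Sum>b\<in>B. q b x * b y)" if xy: "x \<in> X" "y \<in> Y" for x y
  proof -
    have u: "mat_map X Y A (fun_unit x) = (\<lambda>y. if y \<in> Y then A x y else 0)"
    proof
      fix y
      have "(\<Sum>x'\<in>X. A x' y * fun_unit x x') = (\<Sum>x'\<in>X. if x' = x then A x' y else 0)"
        by (intro sum.cong) (auto simp: fun_unit_def)
      then show "mat_map X Y A (fun_unit x) y = (if y \<in> Y then A x y else 0)"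
        using assms xy by (simp add: mat_map_def)
    qed
    have "mat_map X Y A (fun_unit x) \<in> ?W" using xy by (auto simp: fsup_def fun_unit_def)
    from ex[OF this, of y] show ?thesis using xy unfolding u q_def by (simp cong: sum.cong)
  qed
  have "mat_map Y X (\<lambda>y x. A x y) ` fsup Y \<subseteq> fs.span (q ` B)"
  proof (rule image_subsetI)
    fix e :: "'y \<Rightarrow> 'k"
    have "mat_map Y X (\<lambda>y x. A x y) e x = (\<Sum>b\<in>B. fscale (\<Sum>y\<in>Y. b y * e y) (q b)) x" for x
    proof (cases "x \<in> X")
      case True
      then have "mat_map Y X (\<lambda>y x. A x y) e x = (\<Sum>y\<in>Y. \<Sum>b\<in>B. (b y * e y) * q b x)"
        using Aeq by (simp add: mat_map_def sum_distrib_left algebra_simps)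
      also have "\<dots> = (\<Sum>b\<in>B. (\<Sum>y\<in>Y. b y * e y) * q b x)"
        by (subst sum.swap) (simp add: sum_distrib_right)
      finally show ?thesis by simp
    qed (simp add: mat_map_def q_def)
    then have "mat_map Y X (\<lambda>y x. A x y) e = (\<Sum>b\<in>B. fscale (\<Sum>y\<in>Y. b y * e y) (q b))" ..
    also have "\<dots> \<in> fs.span (q ` B)" by (intro fs.span_sum fs.span_scale fs.span_base) auto
    finally show "mat_map Y X (\<lambda>y x. A x y) e \<in> fs.span (q ` B)" .
  qed
  then have "fs.dim (mat_map Y X (\<lambda>y x. A x y) ` fsup Y) \<le> card (q ` B)"
    using B(1) by (intro fs.dim_le_card) auto
  also have "\<dots> \<le> card B" using B(1) by (rule card_image_le)
  finally show ?thesis using B(3) by simp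
qed

lemma mat_map_rank_transpose:
  fixes A :: "'x \<Rightarrow> 'y \<Rightarrow> 'k::field"
  assumes "finite X" "finite Y"
  shows "fs.dim (mat_map Y X (\<lambda>y x. A x y) ` fsup Y) = fs.dim (mat_map X Y A ` fsup X)"
  using mat_map_rank_le[OF assms, of A] mat_map_rank_le[OF assms(2,1), of "\<lambda>y x. A x y"] by simp

section \<open>Exterior algebra\<close>

lemma orient_square [simp]: "orient F v * orient F v = (1::'k::field)"
  by (simp add: orient_def flip: power_mult_distrib)

lemma orient_square_left [simp]: "orient F v * (orient F v * c) = (c::'k::field)"
  by (simp flip: mult.assoc)

lemma orient_remove:
  assumes "finite F" "u \<in> F"
  shows "orient (F - {u}) v = (if u < v then - orient F v else (orient F v :: 'k::field))"
proof (cases "u < v")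
  case True
  have "{w \<in> F. w < v} = insert u {w \<in> F - {u}. w < v}" using True assms by auto
  then have "card {w \<in> F. w < v} = Suc (card {w \<in> F - {u}. w < v})" using assms by simp
  then show ?thesis using True by (simp add: orient_def)
next
  case False
  then have "{w \<in> F. w < v} = {w \<in> F - {u}. w < v}" by auto
  then show ?thesis using False by (simp add: orient_def)
qed

lemma orient_insert:
  assumes "finite F" "u \<notin> F"
  shows "orient (insert u F) v = (if u < v then - orient F v else (orient F v :: 'k::field))"
  using orient_remove[of "insert u F" u v, where 'k='k] assms by (auto split: if_splits)

text \<open>The diagonal is assumed to vanish separately, since in characteristic 2 this does not
  follow from antisymmetry.\<close>

lemma antisymmetric_sum_zero:
  fixes f :: "'i \<Rightarrow> 'i \<Rightarrow> 'b::ab_group_add"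
  assumes "finite A" "\<And>k l. k \<in> A \<Longrightarrow> l \<in> A \<Longrightarrow> f k l = - f l k" "\<And>k. k \<in> A \<Longrightarrow> f k k = 0"
  shows "(\<Sum>k\<in>A. \<Sum>l\<in>A. f k l) = 0"
  using assms
proof (induction A rule: finite_induct)
  case (insert a A)
  have "(\<Sum>k\<in>insert a A. \<Sum>l\<in>insert a A. f k l) =
      f a a + (\<Sum>l\<in>A. f a l) + ((\<Sum>k\<in>A. f k a) + (\<Sum>k\<in>A. \<Sum>l\<in>A. f k l))"
    using insert.hyps by (simp add: sum.distrib add.assoc)
  also have "(\<Sum>k\<in>A. f k a) = - (\<Sum>l\<in>A. f a l)"
    unfolding sum_negf[symmetric] by (intro sum.cong refl insert.prems(1)) auto
  also have "(\<Sum>k\<in>A. \<Sum>l\<in>A. f k l) = 0"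
    by (rule insert.IH) (rule insert.prems; simp)+
  finally show ?case using insert.prems(2) by simp
qed simp

text \<open>Left multiplication by the vector with coordinates \<open>b\<close> in the exterior
  algebra, elements being stored by their coefficients. On vertex sets, with \<open>b\<close>
  constantly 1, it is the simplicial coboundary (\<open>coboundary_wdg\<close>).\<close>

definition wdg :: "('n::linorder \<Rightarrow> 'k::field) \<Rightarrow> ('n set \<Rightarrow> 'k) \<Rightarrow> 'n set \<Rightarrow> 'k"
  where "wdg b w = (\<lambda>\<sigma>. \<Sum>k\<in>\<sigma>. orient \<sigma> k * b k * w (\<sigma> - {k}))"

text \<open>Contraction with the covector \<open>a\<close>, the transpose of \<open>wdg a\<close>.
  It plays three roles: Koszul differential on sets of forms, simplicial boundary
  (\<open>boundary_ctr\<close>), and cone homotopy on vertex sets.\<close>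

definition ctr :: "'n::linorder set \<Rightarrow> ('n \<Rightarrow> 'k::field) \<Rightarrow> ('n set \<Rightarrow> 'k) \<Rightarrow> 'n set \<Rightarrow> 'k"
  where "ctr N a w = (\<lambda>\<sigma>. \<Sum>k\<in>N - \<sigma>. orient (insert k \<sigma>) k * a k * w (insert k \<sigma>))"

lemma wdg_add: "wdg b (x + y) = wdg b x + wdg b y"
  by (simp add: wdg_def fun_eq_iff sum.distrib algebra_simps)

lemma wdg_scale: "wdg b (fscale c x) = fscale c (wdg b x)"
  by (simp add: wdg_def fun_eq_iff sum_distrib_left algebra_simps)

lemma ctr_add: "ctr N b (x + y) = ctr N b x + ctr N b y"
  by (simp add: ctr_def fun_eq_iff sum.distrib algebra_simps)

lemma ctr_scale: "ctr N b (fscale c x) = fscale c (ctr N b x)"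
  by (simp add: ctr_def fun_eq_iff sum_distrib_left algebra_simps)

lemma linear_ctr: "Vector_Spaces.linear fscale fscale (ctr N b)"
  by (simp add: linear_ff_iff ctr_add ctr_scale)

lemma wdg_zero [simp]: "wdg b 0 = 0" and wdg_zero_lambda [simp]: "wdg b (\<lambda>_. 0) = (\<lambda>_. 0)"
  by (simp_all add: wdg_def fun_eq_iff)

lemma ctr_zero [simp]: "ctr N b 0 = 0"
  by (simp add: ctr_def fun_eq_iff)

lemma ctr_minus: "ctr N b (- x) = - ctr N b x"
  by (simp add: ctr_def fun_eq_iff sum_negf)

lemma ctr_diff: "ctr N b (x - y) = ctr N b x - ctr N b y"
  using ctr_add[of N b x "- y"] by (simp add: ctr_minus)

lemma ctr_sum: "ctr N b (\<Sum>i\<in>I. x i) = (\<Sum>i\<in>I. ctr N b (x i))"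
proof -
  interpret Vector_Spaces.linear fscale fscale "ctr N b" by (rule linear_ctr)
  show ?thesis by (rule sum)
qed

lemma wdg_wdg:
  assumes "finite \<sigma>"
  shows "wdg b (wdg b w) \<sigma> = (0::'k::field)"
proof -
  define f where "f k l = (if k = l then 0 else
    orient \<sigma> k * orient (\<sigma> - {k}) l * b k * b l * w (\<sigma> - {k} - {l}))" for k l
  have "wdg b (wdg b w) \<sigma> = (\<Sum>k\<in>\<sigma>. \<Sum>l\<in>\<sigma>. f k l)"
    unfolding wdg_def
  proof (rule sum.cong[OF refl])
    fix k assume k: "k \<in> \<sigma>"
    have "(\<Sum>l\<in>\<sigma>. f k l) = (\<Sum>l\<in>\<sigma> - {k}. f k l)"
      using assms k by (simp add: sum.remove f_def)
    also have "\<dots> = orient \<sigma> k * b k * (\<Sum>l\<in>\<sigma> - {k}. orient (\<sigma> - {k}) l * b l * w (\<sigma> - {k} - {l}))"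
      unfolding sum_distrib_left by (intro sum.cong refl) (auto simp: f_def mult_ac)
    finally show "orient \<sigma> k * b k * (\<Sum>l\<in>\<sigma> - {k}. orient (\<sigma> - {k}) l * b l * w (\<sigma> - {k} - {l}))
      = (\<Sum>l\<in>\<sigma>. f k l)" by simp
  qed
  also have "\<dots> = 0"
  proof (rule antisymmetric_sum_zero[OF assms])
    fix k l assume kl: "k \<in> \<sigma>" "l \<in> \<sigma>"
    have e: "\<sigma> - {l} - {k} = \<sigma> - {k} - {l}" by auto
    show "f k l = - f l k"
      unfolding f_def e using kl assms
      by (cases k l rule: linorder_cases) (auto simp: orient_remove)
  qed (simp add: f_def)
  finally show ?thesis .
qed

text \<open>One antisymmetric kernel \<open>g\<close> serves all pairs of covectors, so that both
  the vanishing of the square and the anticommutation of two contractions follow from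
  \<open>antisymmetric_sum_zero\<close>.\<close>

lemma ctr_ctr_expand:
  assumes "finite N" "finite \<sigma>"
  obtains g where "\<And>a a'. ctr N a (ctr N a' w) \<sigma> = (\<Sum>k\<in>N. \<Sum>l\<in>N. a k * a' l * g k l)"
    "\<And>k l. g k l = - g l k" "\<And>k. g k k = (0::'k::field)"
proof -
  define g where "g k l = (if k = l \<or> k \<in> \<sigma> \<or> l \<in> \<sigma> then 0 else
    orient (insert k \<sigma>) k * orient (insert l (insert k \<sigma>)) l * w (insert l (insert k \<sigma>)))" for k l
  have "ctr N a (ctr N a' w) \<sigma> = (\<Sum>k\<in>N. \<Sum>l\<in>N. a k * a' l * g k l)" for a a'
  proof -
    have "ctr N a (ctr N a' w) \<sigma> = (\<Sum>k\<in>N - \<sigma>. \<Sum>l\<in>N. a k * a' l * g k l)"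
      unfolding ctr_def
    proof (rule sum.cong[OF refl])
      fix k assume k: "k \<in> N - \<sigma>"
      have *: "(\<Sum>l\<in>N. a k * a' l * g k l) = (\<Sum>l\<in>N - insert k \<sigma>. a k * a' l * g k l)"
        using assms by (intro sum.mono_neutral_right) (auto simp: g_def)
      show "orient (insert k \<sigma>) k * a k *
         (\<Sum>l\<in>N - insert k \<sigma>. orient (insert l (insert k \<sigma>)) l * a' l * w (insert l (insert k \<sigma>)))
        = (\<Sum>l\<in>N. a k * a' l * g k l)"
        unfolding * sum_distrib_left using k by (intro sum.cong refl) (auto simp: g_def mult_ac)
    qed
    also have "\<dots> = (\<Sum>k\<in>N. \<Sum>l\<in>N. a k * a' l * g k l)"
      using assms by (intro sum.mono_neutral_left) (auto simp: g_def)
    finally show ?thesis .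
  qed
  moreover have "g k l = - g l k" for k l
    using assms(2) by (cases k l rule: linorder_cases) (auto simp: g_def orient_insert insert_commute)
  moreover have "g k k = 0" for k by (simp add: g_def)
  ultimately show thesis by (rule that)
qed

lemma ctr_ctr_same:
  assumes "finite N" "finite \<sigma>"
  shows "ctr N a (ctr N a w) \<sigma> = (0::'k::field)"
proof (rule ctr_ctr_expand[OF assms, of w])
  fix g :: "'a \<Rightarrow> 'a \<Rightarrow> 'k"
  assume g: "\<And>a a'. ctr N a (ctr N a' w) \<sigma> = (\<Sum>k\<in>N. \<Sum>l\<in>N. a k * a' l * g k l)"
    "\<And>k l. g k l = - g l k" "\<And>k. g k k = 0"
  show ?thesis
    unfolding g(1)
  proof (rule antisymmetric_sum_zero[OF assms(1)])
    fix k l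
    show "a k * a l * g k l = - (a l * a k * g l k)" by (subst g(2)) (simp add: mult.commute)
  qed (simp add: g(3))
qed

lemma ctr_ctr_anticommute:
  assumes "finite N" "finite \<sigma>"
  shows "ctr N a (ctr N a' w) \<sigma> = - (ctr N a' (ctr N a w) \<sigma> :: 'k::field)"
proof (rule ctr_ctr_expand[OF assms, of w])
  fix g :: "'a \<Rightarrow> 'a \<Rightarrow> 'k"
  assume g: "\<And>a a'. ctr N a (ctr N a' w) \<sigma> = (\<Sum>k\<in>N. \<Sum>l\<in>N. a k * a' l * g k l)"
    "\<And>k l. g k l = - g l k" "\<And>k. g k k = 0"
  have "(\<Sum>k\<in>N. \<Sum>l\<in>N. (a k * a' l + a' k * a l) * g k l) = 0"
  proof (rule antisymmetric_sum_zero[OF assms(1)])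
    fix k l
    show "(a k * a' l + a' k * a l) * g k l = - ((a l * a' k + a' l * a k) * g l k)"
      by (subst g(2)) (simp add: algebra_simps)
  qed (simp add: g(3))
  then show ?thesis
    unfolding g(1) by (simp add: sum.distrib distrib_right eq_neg_iff_add_eq_0)
qed

text \<open>Terms that insert \<open>k\<close> and remove a different \<open>l\<close> occur in both
  products with opposite signs; the terms with \<open>k = l\<close> add up to the pairing of
  \<open>a\<close> and \<open>b\<close>. The contracting homotopies below are all instances of this
  identity.\<close>

lemma ctr_wdg:
  assumes "finite N" "\<sigma> \<subseteq> N"
  shows "ctr N a (wdg b w) \<sigma> + wdg b (ctr N a w) \<sigma> = (\<Sum>k\<in>N. a k * b k) * (w \<sigma> :: 'k::field)"
proof -
  have fin: "finite \<sigma>" using assms finite_subset by blast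
  define h where "h k l = orient (insert k \<sigma>) k * orient (insert k \<sigma>) l * a k * b l * w (insert k \<sigma> - {l})"
    for k l
  have 1: "ctr N a (wdg b w) \<sigma> = (\<Sum>k\<in>N - \<sigma>. a k * b k * w \<sigma>) + (\<Sum>k\<in>N - \<sigma>. \<Sum>l\<in>\<sigma>. h k l)"
    unfolding ctr_def wdg_def sum.distrib[symmetric]
  proof (rule sum.cong[OF refl])
    fix k assume k: "k \<in> N - \<sigma>"
    have "orient (insert k \<sigma>) k * a k * (\<Sum>l\<in>insert k \<sigma>. orient (insert k \<sigma>) l * b l * w (insert k \<sigma> - {l}))
      = (\<Sum>l\<in>insert k \<sigma>. h k l)"
      by (simp only: sum_distrib_left h_def ac_simps)
    also have "\<dots> = a k * b k * w \<sigma> + (\<Sum>l\<in>\<sigma>. h k l)"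
      using k fin by (simp add: h_def)
    finally show "orient (insert k \<sigma>) k * a k *
        (\<Sum>l\<in>insert k \<sigma>. orient (insert k \<sigma>) l * b l * w (insert k \<sigma> - {l}))
      = a k * b k * w \<sigma> + (\<Sum>l\<in>\<sigma>. h k l)" .
  qed
  have 2: "wdg b (ctr N a w) \<sigma> = (\<Sum>l\<in>\<sigma>. a l * b l * w \<sigma>) - (\<Sum>l\<in>\<sigma>. \<Sum>k\<in>N - \<sigma>. h k l)"
    unfolding ctr_def wdg_def sum_subtractf[symmetric]
  proof (rule sum.cong[OF refl])
    fix l assume l: "l \<in> \<sigma>"
    define q where "q k = orient \<sigma> l * b l * (orient (insert k (\<sigma> - {l})) k * a k * w (insert k (\<sigma> - {l})))"
      for k
    have "N - (\<sigma> - {l}) = insert l (N - \<sigma>)" using l assms(2) by auto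
    then have "orient \<sigma> l * b l *
        (\<Sum>k\<in>N - (\<sigma> - {l}). orient (insert k (\<sigma> - {l})) k * a k * w (insert k (\<sigma> - {l})))
      = q l + (\<Sum>k\<in>N - \<sigma>. q k)"
      using l assms(1) by (simp add: q_def sum_distrib_left distrib_left)
    also have "q l = a l * b l * w \<sigma>"
      using l by (simp add: q_def insert_absorb mult_ac)
    also have "(\<Sum>k\<in>N - \<sigma>. q k) = - (\<Sum>k\<in>N - \<sigma>. h k l)"
      unfolding sum_negf[symmetric]
    proof (rule sum.cong[OF refl])
      fix k assume k: "k \<in> N - \<sigma>"
      then have "k \<noteq> l" "insert k (\<sigma> - {l}) = insert k \<sigma> - {l}" using l by auto
      then show "q k = - h k l"
        using k l fin unfolding q_def h_def
        by (cases k l rule: linorder_cases) (simp_all add: orient_remove orient_insert)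
    qed
    finally show "orient \<sigma> l * b l *
        (\<Sum>k\<in>N - (\<sigma> - {l}). orient (insert k (\<sigma> - {l})) k * a k * w (insert k (\<sigma> - {l})))
      = a l * b l * w \<sigma> - (\<Sum>k\<in>N - \<sigma>. h k l)" by simp
  qed
  have "(\<Sum>k\<in>N. a k * b k) * w \<sigma> = (\<Sum>k\<in>N. a k * b k * w \<sigma>)"
    by (simp add: sum_distrib_right)
  also have "\<dots> = (\<Sum>k\<in>N - \<sigma>. a k * b k * w \<sigma>) + (\<Sum>k\<in>\<sigma>. a k * b k * w \<sigma>)"
    using assms by (rule sum.subset_diff[of \<sigma> N, rotated -1]) 
  finally show ?thesis
    unfolding 1 2 using sum.swap[of h "\<sigma>" "N - \<sigma>"] by simp
qed

section \<open>Exterior powers of a space with a fixed basis of \<open>d\<close> vectors\<close>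

definition Lam :: "nat \<Rightarrow> nat \<Rightarrow> (nat set \<Rightarrow> 'k::field) set"
  where "Lam d p = fsup {\<sigma>. \<sigma> \<subseteq> {..<d} \<and> card \<sigma> = p}"

lemma Lam_D: "w \<in> Lam d p \<Longrightarrow> w \<sigma> \<noteq> 0 \<Longrightarrow> \<sigma> \<subseteq> {..<d} \<and> card \<sigma> = p"
  by (simp add: Lam_def fsup_def)

lemma finite_Lam: "finite {\<sigma>. \<sigma> \<subseteq> {..<d::nat} \<and> card \<sigma> = p}"
  by (rule finite_subset[of _ "Pow {..<d}"]) auto

lemma subspace_Lam: "fs.subspace (Lam d p)"
  unfolding Lam_def by (rule subspace_fsup)

lemma fdim_Lam: "fs.fdim (Lam d p)"
  unfolding Lam_def by (rule fdim_fsup[OF finite_Lam])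

lemma dim_Lam: "fs.dim (Lam d p :: (nat set \<Rightarrow> 'k::field) set) = d choose p"
  unfolding Lam_def dim_fsup[OF finite_Lam] using n_subsets[of "{..<d}" p] by simp

lemma ctr_Lam:
  assumes "w \<in> Lam d p"
  shows "ctr {..<d} a w \<in> (if p = 0 then {0} else Lam d (p - 1))"
proof -
  have *: "\<sigma> \<subseteq> {..<d} \<and> Suc (card \<sigma>) = p" if nz: "ctr {..<d} a w \<sigma> \<noteq> 0" for \<sigma>
  proof -
    obtain k where "k \<in> {..<d} - \<sigma>" "orient (insert k \<sigma>) k * a k * w (insert k \<sigma>) \<noteq> 0"
      using nz unfolding ctr_def by (rule sum.not_neutral_contains_not_neutral)
    then have k: "k \<in> {..<d} - \<sigma>" "w (insert k \<sigma>) \<noteq> 0" by auto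
    then have "insert k \<sigma> \<subseteq> {..<d}" "card (insert k \<sigma>) = p" using Lam_D[OF assms] by auto
    moreover from this have "finite \<sigma>" using finite_subset[of _ "{..<d}"] by auto
    ultimately show ?thesis using k by auto
  qed
  show ?thesis
  proof (cases "p = 0")
    case True
    then have "ctr {..<d} a w \<sigma> = 0" for \<sigma> using *[of \<sigma>] by auto
    then show ?thesis using True by (simp add: fun_eq_iff)
  next
    case False
    then show ?thesis using * by (force simp: Lam_def fsup_def)
  qed
qed

lemma ctr_Lam_Suc: "w \<in> Lam d (Suc p) \<Longrightarrow> ctr {..<d} a w \<in> Lam d p"
  using ctr_Lam[of w d "Suc p" a] by simp

lemma wdg_Lam:
  assumes "w \<in> Lam d p" "b \<in> fsup {..<d}"
  shows "wdg b w \<in> Lam d (Suc p)"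
proof -
  have "\<sigma> \<subseteq> {..<d} \<and> card \<sigma> = Suc p" if nz: "wdg b w \<sigma> \<noteq> 0" for \<sigma>
  proof -
    obtain k where "k \<in> \<sigma>" "orient \<sigma> k * b k * w (\<sigma> - {k}) \<noteq> 0"
      using nz unfolding wdg_def by (rule sum.not_neutral_contains_not_neutral)
    then have k: "k \<in> \<sigma>" "b k \<noteq> 0" "w (\<sigma> - {k}) \<noteq> 0" by auto
    then have *: "\<sigma> - {k} \<subseteq> {..<d}" "card (\<sigma> - {k}) = p" using Lam_D[OF assms(1)] by auto
    then have "finite \<sigma>" using finite_subset[of _ "{..<d}"] by (metis finite_Diff_insert finite.emptyI Diff_empty finite_lessThan)
    then have "card \<sigma> = Suc p" using k(1) *(2) by (metis card_Suc_Diff1)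
    then show ?thesis using k assms(2) * by (auto simp: fsup_def)
  qed
  then show ?thesis by (auto simp: Lam_def fsup_def)
qed

lemma ctr_wdg_Lam:
  assumes "w \<in> Lam d p" "b \<in> fsup {..<d}"
  shows "ctr {..<d} a (wdg b w) = fscale (\<Sum>k<d. a k * b k) w - wdg b (ctr {..<d} a w)"
proof
  fix \<sigma>
  show "ctr {..<d} a (wdg b w) \<sigma> = (fscale (\<Sum>k<d. a k * b k) w - wdg b (ctr {..<d} a w)) \<sigma>"
  proof (cases "\<sigma> \<subseteq> {..<d}")
    case True
    then show ?thesis using ctr_wdg[of "{..<d}" \<sigma> a b w] by (simp add: algebra_simps)
  next
    case False
    have 1: "ctr {..<d} a (wdg b w) \<sigma> = 0"
      using Lam_D[OF ctr_Lam_Suc[OF wdg_Lam[OF assms]], where \<sigma> = \<sigma>] False by auto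
    have "wdg b (ctr {..<d} a w) \<sigma> = 0"
    proof (cases p)
      case 0
      then have "ctr {..<d} a w = 0" using ctr_Lam[OF assms(1)] by auto
      then show ?thesis by simp
    next
      case (Suc q)
      then have "ctr {..<d} a w \<in> Lam d q" using ctr_Lam_Suc assms(1) by blast
      from Lam_D[OF wdg_Lam[OF this assms(2)], where \<sigma> = \<sigma>] show ?thesis using False by auto
    qed
    then show ?thesis using 1 Lam_D[OF assms(1), of \<sigma>] False by auto
  qed
qed

text \<open>Each \<open>g\<close> is traded for one exterior degree. The product
  \<open>wdg (b g) w\<close> is still killed by the other contractions and vanishes by induction;
  contracting it with \<open>a g\<close> gives back \<open>w\<close>. Once \<open>G\<close> is used
  up, the exterior degree exceeds \<open>d\<close>.\<close>

lemma ctr_kernel_trivial: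
  assumes "finite G" and "\<And>g. b g \<in> fsup {..<d}"
    and "\<And>g g'. g \<in> G \<Longrightarrow> g' \<in> G \<Longrightarrow> (\<Sum>k<d. a g k * b g' k) = (if g = g' then 1 else (0::'k::field))"
    and "w \<in> Lam d q" "\<And>g. g \<in> G \<Longrightarrow> ctr {..<d} (a g) w = 0" "q + card G > d"
  shows "w = 0"
  using assms
proof (induction G arbitrary: q w rule: finite_induct)
  case empty
  have "w \<sigma> = 0" for \<sigma>
  proof (rule ccontr)
    assume "w \<sigma> \<noteq> 0"
    then have "\<sigma> \<subseteq> {..<d}" "card \<sigma> = q" using Lam_D[OF empty(3)] by auto
    then have "q \<le> d" using card_mono[of "{..<d}" \<sigma>] by simp
    then show False using empty by simp
  qed
  then show ?case by (simp add: fun_eq_iff)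
next
  case (insert g G)
  have cw: "ctr {..<d} (a g') (wdg (b g) w) = fscale (if g' = g then 1 else 0) w"
    if "g' \<in> insert g G" for g'
    using ctr_wdg_Lam[OF insert.prems(3) insert.prems(1)[of g], where a = "a g'"]
      insert.prems(2)[of g' g] insert.prems(4)[of g'] that by auto
  have "wdg (b g) w = 0"
  proof (rule insert.IH[where q = "Suc q"])
    show "wdg (b g) w \<in> Lam d (Suc q)" by (rule wdg_Lam[OF insert.prems(3,1)])
    show "ctr {..<d} (a g') (wdg (b g) w) = 0" if "g' \<in> G" for g'
      using cw[of g'] that insert(2) by (auto simp: fun_eq_iff)
  qed (use insert in auto)
  then have "fscale 1 w = 0" using cw[of g] by simp
  then show ?case by (simp add: fun_eq_iff)
qed

text \<open>This is the exterior power of the common kernel of the covectors \<open>a g\<close>. It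
  is the part of the Koszul complex of the polynomial ring in the variables \<open>G\<close> that
  carries its homology, in polynomial degree 0.\<close>

definition LamW :: "nat \<Rightarrow> ('g \<Rightarrow> nat \<Rightarrow> 'k::field) \<Rightarrow> 'g set \<Rightarrow> nat \<Rightarrow> (nat set \<Rightarrow> 'k) set"
  where "LamW d a G p = {w \<in> Lam d p. \<forall>g\<in>G. ctr {..<d} (a g) w = 0}"

lemma LamW_subset: "LamW d a G p \<subseteq> fsup {\<sigma>. \<sigma> \<subseteq> {..<d} \<and> card \<sigma> = p}"
  by (auto simp: LamW_def Lam_def)

lemma subspace_LamW: "fs.subspace (LamW d a G p)"
  using subspace_Lam[of d p]
  unfolding fs.subspace_def LamW_def by (auto simp: ctr_add ctr_scale)

lemma LamW_empty: "LamW d a {} p = Lam d p"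
  by (simp add: LamW_def)

text \<open>Wedging with \<open>b\<close> shows that kernel and image of the contraction agree. The
  dimensions of two consecutive kernels therefore add up to \<open>d choose Suc p\<close>, which is
  Pascal's recursion for \<open>(d - 1) choose p\<close>.\<close>

lemma dim_LamW_single:
  fixes a :: "'g \<Rightarrow> nat \<Rightarrow> 'k::field"
  assumes "(\<Sum>k<d. a g k * b k) = 1"
  shows "fs.dim (LamW d a {g} p) = (d - 1) choose p"
proof -
  let ?b = "\<lambda>k. if k < d then b k else 0"
  have b: "(\<Sum>k<d. a g k * ?b k) = 1" "?b \<in> fsup {..<d}"
    using assms by (auto simp: fsup_def split: if_splits)
  have "d \<noteq> 0" using assms by (intro notI) simp
  then obtain e where e: "d = Suc e" using not0_implies_Suc by blast
  have eq: "LamW d a {g} q = {w \<in> Lam d q. ctr {..<d} (a g) w = 0}" for q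
    by (simp add: LamW_def)
  have im: "ctr {..<d} (a g) ` Lam d (Suc q) = LamW d a {g} q" for q
  proof (intro subset_antisym image_subsetI subsetI)
    fix w :: "nat set \<Rightarrow> 'k" assume w: "w \<in> Lam d (Suc q)"
    have "ctr {..<d} (a g) (ctr {..<d} (a g) w) \<sigma> = 0" for \<sigma>
    proof (cases "finite \<sigma>")
      case False
      then have "w (insert k (insert l \<sigma>)) = 0" for k l
        using Lam_D[OF w, of "insert k (insert l \<sigma>)"] finite_subset[OF _ finite_lessThan] by blast
      then show ?thesis by (simp add: ctr_def)
    qed (simp add: ctr_ctr_same)
    then show "ctr {..<d} (a g) w \<in> LamW d a {g} q"
      using ctr_Lam_Suc[OF w] by (simp add: eq fun_eq_iff)
  next
    fix w :: "nat set \<Rightarrow> 'k" assume "w \<in> LamW d a {g} q"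
    then have w: "w \<in> Lam d q" "ctr {..<d} (a g) w = 0" by (auto simp: eq)
    show "w \<in> ctr {..<d} (a g) ` Lam d (Suc q)"
    proof (rule image_eqI)
      show "wdg ?b w \<in> Lam d (Suc q)" using wdg_Lam[OF w(1) b(2)] .
      show "w = ctr {..<d} (a g) (wdg ?b w)"
        using ctr_wdg_Lam[OF w(1) b(2), of "a g"] unfolding b(1) w(2) by (simp add: fun_eq_iff)
    qed
  qed
  define D where "D q = fs.dim (LamW d a {g} q)" for q
  have "D p = (d - 1) choose p"
  proof (induction p)
    case 0
    have "LamW d a {g} 0 = Lam d 0"
      unfolding eq using ctr_Lam[where p = 0 and d = d] by auto
    then show ?case unfolding D_def using dim_Lam[of d 0, where 'k='k] by simp
  next
    case (Suc p)
    have "D p + D (Suc p) = d choose Suc p"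
      using dim_image_kernel[OF kspace_fscale kspace_fscale linear_ctr subspace_Lam[of d "Suc p"]
          fdim_Lam[of d "Suc p"], of "{..<d}" "a g"] dim_Lam[of d "Suc p", where 'k='k]
      unfolding im eq D_def by simp
    then show ?case using Suc e by simp
  qed
  then show ?thesis by (simp add: D_def)
qed

section \<open>Koszul complexes of polynomial rings\<close>

definition xv :: "'v \<Rightarrow> 'v \<Rightarrow>\<^sub>0 nat"
  where "xv v = Poly_Mapping.single v 1"

lemma lookup_xv [simp]: "Poly_Mapping.lookup (xv v) u = (if v = u then 1 else 0)"
  by (simp add: xv_def lookup_single when_def)

lemma keys_xv [simp]: "Poly_Mapping.keys (xv v) = {v}"
  by (simp add: xv_def)

definition pdeg :: "('v \<Rightarrow>\<^sub>0 nat) \<Rightarrow> nat"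
  where "pdeg m = (\<Sum>v\<in>Poly_Mapping.keys m. Poly_Mapping.lookup m v)"

lemma pdeg_superset: "finite S \<Longrightarrow> Poly_Mapping.keys m \<subseteq> S \<Longrightarrow> pdeg m = (\<Sum>v\<in>S. Poly_Mapping.lookup m v)"
  unfolding pdeg_def by (intro sum.mono_neutral_left) (auto simp: in_keys_iff)

lemma keys_plus_nat: "Poly_Mapping.keys (m + m' :: 'v \<Rightarrow>\<^sub>0 nat) = Poly_Mapping.keys m \<union> Poly_Mapping.keys m'"
  by (auto simp: in_keys_iff lookup_add)

lemma pdeg_plus: "pdeg (m + m') = pdeg m + pdeg m'"
  using pdeg_superset[of "Poly_Mapping.keys m \<union> Poly_Mapping.keys m'" m]
    pdeg_superset[of "Poly_Mapping.keys m \<union> Poly_Mapping.keys m'" m']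
    pdeg_superset[of "Poly_Mapping.keys m \<union> Poly_Mapping.keys m'" "m + m'"]
  by (simp add: keys_plus_nat lookup_add sum.distrib)

lemma pdeg_zero [simp]: "pdeg 0 = 0"
  by (simp add: pdeg_def)

lemma pdeg_single [simp]: "pdeg (Poly_Mapping.single v c) = c"
  by (cases "c = 0") (simp_all add: pdeg_def)

lemma pdeg_xv [simp]: "pdeg (xv v) = 1"
  by (simp add: xv_def)

lemma pdeg_eq_0_iff [simp]: "pdeg m = 0 \<longleftrightarrow> m = 0"
proof
  assume "pdeg m = 0"
  then have "\<forall>v\<in>Poly_Mapping.keys m. Poly_Mapping.lookup m v = 0" by (simp add: pdeg_def)
  then show "m = 0" by (intro poly_mapping_eqI) (auto simp: in_keys_iff)
qed simp

lemma minus_xv_plus: "v \<in> Poly_Mapping.keys m \<Longrightarrow> m - xv v + xv v = m"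
  by (intro poly_mapping_eqI) (auto simp: lookup_add lookup_minus lookup_single when_def in_keys_iff)

lemma plus_xv_minus [simp]: "m + xv v - xv v = m"
  by (intro poly_mapping_eqI) (auto simp: lookup_add lookup_minus)

lemma keys_minus_subset: "Poly_Mapping.keys (m - m' :: 'v \<Rightarrow>\<^sub>0 nat) \<subseteq> Poly_Mapping.keys m"
  by (auto simp: in_keys_iff lookup_minus)

lemma pdeg_minus_xv: "v \<in> Poly_Mapping.keys m \<Longrightarrow> pdeg m = Suc (pdeg (m - xv v))"
  using pdeg_plus[of "m - xv v" "xv v"] by (simp add: minus_xv_plus)

lemma keys_xv_mem: "v \<in> Poly_Mapping.keys (m + xv v)"
  by (simp add: keys_plus_nat)

lemma finite_monomials:
  assumes "finite V"
  shows "finite {m :: 'v \<Rightarrow>\<^sub>0 nat. Poly_Mapping.keys m \<subseteq> V \<and> pdeg m \<le> e}"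
proof (induction e)
  case 0
  have "{m :: 'v \<Rightarrow>\<^sub>0 nat. Poly_Mapping.keys m \<subseteq> V \<and> pdeg m \<le> 0} = {0}" by auto
  then show ?case by simp
next
  case (Suc e)
  let ?A = "{m :: 'v \<Rightarrow>\<^sub>0 nat. Poly_Mapping.keys m \<subseteq> V \<and> pdeg m \<le> e}"
  have "{m. Poly_Mapping.keys m \<subseteq> V \<and> pdeg m \<le> Suc e} \<subseteq> insert 0 ((\<lambda>(m, v). m + xv v) ` (?A \<times> V))"
  proof
    fix m :: "'v \<Rightarrow>\<^sub>0 nat" assume m: "m \<in> {m. Poly_Mapping.keys m \<subseteq> V \<and> pdeg m \<le> Suc e}"
    show "m \<in> insert 0 ((\<lambda>(m, v). m + xv v) ` (?A \<times> V))"
    proof (cases "m = 0")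
      case False
      then obtain v where v: "v \<in> Poly_Mapping.keys m" using keys_eq_empty by blast
      have "(m - xv v, v) \<in> ?A \<times> V"
        using m v pdeg_minus_xv[OF v] keys_minus_subset[of m "xv v"] by auto
      moreover have "m = (\<lambda>(m, v). m + xv v) (m - xv v, v)" using minus_xv_plus[OF v] by simp
      ultimately show ?thesis by blast
    qed simp
  qed
  moreover have "finite (insert 0 ((\<lambda>(m, v). m + xv v) ` (?A \<times> V)))" using Suc assms by simp
  ultimately show ?case by (rule finite_subset)
qed

lemma fsup_Pow_infinite:
  assumes "w \<in> fsup (Pow {..<d::nat})" "infinite \<sigma>"
  shows "w \<sigma> = 0"
proof (rule ccontr)
  assume "w \<sigma> \<noteq> 0"
  then have "\<sigma> \<subseteq> {..<d}" using assms(1) by (auto simp: fsup_def)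
  then show False using assms(2) finite_subset by blast
qed

text \<open>On infinite sets the signs \<open>orient\<close> degenerate; there the vanishing comes
  from the support condition.\<close>

lemma fsup_Pow_ctr_same:
  assumes "w \<in> fsup (Pow {..<d})"
  shows "ctr {..<d} a (ctr {..<d} a w) = (0 :: nat set \<Rightarrow> 'k::field)"
proof
  fix \<sigma>
  show "ctr {..<d} a (ctr {..<d} a w) \<sigma> = 0 \<sigma>"
  proof (cases "finite \<sigma>")
    case False
    then have "w (insert k (insert l \<sigma>)) = 0" for k l
      using fsup_Pow_infinite[OF assms, of "insert k (insert l \<sigma>)"] by simp
    then show ?thesis by (simp add: ctr_def)
  qed (simp add: ctr_ctr_same)
qed

lemma fsup_Pow_ctr_anticommute:
  assumes "w \<in> fsup (Pow {..<d})"
  shows "ctr {..<d} a (ctr {..<d} a' w) = - (ctr {..<d} a' (ctr {..<d} a w) :: nat set \<Rightarrow> 'k::field)"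
proof
  fix \<sigma>
  show "ctr {..<d} a (ctr {..<d} a' w) \<sigma> = (- ctr {..<d} a' (ctr {..<d} a w)) \<sigma>"
  proof (cases "finite \<sigma>")
    case False
    then have "w (insert k (insert l \<sigma>)) = 0" for k l
      using fsup_Pow_infinite[OF assms, of "insert k (insert l \<sigma>)"] by simp
    then show ?thesis by (simp add: ctr_def)
  next
    case True
    then show ?thesis using ctr_ctr_anticommute[of "{..<d}" \<sigma> a a' w] by simp
  qed
qed

text \<open>The Koszul differential in coefficients: \<open>a v k\<close> is the coefficient of the
  variable \<open>v\<close> in the form with index \<open>k\<close>, and multiplication by this
  variable reads off the coefficient at \<open>m - xv v\<close>.\<close>

definition kap :: "nat \<Rightarrow> ('v \<Rightarrow> nat \<Rightarrow> 'k::field) \<Rightarrow> (('v \<Rightarrow>\<^sub>0 nat) \<Rightarrow> nat set \<Rightarrow> 'k) \<Rightarrow>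
    ('v \<Rightarrow>\<^sub>0 nat) \<Rightarrow> nat set \<Rightarrow> 'k"
  where "kap d a x m = (\<Sum>v\<in>Poly_Mapping.keys m. ctr {..<d} (a v) (x (m - xv v)))"

lemma kap_apply: "kap d a x m \<sigma> = (\<Sum>v\<in>Poly_Mapping.keys m. ctr {..<d} (a v) (x (m - xv v)) \<sigma>)"
  by (simp add: kap_def)

lemma kap_add: "kap d a (x + y) = kap d a x + kap d a y"
  by (simp add: fun_eq_iff kap_apply ctr_add sum.distrib)

lemma kap_scale: "kap d a (tscale c x) = tscale c (kap d a x)"
proof -
  have *: "tscale c x m = fscale c (x m)" for m by (simp add: fun_eq_iff)
  show ?thesis
    by (intro ext, subst tscale_apply) (simp only: kap_apply * ctr_scale fscale_apply sum_distrib_left)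
qed

lemma kap_diff: "kap d a (x - y) = kap d a x - kap d a y"
  by (simp add: fun_eq_iff kap_apply ctr_diff sum_subtractf)

lemma kap_zero [simp]: "kap d a 0 = 0"
  by (simp add: fun_eq_iff kap_apply)

lemma kap_nonzero:
  assumes "kap d a x m \<sigma> \<noteq> 0"
  obtains v k where "v \<in> Poly_Mapping.keys m" "k < d" "k \<notin> \<sigma>" "x (m - xv v) (insert k \<sigma>) \<noteq> 0"
proof -
  obtain v where v: "v \<in> Poly_Mapping.keys m" "ctr {..<d} (a v) (x (m - xv v)) \<sigma> \<noteq> 0"
    using assms unfolding kap_apply by (rule sum.not_neutral_contains_not_neutral)
  from v(2) obtain k where "k \<in> {..<d} - \<sigma>"
    "orient (insert k \<sigma>) k * a v k * x (m - xv v) (insert k \<sigma>) \<noteq> 0"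
    unfolding ctr_def by (rule sum.not_neutral_contains_not_neutral)
  then show thesis using that[OF v(1), of k] by auto
qed

text \<open>The terms for \<open>v, w\<close> and for \<open>w, v\<close> start from the same
  monomial and cancel because contractions anticommute; a repeated \<open>v\<close> contributes the
  square of one contraction.\<close>

lemma kap_kap:
  assumes "\<And>m. y m \<in> fsup (Pow {..<d})"
  shows "kap d a (kap d a y) m = 0"
proof -
  define f where "f v w = (if w \<in> Poly_Mapping.keys (m - xv v) then
    ctr {..<d} (a v) (ctr {..<d} (a w) (y (m - xv v - xv w))) else 0)" for v w
  have "kap d a (kap d a y) m = (\<Sum>v\<in>Poly_Mapping.keys m. \<Sum>w\<in>Poly_Mapping.keys m. f v w)"
    unfolding kap_def[of d a "kap d a y"]
  proof (rule sum.cong[OF refl])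
    fix v assume "v \<in> Poly_Mapping.keys m"
    have "ctr {..<d} (a v) (kap d a y (m - xv v)) = (\<Sum>w\<in>Poly_Mapping.keys (m - xv v). f v w)"
      unfolding kap_def ctr_sum by (intro sum.cong) (auto simp: f_def)
    also have "\<dots> = (\<Sum>w\<in>Poly_Mapping.keys m. f v w)"
      using keys_minus_subset[of m "xv v"] by (intro sum.mono_neutral_left) (auto simp: f_def)
    finally show "ctr {..<d} (a v) (kap d a y (m - xv v)) = (\<Sum>w\<in>Poly_Mapping.keys m. f v w)" .
  qed
  also have "\<dots> = 0"
  proof (rule antisymmetric_sum_zero)
    fix v w assume vw: "v \<in> Poly_Mapping.keys m" "w \<in> Poly_Mapping.keys m"
    show "f v w = - f w v"
    proof (cases "v = w")
      case True
      then show ?thesis using fsup_Pow_ctr_same[OF assms] by (simp add: f_def)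
    next
      case False
      then have "w \<in> Poly_Mapping.keys (m - xv v)" "v \<in> Poly_Mapping.keys (m - xv w)"
        using vw by (auto simp: in_keys_iff lookup_minus lookup_single)
      moreover have e: "m - xv w - xv v = m - xv v - xv w"
        by (intro poly_mapping_eqI) (simp add: lookup_minus)
      ultimately show ?thesis
        unfolding f_def e using fsup_Pow_ctr_anticommute[OF assms, of "a v" "a w"] by simp
    qed
  next
    fix v show "f v v = 0" using fsup_Pow_ctr_same[OF assms] by (simp add: f_def)
  qed simp
  finally show ?thesis .
qed

text \<open>
  Exactness of the Koszul complex of a polynomial ring with respect to linear forms of full rank,
  in positive polynomial degree. The variables are split off one at a time: subtracting boundaries
  raises the exponent of the new variable \<open>g\<close> until only \<open>x\<^sub>g\<^sup>e\<close> is left, and wedging with the dual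
  vector \<open>b g\<close> is a primitive for the rest.
\<close>

lemma kap_exact_polynomial:
  fixes a b :: "'v \<Rightarrow> nat \<Rightarrow> 'k::field"
  assumes "finite G" and b: "\<And>g. b g \<in> fsup {..<d}"
    and dual: "\<And>g g'. g \<in> G \<Longrightarrow> g' \<in> G \<Longrightarrow> (\<Sum>k<d. a g k * b g' k) = (if g = g' then 1 else 0)"
    and "e > 0" and "\<And>m. x m \<in> Lam d p" and "\<And>m \<sigma>. x m \<sigma> \<noteq> 0 \<Longrightarrow> Poly_Mapping.keys m \<subseteq> G \<and> pdeg m = e"
    and "\<And>m. Poly_Mapping.keys m \<subseteq> G \<Longrightarrow> kap d a x m = 0"
  shows "\<exists>y. (\<forall>m. y m \<in> Lam d (Suc p)) \<and>
    (\<forall>m \<sigma>. y m \<sigma> \<noteq> 0 \<longrightarrow> Poly_Mapping.keys m \<subseteq> G \<and> Suc (pdeg m) = e) \<and>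
    (\<forall>m. Poly_Mapping.keys m \<subseteq> G \<longrightarrow> kap d a y m = x m)"
  using assms(1) dual assms(4-7)
proof (induction G arbitrary: e x rule: finite_induct)
  case empty
  have "x m = 0" for m
  proof (rule ccontr)
    assume "x m \<noteq> 0"
    then obtain \<sigma> where "x m \<sigma> \<noteq> 0" by (auto simp: fun_eq_iff)
    then have "m = 0" "pdeg m = e" using empty(4) by auto
    then show False using empty(2) by simp
  qed
  then show ?case
    by (intro exI[of _ 0]) (auto simp: zero_fun_def Lam_def fsup_def kap_def ctr_def)
next
  case (insert g G)
  define G' where "G' = insert g G"
  note prems = insert.prems[folded G'_def]
  define ok where "ok q c y \<longleftrightarrow> (\<forall>m. y m \<in> Lam d q) \<and>
    (\<forall>m \<sigma>. y m \<sigma> \<noteq> 0 \<longrightarrow> Poly_Mapping.keys m \<subseteq> G' \<and> pdeg m = c)" for q c and y :: "_ \<Rightarrow> nat set \<Rightarrow> 'k"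
  have ok0: "ok q c 0" for q c
    by (auto simp: ok_def intro!: fs.subspace_0[OF subspace_Lam])
  have ok_add: "ok q c (y + z)" if "ok q c y" "ok q c z" for q c y z
    unfolding ok_def
  proof (intro conjI allI)
    fix m \<sigma>
    show "(y + z) m \<in> Lam d q"
      using that by (auto simp: ok_def intro!: fs.subspace_add[OF subspace_Lam])
    have "y m \<sigma> \<noteq> 0 \<or> z m \<sigma> \<noteq> 0" if "(y + z) m \<sigma> \<noteq> 0" using that by auto
    then show "(y + z) m \<sigma> \<noteq> 0 \<longrightarrow> Poly_Mapping.keys m \<subseteq> G' \<and> pdeg m = c"
      using that unfolding ok_def by blast
  qed
  obtain e' where e': "e = Suc e'" using prems(2) not0_implies_Suc by blast
  have step: "\<exists>w. ok (Suc p) e' w \<and>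
      (\<forall>m. Poly_Mapping.keys m \<subseteq> G' \<and> Poly_Mapping.lookup m g < c \<longrightarrow> x m = kap d a w m)" if "c \<le> e" for c
    using that
  proof (induction c)
    case 0
    show ?case by (intro exI[of _ 0] conjI ok0) simp
  next
    case (Suc c)
    then obtain w where w: "ok (Suc p) e' w"
      "\<And>m. Poly_Mapping.keys m \<subseteq> G' \<Longrightarrow> Poly_Mapping.lookup m g < c \<Longrightarrow> x m = kap d a w m" by auto
    define cg where "cg = Poly_Mapping.single g c"
    define r where "r = (\<lambda>m. if Poly_Mapping.keys m \<subseteq> G' then x m - kap d a w m else 0)"
    have r0: "r m = 0" if "Poly_Mapping.lookup m g < c" for m
      using w(2) that by (simp add: r_def)
    have kr: "kap d a r m = 0" if m: "Poly_Mapping.keys m \<subseteq> G'" for m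
    proof -
      have "kap d a r m = kap d a (x - kap d a w) m"
        unfolding kap_def
      proof (rule sum.cong[OF refl])
        fix v assume "v \<in> Poly_Mapping.keys m"
        have "Poly_Mapping.keys (m - xv v) \<subseteq> G'" using m keys_minus_subset[of m "xv v"] by auto
        then show "ctr {..<d} (a v) (r (m - xv v)) =
          ctr {..<d} (a v) ((x - (\<lambda>m. \<Sum>v\<in>Poly_Mapping.keys m. ctr {..<d} (a v) (w (m - xv v)))) (m - xv v))"
          by (simp add: r_def kap_def)
      qed
      also have "\<dots> = kap d a x m - kap d a (kap d a w) m" by (simp add: kap_diff)
      also have "kap d a (kap d a w) m = 0"
        by (rule kap_kap) (use w(1) in \<open>auto simp: ok_def Lam_def fsup_def\<close>)
      finally show ?thesis using prems(5)[OF m] by (simp only: diff_zero)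
    qed
    have rs: "r m \<in> Lam d p" "r m \<sigma> \<noteq> 0 \<Longrightarrow> pdeg m = e" for m \<sigma>
    proof -
      have "kap d a w m \<in> Lam d p" for m
        unfolding kap_def using w(1) ctr_Lam_Suc unfolding ok_def
        by (intro fs.subspace_sum[OF subspace_Lam]) blast
      then show "r m \<in> Lam d p"
        using prems(3)
        by (auto simp: r_def intro!: fs.subspace_diff[OF subspace_Lam] fs.subspace_0[OF subspace_Lam])
      assume nz: "r m \<sigma> \<noteq> 0"
      then consider "x m \<sigma> \<noteq> 0" | "kap d a w m \<sigma> \<noteq> 0"
        by (cases "x m \<sigma> = 0") (auto simp: r_def split: if_splits)
      then show "pdeg m = e"
      proof cases
        case 2
        then obtain v k where v: "v \<in> Poly_Mapping.keys m" "w (m - xv v) (insert k \<sigma>) \<noteq> 0"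
          by (rule kap_nonzero)
        then show ?thesis using w(1) pdeg_minus_xv[OF v(1)] e' by (auto simp: ok_def)
      qed (use prems(4) in auto)
    qed
    \<comment> \<open>The terms of \<open>r\<close> with exponent exactly \<open>c\<close> in
      \<open>g\<close>, divided by that power. As \<open>r\<close> has no smaller exponents,
      multiplication by the variable \<open>g\<close> contributes nothing to this slice of
      \<open>kap d a r\<close>, so \<open>z\<close> is a cycle in the variables \<open>G\<close>, of
      positive degree \<open>e - c\<close>.\<close>
    define z where "z = (\<lambda>m. if Poly_Mapping.keys m \<subseteq> G then r (m + cg) else 0)"
    have gG: "g \<notin> G" by fact
    have lg: "Poly_Mapping.lookup m g = 0" if "Poly_Mapping.keys m \<subseteq> G" for m :: "'v \<Rightarrow>\<^sub>0 nat"
      using that gG by (auto simp: in_keys_iff)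
    have kcg: "Poly_Mapping.keys (m + cg) \<subseteq> G'" if "Poly_Mapping.keys m \<subseteq> G" for m
      using that by (auto simp: keys_plus_nat cg_def G'_def split: if_splits)
    have lcg: "Poly_Mapping.lookup (m + cg) g = Poly_Mapping.lookup m g + c" for m
      by (simp add: lookup_add cg_def)
    have swap: "m + cg - xv v = (m - xv v) + cg" if "v \<in> Poly_Mapping.keys m" for m v
      using that by (intro poly_mapping_eqI)
        (auto simp: lookup_add lookup_minus lookup_single when_def in_keys_iff)
    have slice: "kap d a r (m + cg) = (\<Sum>v\<in>Poly_Mapping.keys m. ctr {..<d} (a v) (r (m - xv v + cg)))"
      if m: "Poly_Mapping.keys m \<subseteq> G" for m
    proof -
      have "kap d a r (m + cg) = (\<Sum>v\<in>Poly_Mapping.keys m. ctr {..<d} (a v) (r (m + cg - xv v)))"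
        unfolding kap_def
      proof (rule sum.mono_neutral_right)
        show "\<forall>v\<in>Poly_Mapping.keys (m + cg) - Poly_Mapping.keys m. ctr {..<d} (a v) (r (m + cg - xv v)) = 0"
        proof
          fix v assume v: "v \<in> Poly_Mapping.keys (m + cg) - Poly_Mapping.keys m"
          then have "v = g" "c > 0" by (auto simp: keys_plus_nat cg_def split: if_splits)
          then have "Poly_Mapping.lookup (m + cg - xv v) g < c"
            using lg[OF m] by (simp add: lookup_minus lcg)
          then show "ctr {..<d} (a v) (r (m + cg - xv v)) = 0" using r0 by simp
        qed
      qed (auto simp: keys_plus_nat)
      then show ?thesis using swap by simp
    qed
    have "\<exists>y. (\<forall>m. y m \<in> Lam d (Suc p)) \<and>
        (\<forall>m \<sigma>. y m \<sigma> \<noteq> 0 \<longrightarrow> Poly_Mapping.keys m \<subseteq> G \<and> Suc (pdeg m) = e - c) \<and>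
        (\<forall>m. Poly_Mapping.keys m \<subseteq> G \<longrightarrow> kap d a y m = z m)"
    proof (rule insert.IH)
      show "(\<Sum>k<d. a g k * b g' k) = (if g = g' then 1 else 0)" if "g \<in> G" "g' \<in> G" for g g'
        using prems(1) that by (simp add: G'_def)
      show "0 < e - c" using Suc(2) by simp
      show "z m \<in> Lam d p" for m
        using rs(1) by (auto simp: z_def intro!: fs.subspace_0[OF subspace_Lam])
      show "Poly_Mapping.keys m \<subseteq> G \<and> pdeg m = e - c" if "z m \<sigma> \<noteq> 0" for m \<sigma>
        using that rs(2)[of "m + cg" \<sigma>] by (auto simp: z_def pdeg_plus cg_def split: if_splits)
      show "kap d a z m = 0" if m: "Poly_Mapping.keys m \<subseteq> G" for m
      proof -
        have "kap d a z m = (\<Sum>v\<in>Poly_Mapping.keys m. ctr {..<d} (a v) (r (m - xv v + cg)))"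
          unfolding kap_def
        proof (rule sum.cong[OF refl])
          fix v
          have "Poly_Mapping.keys (m - xv v) \<subseteq> G" using m keys_minus_subset[of m "xv v"] by auto
          then show "ctr {..<d} (a v) (z (m - xv v)) = ctr {..<d} (a v) (r (m - xv v + cg))"
            by (simp add: z_def)
        qed
        then show ?thesis using slice[OF m] kr[OF kcg[OF m]] by simp
      qed
    qed
    then obtain y where y: "\<And>m. y m \<in> Lam d (Suc p)"
      "\<And>m \<sigma>. y m \<sigma> \<noteq> 0 \<Longrightarrow> Poly_Mapping.keys m \<subseteq> G \<and> Suc (pdeg m) = e - c"
      "\<And>m. Poly_Mapping.keys m \<subseteq> G \<Longrightarrow> kap d a y m = z m" by blast
    \<comment> \<open>The primitive of \<open>z\<close>, multiplied back by the power of
      \<open>g\<close>. Its Koszul differential equals \<open>r\<close> at exponent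
      \<open>c\<close>; the only further terms it creates have exponent \<open>c + 1\<close> and are
      left to the next round.\<close>
    define w' where "w' = (\<lambda>m. if Poly_Mapping.lookup m g = c then y (m - cg) else 0)"
    have cgback: "m - cg + cg = m" if "Poly_Mapping.lookup m g = c" for m
      using that by (intro poly_mapping_eqI)
        (auto simp: lookup_add lookup_minus lookup_single cg_def when_def)
    have okw': "ok (Suc p) e' w'"
      unfolding ok_def
    proof (intro conjI allI impI)
      fix m \<sigma>
      show "w' m \<in> Lam d (Suc p)" using y(1) by (auto simp: w'_def intro!: fs.subspace_0[OF subspace_Lam])
      assume "w' m \<sigma> \<noteq> 0"
      then have c: "Poly_Mapping.lookup m g = c" and nz: "y (m - cg) \<sigma> \<noteq> 0"
        by (auto simp: w'_def split: if_splits)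
      then show "Poly_Mapping.keys m \<subseteq> G'" using y(2)[OF nz] kcg[of "m - cg"] cgback[OF c] by simp
      show "pdeg m = e'"
        using conjunct2[OF y(2)[OF nz]] pdeg_plus[of "m - cg" cg] cgback[OF c] e' Suc(2)
        by (simp add: cg_def)
    qed
    have kw': "kap d a w' m = (if Poly_Mapping.lookup m g = c then r m else 0)"
      if m: "Poly_Mapping.keys m \<subseteq> G'" and lt: "Poly_Mapping.lookup m g < Suc c" for m
    proof (cases "Poly_Mapping.lookup m g = c")
      case False
      then have "Poly_Mapping.lookup (m - xv v) g \<noteq> c" for v using lt by (simp add: lookup_minus)
      then show ?thesis using False by (simp add: kap_def w'_def)
    next
      case True
      define m0 where "m0 = m - cg"
      have m0: "m = m0 + cg" using cgback[OF True] by (simp add: m0_def)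
      have l0: "Poly_Mapping.lookup m0 g = 0" using True by (simp add: m0_def lookup_minus cg_def)
      then have k0: "Poly_Mapping.keys m0 \<subseteq> G"
        using m keys_minus_subset[of m cg] by (auto simp: m0_def G'_def in_keys_iff)
      have "kap d a w' m = (\<Sum>v\<in>Poly_Mapping.keys m0. ctr {..<d} (a v) (w' (m - xv v)))"
        unfolding kap_def
      proof (rule sum.mono_neutral_right)
        show "Poly_Mapping.keys m0 \<subseteq> Poly_Mapping.keys m" unfolding m0 by (auto simp: keys_plus_nat)
        show "\<forall>v\<in>Poly_Mapping.keys m - Poly_Mapping.keys m0. ctr {..<d} (a v) (w' (m - xv v)) = 0"
        proof
          fix v assume v: "v \<in> Poly_Mapping.keys m - Poly_Mapping.keys m0"
          then have "v = g" unfolding m0 by (auto simp: keys_plus_nat cg_def split: if_splits)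
          then have "Poly_Mapping.lookup (m - xv v) g \<noteq> c"
            using True v by (auto simp: lookup_minus in_keys_iff)
          then show "ctr {..<d} (a v) (w' (m - xv v)) = 0" by (simp add: w'_def)
        qed
      qed simp
      also have "\<dots> = kap d a y m0"
        unfolding kap_def
      proof (rule sum.cong[OF refl])
        fix v assume v: "v \<in> Poly_Mapping.keys m0"
        have e: "m - xv v = m0 - xv v + cg" using swap[OF v] m0 by simp
        have "Poly_Mapping.lookup (m0 - xv v) g = 0" using l0 by (simp add: lookup_minus)
        moreover have "m0 - xv v + cg - cg = m0 - xv v"
          by (intro poly_mapping_eqI) (simp add: lookup_add lookup_minus)
        ultimately have "w' (m - xv v) = y (m0 - xv v)" unfolding e w'_def lcg by simp
        then show "ctr {..<d} (a v) (w' (m - xv v)) = ctr {..<d} (a v) (y (m0 - xv v))" by simp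
      qed
      also have "\<dots> = r m" using y(3)[OF k0] k0 m0 by (simp add: z_def)
      finally show ?thesis using True by simp
    qed
    show ?case
    proof (intro exI[of _ "w + w'"] conjI allI impI)
      show "ok (Suc p) e' (w + w')" using ok_add w(1) okw' by blast
      fix m assume m: "Poly_Mapping.keys m \<subseteq> G' \<and> Poly_Mapping.lookup m g < Suc c"
      then show "x m = kap d a (w + w') m"
        using kw'[of m] w(2)[of m] by (auto simp: kap_add r_def)
    qed
  qed
  obtain w where w: "ok (Suc p) e' w"
    "\<And>m. Poly_Mapping.keys m \<subseteq> G' \<Longrightarrow> Poly_Mapping.lookup m g < e \<Longrightarrow> x m = kap d a w m"
    using step[of e] by auto
  \<comment> \<open>A monomial of degree \<open>e\<close> whose exponent in \<open>g\<close> is at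
    least \<open>e\<close> is the pure power; \<open>u\<close> is the remainder at that single
    monomial, which is split as \<open>eg + xv g\<close>.\<close>
  define eg where "eg = Poly_Mapping.single g e'"
  have eg1: "eg + xv g = Poly_Mapping.single g e" by (simp add: eg_def e' xv_def flip: single_add)
  define u where "u = x (eg + xv g) - kap d a w (eg + xv g)"
  have kapw: "kap d a w m \<in> Lam d p" for m
    unfolding kap_def using w(1) ctr_Lam_Suc unfolding ok_def
    by (intro fs.subspace_sum[OF subspace_Lam]) blast
  have uL: "u \<in> Lam d p" unfolding u_def using prems(3) kapw by (intro fs.subspace_diff[OF subspace_Lam])
  have other: "x m = kap d a w m" if m: "Poly_Mapping.keys m \<subseteq> G'" "m \<noteq> eg + xv g" for m
  proof (cases "pdeg m = e")
    case False
    have "x m \<sigma> = 0" "kap d a w m \<sigma> = 0" for \<sigma>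
    proof -
      show "x m \<sigma> = 0" using prems(4)[of m \<sigma>] False by auto
      show "kap d a w m \<sigma> = 0"
      proof (rule ccontr)
        assume "kap d a w m \<sigma> \<noteq> 0"
        then obtain v k where v: "v \<in> Poly_Mapping.keys m" "w (m - xv v) (insert k \<sigma>) \<noteq> 0"
          by (rule kap_nonzero)
        then show False using w(1) pdeg_minus_xv[OF v(1)] e' False by (auto simp: ok_def)
      qed
    qed
    then show ?thesis by (simp add: fun_eq_iff)
  next
    case True
    have "Poly_Mapping.lookup m g < e"
    proof (rule ccontr)
      assume "\<not> Poly_Mapping.lookup m g < e"
      then have "m = (m - (eg + xv g)) + (eg + xv g)"
        unfolding eg1 by (intro poly_mapping_eqI) (auto simp: lookup_add lookup_minus lookup_single when_def)
      then have "pdeg m = pdeg (m - (eg + xv g)) + e"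
        using pdeg_plus[of "m - (eg + xv g)" "eg + xv g"] by (simp add: eg1)
      then have "m - (eg + xv g) = 0" using True by simp
      then show False using \<open>m = (m - (eg + xv g)) + (eg + xv g)\<close> m(2) by simp
    qed
    then show ?thesis using w(2) m by blast
  qed
  have egG: "Poly_Mapping.keys eg \<subseteq> {g}" by (simp add: eg_def)
  \<comment> \<open>At the monomial \<open>eg + xv g + xv v\<close> the cycle condition receives a
    contribution from the pure power only, namely the contraction of \<open>u\<close> with
    \<open>a v\<close>.\<close>
  have ctru: "ctr {..<d} (a v) u = 0" if v: "v \<in> G'" for v
  proof -
    define m where "m = eg + xv g + xv v"
    have m: "Poly_Mapping.keys m \<subseteq> G'" using egG v by (auto simp: m_def keys_plus_nat G'_def)
    have "0 = kap d a x m - kap d a (kap d a w) m"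
      using prems(5)[OF m] kap_kap[of w d a m] w(1) by (auto simp: ok_def Lam_def fsup_def)
    also have "\<dots> = kap d a (x - kap d a w) m" by (simp add: kap_diff)
    also have "\<dots> = (\<Sum>t\<in>{v}. ctr {..<d} (a t) ((x - kap d a w) (m - xv t)))"
      unfolding kap_def[of d a "x - kap d a w"]
    proof (rule sum.mono_neutral_right)
      show "{v} \<subseteq> Poly_Mapping.keys m" by (simp add: m_def keys_plus_nat)
      show "\<forall>t\<in>Poly_Mapping.keys m - {v}. ctr {..<d} (a t) ((x - kap d a w) (m - xv t)) = 0"
      proof
        fix t assume t: "t \<in> Poly_Mapping.keys m - {v}"
        have "m - xv t \<noteq> eg + xv g"
        proof
          assume "m - xv t = eg + xv g"
          then have "Poly_Mapping.lookup (m - xv t) v = Poly_Mapping.lookup (eg + xv g) v" by simp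
          then show False using t by (simp add: m_def lookup_add lookup_minus lookup_single)
        qed
        moreover have "Poly_Mapping.keys (m - xv t) \<subseteq> G'" using m keys_minus_subset[of m "xv t"] by auto
        ultimately show "ctr {..<d} (a t) ((x - kap d a w) (m - xv t)) = 0" using other by simp
      qed
    qed simp
    also have "\<dots> = ctr {..<d} (a v) u"
      by (simp add: m_def u_def)
    finally show ?thesis by simp
  qed
  define w' where "w' = (\<lambda>m. if m = eg then wdg (b g) u else 0)"
  have okw': "ok (Suc p) e' w'"
    unfolding ok_def
  proof (intro conjI allI impI)
    fix m \<sigma>
    show "w' m \<in> Lam d (Suc p)"
      using wdg_Lam[OF uL b] by (auto simp: w'_def intro!: fs.subspace_0[OF subspace_Lam])
    assume "w' m \<sigma> \<noteq> 0"
    then have "m = eg" by (auto simp: w'_def split: if_splits)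
    then show "Poly_Mapping.keys m \<subseteq> G'" "pdeg m = e'"
      using egG by (auto simp: G'_def eg_def)
  qed
  have cw: "ctr {..<d} (a v) (wdg (b g) u) = (if v = g then u else 0)" if "v \<in> G'" for v
    using ctr_wdg_Lam[OF uL b, of "a v" g] ctru[OF that] prems(1)[of v g] that
    by (auto simp: fun_eq_iff G'_def)
  have kw': "kap d a w' m = (if m = eg + xv g then u else 0)" if m: "Poly_Mapping.keys m \<subseteq> G'" for m
  proof -
    have "kap d a w' m = (\<Sum>v\<in>Poly_Mapping.keys m. if v = g \<and> m = eg + xv g then u else 0)"
      unfolding kap_def
    proof (rule sum.cong[OF refl])
      fix v assume v: "v \<in> Poly_Mapping.keys m"
      have "m - xv v = eg \<longleftrightarrow> m = eg + xv v" using minus_xv_plus[OF v] by (metis plus_xv_minus)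
      then show "ctr {..<d} (a v) (w' (m - xv v)) = (if v = g \<and> m = eg + xv g then u else 0)"
        using cw[of v] m v by (auto simp: w'_def)
    qed
    also have "\<dots> = (if m = eg + xv g then u else 0)"
      by (simp add: sum.delta keys_xv_mem)
    finally show ?thesis .
  qed
  show ?case
    unfolding G'_def[symmetric]
  proof (intro exI[of _ "w + w'"] conjI allI impI)
    have "ok (Suc p) e' (w + w')" using ok_add w(1) okw' by blast
    then show "(w + w') m \<in> Lam d (Suc p)"
      "(w + w') m \<sigma> \<noteq> 0 \<Longrightarrow> Poly_Mapping.keys m \<subseteq> G'"
      "(w + w') m \<sigma> \<noteq> 0 \<Longrightarrow> Suc (pdeg m) = e" for m \<sigma>
      by (auto simp: ok_def e')
    fix m :: "'v \<Rightarrow>\<^sub>0 nat" assume "Poly_Mapping.keys m \<subseteq> G'"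
    then show "kap d a (w + w') m = x m"
      using kw'[of m] other[of m] by (auto simp: kap_add u_def)
  qed
qed

section \<open>The double complex\<close>

text \<open>The set \<open>I\<close> of admissible pairs truncates both parts of the differential,
  so the column at \<open>G\<close> is the Koszul complex of the ring spanned by the monomials
  admissible over \<open>G\<close>. The sign \<open>(-1) ^ card G\<close> makes the two commuting
  differentials anticommute.\<close>

definition DI :: "nat \<Rightarrow> ('v::linorder \<Rightarrow> nat \<Rightarrow> 'k::field) \<Rightarrow> ('v set \<times> 'v set) set \<Rightarrow>
    ('v set \<times> ('v \<Rightarrow>\<^sub>0 nat) \<Rightarrow> nat set \<Rightarrow> 'k) \<Rightarrow> 'v set \<times> ('v \<Rightarrow>\<^sub>0 nat) \<Rightarrow> nat set \<Rightarrow> 'k"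
  where "DI d a I x = (\<lambda>(G, m) \<sigma>. if (G, Poly_Mapping.keys m) \<in> I
    then wdg (\<lambda>_. 1) (\<lambda>F. x (F, m) \<sigma>) G + (-1) ^ card G * kap d a (\<lambda>m'. x (G, m')) m \<sigma> else 0)"

lemma DI_apply: "DI d a I x (G, m) \<sigma> = (if (G, Poly_Mapping.keys m) \<in> I
    then wdg (\<lambda>_. 1) (\<lambda>F. x (F, m) \<sigma>) G + (-1) ^ card G * kap d a (\<lambda>m'. x (G, m')) m \<sigma> else 0)"
  by (simp add: DI_def)

lemma DI_add:
  fixes x y :: "'v::linorder set \<times> ('v \<Rightarrow>\<^sub>0 nat) \<Rightarrow> nat set \<Rightarrow> 'k::field"
  shows "DI d a I (x + y) = DI d a I x + DI d a I y"
proof (intro ext)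
  fix Gm :: "'v set \<times> ('v \<Rightarrow>\<^sub>0 nat)" and \<sigma> :: "nat set"
  obtain G m where [simp]: "Gm = (G, m)" by fastforce
  have 1: "(\<lambda>F. x (F, m) \<sigma> + y (F, m) \<sigma>) = (\<lambda>F. x (F, m) \<sigma>) + (\<lambda>F. y (F, m) \<sigma>)"
    "(\<lambda>m'. x (G, m') + y (G, m')) = (\<lambda>m'. x (G, m')) + (\<lambda>m'. y (G, m'))"
    by (simp_all add: fun_eq_iff)
  show "DI d a I (x + y) Gm \<sigma> = (DI d a I x + DI d a I y) Gm \<sigma>"
    by (simp add: DI_apply 1 wdg_add kap_add distrib_left)
qed

lemma DI_scale:
  fixes x :: "'v::linorder set \<times> ('v \<Rightarrow>\<^sub>0 nat) \<Rightarrow> nat set \<Rightarrow> 'k::field"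
  shows "DI d a I (tscale c x) = tscale c (DI d a I x)"
proof (intro ext)
  fix Gm :: "'v set \<times> ('v \<Rightarrow>\<^sub>0 nat)" and \<sigma> :: "nat set"
  obtain G m where [simp]: "Gm = (G, m)" by fastforce
  have 1: "(\<lambda>F. tscale c x (F, m) \<sigma>) = fscale c (\<lambda>F. x (F, m) \<sigma>)"
    "(\<lambda>m'. tscale c x (G, m')) = tscale c (\<lambda>m'. x (G, m'))"
    by (simp_all add: fun_eq_iff)
  show "DI d a I (tscale c x) Gm \<sigma> = tscale c (DI d a I x) Gm \<sigma>"
    unfolding \<open>Gm = (G, m)\<close> tscale_apply[of c "DI d a I x"] DI_apply 1 wdg_scale kap_scale
    by (simp add: algebra_simps)
qed

lemma linear_DI: "Vector_Spaces.linear tscale tscale (DI d a I)"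
  by (simp add: linear_tt_iff DI_add DI_scale)

lemma DI_zero [simp]: "DI d a I 0 = 0"
  using linear_DI Vector_Spaces.linear.axioms(3) module_hom.zero by blast

lemma DI_diff: "DI d a I (x - y) = DI d a I x - DI d a I y"
  using linear_DI Vector_Spaces.linear.axioms(3) module_hom.diff by blast

lemma DI_nonzero:
  assumes "DI d a I x (G, m) \<sigma> \<noteq> 0"
  shows "(G, Poly_Mapping.keys m) \<in> I"
    and "(\<exists>u\<in>G. x (G - {u}, m) \<sigma> \<noteq> 0) \<or>
      (\<exists>v\<in>Poly_Mapping.keys m. \<exists>k. k < d \<and> k \<notin> \<sigma> \<and> x (G, m - xv v) (insert k \<sigma>) \<noteq> 0)"
proof -
  show I: "(G, Poly_Mapping.keys m) \<in> I" using assms by (auto simp: DI_apply split: if_splits)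
  consider "wdg (\<lambda>_. 1) (\<lambda>F. x (F, m) \<sigma>) G \<noteq> 0" | "kap d a (\<lambda>m'. x (G, m')) m \<sigma> \<noteq> 0"
    using assms by (cases "wdg (\<lambda>_. 1) (\<lambda>F. x (F, m) \<sigma>) G = 0") (auto simp: DI_apply split: if_splits)
  then show "(\<exists>u\<in>G. x (G - {u}, m) \<sigma> \<noteq> 0) \<or>
      (\<exists>v\<in>Poly_Mapping.keys m. \<exists>k. k < d \<and> k \<notin> \<sigma> \<and> x (G, m - xv v) (insert k \<sigma>) \<noteq> 0)"
  proof cases
    case 1
    then obtain u where "u \<in> G" "orient G u * 1 * x (G - {u}, m) \<sigma> \<noteq> 0"
      unfolding wdg_def by (rule sum.not_neutral_contains_not_neutral)
    then show ?thesis by auto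
  next
    case 2
    then obtain v k where "v \<in> Poly_Mapping.keys m" "k < d" "k \<notin> \<sigma>" "x (G, m - xv v) (insert k \<sigma>) \<noteq> 0"
      by (rule kap_nonzero)
    then show ?thesis by blast
  qed
qed

text \<open>Closure under smaller faces and smaller supports: everything that the differential reads
  in order to produce an admissible entry is admissible, so the truncated operator still squares to
  zero.\<close>

definition okI :: "'v set set \<Rightarrow> ('v set \<times> 'v set) set \<Rightarrow> bool"
  where "okI \<Delta> I \<longleftrightarrow> (\<forall>G s. (G, s) \<in> I \<longrightarrow> G \<in> \<Delta> \<and> s \<subseteq> \<Union>\<Delta> \<and>
    (\<forall>F s'. F \<subseteq> G \<longrightarrow> s' \<subseteq> s \<longrightarrow> (F, s') \<in> I))"

text \<open>Both parts of the differential lead from a face to the same or a larger face, so this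
  closure makes the functions supported on the family a subcomplex.\<close>

definition upc :: "('v set \<times> 'v set) set \<Rightarrow> 'v set set \<Rightarrow> bool"
  where "upc I \<G> \<longleftrightarrow> (\<forall>F G s. F \<in> \<G> \<longrightarrow> F \<subseteq> G \<longrightarrow> (G, s) \<in> I \<longrightarrow> G \<in> \<G>)"

text \<open>The total degree \<open>n\<close> is the size of the face minus the exterior degree and
  is raised by one by both parts of the differential; the internal degree \<open>i\<close> is
  preserved by both. The Koszul complex of the empty face sits in total degrees at most 0, so
  \<open>n\<close> is an integer.\<close>

definition Tidx :: "nat \<Rightarrow> ('v set \<times> 'v set) set \<Rightarrow> 'v set set \<Rightarrow> int \<Rightarrow> nat \<Rightarrow>
    (('v set \<times> ('v \<Rightarrow>\<^sub>0 nat)) \<times> nat set) set"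
  where "Tidx d I \<G> n i = {((G, m), \<sigma>). G \<in> \<G> \<and> (G, Poly_Mapping.keys m) \<in> I \<and> \<sigma> \<subseteq> {..<d} \<and>
    card \<sigma> + pdeg m = i \<and> int (card G) = n + int (card \<sigma>)}"

definition Tsp :: "nat \<Rightarrow> ('v set \<times> 'v set) set \<Rightarrow> 'v set set \<Rightarrow> int \<Rightarrow> nat \<Rightarrow>
    ('v set \<times> ('v \<Rightarrow>\<^sub>0 nat) \<Rightarrow> nat set \<Rightarrow> 'k::field) set"
  where "Tsp d I \<G> n i = tsup (Tidx d I \<G> n i)"

lemma TspI:
  assumes "\<And>G m \<sigma>. x (G, m) \<sigma> \<noteq> 0 \<Longrightarrow> G \<in> \<G> \<and> (G, Poly_Mapping.keys m) \<in> I \<and> \<sigma> \<subseteq> {..<d} \<and>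
    card \<sigma> + pdeg m = i \<and> int (card G) = n + int (card \<sigma>)"
  shows "x \<in> Tsp d I \<G> n i"
  using assms by (auto simp: Tsp_def tsup_def Tidx_def)

lemma TspD:
  assumes "x \<in> Tsp d I \<G> n i" "x (G, m) \<sigma> \<noteq> 0"
  shows "G \<in> \<G>" "(G, Poly_Mapping.keys m) \<in> I" "\<sigma> \<subseteq> {..<d}"
    "card \<sigma> + pdeg m = i" "int (card G) = n + int (card \<sigma>)"
  using assms by (auto simp: Tsp_def tsup_def Tidx_def)

lemma subspace_Tsp: "ts.subspace (Tsp d I \<G> n i)"
  unfolding Tsp_def by (rule subspace_tsup)

lemma Tsp_mono:
  assumes "\<G> \<subseteq> \<G>'" "I \<subseteq> I'"
  shows "Tsp d I \<G> n i \<subseteq> Tsp d I' \<G>' n i"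
proof
  fix x assume x: "x \<in> Tsp d I \<G> n i"
  show "x \<in> Tsp d I' \<G>' n i" by (rule TspI) (use TspD[OF x] assms in blast)
qed

lemma Tsp_Lam:
  assumes "x \<in> Tsp d I \<G> n i"
  shows "x Gm \<in> fsup (Pow {..<d})"
  using assms by (cases Gm) (auto simp: Tsp_def tsup_def Tidx_def fsup_def)

section \<open>The total complex of a simplicial complex\<close>

locale complex =
  fixes \<Delta> :: "'v::linorder set set" and d :: nat and a :: "'v \<Rightarrow> nat \<Rightarrow> 'k::field"
  assumes sc: "simplicial_complex \<Delta>"
begin

abbreviation V :: "'v set" where "V \<equiv> \<Union>\<Delta>"

lemma finite_V: "finite V" and empty_face: "{} \<in> \<Delta>"
  and face_subset: "F \<in> \<Delta> \<Longrightarrow> G \<subseteq> F \<Longrightarrow> G \<in> \<Delta>"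
  using sc unfolding simplicial_complex_def by blast+

lemma finite_face: "F \<in> \<Delta> \<Longrightarrow> finite F"
  using finite_V by (meson Union_upper finite_subset)

lemma finite_Delta: "finite \<Delta>"
  using finite_V by (rule finite_UnionD)

lemma card_face_le: "F \<in> \<Delta> \<Longrightarrow> card F \<le> card V"
  using finite_V by (meson Union_upper card_mono)

lemma okID:
  assumes "okI \<Delta> I" "(G, s) \<in> I"
  shows "G \<in> \<Delta>" "s \<subseteq> V" "F \<subseteq> G \<Longrightarrow> s' \<subseteq> s \<Longrightarrow> (F, s') \<in> I"
  using assms unfolding okI_def by blast+

lemma finite_Tidx:
  assumes "okI \<Delta> I"
  shows "finite (Tidx d I \<G> n i)"
proof (rule finite_subset)
  show "Tidx d I \<G> n i \<subseteq> (\<Delta> \<times> {m. Poly_Mapping.keys m \<subseteq> V \<and> pdeg m \<le> i}) \<times> Pow {..<d}"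
  proof
    fix z assume "z \<in> Tidx d I \<G> n i"
    then obtain G m \<sigma> where z: "z = ((G, m), \<sigma>)" "(G, Poly_Mapping.keys m) \<in> I" "\<sigma> \<subseteq> {..<d}"
      "card \<sigma> + pdeg m = i" by (auto simp: Tidx_def)
    then show "z \<in> (\<Delta> \<times> {m. Poly_Mapping.keys m \<subseteq> V \<and> pdeg m \<le> i}) \<times> Pow {..<d}"
      using okID(1,2)[OF assms z(2)] by simp
  qed
  show "finite ((\<Delta> \<times> {m. Poly_Mapping.keys m \<subseteq> V \<and> pdeg m \<le> i}) \<times> Pow {..<d})"
    using finite_monomials[OF finite_V] finite_Delta by auto
qed

lemma fdim_Tsp: "okI \<Delta> I \<Longrightarrow> ts.fdim (Tsp d I \<G> n i :: (_ \<Rightarrow> _ \<Rightarrow> 'k) set)"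
  unfolding Tsp_def by (rule fdim_tsup[OF finite_Tidx])

abbreviation D where "D \<equiv> DI d a"

lemma D_Tsp:
  assumes I: "okI \<Delta> I" and up: "upc I \<G>" and x: "x \<in> Tsp d I \<G> n i"
  shows "D I x \<in> Tsp d I \<G> (n + 1) i"
proof (rule TspI)
  fix G m \<sigma> assume nz: "D I x (G, m) \<sigma> \<noteq> 0"
  note GI = DI_nonzero(1)[OF nz]
  have fin: "finite G" using okID(1)[OF I GI] finite_face by blast
  from DI_nonzero(2)[OF nz]
  show "G \<in> \<G> \<and> (G, Poly_Mapping.keys m) \<in> I \<and> \<sigma> \<subseteq> {..<d} \<and> card \<sigma> + pdeg m = i \<and>
    int (card G) = n + 1 + int (card \<sigma>)"
  proof
    assume "\<exists>u\<in>G. x (G - {u}, m) \<sigma> \<noteq> 0"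
    then obtain u where u: "u \<in> G" "x (G - {u}, m) \<sigma> \<noteq> 0" by blast
    note * = TspD[OF x u(2)]
    have "G \<in> \<G>" using up *(1) GI unfolding upc_def by blast
    moreover have "card G = Suc (card (G - {u}))" using fin u(1) by (metis card_Suc_Diff1)
    ultimately show ?thesis using * GI by simp
  next
    assume "\<exists>v\<in>Poly_Mapping.keys m. \<exists>k. k < d \<and> k \<notin> \<sigma> \<and> x (G, m - xv v) (insert k \<sigma>) \<noteq> 0"
    then obtain v k where v: "v \<in> Poly_Mapping.keys m" "k < d" "k \<notin> \<sigma>" "x (G, m - xv v) (insert k \<sigma>) \<noteq> 0"
      by blast
    note * = TspD[OF x v(4)]
    have "finite (insert k \<sigma>)" using *(3) finite_lessThan by (rule finite_subset)
    then show ?thesis using * GI v pdeg_minus_xv[OF v(1)] by auto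
  qed
qed

text \<open>The two parts square to zero by \<open>wdg_wdg\<close> and \<open>kap_kap\<close>; the
  mixed terms cancel because \<open>G\<close> and \<open>G - {u}\<close> carry opposite
  signs.\<close>

lemma D_D:
  assumes I: "okI \<Delta> I" and x: "\<And>Gm. x Gm \<in> fsup (Pow {..<d})"
  shows "D I (D I x) = 0"
proof (intro ext, clarsimp)
  fix G m \<sigma>
  show "D I (D I x) (G, m) \<sigma> = 0"
  proof (cases "(G, Poly_Mapping.keys m) \<in> I")
    case True
    have fin: "finite G" using okID(1)[OF I True] finite_face by blast
    define c where "c = (-1 :: 'k) ^ card G"
    have cc: "c * c = 1" by (simp add: c_def flip: power_mult_distrib)
    have sub: "(G - {u}, Poly_Mapping.keys m) \<in> I" for u using okID(3)[OF I True] by blast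
    have subv: "(G, Poly_Mapping.keys (m - xv v)) \<in> I" for v
      using okID(3)[OF I True] keys_minus_subset[of m "xv v"] by blast
    have 1: "wdg (\<lambda>_. 1) (\<lambda>F. D I x (F, m) \<sigma>) G =
      - c * (\<Sum>u\<in>G. orient G u * kap d a (\<lambda>m'. x (G - {u}, m')) m \<sigma>)"
    proof -
      have "wdg (\<lambda>_. 1) (\<lambda>F. D I x (F, m) \<sigma>) G =
        (\<Sum>u\<in>G. orient G u * wdg (\<lambda>_. 1) (\<lambda>F. x (F, m) \<sigma>) (G - {u})
          + - c * (orient G u * kap d a (\<lambda>m'. x (G - {u}, m')) m \<sigma>))"
        unfolding wdg_def[of "\<lambda>_. 1" "\<lambda>F. D I x (F, m) \<sigma>"]
      proof (rule sum.cong[OF refl])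
        fix u assume u: "u \<in> G"
        have "card G = Suc (card (G - {u}))" using fin u by (metis card_Suc_Diff1)
        then have "(-1) ^ card (G - {u}) = - c" by (simp add: c_def)
        then show "orient G u * 1 * D I x (G - {u}, m) \<sigma> =
          orient G u * wdg (\<lambda>_. 1) (\<lambda>F. x (F, m) \<sigma>) (G - {u})
          + - c * (orient G u * kap d a (\<lambda>m'. x (G - {u}, m')) m \<sigma>)"
          using sub[of u] by (simp add: DI_apply algebra_simps)
      qed
      also have "\<dots> = wdg (\<lambda>_. 1) (wdg (\<lambda>_. 1) (\<lambda>F. x (F, m) \<sigma>)) G
        + - c * (\<Sum>u\<in>G. orient G u * kap d a (\<lambda>m'. x (G - {u}, m')) m \<sigma>)"
        unfolding sum.distrib sum_distrib_left[symmetric]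
        by (simp add: wdg_def[of "\<lambda>_. 1" "wdg (\<lambda>_. 1) (\<lambda>F. x (F, m) \<sigma>)"])
      finally show ?thesis using wdg_wdg[OF fin] by simp
    qed
    have Dx: "(D I x (G, m - xv v)) = (\<Sum>u\<in>G. fscale (orient G u) (x (G - {u}, m - xv v))) +
        fscale c (kap d a (\<lambda>m'. x (G, m')) (m - xv v))" for v
      using subv[of v] by (intro ext) (simp add: DI_apply wdg_def c_def)
    have 2: "kap d a (\<lambda>m'. D I x (G, m')) m \<sigma> =
      (\<Sum>v\<in>Poly_Mapping.keys m. \<Sum>u\<in>G. orient G u * ctr {..<d} (a v) (x (G - {u}, m - xv v)) \<sigma>)
        + c * kap d a (kap d a (\<lambda>m'. x (G, m'))) m \<sigma>"
      unfolding kap_apply[of d a "\<lambda>m'. D I x (G, m')"] kap_apply[of d a "kap d a _"] Dx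
        ctr_add ctr_sum ctr_scale
      by (simp add: sum.distrib sum_distrib_left)
    have 3: "kap d a (kap d a (\<lambda>m'. x (G, m'))) m \<sigma> = 0"
      using kap_kap[of "\<lambda>m'. x (G, m')" d a m] x by simp
    have "D I (D I x) (G, m) \<sigma> = - c * (\<Sum>u\<in>G. orient G u * kap d a (\<lambda>m'. x (G - {u}, m')) m \<sigma>)
      + c * (\<Sum>v\<in>Poly_Mapping.keys m. \<Sum>u\<in>G. orient G u * ctr {..<d} (a v) (x (G - {u}, m - xv v)) \<sigma>)"
      using True 1 2 3 by (simp add: DI_apply[of d a I "D I x"] flip: c_def)
    also have "(\<Sum>v\<in>Poly_Mapping.keys m. \<Sum>u\<in>G. orient G u * ctr {..<d} (a v) (x (G - {u}, m - xv v)) \<sigma>)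
      = (\<Sum>u\<in>G. orient G u * kap d a (\<lambda>m'. x (G - {u}, m')) m \<sigma>)"
      by (subst sum.swap) (simp add: kap_apply sum_distrib_left)
    finally show ?thesis by simp
  qed (simp add: DI_apply)
qed

lemma D_D_Tsp: "okI \<Delta> I \<Longrightarrow> x \<in> Tsp d I \<G> n i \<Longrightarrow> D I (D I x) = 0"
  by (rule D_D, assumption, rule Tsp_Lam)

section \<open>Clearing exact columns\<close>

definition col :: "('v set \<times> 'v set) set \<Rightarrow> 'v set \<Rightarrow> nat \<Rightarrow> nat \<Rightarrow> (('v \<Rightarrow>\<^sub>0 nat) \<Rightarrow> nat set \<Rightarrow> 'k) set"
  where "col I G p i = {x. \<forall>m \<sigma>. x m \<sigma> \<noteq> 0 \<longrightarrow> (G, Poly_Mapping.keys m) \<in> I \<and> \<sigma> \<subseteq> {..<d} \<and>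
    card \<sigma> = p \<and> card \<sigma> + pdeg m = i}"

definition col_exact :: "('v set \<times> 'v set) set \<Rightarrow> 'v set \<Rightarrow> nat \<Rightarrow> nat \<Rightarrow> bool"
  where "col_exact I G p i \<longleftrightarrow> (\<forall>x\<in>col I G p i.
    (\<forall>m. (G, Poly_Mapping.keys m) \<in> I \<longrightarrow> kap d a x m = 0) \<longrightarrow>
    (\<exists>y\<in>col I G (Suc p) i. \<forall>m. (G, Poly_Mapping.keys m) \<in> I \<longrightarrow> kap d a y m = x m))"

text \<open>Faces are cleared by increasing size. Once all smaller faces are cleared, the coboundary
  part of the differential at \<open>G\<close> vanishes, so the entry at \<open>G\<close> is a
  Koszul cycle; a Koszul primitive of it is added to \<open>w\<close>, which affects only
  \<open>G\<close> and larger faces. The set \<open>E\<close> collects the exterior degrees in which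
  columns are exact. The cycle condition in degree \<open>p\<close> involves smaller faces in degree
  \<open>p - 1\<close>, and the closure assumption on \<open>E\<close> guarantees that these have
  been cleared.\<close>

lemma column_reduction:
  assumes I: "okI \<Delta> I" and up: "upc I \<G>" and sub: "\<G> \<subseteq> \<Delta>"
    and E: "\<And>F p. F \<in> \<G> \<Longrightarrow> int (card F) = n + int p \<Longrightarrow> Suc p \<in> E \<Longrightarrow> p \<in> E"
    and ex: "\<And>G p. G \<in> \<G> \<Longrightarrow> int (card G) = n + int p \<Longrightarrow> p \<in> E \<Longrightarrow> col_exact I G p i"
    and x: "x \<in> Tsp d I \<G> n i"
    and Dx: "\<And>G m \<sigma>. Suc (card \<sigma>) \<in> E \<Longrightarrow> D I x (G, m) \<sigma> = 0"
  obtains w where "w \<in> Tsp d I \<G> (n - 1) i" "\<And>G m \<sigma>. card \<sigma> \<in> E \<Longrightarrow> (x - D I w) (G, m) \<sigma> = 0"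
proof -
  have step: "\<exists>w\<in>Tsp d I \<G> (n - 1) i. \<forall>G m \<sigma>. card G < j \<longrightarrow> card \<sigma> \<in> E \<longrightarrow> (x - D I w) (G, m) \<sigma> = 0" for j
  proof (induction j)
    case 0
    show ?case using ts.subspace_0[OF subspace_Tsp] by blast
  next
    case (Suc j)
    then obtain w where w: "w \<in> Tsp d I \<G> (n - 1) i"
      "\<And>G m \<sigma>. card G < j \<Longrightarrow> card \<sigma> \<in> E \<Longrightarrow> (x - D I w) (G, m) \<sigma> = 0" by blast
    define r where "r = x - D I w"
    have r: "r \<in> Tsp d I \<G> n i"
      unfolding r_def using x D_Tsp[OF I up w(1)] by (intro ts.subspace_diff[OF subspace_Tsp]) auto
    have Dr: "D I r (G, m) \<sigma> = 0" if "Suc (card \<sigma>) \<in> E" for G m and \<sigma> :: "nat set"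
      unfolding r_def DI_diff D_D_Tsp[OF I w(1)] using Dx[OF that] by simp
    have "\<exists>y. y \<in> col I G (Suc p) i \<and> (\<forall>m. (G, Poly_Mapping.keys m) \<in> I \<longrightarrow> kap d a y m = r (G, m))"
      if G: "G \<in> \<G>" "card G = j" "int j = n + int p" "p \<in> E" for G p
    proof -
      have c: "(\<lambda>m. r (G, m)) \<in> col I G p i"
        unfolding col_def using TspD[OF r] G by fastforce
      have "kap d a (\<lambda>m. r (G, m)) m \<sigma> = 0" if m: "(G, Poly_Mapping.keys m) \<in> I" for m \<sigma>
      proof (rule ccontr)
        assume nz: "kap d a (\<lambda>m. r (G, m)) m \<sigma> \<noteq> 0"
        then obtain v k where vk: "v \<in> Poly_Mapping.keys m" "k < d" "k \<notin> \<sigma>" "r (G, m - xv v) (insert k \<sigma>) \<noteq> 0"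
          by (rule kap_nonzero)
        note * = TspD[OF r vk(4)]
        have "finite (insert k \<sigma>)" using *(3) finite_lessThan by (rule finite_subset)
        then have cs: "Suc (card \<sigma>) = p" using *(5) vk(3) G by simp
        have "r (G - {u}, m) \<sigma> = 0" if u: "u \<in> G" for u
        proof (rule ccontr)
          assume nz: "r (G - {u}, m) \<sigma> \<noteq> 0"
          have "finite G" using G(1) sub finite_face by blast
          then have "card (G - {u}) < j" using G(2) u by (metis card_Diff1_less)
          moreover have "card \<sigma> \<in> E"
            by (rule E[OF TspD(1,5)[OF r nz]]) (use cs G(4) in simp)
          ultimately show False using w(2) nz unfolding r_def by blast
        qed
        then have "wdg (\<lambda>_. 1) (\<lambda>F. r (F, m) \<sigma>) G = 0" by (simp add: wdg_def)
        then have "(-1) ^ card G * kap d a (\<lambda>m. r (G, m)) m \<sigma> = 0"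
          using Dr[of \<sigma> G m] cs G(4) m by (simp add: DI_apply)
        then show False using nz by simp
      qed
      then have "\<forall>m. (G, Poly_Mapping.keys m) \<in> I \<longrightarrow> kap d a (\<lambda>m. r (G, m)) m = 0"
        by (simp add: fun_eq_iff)
      then show ?thesis
        using ex[OF G(1) _ G(4)] G(2,3) c unfolding col_exact_def by auto
    qed
    \<comment> \<open>In total degree \<open>n\<close> the exterior degree at a face of size
      \<open>j\<close> is forced to be \<open>j - n\<close>.\<close>
    then have "\<forall>G. \<exists>y. G \<in> \<G> \<and> card G = j \<and> n \<le> int j \<and> nat (int j - n) \<in> E \<longrightarrow>
      y \<in> col I G (Suc (nat (int j - n))) i \<and> (\<forall>m. (G, Poly_Mapping.keys m) \<in> I \<longrightarrow> kap d a y m = r (G, m))"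
      by (metis (no_types, lifting) add.commute diff_add_cancel diff_ge_0_iff_ge int_nat_eq)
    from choice[OF this] obtain Y where Y: "\<And>G. G \<in> \<G> \<Longrightarrow> card G = j \<Longrightarrow> n \<le> int j \<Longrightarrow>
      nat (int j - n) \<in> E \<Longrightarrow> Y G \<in> col I G (Suc (nat (int j - n))) i \<and>
      (\<forall>m. (G, Poly_Mapping.keys m) \<in> I \<longrightarrow> kap d a (Y G) m = r (G, m))" by blast
    define P where "P G \<longleftrightarrow> G \<in> \<G> \<and> card G = j \<and> n \<le> int j \<and> nat (int j - n) \<in> E" for G
    \<comment> \<open>The factor \<open>(-1) ^ j\<close> compensates for the sign of the Koszul part
      of the differential.\<close>
    define y where "y = (\<lambda>(G, m). if P G then fscale ((-1) ^ j) (Y G m) else 0)"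
    have yT: "y \<in> Tsp d I \<G> (n - 1) i"
    proof (rule TspI)
      fix G m \<sigma> assume nz: "y (G, m) \<sigma> \<noteq> 0"
      then have P: "P G" and nz': "Y G m \<sigma> \<noteq> 0" by (auto simp: y_def split: if_splits)
      then have "(G, Poly_Mapping.keys m) \<in> I" "\<sigma> \<subseteq> {..<d}" "card \<sigma> = Suc (nat (int j - n))" "card \<sigma> + pdeg m = i"
        using Y unfolding P_def col_def by blast+
      then show "G \<in> \<G> \<and> (G, Poly_Mapping.keys m) \<in> I \<and> \<sigma> \<subseteq> {..<d} \<and> card \<sigma> + pdeg m = i \<and>
        int (card G) = n - 1 + int (card \<sigma>)" using P by (simp add: P_def)
    qed
    have y0: "y (F, m) \<sigma> = 0" if "card F \<noteq> j" for F m \<sigma>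
      using that by (simp add: y_def P_def)
    have "(x - D I (w + y)) (G, m) \<sigma> = 0" if lt: "card G < Suc j" and sE: "card \<sigma> \<in> E" for G m and \<sigma> :: "nat set"
    proof -
      have "D I y (G, m) \<sigma> = r (G, m) \<sigma>"
      proof (cases "(G, Poly_Mapping.keys m) \<in> I")
        case False
        then have "r (G, m) \<sigma> = 0" using TspD(2)[OF r] by blast
        then show ?thesis using False by (simp add: DI_apply)
      next
        case True
        have fin: "finite G" using okID(1)[OF I True] finite_face by blast
        have "y (G - {u}, m) \<sigma> = 0" if "u \<in> G" for u
          using y0 lt card_Diff1_less[OF fin that] by simp
        then have "wdg (\<lambda>_. 1) (\<lambda>F. y (F, m) \<sigma>) G = 0" by (simp add: wdg_def)
        then have Dy: "D I y (G, m) \<sigma> = (-1) ^ card G * kap d a (\<lambda>m'. y (G, m')) m \<sigma>"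
          using True by (simp add: DI_apply)
        show ?thesis
        proof (cases "P G")
          case P: True
          have "(\<lambda>m'. y (G, m')) = tscale ((-1) ^ j) (Y G)" using P by (simp add: y_def fun_eq_iff)
          then have "D I y (G, m) \<sigma> = (-1) ^ j * ((-1) ^ j * kap d a (Y G) m \<sigma>)"
            using Dy P by (simp add: kap_scale P_def)
          also have "\<dots> = kap d a (Y G) m \<sigma>" by (simp flip: mult.assoc power_mult_distrib)
          also have "\<dots> = r (G, m) \<sigma>" using Y P True unfolding P_def by simp
          finally show ?thesis .
        next
          case P: False
          have "(\<lambda>m'. y (G, m')) = 0" using P by (simp add: y_def fun_eq_iff)
          then have "D I y (G, m) \<sigma> = 0" using Dy by simp
          moreover have "r (G, m) \<sigma> = 0"
          proof (rule ccontr)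
            assume nz: "r (G, m) \<sigma> \<noteq> 0"
            have "card G \<noteq> j"
            proof
              assume j: "card G = j"
              have "int j = n + int (card \<sigma>)" "G \<in> \<G>" using TspD[OF r nz] j by auto
              then show False using P sE j by (simp add: P_def)
            qed
            then show False using w(2)[of G \<sigma> m] lt sE nz by (simp add: r_def)
          qed
          ultimately show ?thesis by simp
        qed
      qed
      then show ?thesis by (simp add: DI_add r_def)
    qed
    moreover have "w + y \<in> Tsp d I \<G> (n - 1) i"
      using w(1) yT by (rule ts.subspace_add[OF subspace_Tsp])
    ultimately show ?case by blast
  qed
  obtain w where w: "w \<in> Tsp d I \<G> (n - 1) i"
    "\<And>G m \<sigma>. card G < Suc (card V) \<Longrightarrow> card \<sigma> \<in> E \<Longrightarrow> (x - D I w) (G, m) \<sigma> = 0"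
    using step[of "Suc (card V)"] by blast
  have r: "x - D I w \<in> Tsp d I \<G> n i"
    using x D_Tsp[OF I up w(1)] by (intro ts.subspace_diff[OF subspace_Tsp]) auto
  show thesis
  proof (rule that[OF w(1)])
    fix G m and \<sigma> :: "nat set" assume sE: "card \<sigma> \<in> E"
    show "(x - D I w) (G, m) \<sigma> = 0"
    proof (rule ccontr)
      assume nz: "(x - D I w) (G, m) \<sigma> \<noteq> 0"
      then have "G \<in> \<Delta>" using TspD(1)[OF r nz] sub by blast
      then show False using w(2)[of G \<sigma> m] card_face_le[of G] sE nz by simp
    qed
  qed
qed

section \<open>Monomials of stars and monomials supported in a face\<close>

definition If :: "('v set \<times> 'v set) set"
  where "If = {(G, s). G \<union> s \<in> \<Delta>}"

text \<open>With \<open>If\<close> the monomials over a face are those of its star. For faces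
  containing \<open>G\<close>, the relation \<open>IK G\<close> keeps the monomials in the variables
  \<open>G\<close> only; admissibility is then the same for all these faces, and the complex becomes
  relative cochains tensored with a polynomial Koszul complex.\<close>

definition IK :: "'v set \<Rightarrow> ('v set \<times> 'v set) set"
  where "IK G = {(F, s). F \<in> \<Delta> \<and> s \<subseteq> G}"

lemma okI_If: "okI \<Delta> If"
  unfolding okI_def If_def by (auto intro: face_subset)

lemma okI_IK: "G \<in> \<Delta> \<Longrightarrow> okI \<Delta> (IK G)"
  unfolding okI_def IK_def by (auto intro: face_subset)

definition up :: "'v set \<Rightarrow> 'v set set"
  where "up G = {F \<in> \<Delta>. G \<subseteq> F}"

lemma upc_up: "okI \<Delta> I \<Longrightarrow> upc I (up G)"
  unfolding upc_def up_def okI_def by blast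

text \<open>Multiplying by variables only enlarges the support of a monomial, so the monomials not
  supported in \<open>G\<close> span a subcomplex. Its acyclicity reduces the faces containing
  \<open>G\<close> to the polynomial case.\<close>

definition Usp :: "'v set \<Rightarrow> int \<Rightarrow> nat \<Rightarrow> ('v set \<times> ('v \<Rightarrow>\<^sub>0 nat) \<Rightarrow> nat set \<Rightarrow> 'k) set"
  where "Usp G n i = {x \<in> Tsp d If (up G) n i. \<forall>F m \<sigma>. x (F, m) \<sigma> \<noteq> 0 \<longrightarrow> \<not> Poly_Mapping.keys m \<subseteq> G}"

lemma subspace_Usp: "ts.subspace (Usp G n i)"
proof -
  have "Usp G n i = Tsp d If (up G) n i \<inter> tsup {((F, m), \<sigma>). \<not> Poly_Mapping.keys m \<subseteq> G}"
    unfolding Usp_def tsup_def by blast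
  then show ?thesis using ts.subspace_inter[OF subspace_Tsp subspace_tsup] by simp
qed

lemma D_Usp: "x \<in> Usp G n i \<Longrightarrow> D If x \<in> Usp G (n + 1) i"
proof -
  assume x: "x \<in> Usp G n i"
  have "\<not> Poly_Mapping.keys m \<subseteq> G" if nz: "D If x (F, m) \<sigma> \<noteq> 0" for F m \<sigma>
    using DI_nonzero(2)[OF nz]
  proof
    assume "\<exists>u\<in>F. x (F - {u}, m) \<sigma> \<noteq> 0"
    then show ?thesis using x unfolding Usp_def by blast
  next
    assume "\<exists>v\<in>Poly_Mapping.keys m. \<exists>k. k < d \<and> k \<notin> \<sigma> \<and> x (F, m - xv v) (insert k \<sigma>) \<noteq> 0"
    then obtain v where "\<not> Poly_Mapping.keys (m - xv v) \<subseteq> G" using x unfolding Usp_def by blast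
    then show ?thesis using keys_minus_subset[of m "xv v"] by blast
  qed
  then show ?thesis
    using D_Tsp[OF okI_If upc_up[OF okI_If]] x unfolding Usp_def by blast
qed

text \<open>
  For a monomial \<open>m\<close> whose support is not contained in \<open>G\<close>, the faces \<open>F \<supseteq> G\<close> with
  \<open>F \<union> supp m \<in> \<Delta>\<close> form a cone over any vertex of \<open>supp m - G\<close>; the homotopy below is the
  corresponding contraction. It only shrinks the exterior degree, so it can be iterated.
\<close>

definition cone_vertex :: "'v set \<Rightarrow> ('v \<Rightarrow>\<^sub>0 nat) \<Rightarrow> 'v"
  where "cone_vertex G m = Min (Poly_Mapping.keys m - G)"

definition cone_htpy :: "'v set \<Rightarrow> ('v set \<times> ('v \<Rightarrow>\<^sub>0 nat) \<Rightarrow> nat set \<Rightarrow> 'k) \<Rightarrow>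
    'v set \<times> ('v \<Rightarrow>\<^sub>0 nat) \<Rightarrow> nat set \<Rightarrow> 'k"
  where "cone_htpy G x = (\<lambda>(F, m) \<sigma>. if Poly_Mapping.keys m \<subseteq> G then 0
    else ctr V (\<lambda>k. if k = cone_vertex G m then 1 else 0) (\<lambda>F. x (F, m) \<sigma>) F)"

lemma cone_vertex_mem:
  assumes "\<not> Poly_Mapping.keys m \<subseteq> G"
  shows "cone_vertex G m \<in> Poly_Mapping.keys m - G"
  unfolding cone_vertex_def using assms by (intro Min_in) auto

lemma ctr_indicator:
  assumes "w \<in> V"
  shows "ctr V (\<lambda>k. if k = w then 1 else 0) f F =
    (if w \<in> F then 0 else orient (insert w F) w * (f (insert w F) :: 'k))"
proof -
  have "ctr V (\<lambda>k. if k = w then 1 else 0) f F =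
    (\<Sum>k\<in>V - F. if k = w then orient (insert w F) w * f (insert w F) else 0)"
    unfolding ctr_def by (intro sum.cong) auto
  then show ?thesis using assms finite_V by simp
qed

lemma cone_htpy_nonzero:
  assumes "x \<in> Usp G n i" "cone_htpy G x (F, m) \<sigma> \<noteq> 0"
  shows "\<not> Poly_Mapping.keys m \<subseteq> G" "cone_vertex G m \<notin> F" "x (insert (cone_vertex G m) F, m) \<sigma> \<noteq> 0"
proof -
  show k: "\<not> Poly_Mapping.keys m \<subseteq> G" using assms(2) by (auto simp: cone_htpy_def)
  then have "ctr V (\<lambda>k. if k = cone_vertex G m then 1 else 0) (\<lambda>F. x (F, m) \<sigma>) F \<noteq> 0"
    using assms(2) by (simp add: cone_htpy_def)
  then obtain k where "k \<in> V - F"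
    "orient (insert k F) k * (if k = cone_vertex G m then 1 else 0) * x (insert k F, m) \<sigma> \<noteq> 0"
    unfolding ctr_def by (rule sum.not_neutral_contains_not_neutral)
  then show "cone_vertex G m \<notin> F" "x (insert (cone_vertex G m) F, m) \<sigma> \<noteq> 0"
    by (auto split: if_splits)
qed

lemma cone_htpy_Usp:
  assumes x: "x \<in> Usp G n i"
  shows "cone_htpy G x \<in> Usp G (n - 1) i"
proof -
  have "cone_htpy G x \<in> Tsp d If (up G) (n - 1) i"
  proof (rule TspI)
    fix F m \<sigma> assume nz: "cone_htpy G x (F, m) \<sigma> \<noteq> 0"
    note * = cone_htpy_nonzero[OF x nz]
    have xT: "x \<in> Tsp d If (up G) n i" using x by (simp add: Usp_def)
    note t = TspD[OF xT *(3)]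
    have fin: "finite F"
      using t(1) finite_face[of "insert (cone_vertex G m) F"] by (simp add: up_def)
    have "F \<in> up G"
      using t(1) cone_vertex_mem[OF *(1)] face_subset[of "insert (cone_vertex G m) F" F] by (auto simp: up_def)
    moreover have "(F, Poly_Mapping.keys m) \<in> If" using okID(3)[OF okI_If t(2)] by blast
    ultimately show "F \<in> up G \<and> (F, Poly_Mapping.keys m) \<in> If \<and> \<sigma> \<subseteq> {..<d} \<and>
      card \<sigma> + pdeg m = i \<and> int (card F) = n - 1 + int (card \<sigma>)"
      using t(3-5) fin *(2) by simp
  qed
  then show ?thesis using cone_htpy_nonzero(1)[OF x] unfolding Usp_def by blast
qed

text \<open>In the top exterior degree of \<open>x\<close> nothing arrives from the Koszul part, so
  there the total differential is the simplicial coboundary and the cone homotopy is a genuine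
  contraction. Subtracting its coboundary removes the top exterior degree.\<close>

lemma cone_htpy_reduce:
  assumes x: "x \<in> Usp G n i" and Dx: "D If x = 0"
    and N: "\<And>F m \<sigma>. x (F, m) \<sigma> \<noteq> 0 \<Longrightarrow> card \<sigma> < Suc N"
    and nz: "(x - D If (cone_htpy G x)) (F, m) \<sigma> \<noteq> 0"
  shows "card \<sigma> < N"
proof (rule ccontr)
  assume ge: "\<not> card \<sigma> < N"
  let ?h = "cone_htpy G x"
  have r: "x - D If ?h \<in> Usp G n i"
    using x D_Usp[OF cone_htpy_Usp[OF x]] by (intro ts.subspace_diff[OF subspace_Usp]) auto
  then have rT: "x - D If ?h \<in> Tsp d If (up G) n i" by (simp add: Usp_def)
  have Fm: "(F, Poly_Mapping.keys m) \<in> If" "\<not> Poly_Mapping.keys m \<subseteq> G" "\<sigma> \<subseteq> {..<d}"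
    using TspD[OF rT nz] r nz unfolding Usp_def by blast+
  have fs: "finite \<sigma>" using Fm(3) finite_lessThan by (rule finite_subset)
  have FV: "F \<subseteq> V" using okID(1)[OF okI_If Fm(1)] by blast
  define w where "w = cone_vertex G m"
  have w: "w \<in> Poly_Mapping.keys m" "w \<in> V"
    using cone_vertex_mem[OF Fm(2)] okID(2)[OF okI_If Fm(1)] by (auto simp: w_def)
  define f where "f = (\<lambda>F. x (F, m) \<sigma>)"
  have kap0: "kap d a (\<lambda>m'. y (F', m')) m' \<sigma> = 0"
    if "\<And>F m \<tau>. y (F, m) \<tau> \<noteq> 0 \<Longrightarrow> card \<tau> < Suc N" for y :: "'v set \<times> ('v \<Rightarrow>\<^sub>0 nat) \<Rightarrow> nat set \<Rightarrow> 'k" and F' m'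
  proof (rule ccontr)
    assume "kap d a (\<lambda>m'. y (F', m')) m' \<sigma> \<noteq> 0"
    then obtain v k where "k \<notin> \<sigma>" "y (F', m' - xv v) (insert k \<sigma>) \<noteq> 0" by (rule kap_nonzero)
    then show False using that[of F' "m' - xv v" "insert k \<sigma>"] fs ge by simp
  qed
  have hN: "card \<tau> < Suc N" if "?h (F, m) \<tau> \<noteq> 0" for F m \<tau>
    using N[OF cone_htpy_nonzero(3)[OF x that]] .
  have "D If ?h (F, m) \<sigma> = wdg (\<lambda>_. 1) (ctr V (\<lambda>k. if k = w then 1 else 0) f) F"
  proof -
    have k: "kap d a (\<lambda>m'. ?h (F, m')) m \<sigma> = 0" by (rule kap0) (rule hN)
    have "(\<lambda>F. ?h (F, m) \<sigma>) = ctr V (\<lambda>k. if k = w then 1 else 0) f"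
      using Fm(2) by (simp add: fun_eq_iff cone_htpy_def w_def f_def)
    then show ?thesis using Fm(1) by (simp add: DI_apply k)
  qed
  moreover have "ctr V (\<lambda>k. if k = w then 1 else 0) (wdg (\<lambda>_. 1) f) F = 0"
  proof (cases "w \<in> F")
    case False
    \<comment> \<open>The cone property: \<open>w\<close> already belongs to the support of
      \<open>m\<close>, so adding it to the face keeps the pair admissible and the cocycle condition
      may be used there.\<close>
    have "insert w F \<union> Poly_Mapping.keys m = F \<union> Poly_Mapping.keys m" using w(1) by blast
    then have "(insert w F, Poly_Mapping.keys m) \<in> If" using Fm(1) by (simp add: If_def)
    moreover have "D If x (insert w F, m) \<sigma> = 0" using Dx by simp
    moreover have "kap d a (\<lambda>m'. x (insert w F, m')) m \<sigma> = 0" by (rule kap0) (rule N)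
    ultimately have "wdg (\<lambda>_. 1) f (insert w F) = 0"
      by (simp add: DI_apply f_def)
    then show ?thesis using ctr_indicator[OF w(2)] by simp
  qed (simp add: ctr_indicator[OF w(2)])
  moreover have "(\<Sum>k\<in>V. (if k = w then 1 else 0) * (1::'k)) = 1"
    using w(2) finite_V by simp
  ultimately have "D If ?h (F, m) \<sigma> = x (F, m) \<sigma>"
    using ctr_wdg[OF finite_V FV, of "\<lambda>k. if k = w then 1 else 0" "\<lambda>_. 1" f] by (simp add: f_def)
  then show False using nz by simp
qed

lemma Usp_acyclic:
  assumes "x \<in> Usp G n i" "D If x = 0"
  shows "\<exists>u\<in>Usp G (n - 1) i. D If u = x"
proof -
  have "\<exists>u\<in>Usp G (n - 1) i. D If u = x"
    if "x \<in> Usp G n i" "D If x = 0" "\<And>F m \<sigma>. x (F, m) \<sigma> \<noteq> 0 \<Longrightarrow> card \<sigma> < N" for N x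
    using that
  proof (induction N arbitrary: x)
    case 0
    then have "x (F, m) \<sigma> = 0" for F m \<sigma> by blast
    then have "x = 0" by (auto simp: fun_eq_iff)
    then show ?case using ts.subspace_0[OF subspace_Usp] DI_zero by blast
  next
    case (Suc N)
    let ?r = "x - D If (cone_htpy G x)"
    have h: "cone_htpy G x \<in> Usp G (n - 1) i" using cone_htpy_Usp[OF Suc.prems(1)] .
    have "\<exists>u\<in>Usp G (n - 1) i. D If u = ?r"
    proof (rule Suc.IH)
      show "?r \<in> Usp G n i"
        using Suc.prems(1) D_Usp[OF h] by (intro ts.subspace_diff[OF subspace_Usp]) auto
      have "cone_htpy G x \<in> Tsp d If (up G) (n - 1) i" using h by (simp add: Usp_def)
      then show "D If ?r = 0" unfolding DI_diff Suc.prems(2) by (simp add: D_D_Tsp[OF okI_If])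
      show "card \<sigma> < N" if "?r (F, m) \<sigma> \<noteq> 0" for F m \<sigma>
        using cone_htpy_reduce[OF Suc.prems(1,2) Suc.prems(3) that] .
    qed
    then obtain u where u: "u \<in> Usp G (n - 1) i" "D If u = ?r" by blast
    then have "D If (u + cone_htpy G x) = x" by (simp add: DI_add)
    moreover have "u + cone_htpy G x \<in> Usp G (n - 1) i"
      using u(1) h by (rule ts.subspace_add[OF subspace_Usp])
    ultimately show ?case by blast
  qed
  moreover have "card \<sigma> < Suc i" if "x (F, m) \<sigma> \<noteq> 0" for F m \<sigma>
    using assms(1) TspD(4)[of x d If "up G" n i, OF _ that] unfolding Usp_def by auto
  ultimately show ?thesis using assms by blast
qed

end

section \<open>Simplicial cochains and the monomial 1\<close>

lemma coboundary_wdg: "coboundary \<Delta> c F = (if F \<in> \<Delta> then wdg (\<lambda>_. 1) c F else 0)"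
  by (simp add: coboundary_def wdg_def)

lemma linear_coboundary: "Vector_Spaces.linear fscale fscale (coboundary \<Delta>)"
  by (auto simp: linear_ff_iff fun_eq_iff coboundary_wdg wdg_add wdg_scale)

definition emb :: "('v set \<Rightarrow> nat set \<Rightarrow> 'k::field) \<Rightarrow> 'v set \<times> ('v \<Rightarrow>\<^sub>0 nat) \<Rightarrow> nat set \<Rightarrow> 'k"
  where "emb y = (\<lambda>(F, m) \<sigma>. if m = 0 then y F \<sigma> else 0)"

lemma emb_apply: "emb y (F, m) \<sigma> = (if m = 0 then y F \<sigma> else 0)"
  by (simp add: emb_def)

lemma linear_emb: "Vector_Spaces.linear tscale tscale emb"
  by (auto simp: linear_tt_iff fun_eq_iff emb_def)

lemma emb_eq_0: "emb y = 0 \<Longrightarrow> y = 0"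
proof (intro ext)
  fix F \<sigma> assume "emb y = 0"
  then have "emb y (F, 0) \<sigma> = 0" by simp
  then show "y F \<sigma> = 0 F \<sigma>" by (simp add: emb_apply)
qed

text \<open>On the faces containing \<open>G\<close> the kernel is \<open>Usp G\<close>, so this is
  the quotient map from the complex with support \<open>If\<close> to the one with support
  \<open>IK G\<close>.\<close>

definition prj :: "'v set \<Rightarrow> ('v set \<times> ('v \<Rightarrow>\<^sub>0 nat) \<Rightarrow> nat set \<Rightarrow> 'k::field) \<Rightarrow>
    'v set \<times> ('v \<Rightarrow>\<^sub>0 nat) \<Rightarrow> nat set \<Rightarrow> 'k"
  where "prj G x = (\<lambda>(F, m) \<sigma>. if Poly_Mapping.keys m \<subseteq> G then x (F, m) \<sigma> else 0)"

lemma prj_apply: "prj G x (F, m) \<sigma> = (if Poly_Mapping.keys m \<subseteq> G then x (F, m) \<sigma> else 0)"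
  by (simp add: prj_def)

lemma linear_prj: "Vector_Spaces.linear tscale tscale (prj G)"
  by (auto simp: linear_tt_iff fun_eq_iff prj_def)

lemma prj_diff: "prj G (x - y) = prj G x - prj G y"
  by (auto simp: fun_eq_iff prj_def)

context complex
begin

text \<open>Linear independence of the coefficient vectors \<open>a g\<close>, in the form of a dual
  family: the vectors \<open>b g\<close> are what the Koszul homotopies wedge with.\<close>

definition dual_on :: "'v set \<Rightarrow> bool"
  where "dual_on G \<longleftrightarrow> (\<exists>b. (\<forall>g. b g \<in> fsup {..<d}) \<and>
    (\<forall>g\<in>G. \<forall>g'\<in>G. (\<Sum>k<d. a g k * b g' k) = (if g = g' then 1 else 0)))"

text \<open>Cochains of the complex relative to the faces not containing \<open>G\<close>. The index
  \<open>j\<close> counts vertices, so the cohomological degree is \<open>j - 1\<close>.\<close>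

definition Cs :: "'v set \<Rightarrow> int \<Rightarrow> ('v set \<Rightarrow> 'k) set"
  where "Cs G j = fsup {F \<in> up G. int (card F) = j}"

definition Zs :: "'v set \<Rightarrow> int \<Rightarrow> ('v set \<Rightarrow> 'k) set"
  where "Zs G j = {c \<in> Cs G j. coboundary \<Delta> c = 0}"

definition Bs :: "'v set \<Rightarrow> int \<Rightarrow> ('v set \<Rightarrow> 'k) set"
  where "Bs G j = coboundary \<Delta> ` Cs G (j - 1)"

lemma finite_up: "finite (up G)"
  using finite_Delta by (simp add: up_def)

lemma finite_Cs: "finite {F \<in> up G. int (card F) = j}"
  using finite_up by simp

lemma subspace_Cs: "fs.subspace (Cs G j)"
  unfolding Cs_def by (rule subspace_fsup)

lemma subspace_Zs: "fs.subspace (Zs G j)"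
  unfolding Zs_def by (rule linear_ker_subspace[OF linear_coboundary subspace_Cs])

lemma subspace_Bs: "fs.subspace (Bs G j)"
  unfolding Bs_def by (rule linear_image_subspace[OF linear_coboundary subspace_Cs])

lemma fdim_Cs: "fs.fdim (Cs G j)"
  unfolding Cs_def by (rule fdim_fsup[OF finite_Cs])

lemma coboundary_Cs:
  assumes "c \<in> Cs G j"
  shows "coboundary \<Delta> c \<in> Cs G (j + 1)"
proof -
  have "F \<in> up G \<and> int (card F) = j + 1" if nz: "coboundary \<Delta> c F \<noteq> 0" for F
  proof -
    have F: "F \<in> \<Delta>" "wdg (\<lambda>_. 1) c F \<noteq> 0"
      using nz by (auto simp: coboundary_wdg split: if_splits)
    from F(2) obtain u where "u \<in> F" "orient F u * 1 * c (F - {u}) \<noteq> 0"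
      unfolding wdg_def by (rule sum.not_neutral_contains_not_neutral)
    then have u: "u \<in> F" "F - {u} \<in> up G" "int (card (F - {u})) = j"
      using assms by (auto simp: Cs_def fsup_def)
    then show ?thesis using F(1) card_Suc_Diff1[OF finite_face[OF F(1)] u(1)] by (auto simp: up_def)
  qed
  then show ?thesis by (simp add: Cs_def fsup_def)
qed

lemma coboundary_coboundary: "coboundary \<Delta> (coboundary \<Delta> (c :: 'v set \<Rightarrow> 'k)) = 0"
proof
  fix F
  show "coboundary \<Delta> (coboundary \<Delta> c) F = 0 F"
  proof (cases "F \<in> \<Delta>")
    case True
    have "wdg (\<lambda>_. 1) (coboundary \<Delta> c) F = wdg (\<lambda>_. 1) (wdg (\<lambda>_. 1) c) F"
      unfolding wdg_def[of _ "coboundary \<Delta> c"] wdg_def[of _ "wdg (\<lambda>_. 1) c"]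
      using face_subset[OF True] by (intro sum.cong) (auto simp: coboundary_wdg)
    then show ?thesis
      using True wdg_wdg[OF finite_face[OF True]] by (simp add: coboundary_wdg[of _ "coboundary \<Delta> c"])
  qed (simp add: coboundary_wdg)
qed

lemma Bs_subset_Zs: "Bs G j \<subseteq> Zs G j"
  using coboundary_Cs[of _ G "j - 1"] coboundary_coboundary by (auto simp: Bs_def Zs_def)

lemma Zs_subset: "Zs G j \<subseteq> fsup {F \<in> up G. int (card F) = j}"
  by (auto simp: Zs_def Cs_def)

lemma Bs_subset: "Bs G j \<subseteq> fsup {F \<in> up G. int (card F) = j}"
  using Bs_subset_Zs Zs_subset by blast

section \<open>The quotient with monomials supported in a fixed face\<close>

definition Xsp :: "'v set \<Rightarrow> int \<Rightarrow> nat \<Rightarrow> ('v set \<times> ('v \<Rightarrow>\<^sub>0 nat) \<Rightarrow> nat set \<Rightarrow> 'k) set"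
  where "Xsp G n i = Tsp d (IK G) (up G) n i"

lemma Xsp_subset: "G \<in> \<Delta> \<Longrightarrow> Xsp G n i \<subseteq> Tsp d If (up G) n i"
proof
  fix x assume x: "x \<in> Xsp G n i"
  show "x \<in> Tsp d If (up G) n i"
  proof (rule TspI)
    fix F m \<sigma> assume "x (F, m) \<sigma> \<noteq> 0"
    note * = TspD[OF x[unfolded Xsp_def] this]
    have "F \<union> Poly_Mapping.keys m = F" using *(1,2) by (auto simp: up_def IK_def)
    then show "F \<in> up G \<and> (F, Poly_Mapping.keys m) \<in> If \<and> \<sigma> \<subseteq> {..<d} \<and> card \<sigma> + pdeg m = i \<and>
      int (card F) = n + int (card \<sigma>)" using * by (auto simp: If_def up_def)
  qed
qed

lemma prj_Xsp:
  assumes "x \<in> Tsp d If (up G) n i"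
  shows "prj G x \<in> Xsp G n i"
  unfolding Xsp_def
proof (rule TspI)
  fix F m \<sigma> assume "prj G x (F, m) \<sigma> \<noteq> 0"
  then have k: "Poly_Mapping.keys m \<subseteq> G" and nz: "x (F, m) \<sigma> \<noteq> 0" by (auto simp: prj_apply split: if_splits)
  show "F \<in> up G \<and> (F, Poly_Mapping.keys m) \<in> IK G \<and> \<sigma> \<subseteq> {..<d} \<and> card \<sigma> + pdeg m = i \<and>
      int (card F) = n + int (card \<sigma>)"
    using TspD[OF assms nz] k by (auto simp: IK_def up_def)
qed

lemma prj_id: "x \<in> Xsp G n i \<Longrightarrow> prj G x = x"
proof (intro ext, clarsimp)
  fix F m \<sigma> assume x: "x \<in> Xsp G n i"
  show "prj G x (F, m) \<sigma> = x (F, m) \<sigma>"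
    using TspD(2)[OF x[unfolded Xsp_def], of F m \<sigma>] by (auto simp: prj_apply IK_def)
qed

lemma D_Xsp: "G \<in> \<Delta> \<Longrightarrow> x \<in> Xsp G n i \<Longrightarrow> D (IK G) x \<in> Xsp G (n + 1) i"
  unfolding Xsp_def by (rule D_Tsp[OF okI_IK upc_up[OF okI_IK]])

lemma prj_D:
  assumes G: "G \<in> \<Delta>" and x: "x \<in> Tsp d If (up G) n i"
  shows "prj G (D If x) = D (IK G) (prj G x)"
proof (intro ext, clarsimp)
  fix F m \<sigma>
  have L: "prj G (D If x) \<in> Xsp G (n + 1) i"
    by (rule prj_Xsp[OF D_Tsp[OF okI_If upc_up[OF okI_If] x]])
  have R: "D (IK G) (prj G x) \<in> Xsp G (n + 1) i" by (rule D_Xsp[OF G prj_Xsp[OF x]])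
  show "prj G (D If x) (F, m) \<sigma> = D (IK G) (prj G x) (F, m) \<sigma>"
  proof (cases "F \<in> up G \<and> Poly_Mapping.keys m \<subseteq> G")
    case False
    have vanish: "y (F, m) \<sigma> = 0" if y: "y \<in> Xsp G (n + 1) i" for y :: "'v set \<times> ('v \<Rightarrow>\<^sub>0 nat) \<Rightarrow> nat set \<Rightarrow> 'k"
    proof (rule ccontr)
      assume "y (F, m) \<sigma> \<noteq> 0"
      from TspD(1,2)[OF y[unfolded Xsp_def] this] show False using False by (auto simp: IK_def)
    qed
    show ?thesis using vanish[OF L] vanish[OF R] by simp
  next
    case True
    then have "F \<union> Poly_Mapping.keys m = F" "F \<in> \<Delta>" by (auto simp: up_def)
    then have I: "(F, Poly_Mapping.keys m) \<in> If" "(F, Poly_Mapping.keys m) \<in> IK G"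
      using True by (auto simp: If_def IK_def)
    have "kap d a (\<lambda>m'. prj G x (F, m')) m = kap d a (\<lambda>m'. x (F, m')) m"
      unfolding kap_def
    proof (rule sum.cong[OF refl])
      fix v
      have "Poly_Mapping.keys (m - xv v) \<subseteq> G" using True keys_minus_subset[of m "xv v"] by blast
      then have "prj G x (F, m - xv v) = x (F, m - xv v)" by (simp add: fun_eq_iff prj_apply)
      then show "ctr {..<d} (a v) (prj G x (F, m - xv v)) = ctr {..<d} (a v) (x (F, m - xv v))" by simp
    qed
    moreover have "(\<lambda>F. prj G x (F, m) \<sigma>) = (\<lambda>F. x (F, m) \<sigma>)" using True by (simp add: prj_apply)
    ultimately show ?thesis using True I by (simp add: prj_apply[of G "D If x"] DI_apply)
  qed
qed

lemma prj_0_Usp: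
  assumes "x \<in> Tsp d If (up G) n i" "prj G x = 0"
  shows "x \<in> Usp G n i"
proof -
  have "\<not> Poly_Mapping.keys m \<subseteq> G" if "x (F, m) \<sigma> \<noteq> 0" for F m \<sigma>
  proof
    assume "Poly_Mapping.keys m \<subseteq> G"
    then have "prj G x (F, m) \<sigma> = x (F, m) \<sigma>" by (simp add: prj_apply)
    then show False using assms(2) that by simp
  qed
  then show ?thesis using assms(1) by (auto simp: Usp_def)
qed

text \<open>Every such column is the Koszul complex of the polynomial ring in the variables
  \<open>G\<close>, and exterior degree \<open>p < i\<close> means positive polynomial degree
  \<open>i - p\<close>.\<close>

lemma col_exact_IK:
  assumes G: "G \<in> \<Delta>" and dual: "dual_on G" and F: "F \<in> up G" and p: "p < i"
  shows "col_exact (IK G) F p i"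
  unfolding col_exact_def
proof (intro ballI impI)
  fix x assume x: "x \<in> col (IK G) F p i"
    and k: "\<forall>m. (F, Poly_Mapping.keys m) \<in> IK G \<longrightarrow> kap d a x m = 0"
  obtain b where b: "\<And>g. b g \<in> fsup {..<d}"
    "\<And>g g'. g \<in> G \<Longrightarrow> g' \<in> G \<Longrightarrow> (\<Sum>k<d. a g k * b g' k) = (if g = g' then 1 else 0)"
    using dual unfolding dual_on_def by blast
  have FK: "(F, s) \<in> IK G \<longleftrightarrow> s \<subseteq> G" for s using F by (auto simp: IK_def up_def)
  have xs: "Poly_Mapping.keys m \<subseteq> G" "\<sigma> \<subseteq> {..<d}" "card \<sigma> = p" "p + pdeg m = i"
    if "x m \<sigma> \<noteq> 0" for m \<sigma>
    using x that FK unfolding col_def by auto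
  have "\<exists>y. (\<forall>m. y m \<in> Lam d (Suc p)) \<and>
    (\<forall>m \<sigma>. y m \<sigma> \<noteq> 0 \<longrightarrow> Poly_Mapping.keys m \<subseteq> G \<and> Suc (pdeg m) = i - p) \<and>
    (\<forall>m. Poly_Mapping.keys m \<subseteq> G \<longrightarrow> kap d a y m = x m)"
  proof (rule kap_exact_polynomial[OF finite_face[OF G] b])
    show "0 < i - p" using p by simp
    show "x m \<in> Lam d p" for m using xs(2,3) by (simp add: Lam_def fsup_def)
    show "Poly_Mapping.keys m \<subseteq> G \<and> pdeg m = i - p" if "x m \<sigma> \<noteq> 0" for m \<sigma>
      using xs(1,4)[OF that] by auto
    show "kap d a x m = 0" if "Poly_Mapping.keys m \<subseteq> G" for m using k FK that by blast
  qed
  then obtain y where y: "\<And>m. y m \<in> Lam d (Suc p)"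
    "\<And>m \<sigma>. y m \<sigma> \<noteq> 0 \<Longrightarrow> Poly_Mapping.keys m \<subseteq> G \<and> Suc (pdeg m) = i - p"
    "\<And>m. Poly_Mapping.keys m \<subseteq> G \<Longrightarrow> kap d a y m = x m" by blast
  have "y \<in> col (IK G) F (Suc p) i"
    unfolding col_def
  proof (intro CollectI allI impI)
    fix m \<sigma> assume nz: "y m \<sigma> \<noteq> 0"
    show "(F, Poly_Mapping.keys m) \<in> IK G \<and> \<sigma> \<subseteq> {..<d} \<and> card \<sigma> = Suc p \<and> card \<sigma> + pdeg m = i"
      using y(2)[OF nz] Lam_D[OF y(1) nz] FK by auto
  qed
  then show "\<exists>y\<in>col (IK G) F (Suc p) i. \<forall>m. (F, Poly_Mapping.keys m) \<in> IK G \<longrightarrow> kap d a y m = x m"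
    using y(3) FK by blast
qed

definition cobT :: "('v set \<Rightarrow> nat set \<Rightarrow> 'k) \<Rightarrow> 'v set \<Rightarrow> nat set \<Rightarrow> 'k"
  where "cobT y = (\<lambda>F \<sigma>. coboundary \<Delta> (\<lambda>F. y F \<sigma>) F)"

lemma emb_Xsp:
  assumes "y \<in> Ten (Cs G (n + int i)) (Lam d i)" "G \<in> \<Delta>"
  shows "emb y \<in> Xsp G n i"
  unfolding Xsp_def
proof (rule TspI)
  fix F m \<sigma> assume "emb y (F, m) \<sigma> \<noteq> 0"
  then have m: "m = 0" and nz: "y F \<sigma> \<noteq> 0" by (auto simp: emb_apply split: if_splits)
  have "(\<lambda>F. y F \<sigma>) \<in> Cs G (n + int i)" "y F \<in> Lam d i" using assms(1) by (auto simp: Ten_def)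
  then have "F \<in> up G" "int (card F) = n + int i" "\<sigma> \<subseteq> {..<d}" "card \<sigma> = i"
    using nz Lam_D[of "y F" d i \<sigma>] by (auto simp: Cs_def fsup_def)
  then show "F \<in> up G \<and> (F, Poly_Mapping.keys m) \<in> IK G \<and> \<sigma> \<subseteq> {..<d} \<and> card \<sigma> + pdeg m = i \<and>
    int (card F) = n + int (card \<sigma>)" using m by (auto simp: IK_def up_def)
qed

lemma kap_emb:
  "kap d a (\<lambda>m'. emb y (F, m')) m \<sigma> =
    (if \<exists>g. m = xv g then ctr {..<d} (a (THE g. m = xv g)) (y F) \<sigma> else 0)"
proof (cases "\<exists>g. m = xv g")
  case True
  then obtain g where g: "m = xv g" by blast
  have u: "(THE g'. xv g = xv g') = g"
    by (rule the_equality) (metis keys_xv singleton_inject)+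
  have "emb y (F, xv g - xv g) = y F" by (simp add: fun_eq_iff emb_apply)
  then show ?thesis using g u by (auto simp: kap_apply)
next
  case False
  have "emb y (F, m - xv v) = 0" if "v \<in> Poly_Mapping.keys m" for v
  proof -
    have "m - xv v \<noteq> 0" using False minus_xv_plus[OF that] by (metis add_0)
    then show ?thesis by (simp add: fun_eq_iff emb_apply)
  qed
  then show ?thesis using False by (simp add: kap_apply)
qed

text \<open>Having rows in \<open>LamW\<close> is exactly the condition that kills the Koszul part
  at the monomials of degree 1; all other monomials are out of reach from the monomial 1.\<close>

lemma D_emb:
  assumes "y \<in> Ten (Cs G j) (LamW d a G i)" "G \<in> \<Delta>"
  shows "D (IK G) (emb y) = emb (cobT y)"
proof (intro ext, clarsimp)
  fix F m \<sigma>
  have yW: "y F \<in> LamW d a G i" for F using assms(1) by (simp add: Ten_def)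
  show "D (IK G) (emb y) (F, m) \<sigma> = emb (cobT y) (F, m) \<sigma>"
  proof (cases "F \<in> \<Delta> \<and> Poly_Mapping.keys m \<subseteq> G")
    case False
    then have "(F, Poly_Mapping.keys m) \<notin> IK G" by (auto simp: IK_def)
    moreover have "emb (cobT y) (F, m) \<sigma> = 0" using False by (auto simp: emb_apply cobT_def coboundary_wdg)
    ultimately show ?thesis by (simp add: DI_apply)
  next
    case True
    have "kap d a (\<lambda>m'. emb y (F, m')) m \<sigma> = 0"
    proof (cases "\<exists>g. m = xv g")
      case g: True
      then obtain g where g: "m = xv g" by blast
      have u: "(THE g'. xv g = xv g') = g"
        by (rule the_equality) (metis keys_xv singleton_inject)+
      have "g \<in> G" using True g by simp
      then have "ctr {..<d} (a g) (y F) = 0" using yW[of F] by (simp add: LamW_def)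
      then show ?thesis using g u by (simp add: kap_emb)
    qed (simp add: kap_emb)
    moreover have "wdg (\<lambda>_. 1) (\<lambda>F. emb y (F, m) \<sigma>) F = (if m = 0 then wdg (\<lambda>_. 1) (\<lambda>F. y F \<sigma>) F else 0)"
      by (simp add: emb_apply)
    ultimately show ?thesis
      using True by (auto simp: DI_apply IK_def emb_apply cobT_def coboundary_wdg)
  qed
qed

text \<open>Clearing all exterior degrees below \<open>i\<close> leaves exterior degree
  \<open>i\<close> and thus the monomial 1. The differential is assumed to vanish only in exterior
  degrees below \<open>i\<close>, so that the lemma applies to cocycles and also to primitives of
  embedded cochains.\<close>

lemma reduce_to_emb:
  assumes G: "G \<in> \<Delta>" and dual: "dual_on G" and x: "x \<in> Xsp G n i"
    and Dx: "\<And>F m \<sigma>. card \<sigma> < i \<Longrightarrow> D (IK G) x (F, m) \<sigma> = 0"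
  obtains w y where "w \<in> Xsp G (n - 1) i" "y \<in> Ten (Cs G (n + int i)) (LamW d a G i)"
    "x - D (IK G) w = emb y"
proof -
  obtain w where w: "w \<in> Tsp d (IK G) (up G) (n - 1) i"
    "\<And>F m \<sigma>. card \<sigma> \<in> {..<i} \<Longrightarrow> (x - D (IK G) w) (F, m) \<sigma> = 0"
  proof (rule column_reduction[OF okI_IK[OF G] upc_up[OF okI_IK[OF G]], where E = "{..<i}" and x = x])
    show "up G \<subseteq> \<Delta>" by (auto simp: up_def)
    show "x \<in> Tsp d (IK G) (up G) n i" using x by (simp add: Xsp_def)
    show "col_exact (IK G) F p i" if "F \<in> up G" "p \<in> {..<i}" for F p
      using col_exact_IK[OF G dual that(1)] that(2) by simp
  qed (use Dx in auto)
  define r where "r = x - D (IK G) w"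
  have wX: "w \<in> Xsp G (n - 1) i" using w(1) by (simp add: Xsp_def)
  have r: "r \<in> Xsp G n i"
    unfolding r_def using x D_Xsp[OF G wX]
    by (auto simp: Xsp_def intro!: ts.subspace_diff[OF subspace_Tsp])
  have rs: "m = 0" "F \<in> up G" "\<sigma> \<subseteq> {..<d}" "card \<sigma> = i" "int (card F) = n + int i" if nz: "r (F, m) \<sigma> \<noteq> 0" for F m \<sigma>
  proof -
    note * = TspD[OF r[unfolded Xsp_def] nz]
    have "\<not> card \<sigma> < i" using w(2)[of \<sigma> F m] nz by (auto simp: r_def)
    then have c: "card \<sigma> = i" "pdeg m = 0" using *(4) by auto
    then show "m = 0" "F \<in> up G" "\<sigma> \<subseteq> {..<d}" "card \<sigma> = i" "int (card F) = n + int i" using * by auto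
  qed
  define y where "y = (\<lambda>F. r (F, 0))"
  have ry: "r = emb y"
  proof (intro ext, clarsimp)
    fix F m \<sigma> show "r (F, m) \<sigma> = emb y (F, m) \<sigma>" using rs(1)[of F m \<sigma>] by (auto simp: emb_apply y_def)
  qed
  have yL: "y \<in> Ten (Cs G (n + int i)) (Lam d i)"
    unfolding Ten_def Cs_def Lam_def fsup_def y_def using rs by auto
  have Dr: "D (IK G) r (F, m) \<sigma> = 0" if "card \<sigma> < i" for F m \<sigma>
    unfolding r_def DI_diff D_D_Tsp[OF okI_IK[OF G] w(1)] using Dx[OF that] by simp
  \<comment> \<open>At the monomial of degree 1 in \<open>g\<close> the differential of
    \<open>r\<close> receives only the entry at the monomial 1, contracted with \<open>a g\<close>;
    this happens in exterior degree \<open>i - 1\<close>, where the differential vanishes.\<close>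
  have "ctr {..<d} (a g) (y F) \<sigma> = 0" if g: "g \<in> G" for g F \<sigma>
  proof (rule ccontr)
    assume nz: "ctr {..<d} (a g) (y F) \<sigma> \<noteq> 0"
    then have "y F \<noteq> 0" by auto
    then obtain \<tau> where "y F \<tau> \<noteq> 0" by (auto simp: fun_eq_iff)
    then have "F \<in> up G" using rs(2) by (auto simp: y_def)
    then have F: "F \<in> \<Delta>" by (simp add: up_def)
    have "y F \<in> Lam d i" using yL by (simp add: Ten_def)
    from ctr_Lam[OF this, of "a g"] nz have "i \<noteq> 0" and "ctr {..<d} (a g) (y F) \<in> Lam d (i - 1)"
      by (auto split: if_splits)
    then have c: "card \<sigma> < i" using Lam_D nz by fastforce
    have u: "(THE g'. xv g = xv g') = g"
      by (rule the_equality) (metis keys_xv singleton_inject)+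
    have "xv g \<noteq> 0" by (metis keys_xv keys_zero insert_not_empty)
    then have "D (IK G) r (F, xv g) \<sigma> = (-1) ^ card F * ctr {..<d} (a g) (y F) \<sigma>"
      using F g unfolding ry by (auto simp: DI_apply IK_def kap_emb u emb_apply wdg_def)
    then show False using Dr[OF c, of F "xv g"] nz by simp
  qed
  then have "y \<in> Ten (Cs G (n + int i)) (LamW d a G i)"
    using yL unfolding Ten_def LamW_def by (auto simp: fun_eq_iff)
  then show thesis using that[OF wX] ry unfolding r_def by blast
qed

section \<open>Total cohomology of the faces containing a given face\<close>

definition Zt :: "'v set set \<Rightarrow> int \<Rightarrow> nat \<Rightarrow> ('v set \<times> ('v \<Rightarrow>\<^sub>0 nat) \<Rightarrow> nat set \<Rightarrow> 'k) set"
  where "Zt \<G> n i = {x \<in> Tsp d If \<G> n i. D If x = 0}"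

definition Bt :: "'v set set \<Rightarrow> int \<Rightarrow> nat \<Rightarrow> ('v set \<times> ('v \<Rightarrow>\<^sub>0 nat) \<Rightarrow> nat set \<Rightarrow> 'k) set"
  where "Bt \<G> n i = D If ` Tsp d If \<G> (n - 1) i"

lemma subspace_Zt: "ts.subspace (Zt \<G> n i)"
  unfolding Zt_def by (rule linear_ker_subspace[OF linear_DI subspace_Tsp])

lemma subspace_Bt: "ts.subspace (Bt \<G> n i)"
  unfolding Bt_def by (rule linear_image_subspace[OF linear_DI subspace_Tsp])

lemma fdim_Zt: "ts.fdim (Zt \<G> n i)"
  by (rule ts.fdim_mono[OF fdim_Tsp[OF okI_If]]) (auto simp: Zt_def)

lemma fdim_Bt: "ts.fdim (Bt \<G> n i)"
  unfolding Bt_def by (rule linear_image_fdim[OF kspace_tscale kspace_tscale linear_DI fdim_Tsp[OF okI_If]])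

lemma Bt_subset_Zt: "upc If \<G> \<Longrightarrow> Bt \<G> n i \<subseteq> Zt \<G> n i"
  using D_Tsp[OF okI_If, of \<G> _ "n - 1" i] D_D_Tsp[OF okI_If] by (auto simp: Bt_def Zt_def)

definition Yb :: "'v set \<Rightarrow> int \<Rightarrow> nat \<Rightarrow> ('v set \<times> ('v \<Rightarrow>\<^sub>0 nat) \<Rightarrow> nat set \<Rightarrow> 'k) set"
  where "Yb G n i = D (IK G) ` Xsp G (n - 1) i"

lemma subspace_Yb: "ts.subspace (Yb G n i)"
  unfolding Yb_def Xsp_def by (rule linear_image_subspace[OF linear_DI subspace_Tsp])

text \<open>Dividing by the acyclic subcomplex \<open>Usp\<close> does not change cohomology; this
  is the injective half.\<close>

lemma Zt_up_boundary_iff: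
  assumes G: "G \<in> \<Delta>" and z: "z \<in> Zt (up G) n i"
  shows "prj G z \<in> Yb G n i \<longleftrightarrow> z \<in> Bt (up G) n i"
proof
  assume "z \<in> Bt (up G) n i"
  then obtain y where y: "y \<in> Tsp d If (up G) (n - 1) i" "z = D If y" by (auto simp: Bt_def)
  show "prj G z \<in> Yb G n i"
    unfolding y(2) prj_D[OF G y(1)] Yb_def using prj_Xsp[OF y(1)] by blast
next
  have zT: "z \<in> Tsp d If (up G) n i" "D If z = 0" using z by (auto simp: Zt_def)
  assume "prj G z \<in> Yb G n i"
  then obtain y where y: "y \<in> Xsp G (n - 1) i" "prj G z = D (IK G) y" by (auto simp: Yb_def)
  have yT: "y \<in> Tsp d If (up G) (n - 1) i" using Xsp_subset[OF G] y(1) by blast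
  have DyT: "D If y \<in> Tsp d If (up G) n i" using D_Tsp[OF okI_If upc_up[OF okI_If] yT] by simp
  have "z - D If y \<in> Usp G n i"
  proof (rule prj_0_Usp)
    show "z - D If y \<in> Tsp d If (up G) n i" using zT(1) DyT by (rule ts.subspace_diff[OF subspace_Tsp])
    show "prj G (z - D If y) = 0" unfolding prj_diff prj_D[OF G yT] y(2) prj_id[OF y(1)] by simp
  qed
  moreover have "D If (z - D If y) = 0" unfolding DI_diff zT(2) D_D_Tsp[OF okI_If yT] by simp
  ultimately obtain u where u: "u \<in> Usp G (n - 1) i" "D If u = z - D If y" using Usp_acyclic by blast
  have "z = D If (u + y)" using u(2) by (simp add: DI_add)
  moreover have "u + y \<in> Tsp d If (up G) (n - 1) i"
    using u(1) yT by (intro ts.subspace_add[OF subspace_Tsp]) (simp_all add: Usp_def)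
  ultimately show "z \<in> Bt (up G) n i" unfolding Bt_def by blast
qed

lemma Zt_up_to_Ten:
  assumes G: "G \<in> \<Delta>" "dual_on G" and z: "z \<in> Zt (up G) n i"
  shows "\<exists>y\<in>Ten (Zs G (n + int i)) (LamW d a G i). prj G z - emb y \<in> Yb G n i"
proof -
  have zT: "z \<in> Tsp d If (up G) n i" "D If z = 0" using z by (auto simp: Zt_def)
  have pz: "prj G z \<in> Xsp G n i" by (rule prj_Xsp[OF zT(1)])
  have D0: "D (IK G) (prj G z) = 0"
    unfolding prj_D[OF G(1) zT(1), symmetric] zT(2) by (auto simp: prj_def fun_eq_iff)
  obtain w y where w: "w \<in> Xsp G (n - 1) i" and y: "y \<in> Ten (Cs G (n + int i)) (LamW d a G i)"
    and e: "prj G z - D (IK G) w = emb y"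
    using reduce_to_emb[OF G pz] D0 by auto
  have "emb (cobT y) = D (IK G) (prj G z - D (IK G) w)"
    unfolding e by (rule D_emb[OF y G(1), symmetric])
  also have "\<dots> = 0"
    unfolding DI_diff D0 using D_D_Tsp[OF okI_IK[OF G(1)] w[unfolded Xsp_def]] by simp
  finally have "cobT y = 0" by (rule emb_eq_0)
  then have "coboundary \<Delta> (\<lambda>F. y F \<sigma>) F = 0" for F \<sigma> by (metis cobT_def zero_fun_apply)
  then have "y \<in> Ten (Zs G (n + int i)) (LamW d a G i)"
    using y by (auto simp: Ten_def Zs_def fun_eq_iff)
  moreover have "prj G z - emb y \<in> Yb G n i"
  proof -
    have "prj G z - emb y = D (IK G) w" using e by (simp add: algebra_simps)
    then show ?thesis using w by (auto simp: Yb_def)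
  qed
  ultimately show ?thesis by blast
qed

lemma LamW_Lam: "LamW d a G i \<subseteq> Lam d i"
  by (auto simp: LamW_def)

text \<open>The surjective half: the differential of \<open>emb y\<close> in the full complex lies
  in \<open>Usp\<close>, and a primitive of it there corrects \<open>emb y\<close> to a cocycle
  without changing its projection.\<close>

lemma Ten_to_Zt_up:
  assumes G: "G \<in> \<Delta>" and y: "y \<in> Ten (Zs G (n + int i)) (LamW d a G i)"
  shows "\<exists>z\<in>Zt (up G) n i. prj G z = emb y"
proof -
  have yC: "y \<in> Ten (Cs G (n + int i)) (LamW d a G i)"
    using y Ten_mono[of "Zs G (n + int i)" "Cs G (n + int i)"] by (auto simp: Zs_def)
  have eX: "emb y \<in> Xsp G n i"
    using yC Ten_mono[OF order_refl LamW_Lam] by (intro emb_Xsp[OF _ G]) blast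
  then have eT: "emb y \<in> Tsp d If (up G) n i" using Xsp_subset[OF G] by blast
  have "cobT y F \<sigma> = 0" for F \<sigma>
  proof -
    have "coboundary \<Delta> (\<lambda>F. y F \<sigma>) = 0" using y by (simp add: Ten_def Zs_def)
    then show ?thesis by (simp add: cobT_def)
  qed
  then have "emb (cobT y) = 0" by (auto simp: fun_eq_iff emb_def)
  then have "prj G (D If (emb y)) = 0"
    unfolding prj_D[OF G eT] prj_id[OF eX] D_emb[OF yC G] .
  then have "D If (emb y) \<in> Usp G (n + 1) i"
    using D_Tsp[OF okI_If upc_up[OF okI_If] eT] by (intro prj_0_Usp)
  from Usp_acyclic[OF this D_D_Tsp[OF okI_If eT]]
  obtain u where u: "u \<in> Usp G n i" "D If u = D If (emb y)" by auto
  have pu: "prj G u = 0"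
  proof (intro ext, clarsimp)
    fix F m \<sigma> show "prj G u (F, m) \<sigma> = 0" using u(1) by (auto simp: prj_apply Usp_def)
  qed
  have "emb y - u \<in> Zt (up G) n i"
  proof -
    have "D If (emb y - u) = 0" unfolding DI_diff u(2) by simp
    then show ?thesis
      using eT u(1) by (auto simp: Zt_def Usp_def intro: ts.subspace_diff[OF subspace_Tsp])
  qed
  moreover have "prj G (emb y - u) = emb y" unfolding prj_diff pu prj_id[OF eX] by simp
  ultimately show ?thesis by blast
qed

text \<open>A primitive of \<open>emb y\<close> has vanishing differential below exterior degree
  \<open>i\<close>, so it can itself be reduced to an embedded cochain, whose simplicial coboundary
  is \<open>y\<close>. For the converse \<open>Ten_lift\<close> supplies a primitive with rows in
  \<open>LamW\<close>.\<close>

lemma emb_Ten_boundary_iff: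
  assumes G: "G \<in> \<Delta>" "dual_on G" and y: "y \<in> Ten (Zs G (n + int i)) (LamW d a G i)"
  shows "emb y \<in> Yb G n i \<longleftrightarrow> y \<in> Ten (Bs G (n + int i)) (LamW d a G i)"
proof
  assume "emb y \<in> Yb G n i"
  then obtain w where w: "w \<in> Xsp G (n - 1) i" "emb y = D (IK G) w" by (auto simp: Yb_def)
  have yL: "y F \<in> Lam d i" for F using y by (auto simp: Ten_def intro: subsetD[OF LamW_Lam])
  have low: "D (IK G) w (F, m) \<sigma> = 0" if "card \<sigma> < i" for F m \<sigma>
    unfolding w(2)[symmetric] emb_apply using Lam_D[OF yL[of F], of \<sigma>] that by auto
  obtain w' y' where w': "w' \<in> Xsp G (n - 1 - 1) i"
    and y': "y' \<in> Ten (Cs G (n - 1 + int i)) (LamW d a G i)" "w - D (IK G) w' = emb y'"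
    using reduce_to_emb[OF G w(1) low] by blast
  have "emb (cobT y') = D (IK G) (w - D (IK G) w')"
    unfolding y'(2) by (rule D_emb[OF y'(1) G(1), symmetric])
  also have "\<dots> = emb y"
    unfolding DI_diff w(2) using D_D_Tsp[OF okI_IK[OF G(1)] w'[unfolded Xsp_def]] by simp
  finally have e: "emb (cobT y') = emb y" .
  have yy: "y F \<sigma> = cobT y' F \<sigma>" for F \<sigma>
    using fun_cong[OF fun_cong[OF e, of "(F, 0)"], of \<sigma>] by (simp add: emb_apply)
  have "(\<lambda>F. y F \<sigma>) \<in> Bs G (n + int i)" for \<sigma>
  proof -
    have "(\<lambda>F. y' F \<sigma>) \<in> Cs G (n + int i - 1)" using y'(1) by (simp add: Ten_def algebra_simps)
    moreover have "(\<lambda>F. y F \<sigma>) = coboundary \<Delta> (\<lambda>F. y' F \<sigma>)" using yy by (simp add: cobT_def)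
    ultimately show ?thesis unfolding Bs_def by blast
  qed
  then show "y \<in> Ten (Bs G (n + int i)) (LamW d a G i)" using y by (simp add: Ten_def)
next
  assume yB: "y \<in> Ten (Bs G (n + int i)) (LamW d a G i)"
  obtain y' where y': "y' \<in> Ten (Cs G (n + int i - 1)) (LamW d a G i)"
    "\<And>\<sigma>. (\<lambda>F. y F \<sigma>) = coboundary \<Delta> (\<lambda>F. y' F \<sigma>)"
    by (rule Ten_lift[OF linear_coboundary subspace_Cs finite_Lam LamW_subset subspace_LamW
          yB[unfolded Bs_def]]) blast
  have y'C: "y' \<in> Ten (Cs G (n - 1 + int i)) (LamW d a G i)" using y'(1) by (simp add: algebra_simps)
  have "y = cobT y'" using y'(2) by (simp add: cobT_def fun_eq_iff)
  then have "emb y = D (IK G) (emb y')" using D_emb[OF y'C G(1)] by simp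
  moreover have "emb y' \<in> Xsp G (n - 1) i"
    using y'C Ten_mono[OF order_refl LamW_Lam] by (intro emb_Xsp[OF _ G(1)]) blast
  ultimately show "emb y \<in> Yb G n i" unfolding Yb_def by blast
qed

text \<open>The reductions identify the total cohomology in degree \<open>n\<close> with the
  relative cohomology of the faces containing \<open>G\<close>, at \<open>n + i\<close> vertices,
  tensored with \<open>LamW\<close>. All terms are natural numbers, hence the additive form.\<close>

lemma dim_total_up:
  assumes G: "G \<in> \<Delta>" "dual_on G"
  shows "ts.dim (Zt (up G) n i) + fs.dim (Bs G (n + int i)) * fs.dim (LamW d a G i) =
    fs.dim (Zs G (n + int i)) * fs.dim (LamW d a G i) + ts.dim (Bt (up G) n i)"
proof -
  let ?Z = "Ten (Zs G (n + int i)) (LamW d a G i)" and ?B = "Ten (Bs G (n + int i)) (LamW d a G i)"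
  note W = finite_Lam LamW_subset subspace_LamW
  have BZ: "?B \<subseteq> ?Z" by (rule Ten_mono[OF Bs_subset_Zs order_refl])
  have up: "upc If (up G)" by (rule upc_up[OF okI_If])
  have "ts.dim (Zt (up G) n i) + ts.dim {w\<in>?Z. emb w \<in> Yb G n i} =
    ts.dim ?Z + ts.dim {z\<in>Zt (up G) n i. prj G z \<in> Yb G n i}"
  proof (rule dim_correspondence[OF kspace_tscale kspace_tscale kspace_tscale linear_prj linear_emb
        subspace_Zt fdim_Zt _ _ subspace_Yb])
    show "ts.subspace ?Z" by (rule subspace_Ten[OF subspace_Zs subspace_LamW])
    show "ts.fdim ?Z" by (rule fdim_Ten[OF finite_Cs Zs_subset subspace_Zs W])
    show "\<exists>w\<in>?Z. prj G z - emb w \<in> Yb G n i" if "z \<in> Zt (up G) n i" for z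
      by (rule Zt_up_to_Ten[OF G that])
    show "\<exists>z\<in>Zt (up G) n i. prj G z - emb w \<in> Yb G n i" if w: "w \<in> ?Z" for w
    proof -
      obtain z where "z \<in> Zt (up G) n i" "prj G z = emb w" using Ten_to_Zt_up[OF G(1) w] by blast
      then show ?thesis using ts.subspace_0[OF subspace_Yb] by force
    qed
  qed
  moreover have "{w\<in>?Z. emb w \<in> Yb G n i} = ?B" using emb_Ten_boundary_iff[OF G] BZ by blast
  moreover have "{z\<in>Zt (up G) n i. prj G z \<in> Yb G n i} = Bt (up G) n i"
    using Zt_up_boundary_iff[OF G(1)] Bt_subset_Zt[OF up] by blast
  ultimately show ?thesis
    by (simp add: dim_Ten[OF finite_Cs Zs_subset subspace_Zs W] dim_Ten[OF finite_Cs Bs_subset subspace_Bs W])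
qed

end

text \<open>Rank and nullity give \<open>B p = T (Suc p) - Z (Suc p)\<close>; inserting
  \<open>Z = B + (Z - B)\<close> and descending from \<open>B (Suc i) = 0\<close> expresses a rank
  by dimensions \<open>T\<close> and cohomology dimensions \<open>Z - B\<close>.\<close>

lemma alternating_telescope:
  fixes T Z B :: "nat \<Rightarrow> int"
  assumes "\<And>p. B p + Z (Suc p) = T (Suc p)" "B (Suc i) = 0" "p \<le> Suc i"
  shows "B p = (\<Sum>q=p+1..i+1. (-1) ^ (q - p - 1) * (T q - (Z q - B q)))"
  using assms(3)
proof (induction p rule: inc_induct)
  case base
  then show ?case using assms(2) by simp
next
  case (step p)
  define f where "f q = T q - (Z q - B q)" for q
  have IH: "B (Suc p) = (\<Sum>q=Suc p+1..i+1. (-1) ^ (q - Suc p - 1) * f q)"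
    using step.IH by (simp add: f_def)
  have "B p = f (Suc p) - B (Suc p)"
    using assms(1)[of p] by (simp add: f_def)
  also have "B (Suc p) = - (\<Sum>q=Suc p+1..i+1. (-1) ^ (q - p - 1) * f q)"
    unfolding IH sum_negf[symmetric]
  proof (rule sum.cong[OF refl])
    fix q assume "q \<in> {Suc p + 1..i + 1}"
    then have "q - p - 1 = Suc (q - Suc p - 1)" by auto
    then show "(-1) ^ (q - Suc p - 1) * f q = - ((-1) ^ (q - p - 1) * f q)" by simp
  qed
  also have "f (Suc p) - - (\<Sum>q=Suc p+1..i+1. (-1) ^ (q - p - 1) * f q) = (\<Sum>q=p+1..i+1. (-1) ^ (q - p - 1) * f q)"
    using step.hyps by (subst sum.atLeast_Suc_atMost[of "p + 1"]) auto
  finally show ?case by (simp add: f_def)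
qed

text \<open>The facts on which the count rests: independence of the coefficient vectors on each face
  (from the l.s.o.p.), vanishing of cohomology below the top degree for links of faces with at least
  two vertices (from the isolated singularities), and the dimension bound. As \<open>j\<close>
  counts the vertices of \<open>G\<close> too, the top degree is \<open>d\<close> for every
  face.\<close>

locale isolated_complex = complex \<Delta> d a
  for \<Delta> :: "'v::linorder set set" and d :: nat and a :: "'v \<Rightarrow> nat \<Rightarrow> 'k::field" +
  assumes dual: "\<And>G. G \<in> \<Delta> \<Longrightarrow> dual_on G"
    and cm: "\<And>G j. G \<in> \<Delta> \<Longrightarrow> 2 \<le> card G \<Longrightarrow> j < int d \<Longrightarrow> Zs G j = Bs G j"
    and card_le: "\<And>G. G \<in> \<Delta> \<Longrightarrow> card G \<le> d"
begin

section \<open>Exactness of the columns over faces with at least two vertices\<close>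

definition above :: "'v set \<Rightarrow> 'v set set"
  where "above G = {F \<in> \<Delta>. G \<subset> F}"

lemma upc_above: "upc If (above G)"
  unfolding upc_def above_def using okID(1)[OF okI_If] by blast

lemma Tsp_up_above:
  assumes x: "x \<in> Tsp d If (up G) n i" and 0: "\<And>m \<sigma>. x (G, m) \<sigma> = 0"
  shows "x \<in> Tsp d If (above G) n i"
proof (rule TspI)
  fix F m \<sigma> assume nz: "x (F, m) \<sigma> \<noteq> 0"
  have "F \<noteq> G" using nz 0 by auto
  then show "F \<in> above G \<and> (F, Poly_Mapping.keys m) \<in> If \<and> \<sigma> \<subseteq> {..<d} \<and> card \<sigma> + pdeg m = i \<and>
    int (card F) = n + int (card \<sigma>)"
    using TspD[OF x nz] by (auto simp: above_def up_def)
qed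

lemma Tsp_above_up: "Tsp d If (above G) n i \<subseteq> Tsp d If (up G) n i"
  by (rule Tsp_mono) (auto simp: above_def up_def)

lemma Tsp_above_0: "x \<in> Tsp d If (above G) n i \<Longrightarrow> x (G, m) \<sigma> = 0"
  using TspD(1)[of x d If "above G" n i G m \<sigma>] by (auto simp: above_def)

text \<open>Exactness in positive exterior degrees lets \<open>column_reduction\<close> clear every
  entry with nonempty \<open>\<sigma>\<close>. In total degree \<open>n\<close> below the size of
  all faces, each entry has positive exterior degree, so nothing is left.\<close>

lemma acyclic_family:
  assumes up: "upc If \<G>" and sub: "\<G> \<subseteq> \<Delta>"
    and ex: "\<And>G p. G \<in> \<G> \<Longrightarrow> 1 \<le> p \<Longrightarrow> col_exact If G p i"
    and large: "\<And>G. G \<in> \<G> \<Longrightarrow> n < int (card G)"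
    and x: "x \<in> Tsp d If \<G> n i" "D If x = 0"
  shows "\<exists>w\<in>Tsp d If \<G> (n - 1) i. D If w = x"
proof -
  obtain w where w: "w \<in> Tsp d If \<G> (n - 1) i"
    "\<And>G m \<sigma>. card \<sigma> \<in> {1..} \<Longrightarrow> (x - D If w) (G, m) \<sigma> = 0"
  proof (rule column_reduction[OF okI_If up sub, where E = "{1..}" and x = x and n = n and i = i])
    show "p \<in> {1..}" if "F \<in> \<G>" "int (card F) = n + int p" for F p
      using large[OF that(1)] that(2) by simp
    show "col_exact If G p i" if "G \<in> \<G>" "p \<in> {1..}" for G p
      using ex that by simp
  qed (use x in auto)
  have r: "x - D If w \<in> Tsp d If \<G> n i"
    using x(1) D_Tsp[OF okI_If up w(1)] by (intro ts.subspace_diff[OF subspace_Tsp]) auto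
  have "(x - D If w) (G, m) \<sigma> = 0" for G m \<sigma>
  proof (rule ccontr)
    assume nz: "(x - D If w) (G, m) \<sigma> \<noteq> 0"
    have "card \<sigma> \<in> {1..}" using TspD(1,5)[OF r nz] large[of G] by simp
    then show False using w(2) nz by blast
  qed
  then have "x - D If w = 0" by (intro ext) (auto split: prod.split)
  then show ?thesis using w(1) by (metis eq_iff_diff_eq_0)
qed

text \<open>The differential of \<open>x\<close> lives on the faces strictly above \<open>G\<close>,
  in total degree \<open>n + 1\<close>. These faces have at least one vertex more, so the family is
  acyclic in that degree and a primitive on it corrects \<open>x\<close>.\<close>

lemma lift_to_cocycle:
  assumes ex: "\<And>F p. F \<in> above G \<Longrightarrow> 1 \<le> p \<Longrightarrow> col_exact If F p i"
    and G: "G \<in> \<Delta>" and n: "n < int (card G)"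
    and x: "x \<in> Tsp d If (up G) n i" and 0: "\<And>m \<sigma>. D If x (G, m) \<sigma> = 0"
  shows "\<exists>y\<in>Tsp d If (above G) n i. x - y \<in> Zt (up G) n i"
proof -
  have "D If x \<in> Tsp d If (above G) (n + 1) i"
    using D_Tsp[OF okI_If upc_up[OF okI_If] x] 0 by (rule Tsp_up_above)
  moreover have "n + 1 < int (card F)" if F: "F \<in> above G" for F
  proof -
    have "card G < card F" using F finite_face by (intro psubset_card_mono) (auto simp: above_def)
    then show ?thesis using n by simp
  qed
  ultimately obtain y where y: "y \<in> Tsp d If (above G) n i" "D If y = D If x"
    using acyclic_family[OF upc_above _ ex, of G "n + 1" "D If x"] D_D_Tsp[OF okI_If x]
    by (auto simp: above_def)
  have "x - y \<in> Tsp d If (up G) n i"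
    using x y(1) Tsp_above_up by (intro ts.subspace_diff[OF subspace_Tsp]) auto
  then have "x - y \<in> Zt (up G) n i" using y(2) by (simp add: Zt_def DI_diff)
  then show ?thesis using y(1) by blast
qed

lemma Zt_eq_Bt:
  assumes "upc If \<G>" "ts.dim (Zt \<G> n i) = ts.dim (Bt \<G> n i)"
  shows "Zt \<G> n i = Bt \<G> n i"
  by (rule ts.subspace_dim_equal_fdim[OF Bt_subset_Zt[OF assms(1)] subspace_Bt subspace_Zt fdim_Zt
        assms(2)[symmetric], symmetric])

lemma LamW_trivial:
  assumes G: "G \<in> \<Delta>" and "d < i + card G"
  shows "LamW d a G i = {0}"
proof -
  obtain b where b: "\<And>g. b g \<in> fsup {..<d}"
    "\<And>g g'. g \<in> G \<Longrightarrow> g' \<in> G \<Longrightarrow> (\<Sum>k<d. a g k * b g' k) = (if g = g' then 1 else 0)"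
    using dual[OF G] unfolding dual_on_def by blast
  have "w = 0" if "w \<in> LamW d a G i" for w
    using that assms(2) by (intro ctr_kernel_trivial[OF finite_face[OF G] b, of w i]) (auto simp: LamW_def)
  then show ?thesis using fs.subspace_0[OF subspace_LamW, of d a G i] by auto
qed

lemma ts_dim_zero: "ts.dim {0 :: 'x \<Rightarrow> 'y \<Rightarrow> 'k} = 0"
  using ts.dim_le_card[of "{0 :: 'x \<Rightarrow> 'y \<Rightarrow> 'k}" "{}"] by simp

lemma fs_dim_zero: "fs.dim {0 :: 'x \<Rightarrow> 'k} = 0"
  using fs.dim_le_card[of "{0 :: 'x \<Rightarrow> 'k}" "{}"] by simp

text \<open>The induction runs from large faces to small ones. A Koszul cycle at \<open>G\<close>,
  placed in total degree \<open>card G - p\<close>, extends to a total cocycle because the larger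
  columns are already exact. In this degree total cocycles over \<open>up G\<close> are
  coboundaries, and as no smaller face contains \<open>G\<close>, the value of a total primitive at
  \<open>G\<close> is a Koszul primitive up to sign.\<close>

lemma col_exact_cm:
  assumes "G \<in> \<Delta>" "2 \<le> card G" "1 \<le> p"
  shows "col_exact If G p i"
  using assms
proof (induction "d - card G" arbitrary: G p rule: less_induct)
  case less
  note G = less.prems(1)
  have exF: "col_exact If F q i" if F: "F \<in> above G" "1 \<le> q" for F q
  proof (rule less.hyps)
    have "card G < card F" using F finite_face by (intro psubset_card_mono) (auto simp: above_def)
    then show "d - card F < d - card G" "2 \<le> card F"
      using card_le[of F] F less.prems(2) by (auto simp: above_def)
  qed (use F in \<open>auto simp: above_def\<close>)
  define n where "n = int (card G) - int p"
  have n: "n < int (card G)" using less.prems(3) by (simp add: n_def)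
  show ?case
    unfolding col_exact_def
  proof (intro ballI impI)
    fix x assume x: "x \<in> col If G p i"
      and k: "\<forall>m. (G, Poly_Mapping.keys m) \<in> If \<longrightarrow> kap d a x m = 0"
    define X where "X = (\<lambda>(F, m). if F = G then x m else 0)"
    have XT: "X \<in> Tsp d If (up G) n i"
    proof (rule TspI)
      fix F m \<sigma> assume "X (F, m) \<sigma> \<noteq> 0"
      then have "F = G" "x m \<sigma> \<noteq> 0" by (auto simp: X_def split: if_splits)
      then show "F \<in> up G \<and> (F, Poly_Mapping.keys m) \<in> If \<and> \<sigma> \<subseteq> {..<d} \<and> card \<sigma> + pdeg m = i \<and>
        int (card F) = n + int (card \<sigma>)"
        using x G by (auto simp: col_def up_def n_def)
    qed
    have XG: "(\<lambda>m'. X (G, m')) = x" by (simp add: X_def)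
    have "wdg (\<lambda>_. 1) (\<lambda>F. X (F, m) \<sigma>) G = 0" for m \<sigma>
      unfolding wdg_def by (rule sum.neutral) (auto simp: X_def)
    then have D0: "D If X (G, m) \<sigma> = 0" for m \<sigma>
      using k by (simp add: DI_apply XG)
    obtain y where y: "y \<in> Tsp d If (above G) n i" "X - y \<in> Zt (up G) n i"
      using lift_to_cocycle[OF exF G n XT D0] by blast
    have "Zt (up G) n i = Bt (up G) n i"
    proof (rule Zt_eq_Bt[OF upc_up[OF okI_If]])
      show "ts.dim (Zt (up G) n i) = ts.dim (Bt (up G) n i)"
      \<comment> \<open>Below \<open>d\<close> the cohomology of the link vanishes. Otherwise
        \<open>i + card G \<ge> d + p > d\<close>, and the other tensor factor is zero: an exterior
        power beyond the dimension \<open>d - card G\<close>.\<close>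
      proof (cases "n + int i < int d")
        case True
        then show ?thesis using dim_total_up[OF G dual[OF G], of n i] cm[OF G less.prems(2)] by simp
      next
        case False
        then have "LamW d a G i = {0}" using less.prems(3) by (intro LamW_trivial[OF G]) (simp add: n_def)
        then show ?thesis using dim_total_up[OF G dual[OF G], of n i] by (simp add: fs_dim_zero)
      qed
    qed
    then obtain w where w: "w \<in> Tsp d If (up G) (n - 1) i" "X - y = D If w"
      using y(2) by (auto simp: Bt_def)
    define c :: 'k where "c = (-1) ^ card G"
    define y' where "y' = tscale c (\<lambda>m. w (G, m))"
    have y'c: "y' \<in> col If G (Suc p) i"
      unfolding col_def
    proof (intro CollectI allI impI)
      fix m \<sigma> assume "y' m \<sigma> \<noteq> 0"
      then have "w (G, m) \<sigma> \<noteq> 0" by (auto simp: y'_def)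
      from TspD[OF w(1) this]
      show "(G, Poly_Mapping.keys m) \<in> If \<and> \<sigma> \<subseteq> {..<d} \<and> card \<sigma> = Suc p \<and> card \<sigma> + pdeg m = i"
        by (simp add: n_def)
    qed
    have "kap d a y' m = x m" if m: "(G, Poly_Mapping.keys m) \<in> If" for m
    proof
      fix \<sigma>
      have w0: "w (G - {u}, m) \<sigma> = 0" if "u \<in> G" for u
        using TspD(1)[OF w(1), of "G - {u}" m \<sigma>] that by (auto simp: up_def)
      have "wdg (\<lambda>_. 1) (\<lambda>F. w (F, m) \<sigma>) G = 0"
        unfolding wdg_def by (rule sum.neutral) (use w0 in simp)
      then have "D If w (G, m) \<sigma> = kap d a y' m \<sigma>"
        using m by (simp add: DI_apply y'_def c_def kap_scale)
      moreover have "x m \<sigma> = (X - y) (G, m) \<sigma>" using Tsp_above_0[OF y(1)] by (simp add: X_def)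
      ultimately show "kap d a y' m \<sigma> = x m \<sigma>" using w(2) by simp
    qed
    then show "\<exists>y\<in>col If G (Suc p) i. \<forall>m. (G, Poly_Mapping.keys m) \<in> If \<longrightarrow> kap d a y m = x m"
      using y'c by blast
  qed
qed

section \<open>The nonempty faces, split by vertices\<close>

definition Qf :: "'v set set" where "Qf = \<Delta> - {{}}"

lemma upc_Qf: "upc If Qf"
  unfolding upc_def Qf_def using okID(1)[OF okI_If] by blast

lemma upc_Delta: "upc If \<Delta>"
  unfolding upc_def using okID(1)[OF okI_If] by blast

definition slice :: "'v \<Rightarrow> ('v set \<times> ('v \<Rightarrow>\<^sub>0 nat) \<Rightarrow> nat set \<Rightarrow> 'k) \<Rightarrow>
    'v set \<times> ('v \<Rightarrow>\<^sub>0 nat) \<Rightarrow> nat set \<Rightarrow> 'k"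
  where "slice v z = (\<lambda>(F, m). if F = {v} then z (F, m) else 0)"

lemma slice_apply: "slice v z (F, m) \<sigma> = (if F = {v} then z (F, m) \<sigma> else 0)"
  by (simp add: slice_def)

lemma vertex_face: "v \<in> V \<Longrightarrow> {v} \<in> \<Delta>"
  using face_subset by blast

lemma slice_Tsp:
  assumes "z \<in> Tsp d If Qf n i"
  shows "slice v z \<in> Tsp d If (up {v}) n i"
proof (rule TspI)
  fix F m \<sigma> assume "slice v z (F, m) \<sigma> \<noteq> 0"
  then have "F = {v}" "z (F, m) \<sigma> \<noteq> 0" by (auto simp: slice_apply split: if_splits)
  then show "F \<in> up {v} \<and> (F, Poly_Mapping.keys m) \<in> If \<and> \<sigma> \<subseteq> {..<d} \<and> card \<sigma> + pdeg m = i \<and>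
      int (card F) = n + int (card \<sigma>)"
    using TspD[OF assms, of F m \<sigma>] by (auto simp: up_def Qf_def)
qed

lemma D_slice:
  assumes "z \<in> Tsp d If Qf n i"
  shows "D If (slice v z) ({v}, m) \<sigma> = D If z ({v}, m) \<sigma>"
proof -
  have "z ({}, m) \<sigma> = 0" using TspD(1)[OF assms, of "{}" m \<sigma>] by (auto simp: Qf_def)
  then have "wdg (\<lambda>_. 1) (\<lambda>F. z (F, m) \<sigma>) {v} = 0" "wdg (\<lambda>_. 1) (\<lambda>F. slice v z (F, m) \<sigma>) {v} = 0"
    by (simp_all add: wdg_def slice_apply)
  moreover have "(\<lambda>m'. slice v z ({v}, m')) = (\<lambda>m'. z ({v}, m'))" by (simp add: slice_def)
  ultimately show ?thesis by (simp add: DI_apply)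
qed

lemma col_exact_above_vertex:
  assumes "F \<in> above {v}" "1 \<le> p"
  shows "col_exact If F p i"
proof (rule col_exact_cm)
  show F: "F \<in> \<Delta>" using assms by (simp add: above_def)
  have "card {v} < card F" using assms finite_face[OF F] by (intro psubset_card_mono) (auto simp: above_def)
  then show "2 \<le> card F" by simp
qed fact

lemma above_vertex_acyclic:
  assumes "n < 2" "x \<in> Tsp d If (above {v}) n i" "D If x = 0"
  shows "\<exists>w\<in>Tsp d If (above {v}) (n - 1) i. D If w = x"
proof (rule acyclic_family[OF upc_above])
  show "above {v} \<subseteq> \<Delta>" by (auto simp: above_def)
  show "n < int (card G)" if G: "G \<in> above {v}" for G
  proof -
    have "card {v} < card G" using G finite_face by (intro psubset_card_mono) (auto simp: above_def)
    then show ?thesis using assms(1) by simp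
  qed
qed (use assms col_exact_above_vertex in auto)

lemma up_vertex_Qf: "up {v} \<subseteq> Qf"
  by (auto simp: up_def Qf_def)

lemma Tsp_up_vertex: "Tsp d If (up {v}) n i \<subseteq> Tsp d If Qf n i"
  by (rule Tsp_mono[OF up_vertex_Qf order_refl])

lemma Zt_up_vertex: "Zt (up {v}) n i \<subseteq> Zt Qf n i"
  using Tsp_up_vertex by (auto simp: Zt_def)

lemma Bt_up_vertex: "Bt (up {v}) n i \<subseteq> Bt Qf n i"
  unfolding Bt_def by (intro image_mono Tsp_up_vertex)

text \<open>The slice of \<open>z\<close> at each vertex lifts to a cocycle on the faces containing
  that vertex. After subtracting these lifts nothing is left at the vertices, and the rest lives on
  faces with at least two vertices, which are acyclic in total degree
  \<open>n \<le> 0\<close>.\<close>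

lemma Zt_Qf_decompose:
  assumes n: "n \<le> 0" and z: "z \<in> Zt Qf n i"
  shows "\<exists>\<zeta>. (\<forall>v\<in>V. \<zeta> v \<in> Zt (up {v}) n i) \<and> z - (\<Sum>v\<in>V. \<zeta> v) \<in> Bt Qf n i"
proof -
  have zT: "z \<in> Tsp d If Qf n i" and Dz: "D If z = 0" using z by (auto simp: Zt_def)
  have "\<exists>y\<in>Tsp d If (above {v}) n i. slice v z - y \<in> Zt (up {v}) n i" if v: "v \<in> V" for v
  proof (rule lift_to_cocycle[OF col_exact_above_vertex vertex_face[OF v] _ slice_Tsp[OF zT]])
    show "D If (slice v z) ({v}, m) \<sigma> = 0" for m \<sigma> unfolding D_slice[OF zT] Dz by simp
  qed (use n in auto)
  then have "\<forall>v\<in>V. \<exists>y. y \<in> Tsp d If (above {v}) n i \<and> slice v z - y \<in> Zt (up {v}) n i" by blast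
  from bchoice[OF this] obtain y where y: "\<And>v. v \<in> V \<Longrightarrow> y v \<in> Tsp d If (above {v}) n i"
    "\<And>v. v \<in> V \<Longrightarrow> slice v z - y v \<in> Zt (up {v}) n i" by blast
  define r where "r = z - (\<Sum>v\<in>V. slice v z - y v)"
  have sumZ: "(\<Sum>v\<in>V. slice v z - y v) \<in> Zt Qf n i"
    by (rule ts.subspace_sum[OF subspace_Zt]) (use y(2) Zt_up_vertex in blast)
  have rZ: "r \<in> Zt Qf n i" unfolding r_def using z sumZ by (rule ts.subspace_diff[OF subspace_Zt])
  then have rT: "r \<in> Tsp d If Qf n i" "D If r = 0" by (auto simp: Zt_def)
  define R where "R = {G \<in> \<Delta>. 2 \<le> card G}"
  have rv: "r ({u}, m) \<sigma> = 0" if u: "u \<in> V" for u m \<sigma>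
  proof -
    have "(slice v z - y v) ({u}, m) \<sigma> = (if v = u then z ({u}, m) \<sigma> else 0)" if v: "v \<in> V" for v
    proof -
      have "y v ({u}, m) \<sigma> = 0"
        using TspD(1)[OF y(1)[OF v], of "{u}" m \<sigma>] by (auto simp: above_def)
      then show ?thesis by (auto simp: slice_apply)
    qed
    then have "(\<Sum>v\<in>V. slice v z - y v) ({u}, m) \<sigma> = (\<Sum>v\<in>V. if v = u then z ({u}, m) \<sigma> else 0)"
      unfolding sum_apply by (intro sum.cong) auto
    also have "\<dots> = z ({u}, m) \<sigma>" using u finite_V by simp
    finally show ?thesis by (simp add: r_def del: sum_apply)
  qed
  have rR: "r \<in> Tsp d If R n i"
  proof (rule TspI)
    fix F m \<sigma> assume nz: "r (F, m) \<sigma> \<noteq> 0"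
    note * = TspD[OF rT(1) nz]
    have F: "F \<in> \<Delta>" "F \<noteq> {}" using *(1) by (auto simp: Qf_def)
    have "card F \<noteq> 1"
    proof
      assume "card F = 1"
      then obtain u where "F = {u}" by (rule card_1_singletonE)
      then show False using rv[of u m \<sigma>] nz F by auto
    qed
    moreover have "card F \<noteq> 0" using F finite_face by auto
    ultimately show "F \<in> R \<and> (F, Poly_Mapping.keys m) \<in> If \<and> \<sigma> \<subseteq> {..<d} \<and> card \<sigma> + pdeg m = i \<and>
      int (card F) = n + int (card \<sigma>)" using * F by (auto simp: R_def)
  qed
  have upR: "upc If R"
    unfolding upc_def R_def
  proof (intro allI impI)
    fix F G s assume F: "F \<in> {G \<in> \<Delta>. 2 \<le> card G}" "F \<subseteq> G" "(G, s) \<in> If"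
    have G: "G \<in> \<Delta>" by (rule okID(1)[OF okI_If F(3)])
    have "card F \<le> card G" by (rule card_mono[OF finite_face[OF G] F(2)])
    then show "G \<in> {G \<in> \<Delta>. 2 \<le> card G}" using F(1) G by simp
  qed
  have "\<exists>w\<in>Tsp d If R (n - 1) i. D If w = r"
    by (rule acyclic_family[OF upR _ _ _ rR rT(2)]) (use n col_exact_cm in \<open>auto simp: R_def\<close>)
  then obtain w where w: "w \<in> Tsp d If R (n - 1) i" "D If w = r" by blast
  have "R \<subseteq> Qf" by (auto simp: R_def Qf_def)
  then have "w \<in> Tsp d If Qf (n - 1) i" using w(1) Tsp_mono[OF _ order_refl] by blast
  then have "r \<in> Bt Qf n i" using w(2) by (auto simp: Bt_def)
  then show ?thesis using y(2) unfolding r_def by (intro exI[of _ "\<lambda>v. slice v z - y v"]) blast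
qed

text \<open>At the face \<open>{v}\<close> only the component of \<open>v\<close> is visible.
  Subtracting the differential of the slice of a primitive therefore moves this component to the
  faces strictly above \<open>{v}\<close>, where it is a coboundary.\<close>

lemma Bt_Qf_components:
  assumes n: "n \<le> 0" and z: "\<And>v. v \<in> V \<Longrightarrow> \<zeta> v \<in> Zt (up {v}) n i"
    and s: "(\<Sum>v\<in>V. \<zeta> v) \<in> Bt Qf n i" and v: "v \<in> V"
  shows "\<zeta> v \<in> Bt (up {v}) n i"
proof -
  obtain y where y: "y \<in> Tsp d If Qf (n - 1) i" "(\<Sum>v\<in>V. \<zeta> v) = D If y" using s by (auto simp: Bt_def)
  have zv: "\<zeta> v \<in> Tsp d If (up {v}) n i" "D If (\<zeta> v) = 0" using z[OF v] by (auto simp: Zt_def)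
  note sl = slice_Tsp[OF y(1), of v]
  have DsT: "D If (slice v y) \<in> Tsp d If (up {v}) n i"
    using D_Tsp[OF okI_If upc_up[OF okI_If] sl] by simp
  define x where "x = \<zeta> v - D If (slice v y)"
  have "x \<in> Tsp d If (above {v}) n i"
  proof (rule Tsp_up_above)
    show "x \<in> Tsp d If (up {v}) n i"
      unfolding x_def using zv(1) DsT by (rule ts.subspace_diff[OF subspace_Tsp])
    fix m \<sigma>
    have "\<zeta> u ({v}, m) \<sigma> = 0" if u: "u \<in> V" "u \<noteq> v" for u
    proof -
      have "\<zeta> u \<in> Tsp d If (up {u}) n i" using z[OF u(1)] by (simp add: Zt_def)
      from TspD(1)[OF this, of "{v}" m \<sigma>] show ?thesis using u(2) by (auto simp: up_def)
    qed
    then have "(\<Sum>u\<in>V. \<zeta> u ({v}, m) \<sigma>) = (\<Sum>u\<in>{v}. \<zeta> u ({v}, m) \<sigma>)"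
      using finite_V v by (intro sum.mono_neutral_right) auto
    moreover have "D If y ({v}, m) \<sigma> = (\<Sum>u\<in>V. \<zeta> u ({v}, m) \<sigma>)"
      unfolding y(2)[symmetric] by simp
    ultimately show "x ({v}, m) \<sigma> = 0" by (simp add: x_def D_slice[OF y(1)])
  qed
  moreover have "D If x = 0" unfolding x_def DI_diff zv(2) D_D_Tsp[OF okI_If sl] by simp
  ultimately obtain w where w: "w \<in> Tsp d If (above {v}) (n - 1) i" "D If w = x"
    using above_vertex_acyclic[of n x v i] n by auto
  have "\<zeta> v = D If (w + slice v y)" using w(2) by (simp add: DI_add x_def)
  moreover have "w + slice v y \<in> Tsp d If (up {v}) (n - 1) i"
    using w(1) sl Tsp_above_up by (intro ts.subspace_add[OF subspace_Tsp]) auto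
  ultimately show ?thesis unfolding Bt_def by blast
qed

lemma Zt_up_Int_Bt_Qf:
  assumes "n \<le> 0" "v \<in> V"
  shows "Zt (up {v}) n i \<inter> Bt Qf n i = Bt (up {v}) n i"
proof
  show "Bt (up {v}) n i \<subseteq> Zt (up {v}) n i \<inter> Bt Qf n i"
    using Bt_up_vertex Bt_subset_Zt[OF upc_up[OF okI_If]] by blast
  show "Zt (up {v}) n i \<inter> Bt Qf n i \<subseteq> Bt (up {v}) n i"
  proof
    fix z assume z: "z \<in> Zt (up {v}) n i \<inter> Bt Qf n i"
    let ?\<zeta> = "\<lambda>u. if u = v then z else 0"
    have "?\<zeta> v \<in> Bt (up {v}) n i"
    proof (rule Bt_Qf_components[where \<zeta> = "?\<zeta>", OF assms(1) _ _ assms(2)])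
      show "?\<zeta> u \<in> Zt (up {u}) n i" for u using z ts.subspace_0[OF subspace_Zt] by auto
      have "(\<Sum>u\<in>V. ?\<zeta> u) = z" using assms(2) finite_V by (subst sum.delta) auto
      then show "(\<Sum>u\<in>V. ?\<zeta> u) \<in> Bt Qf n i" using z by simp
    qed
    then show "z \<in> Bt (up {v}) n i" by simp
  qed
qed

text \<open>\<open>Zt_Qf_decompose\<close> is the surjectivity and \<open>Bt_Qf_components\<close>
  the injectivity of the map from the direct sum over the vertices to the cohomology of the nonempty
  faces.\<close>

lemma dim_Qf:
  assumes n: "n \<le> 0"
  shows "ts.dim (Zt Qf n i) + (\<Sum>v\<in>V. ts.dim (Bt (up {v}) n i)) =
    ts.dim (Bt Qf n i) + (\<Sum>v\<in>V. ts.dim (Zt (up {v}) n i))"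
proof -
  have ind: "\<forall>v\<in>V. \<zeta> v \<in> Bt Qf n i"
    if "\<And>v. v \<in> V \<Longrightarrow> \<zeta> v \<in> Zt (up {v}) n i" "(\<Sum>v\<in>V. \<zeta> v) \<in> Bt Qf n i" for \<zeta>
    using Bt_Qf_components[OF n that] Bt_up_vertex by blast
  have "{b + (\<Sum>v\<in>V. \<zeta> v) | b \<zeta>. b \<in> Bt Qf n i \<and> (\<forall>v\<in>V. \<zeta> v \<in> Zt (up {v}) n i)} = Zt Qf n i" (is "?T = _")
  proof
    show "?T \<subseteq> Zt Qf n i"
    proof
      fix x assume "x \<in> ?T"
      then obtain b \<zeta> where x: "x = b + (\<Sum>v\<in>V. \<zeta> v)" "b \<in> Bt Qf n i" "\<forall>v\<in>V. \<zeta> v \<in> Zt (up {v}) n i"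
        by blast
      have "(\<Sum>v\<in>V. \<zeta> v) \<in> Zt Qf n i"
        by (rule ts.subspace_sum[OF subspace_Zt]) (use x(3) Zt_up_vertex in blast)
      moreover have "b \<in> Zt Qf n i" using x(2) Bt_subset_Zt[OF upc_Qf] by blast
      ultimately show "x \<in> Zt Qf n i" unfolding x(1) by (intro ts.subspace_add[OF subspace_Zt])
    qed
    show "Zt Qf n i \<subseteq> ?T"
    proof
      fix z assume "z \<in> Zt Qf n i"
      then obtain \<zeta> where "\<forall>v\<in>V. \<zeta> v \<in> Zt (up {v}) n i" "z - (\<Sum>v\<in>V. \<zeta> v) \<in> Bt Qf n i"
        using Zt_Qf_decompose[OF n] by blast
      moreover have "z = (z - (\<Sum>v\<in>V. \<zeta> v)) + (\<Sum>v\<in>V. \<zeta> v)" by simp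
      ultimately show "z \<in> ?T" by blast
    qed
  qed
  moreover have "(\<Sum>v\<in>V. ts.dim (Zt (up {v}) n i \<inter> Bt Qf n i)) = (\<Sum>v\<in>V. ts.dim (Bt (up {v}) n i))"
    by (rule sum.cong[OF refl]) (simp add: Zt_up_Int_Bt_Qf[OF n])
  ultimately show ?thesis
    using ts.dim_independent_sum(3)[where Z = "\<lambda>v. Zt (up {v}) n i",
        OF finite_V subspace_Bt fdim_Bt subspace_Zt fdim_Zt ind] by simp
qed

section \<open>The map from the nonempty faces to all faces in total degree 0\<close>

lemma up_empty: "up {} = \<Delta>"
  by (simp add: up_def)

lemma dual_vertex:
  assumes "v \<in> V"
  shows "fs.dim (LamW d a {v} i) = (d - 1) choose i"
proof -
  obtain b where "(\<Sum>k<d. a v k * b v k) = 1"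
    using dual[OF vertex_face[OF assms]] unfolding dual_on_def by auto
  then show ?thesis by (rule dim_LamW_single)
qed

text \<open>The reductions over \<open>{v}\<close> and over the empty face are compatible:
  \<open>q\<close> is a projection of a coboundary of the full complex, and keeping only the
  monomial 1 afterwards is the projection for the empty face.\<close>

lemma prj_empty_Yb:
  assumes "v \<in> V" "q \<in> Yb {v} n i"
  shows "prj {} q \<in> Yb {} n i"
proof -
  obtain x where x: "x \<in> Xsp {v} (n - 1) i" "q = D (IK {v}) x" using assms(2) by (auto simp: Yb_def)
  note vf = vertex_face[OF assms(1)]
  have xT: "x \<in> Tsp d If (up {v}) (n - 1) i" using Xsp_subset[OF vf] x(1) by blast
  have xT0: "x \<in> Tsp d If (up {}) (n - 1) i"
    using xT Tsp_mono[of "up {v}" "up {}" If If d "n - 1" i] by (auto simp: up_def)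
  have "q = prj {v} (D If x)" unfolding prj_D[OF vf xT] prj_id[OF x(1)] x(2) ..
  then have "prj {} q = prj {} (D If x)" by (auto simp: fun_eq_iff prj_def)
  also have "\<dots> = D (IK {}) (prj {} x)" by (rule prj_D[OF empty_face xT0])
  finally show ?thesis using prj_Xsp[OF xT0] by (auto simp: Yb_def)
qed

lemma prj_empty_emb: "prj {} (emb y) = emb y"
  by (auto simp: fun_eq_iff prj_def emb_def)

lemma prj_empty_prj: "prj {} (prj G x) = prj {} x"
  by (auto simp: fun_eq_iff prj_def)

lemma prj_sum: "prj G (\<Sum>v\<in>I. x v) = (\<Sum>v\<in>I. prj G (x v))"
  using linear_prj Vector_Spaces.linear.axioms(3) module_hom.sum by blast

lemma emb_sum: "emb (\<Sum>v\<in>I. x v) = (\<Sum>v\<in>I. emb (x v))"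
  using linear_emb Vector_Spaces.linear.axioms(3) module_hom.sum by blast

lemma emb_add: "emb (x + y) = emb x + emb y"
  by (auto simp: fun_eq_iff emb_def)

lemma Zs_vertex: "Zs {v} j \<subseteq> Zs {} j"
  by (auto simp: Zs_def Cs_def fsup_def up_def)

text \<open>After reduction to tensors the map is induced by the inclusions of \<open>Zs {v}\<close>
  tensored with those of \<open>LamW d a {v} i\<close>. Isolation, applied separately for each
  \<open>\<sigma>\<close>, makes the contributions of different vertices independent modulo
  coboundaries, so the kernel is the direct sum of the local kernels.\<close>

lemma dim_comparison_rank:
  assumes iso: "\<And>c. i < d \<Longrightarrow> (\<And>v. v \<in> V \<Longrightarrow> c v \<in> Zs {v} (int i)) \<Longrightarrow> (\<Sum>v\<in>V. c v) \<in> Bs {} (int i) \<Longrightarrow>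
      \<forall>v\<in>V. c v \<in> Bs {} (int i)"
  shows "ts.dim (Zt Qf 0 i) + (\<Sum>v\<in>V. fs.dim (Zs {v} (int i) \<inter> Bs {} (int i)) * ((d - 1) choose i)) =
    ts.dim (Zt Qf 0 i \<inter> Bt \<Delta> 0 i) + (\<Sum>v\<in>V. fs.dim (Zs {v} (int i)) * ((d - 1) choose i))"
proof -
  define TZ where "TZ v = Ten (Zs {v} (int i)) (LamW d a {v} i)" for v
  define TB where "TB = Ten (Bs {} (int i)) (LamW d a {} i)"
  note W = finite_Lam LamW_subset subspace_LamW
  have TZ: "ts.subspace (TZ v)" "ts.fdim (TZ v)" for v
    unfolding TZ_def
    by (rule subspace_Ten[OF subspace_Zs subspace_LamW], rule fdim_Ten[OF finite_Cs Zs_subset subspace_Zs W])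
  have TB: "ts.subspace TB" "ts.fdim TB"
    unfolding TB_def
    by (rule subspace_Ten[OF subspace_Bs subspace_LamW], rule fdim_Ten[OF finite_Cs Bs_subset subspace_Bs W])
  have dTZ: "ts.dim (TZ v) = fs.dim (Zs {v} (int i)) * ((d - 1) choose i)" if "v \<in> V" for v
    unfolding TZ_def dim_Ten[OF finite_Cs Zs_subset subspace_Zs W] dual_vertex[OF that] ..
  have LW: "LamW d a {v} i \<subseteq> LamW d a {} i" for v by (auto simp: LamW_def)
  have inter: "TZ v \<inter> TB = Ten (Zs {v} (int i) \<inter> Bs {} (int i)) (LamW d a {v} i)" for v
    unfolding TZ_def TB_def Ten_def using LW[of v] by blast
  have dI: "ts.dim (TZ v \<inter> TB) = fs.dim (Zs {v} (int i) \<inter> Bs {} (int i)) * ((d - 1) choose i)" if "v \<in> V" for v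
  proof -
    have "Zs {v} (int i) \<inter> Bs {} (int i) \<subseteq> fsup {F \<in> up {v}. int (card F) = int i}"
      using Zs_subset by blast
    then show ?thesis
      unfolding inter dual_vertex[OF that, symmetric]
      by (rule dim_Ten[OF finite_Cs _ fs.subspace_inter[OF subspace_Zs subspace_Bs] W])
  qed
  have ind: "\<forall>v\<in>V. \<zeta> v \<in> TB" if z: "\<And>v. v \<in> V \<Longrightarrow> \<zeta> v \<in> TZ v" and s: "(\<Sum>v\<in>V. \<zeta> v) \<in> TB" for \<zeta>
  \<comment> \<open>Isolation is available for \<open>i < d\<close>; from \<open>i = d\<close> on,
    the \<open>i\<close>-th exterior power of a space of dimension \<open>d - 1\<close> is
    zero.\<close>
  proof (cases "i < d")
    case True
    have "\<forall>v\<in>V. (\<lambda>F. \<zeta> v F \<sigma>) \<in> Bs {} (int i)" for \<sigma>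
    proof (rule iso[OF True])
      show "(\<lambda>F. \<zeta> v F \<sigma>) \<in> Zs {v} (int i)" if "v \<in> V" for v
        using z[OF that] by (simp add: TZ_def Ten_def)
      have "(\<Sum>v\<in>V. (\<lambda>F. \<zeta> v F \<sigma>)) = (\<lambda>F. (\<Sum>v\<in>V. \<zeta> v) F \<sigma>)" by (simp add: fun_eq_iff)
      also have "\<dots> \<in> Bs {} (int i)" using s by (simp add: TB_def Ten_def)
      finally show "(\<Sum>v\<in>V. (\<lambda>F. \<zeta> v F \<sigma>)) \<in> Bs {} (int i)" .
    qed
    moreover have "\<zeta> v F \<in> LamW d a {} i" if "v \<in> V" for v F
      using z[OF that] LW[of v] by (auto simp: TZ_def Ten_def)
    ultimately show ?thesis by (simp add: TB_def Ten_def)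
  next
    case False
    have "\<zeta> v = 0" if v: "v \<in> V" for v
    proof
      fix F
      have "LamW d a {v} i = {0}" using False by (intro LamW_trivial[OF vertex_face[OF v]]) simp
      then show "\<zeta> v F = 0 F" using z[OF v] by (auto simp: TZ_def Ten_def)
    qed
    then show ?thesis using ts.subspace_0[OF TB(1)] by simp
  qed
  \<comment> \<open>The tensors that represent the image: coboundaries together with the sum of the
    local cocycles.\<close>
  define T where "T = {b + (\<Sum>v\<in>V. \<zeta> v) | b \<zeta>. b \<in> TB \<and> (\<forall>v\<in>V. \<zeta> v \<in> TZ v)}"
  have T: "ts.subspace T" "ts.fdim T"
    "ts.dim T + (\<Sum>v\<in>V. ts.dim (TZ v \<inter> TB)) = ts.dim TB + (\<Sum>v\<in>V. ts.dim (TZ v))"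
    unfolding T_def using ts.dim_independent_sum[where Z = TZ, OF finite_V TB TZ ind] by auto
  have TZ0: "TZ v \<subseteq> Ten (Zs {} (int i)) (LamW d a {} i)" for v
    unfolding TZ_def by (rule Ten_mono[OF Zs_vertex LW])
  have TB0: "TB \<subseteq> Ten (Zs {} (int i)) (LamW d a {} i)"
    unfolding TB_def by (rule Ten_mono[OF Bs_subset_Zs order_refl])
  have T0: "T \<subseteq> Ten (Zs {} (int i)) (LamW d a {} i)"
  proof
    fix x assume "x \<in> T"
    then obtain b \<zeta> where x: "x = b + (\<Sum>v\<in>V. \<zeta> v)" "b \<in> TB" "\<forall>v\<in>V. \<zeta> v \<in> TZ v"
      unfolding T_def by blast
    show "x \<in> Ten (Zs {} (int i)) (LamW d a {} i)"
      unfolding x(1) using x(2,3) TZ0 TB0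
      by (intro ts.subspace_add ts.subspace_sum subspace_Ten subspace_Zs subspace_LamW) blast+
  qed
  have embY: "emb y \<in> Yb {} 0 i \<longleftrightarrow> y \<in> TB" if "y \<in> Ten (Zs {} (int i)) (LamW d a {} i)" for y
    using emb_Ten_boundary_iff[OF empty_face dual[OF empty_face], of y 0 i] that by (simp add: TB_def)
  have ZtD: "Zt Qf 0 i \<subseteq> Zt (up {}) 0 i"
    unfolding Zt_def up_empty using Tsp_mono[of Qf \<Delta> If If d 0 i] by (auto simp: Qf_def)
  have BtD: "Bt Qf 0 i \<subseteq> Bt (up {}) 0 i"
    unfolding Bt_def up_empty by (intro image_mono Tsp_mono) (auto simp: Qf_def)
  have prjY: "prj {} z \<in> Yb {} 0 i \<longleftrightarrow> z \<in> Bt (up {}) 0 i" if "z \<in> Zt Qf 0 i" for z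
    using Zt_up_boundary_iff[OF empty_face] that ZtD by blast
  note Y = ts.subspace_add[OF subspace_Yb] ts.subspace_sum[OF subspace_Yb]
  have main: "ts.dim (Zt Qf 0 i) + ts.dim {w \<in> T. emb w \<in> Yb {} 0 i} =
    ts.dim T + ts.dim {z \<in> Zt Qf 0 i. prj {} z \<in> Yb {} 0 i}"
  proof (rule dim_correspondence[OF kspace_tscale kspace_tscale kspace_tscale linear_prj linear_emb
        subspace_Zt fdim_Zt T(1,2) subspace_Yb])
    fix z assume z: "z \<in> Zt Qf 0 i"
    obtain \<zeta> where \<zeta>: "\<forall>v\<in>V. \<zeta> v \<in> Zt (up {v}) 0 i" "z - (\<Sum>v\<in>V. \<zeta> v) \<in> Bt Qf 0 i"
      using Zt_Qf_decompose[OF order_refl z] by blast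
    have "\<exists>y. y \<in> TZ v \<and> prj {v} (\<zeta> v) - emb y \<in> Yb {v} 0 i" if v: "v \<in> V" for v
      using Zt_up_to_Ten[OF vertex_face[OF v] dual[OF vertex_face[OF v]], of "\<zeta> v" 0 i] \<zeta>(1) v
      by (auto simp: TZ_def)
    then have "\<forall>v\<in>V. \<exists>y. y \<in> TZ v \<and> prj {v} (\<zeta> v) - emb y \<in> Yb {v} 0 i" by blast
    from bchoice[OF this] obtain y where y: "\<And>v. v \<in> V \<Longrightarrow> y v \<in> TZ v"
      "\<And>v. v \<in> V \<Longrightarrow> prj {v} (\<zeta> v) - emb (y v) \<in> Yb {v} 0 i" by blast
    have "prj {} (\<zeta> v) - emb (y v) \<in> Yb {} 0 i" if v: "v \<in> V" for v
      using prj_empty_Yb[OF v y(2)[OF v]] by (simp add: prj_diff prj_empty_prj prj_empty_emb)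
    then have 1: "(\<Sum>v\<in>V. prj {} (\<zeta> v) - emb (y v)) \<in> Yb {} 0 i" by (intro Y(2))
    have 2: "prj {} (z - (\<Sum>v\<in>V. \<zeta> v)) \<in> Yb {} 0 i"
      using \<zeta>(2) BtD prjY Bt_subset_Zt[OF upc_Qf] by blast
    have "prj {} z - emb (\<Sum>v\<in>V. y v) =
      (\<Sum>v\<in>V. prj {} (\<zeta> v) - emb (y v)) + prj {} (z - (\<Sum>v\<in>V. \<zeta> v))"
      unfolding prj_diff prj_sum emb_sum sum_subtractf by (simp only: algebra_simps)
    then have "prj {} z - emb (\<Sum>v\<in>V. y v) \<in> Yb {} 0 i" using Y(1)[OF 1 2] by (simp only:)
    moreover have "(\<Sum>v\<in>V. y v) \<in> T"
    proof -
      have "(\<Sum>v\<in>V. y v) = 0 + (\<Sum>v\<in>V. y v)" by simp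
      then show ?thesis unfolding T_def using y(1) ts.subspace_0[OF TB(1)] by blast
    qed
    ultimately show "\<exists>w\<in>T. prj {} z - emb w \<in> Yb {} 0 i" by blast
  next
    fix w assume "w \<in> T"
    then obtain b y where w: "w = b + (\<Sum>v\<in>V. y v)" "b \<in> TB" "\<forall>v\<in>V. y v \<in> TZ v"
      unfolding T_def by blast
    have "\<forall>v\<in>V. \<exists>z. z \<in> Zt (up {v}) 0 i \<and> prj {v} z = emb (y v)"
    proof
      fix v assume v: "v \<in> V"
      have "y v \<in> Ten (Zs {v} (0 + int i)) (LamW d a {v} i)" using bspec[OF w(3) v] by (simp add: TZ_def)
      then show "\<exists>z. z \<in> Zt (up {v}) 0 i \<and> prj {v} z = emb (y v)"
        using Ten_to_Zt_up[OF vertex_face[OF v]] by blast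
    qed
    from bchoice[OF this] obtain z where z: "\<And>v. v \<in> V \<Longrightarrow> z v \<in> Zt (up {v}) 0 i"
      "\<And>v. v \<in> V \<Longrightarrow> prj {v} (z v) = emb (y v)" by blast
    have "prj {} (z v) = emb (y v)" if "v \<in> V" for v
      using z(2)[OF that] prj_empty_prj[of "{v}" "z v"] prj_empty_emb[of "y v"] by simp
    then have "prj {} (\<Sum>v\<in>V. z v) = emb (\<Sum>v\<in>V. y v)"
      unfolding prj_sum emb_sum by (intro sum.cong) auto
    then have "prj {} (\<Sum>v\<in>V. z v) - emb w = - emb b" unfolding w(1) emb_add by (simp add: algebra_simps)
    moreover have "emb b \<in> Yb {} 0 i" using embY[of b] w(2) TB0 by blast
    ultimately have "prj {} (\<Sum>v\<in>V. z v) - emb w \<in> Yb {} 0 i"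
      using ts.subspace_neg[OF subspace_Yb] by simp
    moreover have "(\<Sum>v\<in>V. z v) \<in> Zt Qf 0 i"
      by (rule ts.subspace_sum[OF subspace_Zt]) (use z(1) Zt_up_vertex in blast)
    ultimately show "\<exists>z\<in>Zt Qf 0 i. prj {} z - emb w \<in> Yb {} 0 i" by blast
  qed
  have e1: "{w \<in> T. emb w \<in> Yb {} 0 i} = TB"
  proof -
    have "x \<in> T" if "x \<in> TB" for x
    proof -
      have "x = x + (\<Sum>v\<in>V. (\<lambda>_. 0) v)" by simp
      then show ?thesis unfolding T_def using that ts.subspace_0[OF TZ(1)] by blast
    qed
    then show ?thesis using embY T0 TB0 by blast
  qed
  have e2: "{z \<in> Zt Qf 0 i. prj {} z \<in> Yb {} 0 i} = Zt Qf 0 i \<inter> Bt \<Delta> 0 i"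
    using prjY by (auto simp: up_empty)
  have "(\<Sum>v\<in>V. ts.dim (TZ v)) = (\<Sum>v\<in>V. fs.dim (Zs {v} (int i)) * ((d - 1) choose i))"
    using dTZ by (intro sum.cong) auto
  moreover have "(\<Sum>v\<in>V. ts.dim (TZ v \<inter> TB)) =
      (\<Sum>v\<in>V. fs.dim (Zs {v} (int i) \<inter> Bs {} (int i)) * ((d - 1) choose i))"
    using dI by (intro sum.cong) auto
  ultimately show ?thesis using T(3) main[unfolded e1 e2] by linarith
qed

section \<open>The column at the empty face and the dimension count\<close>

definition kdim :: "nat \<Rightarrow> nat \<Rightarrow> nat"
  where "kdim i p = (d choose p) * card {m. Poly_Mapping.keys m \<in> \<Delta> \<and> p + pdeg m = i}"

lemma dim_Tsp_empty: "ts.dim (Tsp d If {{}} (- int p) i :: (_ \<Rightarrow> _ \<Rightarrow> 'k) set) = kdim i p"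
proof -
  let ?M = "{m. Poly_Mapping.keys m \<in> \<Delta> \<and> p + pdeg m = i}" and ?S = "{\<sigma>. \<sigma> \<subseteq> {..<d} \<and> card \<sigma> = p}"
  define f where "f = (\<lambda>(m :: 'v \<Rightarrow>\<^sub>0 nat, \<sigma> :: nat set). (({} :: 'v set, m), \<sigma>))"
  have T: "Tidx d If {{}} (- int p) i = f ` (?M \<times> ?S)"
    by (auto simp: Tidx_def If_def image_iff f_def)
  have "inj_on f (?M \<times> ?S)" by (auto simp: inj_on_def f_def)
  then have "card (Tidx d If {{}} (- int p) i) = card ?M * card ?S"
    unfolding T card_cartesian_product[symmetric] by (rule card_image)
  then show ?thesis
    unfolding Tsp_def dim_tsup[OF finite_Tidx[OF okI_If]] kdim_def using n_subsets[of "{..<d}" p] by simp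
qed

definition at_empty :: "('v set \<times> ('v \<Rightarrow>\<^sub>0 nat) \<Rightarrow> nat set \<Rightarrow> 'k) \<Rightarrow> 'v set \<times> ('v \<Rightarrow>\<^sub>0 nat) \<Rightarrow> nat set \<Rightarrow> 'k"
  where "at_empty x = (\<lambda>(F, m). if F = {} then x (F, m) else 0)"

lemma at_empty_apply: "at_empty x (F, m) \<sigma> = (if F = {} then x (F, m) \<sigma> else 0)"
  by (simp add: at_empty_def)

lemma linear_at_empty: "Vector_Spaces.linear tscale tscale at_empty"
  by (auto simp: linear_tt_iff fun_eq_iff at_empty_def)

lemma at_empty_kernel: "{x \<in> Tsp d If \<Delta> n i. at_empty x = 0} = Tsp d If Qf n i"
proof (intro subset_antisym subsetI)
  fix x assume x: "x \<in> {x \<in> Tsp d If \<Delta> n i. at_empty x = 0}"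
  show "x \<in> Tsp d If Qf n i"
  proof (rule TspI)
    fix F m \<sigma> assume nz: "x (F, m) \<sigma> \<noteq> 0"
    have "at_empty x (F, m) \<sigma> = 0" using x by simp
    then have "F \<noteq> {}" using nz by (auto simp: at_empty_apply)
    then show "F \<in> Qf \<and> (F, Poly_Mapping.keys m) \<in> If \<and> \<sigma> \<subseteq> {..<d} \<and> card \<sigma> + pdeg m = i \<and>
      int (card F) = n + int (card \<sigma>)" using TspD[of x d If \<Delta> n i, OF _ nz] x by (auto simp: Qf_def)
  qed
next
  fix x :: "'v set \<times> ('v \<Rightarrow>\<^sub>0 nat) \<Rightarrow> nat set \<Rightarrow> 'k" assume x: "x \<in> Tsp d If Qf n i"
  have "at_empty x (F, m) \<sigma> = 0" for F m \<sigma>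
    using TspD(1)[OF x, of "{}" m \<sigma>] by (auto simp: at_empty_apply Qf_def)
  then have "at_empty x = 0" by (intro ext) (auto split: prod.split)
  moreover have "x \<in> Tsp d If \<Delta> n i" using x Tsp_mono[of Qf \<Delta> If If d n i] by (auto simp: Qf_def)
  ultimately show "x \<in> {x \<in> Tsp d If \<Delta> n i. at_empty x = 0}" by simp
qed

lemma at_empty_image: "at_empty ` Tsp d If \<Delta> n i = Tsp d If {{}} n i"
proof (intro subset_antisym image_subsetI subsetI)
  fix x :: "'v set \<times> ('v \<Rightarrow>\<^sub>0 nat) \<Rightarrow> nat set \<Rightarrow> 'k" assume x: "x \<in> Tsp d If \<Delta> n i"
  show "at_empty x \<in> Tsp d If {{}} n i"
  proof (rule TspI)
    fix F m \<sigma> assume "at_empty x (F, m) \<sigma> \<noteq> 0"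
    then have "F = {}" "x (F, m) \<sigma> \<noteq> 0" by (auto simp: at_empty_apply split: if_splits)
    then show "F \<in> {{}} \<and> (F, Poly_Mapping.keys m) \<in> If \<and> \<sigma> \<subseteq> {..<d} \<and> card \<sigma> + pdeg m = i \<and>
      int (card F) = n + int (card \<sigma>)" using TspD[OF x, of F m \<sigma>] by auto
  qed
next
  fix x :: "'v set \<times> ('v \<Rightarrow>\<^sub>0 nat) \<Rightarrow> nat set \<Rightarrow> 'k" assume x: "x \<in> Tsp d If {{}} n i"
  have "at_empty x (F, m) \<sigma> = x (F, m) \<sigma>" for F m \<sigma>
    using TspD(1)[OF x, of F m \<sigma>] by (auto simp: at_empty_apply)
  then have "x = at_empty x" by (intro ext) (auto split: prod.split)
  moreover have "x \<in> Tsp d If \<Delta> n i" using x Tsp_mono[of "{{}}" \<Delta> If If d n i] empty_face by auto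
  ultimately show "x \<in> at_empty ` Tsp d If \<Delta> n i" by blast
qed

text \<open>The column at the empty face is a quotient complex, so these restrictions are its last
  Koszul boundaries. They correspond to the degree \<open>i\<close> part of the ideal generated by
  the forms.\<close>

definition BK :: "nat \<Rightarrow> ('v set \<times> ('v \<Rightarrow>\<^sub>0 nat) \<Rightarrow> nat set \<Rightarrow> 'k) set"
  where "BK i = at_empty ` Bt \<Delta> 0 i"

lemma dim_BK: "ts.dim (BK i) + ts.dim (Zt Qf 0 i \<inter> Bt \<Delta> 0 i) = ts.dim (Bt \<Delta> 0 i)"
proof -
  have "{x \<in> Bt \<Delta> 0 i. at_empty x = 0} = Zt Qf 0 i \<inter> Bt \<Delta> 0 i"
    using Bt_subset_Zt[OF upc_Delta, of 0 i] at_empty_kernel[of 0 i] unfolding Zt_def by blast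
  then show ?thesis
    using dim_image_kernel[OF kspace_tscale kspace_tscale linear_at_empty subspace_Bt fdim_Bt, of \<Delta> 0 i]
    by (simp add: BK_def)
qed

lemma dim_Tsp_split: "ts.dim (Tsp d If \<Delta> (- int p) i :: (_ \<Rightarrow> _ \<Rightarrow> 'k) set) =
    kdim i p + ts.dim (Tsp d If Qf (- int p) i :: (_ \<Rightarrow> _ \<Rightarrow> 'k) set)"
  using dim_image_kernel[OF kspace_tscale kspace_tscale linear_at_empty subspace_Tsp fdim_Tsp[OF okI_If],
      of \<Delta> "- int p" i]
  unfolding at_empty_image at_empty_kernel dim_Tsp_empty by simp

lemma dim_Bt_Zt: "ts.dim (Bt \<G> (n + 1) i) + ts.dim (Zt \<G> n i) = ts.dim (Tsp d If \<G> n i :: (_ \<Rightarrow> _ \<Rightarrow> 'k) set)"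
  using dim_image_kernel[OF kspace_tscale kspace_tscale linear_DI subspace_Tsp fdim_Tsp[OF okI_If],
      of d a If \<G> n i]
  unfolding Bt_def Zt_def by simp

lemma Tsp_low:
  assumes "n < - int i"
  shows "Tsp d If \<G> n i = {0 :: _ \<Rightarrow> _ \<Rightarrow> 'k}"
proof -
  have "x = 0" if x: "x \<in> Tsp d If \<G> n i" for x :: "_ \<Rightarrow> _ \<Rightarrow> 'k"
  proof -
    have "x (F, m) \<sigma> = 0" for F m \<sigma>
      using TspD(4,5)[OF x, of F m \<sigma>] assms by fastforce
    then show ?thesis by (intro ext) (auto split: prod.split)
  qed
  then show ?thesis using ts.subspace_0[OF subspace_Tsp] by blast
qed

text \<open>Rank and nullity telescope downwards through the total degrees. The sum stops at
  \<open>i + 1\<close> because total degree \<open>n\<close> forces an exterior degree of at least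
  \<open>- n\<close>, while the exterior degree is at most \<open>i\<close>.\<close>

lemma dim_Bt_alternating:
  "int (ts.dim (Bt \<G> 0 i)) =
    (\<Sum>q=1..i+1. (-1) ^ (q - 1) * (int (ts.dim (Tsp d If \<G> (- int q) i :: (_ \<Rightarrow> _ \<Rightarrow> 'k) set))
      - (int (ts.dim (Zt \<G> (- int q) i)) - int (ts.dim (Bt \<G> (- int q) i)))))"
proof -
  define B where "B q = int (ts.dim (Bt \<G> (- int q) i))" for q
  have "B 0 = (\<Sum>q=0+1..i+1. (-1) ^ (q - 0 - 1) *
    (int (ts.dim (Tsp d If \<G> (- int q) i :: (_ \<Rightarrow> _ \<Rightarrow> 'k) set)) - (int (ts.dim (Zt \<G> (- int q) i)) - B q)))"
  proof (rule alternating_telescope)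
    fix p
    show "B p + int (ts.dim (Zt \<G> (- int (Suc p)) i)) =
      int (ts.dim (Tsp d If \<G> (- int (Suc p)) i :: (_ \<Rightarrow> _ \<Rightarrow> 'k) set))"
      using dim_Bt_Zt[of \<G> "- int (Suc p)" i] by (simp add: B_def flip: of_nat_add)
    have "Bt \<G> (- int (Suc i)) i = {0}"
      unfolding Bt_def by (subst Tsp_low) auto
    then show "B (Suc i) = 0" unfolding B_def using ts_dim_zero by simp
  qed simp
  then show ?thesis by (simp add: B_def)
qed

text \<open>The alternating counts for all faces and for the nonempty faces are subtracted. Their
  spaces differ by the Koszul strand \<open>kdim\<close>, and their cohomology dimensions are known
  from \<open>dim_total_up\<close> and \<open>dim_Qf\<close>. The rank in total degree 0 is the one
  quantity that no Euler characteristic determines; \<open>dim_comparison_rank\<close> supplies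
  it.\<close>

lemma quotient_dimension:
  assumes iso: "\<And>c. i < d \<Longrightarrow> (\<And>v. v \<in> V \<Longrightarrow> c v \<in> Zs {v} (int i)) \<Longrightarrow> (\<Sum>v\<in>V. c v) \<in> Bs {} (int i) \<Longrightarrow>
      \<forall>v\<in>V. c v \<in> Bs {} (int i)"
  defines "hP \<equiv> \<lambda>j. int (fs.dim (Zs {} j)) - int (fs.dim (Bs {} j))"
    and "hV \<equiv> \<lambda>v j. int (fs.dim (Zs {v} j)) - int (fs.dim (Bs {v} j))"
  shows "int (ts.dim (Tsp d If {{}} 0 i :: (_ \<Rightarrow> _ \<Rightarrow> 'k) set)) - int (ts.dim (BK i)) =
    (\<Sum>p=0..i+1. (-1) ^ p * int (kdim i p))
    + int (d choose i) * (\<Sum>p=1..i+1. (-1) ^ (p - 1) * hP (int i - int p))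
    + int ((d - 1) choose i) * ((\<Sum>v\<in>V. \<Sum>p=1..i+1. (-1) ^ p * hV v (int i - int p))
      + (\<Sum>v\<in>V. int (fs.dim (Zs {v} (int i) \<inter> Bs {} (int i))) - int (fs.dim (Bs {v} (int i)))))"
proof -
  let ?c = "int ((d - 1) choose i)"
  define t where "t \<G> q = int (ts.dim (Tsp d If \<G> (- int q) i :: (_ \<Rightarrow> _ \<Rightarrow> 'k) set))" for \<G> q
  define h where "h \<G> q = int (ts.dim (Zt \<G> (- int q) i)) - int (ts.dim (Bt \<G> (- int q) i))" for \<G> q
  have b: "int (ts.dim (Bt \<G> 0 i)) = (\<Sum>q=1..i+1. (-1) ^ (q - 1) * (t \<G> q - h \<G> q))" for \<G>
    unfolding t_def h_def by (rule dim_Bt_alternating)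
  have tk: "t \<Delta> q = int (kdim i q) + t Qf q" for q
    using dim_Tsp_split[of q i] by (simp add: t_def)
  have hD: "h \<Delta> q = int (d choose i) * hP (int i - int q)" for q
    using dim_total_up[OF empty_face dual[OF empty_face], of "- int q" i] dim_Lam[of d i, where 'k='k]
    unfolding LamW_empty up_empty h_def hP_def
    by (simp add: algebra_simps flip: of_nat_mult of_nat_add)
  have hQ: "h Qf q = ?c * (\<Sum>v\<in>V. hV v (int i - int q))" for q
  proof -
    have "h Qf q = (\<Sum>v\<in>V. int (ts.dim (Zt (up {v}) (- int q) i)) - int (ts.dim (Bt (up {v}) (- int q) i)))"
      using dim_Qf[of "- int q" i] unfolding h_def sum_subtractf of_nat_sum[symmetric] by linarith
    also have "\<dots> = (\<Sum>v\<in>V. ?c * hV v (int i - int q))"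
    proof (rule sum.cong[OF refl])
      fix v assume v: "v \<in> V"
      note vf = vertex_face[OF v]
      show "int (ts.dim (Zt (up {v}) (- int q) i)) - int (ts.dim (Bt (up {v}) (- int q) i))
        = ?c * hV v (int i - int q)"
        using dim_total_up[OF vf dual[OF vf], of "- int q" i] unfolding dual_vertex[OF v] hV_def
        by (simp add: algebra_simps flip: of_nat_mult of_nat_add)
    qed
    finally show ?thesis by (simp add: sum_distrib_left)
  qed
  have r: "int (ts.dim (Zt Qf 0 i)) - int (ts.dim (Zt Qf 0 i \<inter> Bt \<Delta> 0 i)) =
    ?c * (\<Sum>v\<in>V. int (fs.dim (Zs {v} (int i))) - int (fs.dim (Zs {v} (int i) \<inter> Bs {} (int i))))"
  proof -
    have "int (ts.dim (Zt Qf 0 i)) + (\<Sum>v\<in>V. int (fs.dim (Zs {v} (int i) \<inter> Bs {} (int i))) * ?c) =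
      int (ts.dim (Zt Qf 0 i \<inter> Bt \<Delta> 0 i)) + (\<Sum>v\<in>V. int (fs.dim (Zs {v} (int i))) * ?c)"
      using arg_cong[OF dim_comparison_rank[OF iso], of int] by simp
    then show ?thesis
      by (simp add: sum_distrib_left sum_subtractf algebra_simps)
  qed
  have k0: "int (ts.dim (Tsp d If {{}} 0 i :: (_ \<Rightarrow> _ \<Rightarrow> 'k) set)) = int (kdim i 0)"
    using dim_Tsp_empty[of 0 i] by simp
  have h0: "int (ts.dim (Zt Qf 0 i)) = h Qf 0 + int (ts.dim (Bt Qf 0 i))" by (simp add: h_def)
  have "int (ts.dim (BK i)) = int (ts.dim (Bt \<Delta> 0 i)) - int (ts.dim (Zt Qf 0 i \<inter> Bt \<Delta> 0 i))"
    using dim_BK[of i] by linarith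
  then have "int (kdim i 0) - int (ts.dim (BK i)) = int (kdim i 0)
    - (int (ts.dim (Bt \<Delta> 0 i)) - int (ts.dim (Bt Qf 0 i))) + h Qf 0
    - ?c * (\<Sum>v\<in>V. int (fs.dim (Zs {v} (int i))) - int (fs.dim (Zs {v} (int i) \<inter> Bs {} (int i))))"
    using r h0 by linarith
  also have "int (ts.dim (Bt \<Delta> 0 i)) - int (ts.dim (Bt Qf 0 i)) =
    (\<Sum>q=1..i+1. (-1) ^ (q - 1) * (int (kdim i q) - h \<Delta> q + h Qf q))"
    unfolding b sum_subtractf[symmetric] by (intro sum.cong) (auto simp: tk algebra_simps)
  also have "\<dots> = (\<Sum>q=1..i+1. (-1) ^ (q - 1) * int (kdim i q)) - (\<Sum>q=1..i+1. (-1) ^ (q - 1) * h \<Delta> q)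
      + (\<Sum>q=1..i+1. (-1) ^ (q - 1) * h Qf q)"
    by (simp add: sum_subtractf sum.distrib algebra_simps)
  also have "(\<Sum>q=1..i+1. (-1) ^ (q - 1) * h \<Delta> q) = int (d choose i) * (\<Sum>q=1..i+1. (-1) ^ (q - 1) * hP (int i - int q))"
    unfolding hD by (subst sum_distrib_left) (intro sum.cong refl mult.left_commute)
  also have "(\<Sum>q=1..i+1. (-1) ^ (q - 1) * h Qf q) = - (?c * (\<Sum>v\<in>V. \<Sum>q=1..i+1. (-1) ^ q * hV v (int i - int q)))"
  proof -
    have "(\<Sum>v\<in>V. \<Sum>q=1..i+1. (-1) ^ q * hV v (int i - int q)) = (\<Sum>q=1..i+1. (-1) ^ q * (\<Sum>v\<in>V. hV v (int i - int q)))"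
      by (subst sum.swap) (simp add: sum_distrib_left)
    also have "\<dots> = - (\<Sum>q=1..i+1. (-1) ^ (q - 1) * (\<Sum>v\<in>V. hV v (int i - int q)))"
      unfolding sum_negf[symmetric]
    proof (rule sum.cong[OF refl])
      fix q :: nat assume "q \<in> {1..i + 1}"
      then have "q = Suc (q - 1)" by auto
      then have "(-1 :: int) ^ q = - ((-1) ^ (q - 1))" by (metis power_Suc mult_minus1)
      then show "(-1) ^ q * (\<Sum>v\<in>V. hV v (int i - int q)) = - ((-1) ^ (q - 1) * (\<Sum>v\<in>V. hV v (int i - int q)))"
        by simp
    qed
    finally have e: "(\<Sum>v\<in>V. \<Sum>q=1..i+1. (-1) ^ q * hV v (int i - int q)) =
      - (\<Sum>q=1..i+1. (-1) ^ (q - 1) * (\<Sum>v\<in>V. hV v (int i - int q)))" .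
    have "(\<Sum>q=1..i+1. (-1) ^ (q - 1) * h Qf q) =
      ?c * (\<Sum>q=1..i+1. (-1) ^ (q - 1) * (\<Sum>v\<in>V. hV v (int i - int q)))"
      unfolding hQ by (subst sum_distrib_left) (intro sum.cong refl mult.left_commute)
    then show ?thesis unfolding e by (simp only: mult_minus_right minus_minus)
  qed
  also have "(\<Sum>q=1..i+1. (-1) ^ (q - 1) * int (kdim i q)) = int (kdim i 0) - (\<Sum>q=0..i+1. (-1) ^ q * int (kdim i q))"
  proof -
    have "(\<Sum>q=0..i+1. (-1) ^ q * int (kdim i q)) = int (kdim i 0) + (\<Sum>q=1..i+1. (-1) ^ q * int (kdim i q))"
      by (subst sum.atLeast_Suc_atMost) auto
    also have "(\<Sum>q=1..i+1. (-1) ^ q * int (kdim i q)) = - (\<Sum>q=1..i+1. (-1) ^ (q - 1) * int (kdim i q))"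
      unfolding sum_negf[symmetric]
    proof (rule sum.cong[OF refl])
      fix q :: nat assume "q \<in> {1..i + 1}"
      then have "q = Suc (q - 1)" by auto
      then have "(-1 :: int) ^ q = - ((-1) ^ (q - 1))" by (metis power_Suc mult_minus1)
      then show "(-1) ^ q * int (kdim i q) = - ((-1) ^ (q - 1) * int (kdim i q))" by simp
    qed
    finally show ?thesis by simp
  qed
  finally have "int (kdim i 0) - int (ts.dim (BK i)) = (\<Sum>q=0..i+1. (-1) ^ q * int (kdim i q))
    + int (d choose i) * (\<Sum>q=1..i+1. (-1) ^ (q - 1) * hP (int i - int q))
    + ?c * (\<Sum>v\<in>V. \<Sum>q=1..i+1. (-1) ^ q * hV v (int i - int q))
    + (h Qf 0 - ?c * (\<Sum>v\<in>V. int (fs.dim (Zs {v} (int i))) - int (fs.dim (Zs {v} (int i) \<inter> Bs {} (int i)))))"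
    by linarith
  \<comment> \<open>Local cohomology minus the rank of its map to the global one leaves the local
    kernels, the source of the term with \<open>sing_K\<close>.\<close>
  also have "h Qf 0 - ?c * (\<Sum>v\<in>V. int (fs.dim (Zs {v} (int i))) - int (fs.dim (Zs {v} (int i) \<inter> Bs {} (int i))))
    = ?c * (\<Sum>v\<in>V. int (fs.dim (Zs {v} (int i) \<inter> Bs {} (int i))) - int (fs.dim (Bs {v} (int i))))"
    unfolding hQ right_diff_distrib[symmetric] sum_subtractf[symmetric] by (simp add: hV_def)
  finally show ?thesis
    unfolding k0 by (simp only: distrib_left add.assoc)
qed

end

section \<open>Homology of links and singularities\<close>

lemma a_r_coset_fun_mod: "B +>\<^bsub>fun_mod Z\<^esub> z = coset_of B z"
  unfolding a_r_coset_def' coset_of_def by (auto simp: fun_mod_def plus_fun_def)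

lemma quot_fun_mod_simps:
  "carrier (quot_mod (fun_mod Z) B) = coset_of B ` Z"
  "zero (quot_mod (fun_mod Z) B) = B"
  by (auto simp: quot_mod_def A_RCOSETS_def' a_r_coset_fun_mod) (auto simp: fun_mod_def)

lemma quot_fun_mod_add:
  assumes B: "fs.subspace B"
  shows "add (quot_mod (fun_mod Z) B) (coset_of B x) (coset_of B y) = coset_of B (x + y)"
proof -
  have "set_add (fun_mod Z) (coset_of B x) (coset_of B y) =
    {u + w | u w. u \<in> coset_of B x \<and> w \<in> coset_of B y}"
    unfolding set_add_def' by (auto simp: fun_mod_def plus_fun_def)
  then show ?thesis using fs.coset_add[OF B] by (simp add: quot_mod_def)
qed

lemma quot_fun_mod_smult:
  assumes B: "fs.subspace B"
  shows "smult (quot_mod (fun_mod Z) B) c (coset_of B x) = coset_of B (fscale c x)"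
proof -
  have "smult (quot_mod (fun_mod Z) B) c (coset_of B x) = (\<Union>z\<in>coset_of B x. coset_of B (fscale c z))"
    by (simp add: quot_mod_def a_r_coset_fun_mod) (simp add: fun_mod_def fscale_def)
  then show ?thesis unfolding fs.coset_scale[OF B] .
qed

lemma vdim_quot_fun_mod:
  assumes Z: "fs.subspace Z" "fs.fdim Z" and B: "fs.subspace B" "B \<subseteq> Z"
  shows "vdim (quot_mod (fun_mod Z) B) + fs.dim B = fs.dim Z"
proof -
  have "{x \<in> Z. coset_of B x = \<zero>\<^bsub>quot_mod (fun_mod Z) B\<^esub>} = B"
    using B by (auto simp: quot_fun_mod_simps fs.coset_eq_self_iff)
  then show ?thesis
    using vdim_image[OF kspace_fscale Z(1), of "coset_of B" "quot_mod (fun_mod Z) B"] Z(2)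
    by (simp add: quot_fun_mod_simps coset_of_0 quot_fun_mod_add[OF B(1)] quot_fun_mod_smult[OF B(1)])
qed

lemma finsum_quot_fun_mod:
  assumes Z: "fs.subspace Z" and B: "fs.subspace B" "B \<subseteq> Z" and "finite I" "\<And>i. i \<in> I \<Longrightarrow> g i \<in> Z"
  shows "finsum (quot_mod (fun_mod Z) B) (\<lambda>i. coset_of B (g i)) I = coset_of B (sum g I)"
  by (rule finsum_image[OF kspace_fscale Z])
    (use assms(4,5) in \<open>simp_all only: quot_fun_mod_simps coset_of_0 quot_fun_mod_add[OF B(1)]
      quot_fun_mod_smult[OF B(1)]\<close>)

lemma vectorspace_quot_fun_mod:
  assumes Z: "fs.subspace Z" and B: "fs.subspace B" "B \<subseteq> Z"
  shows "vectorspace class_ring (quot_mod (fun_mod Z) B)"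
  by (rule vectorspace_image[OF kspace_fscale Z, of "coset_of B"])
    (simp_all only: quot_fun_mod_simps coset_of_0 quot_fun_mod_add[OF B(1)] quot_fun_mod_smult[OF B(1)])

lemma rel_chains_fsup: "rel_chains \<Delta> \<Gamma> j = fsup {F \<in> \<Delta> - \<Gamma>. int (card F) = j + 1}"
  by (auto simp: rel_chains_def fsup_def)

lemma boundary_ctr: "boundary \<Delta> = ctr (\<Union>\<Delta>) (\<lambda>_. 1)"
  by (simp add: fun_eq_iff boundary_def ctr_def)

lemma linear_boundary: "Vector_Spaces.linear fscale fscale (boundary \<Delta>)"
  unfolding boundary_ctr by (rule linear_ctr)

section \<open>Chains and cochains of the complex\<close>

context complex
begin

text \<open>The hypothesis on \<open>\<Gamma>\<close> covers absolute cohomology with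
  \<open>G = {}\<close> and the cohomology relative to \<open>cost \<Delta> v\<close> with
  \<open>G = {v}\<close>, so both become members of the family \<open>Zs\<close>,
  \<open>Bs\<close>.\<close>

lemma rel_chains_Cs: "\<Gamma> = {F \<in> \<Delta>. \<not> G \<subseteq> F} \<Longrightarrow> rel_chains \<Delta> \<Gamma> j = Cs G (j + 1)"
  unfolding rel_chains_fsup Cs_def up_def by (rule arg_cong[where f = fsup]) auto

lemma cocycles_Zs: "\<Gamma> = {F \<in> \<Delta>. \<not> G \<subseteq> F} \<Longrightarrow> cocycles \<Delta> \<Gamma> j = Zs G (j + 1)"
  by (simp add: cocycles_def Zs_def rel_chains_Cs zero_fun_def)

lemma coboundaries_Bs: "\<Gamma> = {F \<in> \<Delta>. \<not> G \<subseteq> F} \<Longrightarrow> coboundaries \<Delta> \<Gamma> j = Bs G (j + 1)"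
  by (simp add: coboundaries_def Bs_def rel_chains_Cs)

lemma cost_eq: "cost \<Delta> v = {F \<in> \<Delta>. \<not> {v} \<subseteq> F}"
  by (auto simp: cost_def)

definition Sc :: "int \<Rightarrow> ('v set \<Rightarrow> 'k) set"
  where "Sc j = fsup {F \<in> \<Delta>. int (card F) = j}"

lemma finite_Sc: "finite {F \<in> \<Delta>. int (card F) = j}"
  using finite_Delta by simp

lemma subspace_Sc: "fs.subspace (Sc j)"
  unfolding Sc_def by (rule subspace_fsup)

lemma fdim_Sc: "fs.fdim (Sc j)"
  unfolding Sc_def by (rule fdim_fsup[OF finite_Sc])

lemma rel_chains_Sc: "rel_chains \<Delta> {} j = Sc (j + 1)"
  unfolding rel_chains_fsup Sc_def by simp

lemma boundary_Sc:
  assumes "c \<in> Sc (j + 1)"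
  shows "boundary \<Delta> c \<in> Sc j"
proof -
  have "F \<in> \<Delta> \<and> int (card F) = j" if nz: "boundary \<Delta> c F \<noteq> 0" for F
  proof -
    obtain v where "v \<in> V - F" "orient (insert v F) v * c (insert v F) \<noteq> 0"
      using nz unfolding boundary_def by (rule sum.not_neutral_contains_not_neutral)
    then have v: "v \<notin> F" "insert v F \<in> \<Delta>" "int (card (insert v F)) = j + 1"
      using assms by (auto simp: Sc_def fsup_def)
    have "F \<in> \<Delta>" using face_subset[OF v(2)] by blast
    then show ?thesis using v finite_face[of F] by simp
  qed
  then show ?thesis by (auto simp: Sc_def fsup_def)
qed

lemma boundary_boundary:
  assumes "c \<in> Sc j"
  shows "boundary \<Delta> (boundary \<Delta> c) = 0"
proof
  fix F
  show "boundary \<Delta> (boundary \<Delta> c) F = 0 F"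
  proof (cases "finite F")
    case True
    then show ?thesis unfolding boundary_ctr using ctr_ctr_same[OF finite_V True] by simp
  next
    case False
    have "c (insert v (insert u F)) = 0" for u v
    proof (rule ccontr)
      assume "c (insert v (insert u F)) \<noteq> 0"
      then have "insert v (insert u F) \<in> \<Delta>" using assms by (auto simp: Sc_def fsup_def)
      then show False using finite_face[of "insert v (insert u F)"] False by simp
    qed
    then show ?thesis by (simp add: boundary_def)
  qed
qed

lemma cycles_Sc: "cycles \<Delta> j = {c \<in> Sc (j + 1). boundary \<Delta> c = 0}"
  by (simp add: cycles_def rel_chains_Sc zero_fun_def)

lemma boundaries_Sc: "boundaries \<Delta> j = boundary \<Delta> ` Sc (j + 2)"
  unfolding boundaries_def rel_chains_Sc by (simp add: algebra_simps)

lemma boundaries_subset_cycles: "boundaries \<Delta> j \<subseteq> (cycles \<Delta> j :: ('v set \<Rightarrow> 'k) set)"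
  using boundary_Sc[of _ "j + 1"] boundary_boundary by (auto simp: boundaries_Sc cycles_Sc add.assoc)

lemma subspace_cycles: "fs.subspace (cycles \<Delta> j :: ('v set \<Rightarrow> 'k) set)"
  unfolding cycles_Sc by (rule linear_ker_subspace[OF linear_boundary subspace_Sc])

lemma subspace_boundaries: "fs.subspace (boundaries \<Delta> j :: ('v set \<Rightarrow> 'k) set)"
  unfolding boundaries_Sc by (rule linear_image_subspace[OF linear_boundary subspace_Sc])

lemma fdim_cycles: "fs.fdim (cycles \<Delta> j :: ('v set \<Rightarrow> 'k) set)"
  by (rule fs.fdim_mono[OF fdim_Sc[of "j + 1"]]) (auto simp: cycles_Sc)

lemma betti_dim:
  "betti TYPE('k) \<Delta> j + fs.dim (boundaries \<Delta> j :: ('v set \<Rightarrow> 'k) set) = fs.dim (cycles \<Delta> j :: ('v set \<Rightarrow> 'k) set)"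
  unfolding betti_def red_homology_def
  by (rule vdim_quot_fun_mod[OF subspace_cycles fdim_cycles subspace_boundaries boundaries_subset_cycles])

lemma dim_cycles: "fs.dim (boundaries \<Delta> (j - 1) :: ('v set \<Rightarrow> 'k) set) + fs.dim (cycles \<Delta> j :: ('v set \<Rightarrow> 'k) set)
    = fs.dim (Sc (j + 1))"
  using dim_image_kernel[OF kspace_fscale kspace_fscale linear_boundary subspace_Sc fdim_Sc, of \<Delta> "j + 1"]
  unfolding boundaries_Sc cycles_Sc by (simp add: add.commute)

section \<open>Boundary and coboundary as transposed matrices\<close>

definition inc_mat :: "'v set \<Rightarrow> 'v set \<Rightarrow> 'k"
  where "inc_mat x y = (\<Sum>v\<in>y. if y - {v} = x then orient y v else 0)"

lemma coboundary_mat_map: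
  assumes c: "c \<in> Sc j"
  shows "coboundary \<Delta> c = mat_map {F \<in> \<Delta>. int (card F) = j} {F \<in> \<Delta>. int (card F) = j + 1} inc_mat c"
proof
  fix y
  let ?X = "{F \<in> \<Delta>. int (card F) = j}" and ?Y = "{F \<in> \<Delta>. int (card F) = j + 1}"
  have cC: "c \<in> Cs {} j" using c by (simp add: Sc_def Cs_def up_def)
  show "coboundary \<Delta> c y = mat_map ?X ?Y inc_mat c y"
  proof (cases "y \<in> ?Y")
    case False
    have "coboundary \<Delta> c y = 0"
      using coboundary_Cs[OF cC] False by (auto simp: Cs_def fsup_def up_def)
    then show ?thesis using False by (auto simp: mat_map_def)
  next
    case True
    have "(\<Sum>x\<in>?X. inc_mat x y * c x) = (\<Sum>v\<in>y. \<Sum>x\<in>?X. if y - {v} = x then orient y v * c x else 0)"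
      unfolding inc_mat_def sum_distrib_right by (subst sum.swap) (auto intro!: sum.cong)
    also have "\<dots> = (\<Sum>v\<in>y. orient y v * c (y - {v}))"
    proof (rule sum.cong[OF refl])
      fix v
      have "c (y - {v}) = 0" if "y - {v} \<notin> ?X" using c that by (auto simp: Sc_def fsup_def)
      then show "(\<Sum>x\<in>?X. if y - {v} = x then orient y v * c x else 0) = orient y v * c (y - {v})"
        using finite_Sc by (auto simp: sum.delta')
    qed
    finally show ?thesis using True by (simp add: mat_map_def coboundary_def)
  qed
qed

lemma boundary_mat_map:
  assumes e: "e \<in> Sc (j + 1)"
  shows "boundary \<Delta> e = mat_map {F \<in> \<Delta>. int (card F) = j + 1} {F \<in> \<Delta>. int (card F) = j} (\<lambda>y x. inc_mat x y) e"
proof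
  fix x
  let ?X = "{F \<in> \<Delta>. int (card F) = j}" and ?Y = "{F \<in> \<Delta>. int (card F) = j + 1}"
  show "boundary \<Delta> e x = mat_map ?Y ?X (\<lambda>y x. inc_mat x y) e x"
  proof (cases "x \<in> ?X")
    case False
    have "boundary \<Delta> e x = 0" using boundary_Sc[OF e] False by (auto simp: Sc_def fsup_def)
    then show ?thesis using False by (auto simp: mat_map_def)
  next
    case True
    have "(\<Sum>y\<in>?Y. inc_mat x y * e y) = (\<Sum>y\<in>?Y. \<Sum>v\<in>V - x. if insert v x = y then orient y v * e y else 0)"
    proof (rule sum.cong[OF refl])
      fix y assume y: "y \<in> ?Y"
      have fy: "finite y" using y finite_face by blast
      have "inc_mat x y * e y = (\<Sum>v\<in>y. if y - {v} = x then orient y v * e y else 0)"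
        unfolding inc_mat_def sum_distrib_right by (intro sum.cong) auto
      also have "\<dots> = (\<Sum>v\<in>y - x. if insert v x = y then orient y v * e y else 0)"
        using fy by (intro sum.mono_neutral_cong_right) auto
      also have "\<dots> = (\<Sum>v\<in>V - x. if insert v x = y then orient y v * e y else 0)"
        using finite_V y by (intro sum.mono_neutral_left) auto
      finally show "inc_mat x y * e y = (\<Sum>v\<in>V - x. if insert v x = y then orient y v * e y else 0)" .
    qed
    also have "\<dots> = (\<Sum>v\<in>V - x. \<Sum>y\<in>?Y. if insert v x = y then orient y v * e y else 0)"
      by (rule sum.swap)
    also have "\<dots> = (\<Sum>v\<in>V - x. orient (insert v x) v * e (insert v x))"
    proof (rule sum.cong[OF refl])
      fix v
      have "e (insert v x) = 0" if "insert v x \<notin> ?Y" using e that by (auto simp: Sc_def fsup_def)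
      then show "(\<Sum>y\<in>?Y. if insert v x = y then orient y v * e y else 0) = orient (insert v x) v * e (insert v x)"
        using finite_Sc by (auto simp: sum.delta')
    qed
    finally show ?thesis using True by (simp add: mat_map_def boundary_def)
  qed
qed

text \<open>The two maps are given by \<open>inc_mat\<close> and its transpose. The theorem counts
  homology of links and the double complex produces cohomology; this equality of ranks joins
  them.\<close>

lemma rank_coboundary_boundary: "fs.dim (coboundary \<Delta> ` Sc j) = fs.dim (boundary \<Delta> ` Sc (j + 1))"
proof -
  let ?X = "{F \<in> \<Delta>. int (card F) = j}" and ?Y = "{F \<in> \<Delta>. int (card F) = j + 1}"
  have "coboundary \<Delta> ` Sc j = mat_map ?X ?Y inc_mat ` fsup ?X"
    using coboundary_mat_map by (auto simp: Sc_def cong: image_cong)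
  moreover have "boundary \<Delta> ` Sc (j + 1) = mat_map ?Y ?X (\<lambda>y x. inc_mat x y) ` fsup ?Y"
    using boundary_mat_map by (auto simp: Sc_def cong: image_cong)
  ultimately show ?thesis
    using mat_map_rank_transpose[where X = ?X and Y = ?Y and A = inc_mat, OF finite_Sc finite_Sc] by simp
qed

section \<open>Links and the cohomology of the faces containing \<open>G\<close>\<close>

lemma complex_link:
  assumes "G \<in> \<Delta>"
  shows "complex (link \<Delta> G)"
proof
  show "simplicial_complex (link \<Delta> G)"
    unfolding simplicial_complex_def
  proof (intro conjI ballI allI impI)
    show "finite (\<Union>(link \<Delta> G))"
      by (rule finite_subset[OF _ finite_V]) (auto simp: link_def)
    show "{} \<in> link \<Delta> G" using assms empty_face by (simp add: link_def)
    fix F H assume F: "F \<in> link \<Delta> G" "H \<subseteq> F"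
    then have "G \<union> F \<in> \<Delta>" "G \<union> H \<subseteq> G \<union> F" by (auto simp: link_def)
    then have "G \<union> H \<in> \<Delta>" by (rule face_subset)
    then show "H \<in> link \<Delta> G" using F face_subset by (auto simp: link_def)
  qed
qed

lemma link_mem_iff: "G \<in> \<Delta> \<Longrightarrow> H \<in> link \<Delta> G \<longleftrightarrow> G \<inter> H = {} \<and> G \<union> H \<in> \<Delta>"
  using face_subset by (auto simp: link_def)

text \<open>
  The faces containing \<open>G\<close> are the sets \<open>G \<union> H\<close> with \<open>H\<close> in the link of \<open>G\<close>. The sign
  \<open>tw_sign\<close> compensates for the different positions of a vertex in \<open>G \<union> H\<close> and in \<open>H\<close>.
\<close>

definition tw_sign :: "'v set \<Rightarrow> 'v set \<Rightarrow> 'k"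
  where "tw_sign G H = (\<Prod>u\<in>H. (-1) ^ card {g \<in> G. g < u})"

definition tw :: "'v set \<Rightarrow> ('v set \<Rightarrow> 'k) \<Rightarrow> 'v set \<Rightarrow> 'k"
  where "tw G c = (\<lambda>F. if F \<in> \<Delta> \<and> G \<subseteq> F then tw_sign G (F - G) * c (F - G) else 0)"

lemma linear_tw: "Vector_Spaces.linear fscale fscale (tw G)"
  by (auto simp: linear_ff_iff tw_def fun_eq_iff algebra_simps)

lemma tw_sign_square: "tw_sign G H * tw_sign G H = 1"
  unfolding tw_sign_def prod.distrib[symmetric] by (rule prod.neutral) (simp flip: power_mult_distrib)

text \<open>The sign of each vertex in \<open>tw_sign\<close> is the discrepancy between its
  positions in \<open>G \<union> H\<close> and in \<open>H\<close>, which turns \<open>tw G\<close>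
  into a map of cochain complexes.\<close>

lemma tw_coboundary:
  assumes G: "G \<in> \<Delta>"
  shows "coboundary \<Delta> (tw G c) = tw G (coboundary (link \<Delta> G) c)"
proof
  fix F
  show "coboundary \<Delta> (tw G c) F = tw G (coboundary (link \<Delta> G) c) F"
  proof (cases "F \<in> \<Delta> \<and> G \<subseteq> F")
    case False
    have "tw G c (F - {v}) = 0" if "F \<in> \<Delta>" for v using False that by (auto simp: tw_def)
    then show ?thesis using False by (auto simp: coboundary_def tw_def)
  next
    case True
    define H where "H = F - G"
    have fF: "finite F" using True finite_face by blast
    then have fin: "finite H" by (simp add: H_def)
    have HL: "H \<in> link \<Delta> G" using True by (auto simp: link_mem_iff[OF G] H_def Un_absorb1)
    have FGH: "F = G \<union> H" using True by (auto simp: H_def)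
    have "coboundary \<Delta> (tw G c) F = (\<Sum>v\<in>F. orient F v * tw G c (F - {v}))" using True by (simp add: coboundary_def)
    \<comment> \<open>Removing a vertex of \<open>G\<close> leaves a set that no longer contains
      \<open>G\<close>, where \<open>tw G c\<close> vanishes.\<close>
    also have "\<dots> = (\<Sum>v\<in>H. orient F v * tw G c (F - {v}))"
      using fF by (intro sum.mono_neutral_right) (auto simp: H_def tw_def)
    also have "\<dots> = (\<Sum>v\<in>H. tw_sign G H * (orient H v * c (H - {v})))"
    proof (rule sum.cong[OF refl])
      fix v assume v: "v \<in> H"
      define s :: 'k where "s = (-1) ^ card {g \<in> G. g < v}"
      have ss: "s * (s * t) = t" for t by (simp add: s_def flip: mult.assoc power_mult_distrib)
      \<comment> \<open>The position of \<open>v\<close> in \<open>F\<close> exceeds its position in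
        \<open>H\<close> by the number of vertices of \<open>G\<close> below \<open>v\<close>, and
        that is the factor of \<open>v\<close> in \<open>tw_sign G H\<close>.\<close>
      have "{u \<in> F. u < v} = {u \<in> H. u < v} \<union> {g \<in> G. g < v}" unfolding FGH by auto
      then have "card {u \<in> F. u < v} = card {u \<in> H. u < v} + card {g \<in> G. g < v}"
        using fin finite_face[OF G] by (subst card_Un_disjoint[symmetric]) (auto simp: H_def)
      then have o: "orient F v = orient H v * s" by (simp add: orient_def s_def power_add)
      have t: "tw_sign G H = s * tw_sign G (H - {v})"
        unfolding tw_sign_def using prod.remove[OF fin v] by (simp add: s_def)
      have "F - {v} \<in> \<Delta>" "G \<subseteq> F - {v}" "F - {v} - G = H - {v}"
        using True v face_subset[of F "F - {v}"] by (auto simp: H_def)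
      then have "tw G c (F - {v}) = tw_sign G (H - {v}) * c (H - {v})" by (simp add: tw_def)
      then show "orient F v * tw G c (F - {v}) = tw_sign G H * (orient H v * c (H - {v}))"
        unfolding o t by (simp add: mult_ac)
    qed
    also have "\<dots> = tw G (coboundary (link \<Delta> G) c) F"
      using True HL by (simp add: tw_def coboundary_def sum_distrib_left H_def[symmetric])
    finally show ?thesis .
  qed
qed

lemma tw_image:
  assumes G: "G \<in> \<Delta>"
  shows "tw G ` fsup {H \<in> link \<Delta> G. int (card H) = j} = Cs G (j + int (card G))"
proof (intro subset_antisym image_subsetI subsetI)
  fix c :: "'v set \<Rightarrow> 'k" assume c: "c \<in> fsup {H \<in> link \<Delta> G. int (card H) = j}"
  have "F \<in> up G \<and> int (card F) = j + int (card G)" if "tw G c F \<noteq> 0" for F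
  proof -
    have F: "F \<in> \<Delta>" "G \<subseteq> F" "c (F - G) \<noteq> 0" using that by (auto simp: tw_def split: if_splits)
    then have "int (card (F - G)) = j" using c by (auto simp: fsup_def)
    then show ?thesis
      using F card_Diff_subset[OF finite_face[OF G] F(2)] card_mono[OF finite_face[OF F(1)] F(2)]
      by (simp add: up_def)
  qed
  then show "tw G c \<in> Cs G (j + int (card G))" by (auto simp: Cs_def fsup_def)
next
  fix c assume c: "c \<in> Cs G (j + int (card G))"
  define c' where "c' H = (if H \<in> link \<Delta> G then tw_sign G H * c (G \<union> H) else 0)" for H
  show "c \<in> tw G ` fsup {H \<in> link \<Delta> G. int (card H) = j}"
  proof (rule image_eqI)
    have "int (card H) = j" if nz: "c' H \<noteq> 0" for H
    proof -
      have H: "H \<in> link \<Delta> G" "c (G \<union> H) \<noteq> 0" using nz by (auto simp: c'_def split: if_splits)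
      then have "int (card (G \<union> H)) = j + int (card G)" using c by (auto simp: Cs_def fsup_def)
      moreover have "G \<inter> H = {}" "finite H" "finite G"
        using H(1) finite_face G by (auto simp: link_def)
      ultimately show ?thesis by (simp add: card_Un_disjoint)
    qed
    then show "c' \<in> fsup {H \<in> link \<Delta> G. int (card H) = j}" by (auto simp: fsup_def c'_def split: if_splits)
    show "c = tw G c'"
    proof
      fix F
      show "c F = tw G c' F"
      proof (cases "F \<in> \<Delta> \<and> G \<subseteq> F")
        case False
        then show ?thesis using c by (auto simp: tw_def Cs_def fsup_def up_def)
      next
        case True
        then have "G \<union> (F - G) = F" "F - G \<in> link \<Delta> G" by (auto simp: link_mem_iff[OF G] Un_absorb1)
        then show ?thesis using True tw_sign_square[of G "F - G"] by (simp add: tw_def c'_def flip: mult.assoc)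
      qed
    qed
  qed
qed

lemma tw_inj:
  assumes G: "G \<in> \<Delta>" and c: "\<And>H. c H \<noteq> 0 \<Longrightarrow> H \<in> link \<Delta> G" and 0: "tw G c = 0"
  shows "c = 0"
proof
  fix H
  show "c H = 0 H"
  proof (rule ccontr)
    assume "c H \<noteq> 0 H"
    then have nz: "c H \<noteq> 0" by simp
    then have H: "G \<inter> H = {}" "G \<union> H \<in> \<Delta>" using c link_mem_iff[OF G] by auto
    have "tw G c (G \<union> H) = tw_sign G H * c H"
    proof -
      have "G \<union> H - G = H" using H(1) by blast
      then show ?thesis using H(2) by (simp add: tw_def)
    qed
    moreover have "tw_sign G H \<noteq> 0" using tw_sign_square[of G H] by auto
    ultimately show False using 0 nz by simp
  qed
qed

text \<open>\<open>tw G\<close> carries the cochains of the link isomorphically onto the relative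
  cochains, shifting the number of vertices by \<open>card G\<close>. Both coboundary ranks can thus
  be taken in the link, where they are ranks of boundary maps.\<close>

lemma relative_cohomology_dim:
  assumes G: "G \<in> \<Delta>"
  shows "fs.dim (Zs G (j + int (card G))) + fs.dim (boundaries (link \<Delta> G) (j - 1) :: ('v set \<Rightarrow> 'k) set) =
    fs.dim (Bs G (j + int (card G))) + fs.dim (cycles (link \<Delta> G) (j - 1) :: ('v set \<Rightarrow> 'k) set)"
proof -
  define L where "L = link \<Delta> G"
  interpret L: complex L d a unfolding L_def by (rule complex_link[OF G])
  have tw_im: "tw G ` L.Sc i = Cs G (i + int (card G))" for i
    unfolding L.Sc_def by (simp add: L_def tw_image[OF G])
  have tw_cob: "coboundary \<Delta> (tw G c) = tw G (coboundary L c)" for c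
    unfolding L_def by (rule tw_coboundary[OF G])
  have rank: "fs.dim (coboundary \<Delta> ` Cs G (i + int (card G))) = fs.dim (coboundary L ` L.Sc i)" for i
  proof -
    have "coboundary \<Delta> ` Cs G (i + int (card G)) = tw G ` coboundary L ` L.Sc i"
      unfolding tw_im[symmetric] image_image tw_cob ..
    moreover have "fs.dim (tw G ` coboundary L ` L.Sc i) = fs.dim (coboundary L ` L.Sc i)"
    proof (rule dim_image_inj[OF kspace_fscale kspace_fscale linear_tw])
      show "fs.subspace (coboundary L ` L.Sc i)"
        by (rule linear_image_subspace[OF linear_coboundary L.subspace_Sc])
      show "fs.fdim (coboundary L ` L.Sc i)"
        by (rule linear_image_fdim[OF kspace_fscale kspace_fscale linear_coboundary L.fdim_Sc])
      show "x = 0" if "x \<in> coboundary L ` L.Sc i" "tw G x = 0" for x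
      proof (rule tw_inj[OF G _ that(2)])
        show "H \<in> link \<Delta> G" if "x H \<noteq> 0" for H
          using \<open>x \<in> coboundary L ` L.Sc i\<close> that by (auto simp: coboundary_def L_def split: if_splits)
      qed
    qed
    ultimately show ?thesis by simp
  qed
  have dC: "fs.dim (Cs G (j + int (card G))) = fs.dim (L.Sc j)"
    unfolding tw_im[symmetric]
  proof (rule dim_image_inj[OF kspace_fscale kspace_fscale linear_tw L.subspace_Sc L.fdim_Sc])
    fix x assume x: "x \<in> L.Sc j" "tw G x = 0"
    show "x = 0"
      by (rule tw_inj[OF G _ x(2)]) (use x(1) in \<open>auto simp: L.Sc_def fsup_def L_def[symmetric]\<close>)
  qed
  have "fs.dim (coboundary \<Delta> ` Cs G (j + int (card G))) + fs.dim (Zs G (j + int (card G))) = fs.dim (L.Sc j)"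
    using dim_image_kernel[OF kspace_fscale kspace_fscale linear_coboundary subspace_Cs fdim_Cs,
        of \<Delta> G "j + int (card G)"] dC unfolding Zs_def by simp
  moreover have "fs.dim (coboundary \<Delta> ` Cs G (j + int (card G))) = fs.dim (boundaries L (j - 1) :: ('v set \<Rightarrow> 'k) set)"
    unfolding rank L.rank_coboundary_boundary L.boundaries_Sc by (simp add: algebra_simps)
  moreover have "fs.dim (Bs G (j + int (card G))) = fs.dim (boundaries L (j - 1 - 1) :: ('v set \<Rightarrow> 'k) set)"
  proof -
    have "j + int (card G) - 1 = (j - 1) + int (card G)" by simp
    then show ?thesis
      unfolding Bs_def using rank[of "j - 1"] L.rank_coboundary_boundary[of "j - 1"] L.boundaries_Sc[of "j - 1 - 1"]
      by (simp add: algebra_simps)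
  qed
  ultimately show ?thesis
    using L.dim_cycles[of "j - 1"] unfolding L_def by simp
qed

lemma betti_link:
  assumes G: "G \<in> \<Delta>"
  shows "int (betti TYPE('k) (link \<Delta> G) (j - 1)) =
    int (fs.dim (Zs G (j + int (card G)))) - int (fs.dim (Bs G (j + int (card G))))"
proof -
  interpret L: complex "link \<Delta> G" d a by (rule complex_link[OF G])
  show ?thesis using relative_cohomology_dim[OF G, of j] L.betti_dim[of "j - 1"] by linarith
qed

lemma link_empty: "link \<Delta> {} = \<Delta>"
  by (simp add: link_def)

text \<open>Only a dimension count passes from the homology of the link to relative cochains;
  equality of the two sets follows because coboundaries are cocycles.\<close>

lemma trivial_homology_exact:
  assumes G: "G \<in> \<Delta>"
    and H: "carrier (red_homology (link \<Delta> G) (j - 1) :: ('k, ('v set \<Rightarrow> 'k) set) module)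
      = {\<zero>\<^bsub>(red_homology (link \<Delta> G) (j - 1) :: ('k, ('v set \<Rightarrow> 'k) set) module)\<^esub>}"
  shows "Zs G (j + int (card G)) = Bs G (j + int (card G))"
proof -
  interpret L: complex "link \<Delta> G" d a by (rule complex_link[OF G])
  let ?Z = "cycles (link \<Delta> G) (j - 1) :: ('v set \<Rightarrow> 'k) set"
    and ?B = "boundaries (link \<Delta> G) (j - 1) :: ('v set \<Rightarrow> 'k) set"
  have "coset_of ?B ` ?Z = {?B}"
    using H unfolding red_homology_def quot_fun_mod_simps .
  then have "coset_of ?B z = ?B" if "z \<in> ?Z" for z using that by (metis image_eqI singletonD)
  then have "?Z \<subseteq> ?B" by (auto simp only: fs.coset_eq_self_iff[OF L.subspace_boundaries])
  then have "?Z = ?B" using L.boundaries_subset_cycles by blast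
  then have "fs.dim (Bs G (j + int (card G))) = fs.dim (Zs G (j + int (card G)))"
    using relative_cohomology_dim[OF G, of j] by simp
  then show ?thesis
    using fs.subspace_dim_equal_fdim[OF Bs_subset_Zs subspace_Bs subspace_Zs
        fs.fdim_mono[OF fdim_Cs[of G "j + int (card G)"]]] by (auto simp: Zs_def)
qed

lemma link_link:
  assumes "G \<in> \<Delta>" "H \<in> link \<Delta> G"
  shows "link (link \<Delta> G) H = link \<Delta> (G \<union> H)"
proof -
  have "F \<in> link (link \<Delta> G) H \<longleftrightarrow> F \<in> link \<Delta> (G \<union> H)" for F
  proof -
    have GH: "G \<union> H \<in> \<Delta>" "G \<inter> H = {}" using assms by (auto simp: link_def)
    have "F \<in> link (link \<Delta> G) H \<longleftrightarrow> F \<in> link \<Delta> G \<and> H \<inter> F = {} \<and> H \<union> F \<in> link \<Delta> G"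
      by (simp add: link_def[of "link \<Delta> G"])
    also have "\<dots> \<longleftrightarrow> (G \<union> H) \<inter> F = {} \<and> G \<union> H \<union> F \<in> \<Delta>"
      unfolding link_mem_iff[OF assms(1)] using GH face_subset[of "G \<union> H \<union> F" "G \<union> F"]
      by (auto simp: Un_assoc Int_Un_distrib2 Int_Un_distrib)
    finally show ?thesis unfolding link_mem_iff[OF GH(1)] .
  qed
  then show ?thesis by blast
qed

section \<open>Purity, dimensions of links, and exactness from isolated singularities\<close>

lemma face_in_facet:
  assumes pure: "pure_complex \<Delta>" and dim: "sc_dim \<Delta> = int d - 1" and G: "G \<in> \<Delta>"
  shows "\<exists>F\<in>\<Delta>. G \<subseteq> F \<and> card F = d"
proof -
  obtain F where F: "F \<in> up G" "\<And>F'. F' \<in> up G \<Longrightarrow> F \<subseteq> F' \<Longrightarrow> F = F'"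
    using finite_has_maximal[OF finite_up, of G] G by (auto simp: up_def)
  have "\<forall>F'\<in>\<Delta>. F \<subseteq> F' \<longrightarrow> F' = F"
    using F by (auto simp: up_def)
  then have "int (card F) = sc_dim \<Delta> + 1" using pure F(1) by (auto simp: pure_complex_def up_def)
  then show ?thesis using F(1) dim by (auto simp: up_def)
qed

lemma card_face_dim:
  assumes dim: "sc_dim \<Delta> = int d - 1" and G: "G \<in> \<Delta>"
  shows "card G \<le> d"
proof -
  have "card G \<le> Max (card ` \<Delta>)" using finite_Delta G by (intro Max_ge) auto
  then show ?thesis using dim by (simp add: sc_dim_def)
qed

lemma sc_dim_link:
  assumes pure: "pure_complex \<Delta>" and dim: "sc_dim \<Delta> = int d - 1" and G: "G \<in> \<Delta>"
  shows "sc_dim (link \<Delta> G) = int d - int (card G) - 1"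
proof -
  obtain F where F: "F \<in> \<Delta>" "G \<subseteq> F" "card F = d" using face_in_facet[OF assms] by blast
  have fG: "finite G" by (rule finite_face[OF G])
  have FL: "F - G \<in> link \<Delta> G" using F by (auto simp: link_mem_iff[OF G] Un_absorb1)
  have cF: "card (F - G) = d - card G" using F card_Diff_subset[OF fG F(2)] by simp
  have "Max (card ` link \<Delta> G) = d - card G"
  proof (rule Max_eqI)
    show "finite (card ` link \<Delta> G)" using finite_Delta by (auto simp: link_def)
    show "d - card G \<in> card ` link \<Delta> G" using FL cF by (metis image_eqI)
    fix k assume "k \<in> card ` link \<Delta> G"
    then obtain H where H: "H \<in> link \<Delta> G" "k = card H" by blast
    have HG: "G \<inter> H = {}" "G \<union> H \<in> \<Delta>" using H(1) link_mem_iff[OF G] by auto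
    have "finite H" using finite_face[OF HG(2)] by simp
    then have "card G + card H \<le> d" using card_face_dim[OF dim HG(2)] HG(1) fG by (simp add: card_Un_disjoint)
    then show "k \<le> d - card G" using H(2) by simp
  qed
  then show ?thesis using card_face_dim[OF dim G] by (simp add: sc_dim_def)
qed

text \<open>For two vertices \<open>v\<close>, \<open>u\<close> of \<open>G\<close> the link of
  \<open>{v, u}\<close> is the link of \<open>u\<close> in the link of \<open>v\<close>, hence
  Cohen--Macaulay. The link of \<open>G\<close> is the link of a face in it, and shifting by
  \<open>card G\<close> turns the bound on the homological degree into \<open>j < d\<close>.\<close>

lemma isolated_exact:
  assumes iso: "isolated_singularities TYPE('k) \<Delta>" and dim: "sc_dim \<Delta> = int d - 1"
    and G: "G \<in> \<Delta>" "2 \<le> card G" and j: "j < int d"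
  shows "Zs G j = Bs G j"
proof -
  have pure: "pure_complex \<Delta>" using iso by (simp add: isolated_singularities_def)
  obtain v where v: "v \<in> G" using G(2) by fastforce
  have "card (G - {v}) \<noteq> 0" using G v finite_face[OF G(1)] by simp
  then obtain u where u: "u \<in> G" "u \<noteq> v" by (metis Diff_iff card_0_eq card.empty ex_in_conv singletonI)
  have vf: "{v} \<in> \<Delta>" "{u} \<in> link \<Delta> {v}" "{v} \<union> {u} \<in> \<Delta>"
  proof -
    show v': "{v} \<in> \<Delta>" "{v} \<union> {u} \<in> \<Delta>" using face_subset[OF G(1)] u v by auto
    then show "{u} \<in> link \<Delta> {v}" using u by (simp add: link_mem_iff)
  qed
  have "buchsbaum TYPE('k) (vlink \<Delta> v)" using iso vf(1) by (auto simp: isolated_singularities_def)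
  moreover have "u \<in> \<Union>(vlink \<Delta> v)" using vf(2) by blast
  ultimately have "cohen_macaulay TYPE('k) (vlink (vlink \<Delta> v) u)" unfolding buchsbaum_def by blast
  moreover have e: "{v} \<union> {u} = {v, u}" by auto
  ultimately have cmL: "cohen_macaulay TYPE('k) (link \<Delta> {v, u})"
    using link_link[OF vf(1,2)] unfolding e by simp
  define F where "F = G - {v, u}"
  have GF: "{v, u} \<union> F = G" using u v by (auto simp: F_def)
  have vu: "{v, u} \<in> \<Delta>" using vf(3) unfolding e .
  have F: "F \<in> link \<Delta> {v, u}" using G(1) GF by (auto simp: link_mem_iff[OF vu] F_def)
  have LF: "link (link \<Delta> {v, u}) F = link \<Delta> G" using link_link[OF vu F] GF by simp
  define j' where "j' = j - int (card G)"
  have "j' - 1 < sc_dim (link \<Delta> G)" using j by (simp add: sc_dim_link[OF pure dim G(1)] j'_def)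
  then have "carrier (red_homology (link \<Delta> G) (j' - 1) :: ('k, ('v set \<Rightarrow> 'k) set) module)
      = {\<zero>\<^bsub>(red_homology (link \<Delta> G) (j' - 1) :: ('k, ('v set \<Rightarrow> 'k) set) module)\<^esub>}"
    using cmL F unfolding cohen_macaulay_def Let_def LF[symmetric] by blast
  from trivial_homology_exact[OF G(1) this] show ?thesis by (simp add: j'_def)
qed

section \<open>Homological isolation in terms of cocycles\<close>

lemma iota_star_coset:
  assumes "v \<in> V" and z: "z \<in> Zs {v} (j + 1)"
  shows "iota_star \<Delta> j (coset_of (Bs {v} (j + 1)) z) = coset_of (Bs {} (j + 1)) z"
proof -
  have B: "coboundaries \<Delta> {} j = Bs {} (j + 1)" by (rule coboundaries_Bs) simp
  have sub: "Bs {v} (j + 1) \<subseteq> Bs {} (j + 1)"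
    unfolding Bs_def by (intro image_mono) (auto simp: Cs_def fsup_def up_def)
  have "coset_of (Bs {} (j + 1)) y = coset_of (Bs {} (j + 1)) z" if "y \<in> coset_of (Bs {v} (j + 1)) z" for y
    using that sub unfolding fs.coset_eq_iff[OF subspace_Bs] by (auto simp: coset_of_def)
  moreover have "coset_of (Bs {v} (j + 1)) z \<noteq> {}" using fs.coset_mem[OF subspace_Bs] by blast
  ultimately show ?thesis unfolding iota_star_def B a_r_coset_fun_mod by simp
qed

lemma H_empty_eq: "H_empty \<Delta> j = quot_mod (fun_mod (Zs {} (j + 1))) (Bs {} (j + 1))"
  unfolding rel_cohomology_def using cocycles_Zs[of "{}" "{}" j] coboundaries_Bs[of "{}" "{}" j] by simp

lemma H_vertex_eq: "H_vertex \<Delta> v j = quot_mod (fun_mod (Zs {v} (j + 1))) (Bs {v} (j + 1))"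
  unfolding rel_cohomology_def cocycles_Zs[OF cost_eq] coboundaries_Bs[OF cost_eq] ..

lemma Zs_vertex_subset: "Zs {v} j \<subseteq> Zs {} j"
  by (auto simp: Zs_def Cs_def fsup_def up_def)

text \<open>Independence of classes is translated into representatives. As \<open>i\<close> counts
  vertices, isolation is applied in degree \<open>i - 1\<close>, and its range is
  \<open>1 \<le> i \<le> d - 1\<close>. For \<open>i = 0\<close> no face containing \<open>v\<close>
  has the right size, so every \<open>c v\<close> is zero.\<close>

lemma hom_isolated_indep:
  assumes "hom_isolated_singularities TYPE('k) \<Delta>" and dim: "sc_dim \<Delta> = int d - 1" and "i < d"
    and c: "\<And>v. v \<in> V \<Longrightarrow> c v \<in> Zs {v} (int i)" and s: "(\<Sum>v\<in>V. c v) \<in> Bs {} (int i)"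
  shows "\<forall>v\<in>V. c v \<in> Bs {} (int i)"
proof (cases "i = 0")
  case True
  have "c v = 0" if v: "v \<in> V" for v
  proof
    fix F
    show "c v F = 0 F"
    proof (rule ccontr)
      assume "c v F \<noteq> 0 F"
      then have "F \<in> up {v}" "card F = 0" using c[OF v] True by (auto simp: Zs_def Cs_def fsup_def)
      then show False using finite_face[of F] by (auto simp: up_def)
    qed
  qed
  then show ?thesis using fs.subspace_0[OF subspace_Bs] by simp
next
  case False
  define j where "j = int i - 1"
  have j: "0 \<le> j \<and> j \<le> sc_dim \<Delta> - 1" "j + 1 = int i" using False assms(3) dim by (auto simp: j_def)
  let ?H = "H_empty \<Delta> j :: ('k, ('v set \<Rightarrow> 'k) set) module"
  have ind: "indep_subspaces ?H V (\<lambda>v. iota_star \<Delta> j ` carrier (H_vertex \<Delta> v j))"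
    using assms(1) j(1) unfolding hom_isolated_singularities_def by blast
  have H: "?H = quot_mod (fun_mod (Zs {} (int i))) (Bs {} (int i))"
    unfolding H_empty_eq j(2) ..
  define w where "w v = coset_of (Bs {} (int i)) (c v)" for v
  have "w \<in> (\<Pi> v\<in>V. iota_star \<Delta> j ` carrier (H_vertex \<Delta> v j))"
  proof
    fix v assume v: "v \<in> V"
    have "coset_of (Bs {v} (int i)) (c v) \<in> carrier (H_vertex \<Delta> v j)"
      unfolding H_vertex_eq quot_fun_mod_simps j(2) using c[OF v] by blast
    moreover have "w v = iota_star \<Delta> j (coset_of (Bs {v} (int i)) (c v))"
      using iota_star_coset[of v "c v" j] v c[OF v] by (simp add: j(2) w_def)
    ultimately show "w v \<in> iota_star \<Delta> j ` carrier (H_vertex \<Delta> v j)" by blast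
  qed
  moreover have "finsum ?H w V = \<zero>\<^bsub>?H\<^esub>"
  proof -
    have "finsum ?H w V = coset_of (Bs {} (int i)) (\<Sum>v\<in>V. c v)"
      unfolding H w_def using c Zs_vertex_subset
      by (intro finsum_quot_fun_mod[OF subspace_Zs subspace_Bs Bs_subset_Zs finite_V]) blast
    then show ?thesis using s fs.coset_eq_self_iff[OF subspace_Bs] unfolding H quot_fun_mod_simps by blast
  qed
  ultimately have "\<forall>v\<in>V. w v = \<zero>\<^bsub>?H\<^esub>" using ind unfolding indep_subspaces_def by blast
  then show ?thesis unfolding H quot_fun_mod_simps w_def fs.coset_eq_self_iff[OF subspace_Bs] .
qed

end

section \<open>The kernel of \<open>f_theta\<close>\<close>

definition tuples :: "'i set \<Rightarrow> ('i \<Rightarrow> ('x \<Rightarrow> 'k::field) set) \<Rightarrow> ('i \<Rightarrow> 'x \<Rightarrow> 'k) set"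
  where "tuples I S = {y. (\<forall>i\<in>I. y i \<in> S i) \<and> (\<forall>i. i \<notin> I \<longrightarrow> y i = 0)}"

lemma subspace_tuples:
  assumes "\<And>i. i \<in> I \<Longrightarrow> fs.subspace (S i)"
  shows "ts.subspace (tuples I S)"
proof -
  have e: "tscale c y i = fscale c (y i)" for c y and i :: 'a by (simp add: fun_eq_iff)
  show ?thesis
    unfolding ts.subspace_def tuples_def
    using assms by (auto simp: e fs.subspace_0 fs.subspace_add fs.subspace_scale simp del: tscale_apply fs.scale_eq_0_iff)
qed

lemma dim_tuples:
  fixes S :: "'i \<Rightarrow> ('x \<Rightarrow> 'k::field) set"
  assumes "finite I" "\<And>i. i \<in> I \<Longrightarrow> fs.subspace (S i)" "\<And>i. i \<in> I \<Longrightarrow> fs.fdim (S i)"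
  shows "ts.fdim (tuples I S)" "ts.dim (tuples I S) = (\<Sum>i\<in>I. fs.dim (S i))"
proof -
  define e where "e i c = (\<lambda>j. if j = i then c else 0)" for i :: 'i and c :: "'x \<Rightarrow> 'k"
  have lin: "Vector_Spaces.linear fscale tscale (e i)" for i
    by (auto simp: kspace_linear_iff[OF kspace_fscale kspace_tscale] fun_eq_iff e_def)
  have Z: "ts.subspace (e i ` S i)" "ts.fdim (e i ` S i)" "ts.dim (e i ` S i) = fs.dim (S i)" if i: "i \<in> I" for i
  proof -
    show "ts.subspace (e i ` S i)" by (rule linear_image_subspace[OF lin assms(2)[OF i]])
    show "ts.fdim (e i ` S i)" by (rule linear_image_fdim[OF kspace_fscale kspace_tscale lin assms(3)[OF i]])
    show "ts.dim (e i ` S i) = fs.dim (S i)"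
    proof (rule dim_image_inj[OF kspace_fscale kspace_tscale lin assms(2)[OF i] assms(3)[OF i]])
      fix c assume "e i c = 0"
      then have "e i c i = 0" by simp
      then show "c = 0" by (simp add: e_def)
    qed
  qed
  have esum: "(\<Sum>i\<in>I. e i (c i)) j = (if j \<in> I then c j else 0)" for c j
  proof
    fix x
    have "(\<Sum>i\<in>I. e i (c i)) j x = (\<Sum>i\<in>I. if i = j then c j x else 0)"
      unfolding sum_apply by (intro sum.cong) (auto simp: e_def)
    also have "\<dots> = (if j \<in> I then c j x else 0)" using assms(1) by simp
    finally show "(\<Sum>i\<in>I. e i (c i)) j x = (if j \<in> I then c j else 0) x" by simp
  qed
  have ind: "\<forall>i\<in>I. \<zeta> i \<in> {0}" if z: "\<And>i. i \<in> I \<Longrightarrow> \<zeta> i \<in> e i ` S i" and s: "(\<Sum>i\<in>I. \<zeta> i) \<in> {0}" for \<zeta>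
  proof -
    have "\<forall>i\<in>I. \<exists>c. \<zeta> i = e i c" using z by blast
    from bchoice[OF this] obtain c where c: "\<And>i. i \<in> I \<Longrightarrow> \<zeta> i = e i (c i)" by blast
    have "(\<Sum>i\<in>I. e i (c i)) = 0" using s c by simp
    then have "(if j \<in> I then c j else 0) = 0" for j using esum[of c j] by simp
    then have "c j = 0" if "j \<in> I" for j using that by metis
    then show ?thesis using c by (auto simp: e_def fun_eq_iff)
  qed
  have fd0: "ts.fdim {0}" unfolding ts.fdim_def using ts.span_zero by blast
  have T: "{b + (\<Sum>i\<in>I. \<zeta> i) | b \<zeta>. b \<in> {0} \<and> (\<forall>i\<in>I. \<zeta> i \<in> e i ` S i)} = tuples I S" (is "?T = _")
  proof
    show "?T \<subseteq> tuples I S"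
    proof
      fix x assume "x \<in> ?T"
      then obtain \<zeta> where x: "x = (\<Sum>i\<in>I. \<zeta> i)" "\<forall>i\<in>I. \<zeta> i \<in> e i ` S i" by auto
      then have "\<forall>i\<in>I. \<exists>c. c \<in> S i \<and> \<zeta> i = e i c" by blast
      from bchoice[OF this] obtain c where c: "\<And>i. i \<in> I \<Longrightarrow> c i \<in> S i" "\<And>i. i \<in> I \<Longrightarrow> \<zeta> i = e i (c i)" by blast
      have "x = (\<Sum>i\<in>I. e i (c i))" using x(1) c(2) by simp
      then have "x j = (if j \<in> I then c j else 0)" for j using esum[of c j] by simp
      then show "x \<in> tuples I S" using c(1) by (simp add: tuples_def)
    qed
    show "tuples I S \<subseteq> ?T"
    proof
      fix x assume x: "x \<in> tuples I S"
      have "x = 0 + (\<Sum>i\<in>I. e i (x i))"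
      proof
        fix j show "x j = (0 + (\<Sum>i\<in>I. e i (x i))) j" using esum[of x j] x by (auto simp: tuples_def)
      qed
      moreover have "\<forall>i\<in>I. e i (x i) \<in> e i ` S i" using x by (auto simp: tuples_def)
      ultimately show "x \<in> ?T" by blast
    qed
  qed
  have z0: "ts.dim ({0} :: ('i \<Rightarrow> 'x \<Rightarrow> 'k) set) = 0" "ts.dim (e i ` S i \<inter> {0}) = 0" for i
    using ts.dim_le_card[of "{0} :: ('i \<Rightarrow> 'x \<Rightarrow> 'k) set" "{}"] ts.dim_le_card[of "e i ` S i \<inter> {0}" "{}"] by auto
  show "ts.fdim (tuples I S)"
    using ts.dim_independent_sum(2)[where Z = "\<lambda>i. e i ` S i", OF assms(1) ts.subspace_single_0 fd0 Z(1,2) ind]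
    unfolding T by blast
  show "ts.dim (tuples I S) = (\<Sum>i\<in>I. fs.dim (S i))"
    using ts.dim_independent_sum(3)[where Z = "\<lambda>i. e i ` S i", OF assms(1) ts.subspace_single_0 fd0 Z(1,2) ind]
    unfolding T z0 using Z(3) by simp
qed

context complex
begin

text \<open>By isolation a family lies in the kernel iff each member dies under
  \<open>iota_star\<close> separately. The kernel is therefore the direct sum over \<open>v\<close>
  of \<open>Zs {v} \<inter> Bs {}\<close> modulo \<open>Bs {v}\<close>, whatever the nonzero
  coefficients are.\<close>

lemma dim_ker_f_theta:
  assumes iso: "\<And>c. (\<And>v. v \<in> V \<Longrightarrow> c v \<in> Zs {v} (int i)) \<Longrightarrow> (\<Sum>v\<in>V. c v) \<in> Bs {} (int i) \<Longrightarrow>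
      \<forall>v\<in>V. c v \<in> Bs {} (int i)"
    and t: "\<And>v. v \<in> V \<Longrightarrow> t v \<noteq> (0::'k)"
  shows "vdim (ker_f_theta t \<Delta> (int i - 1)) + (\<Sum>v\<in>V. fs.dim (Bs {v} (int i))) =
    (\<Sum>v\<in>V. fs.dim (Zs {v} (int i) \<inter> Bs {} (int i)))"
proof -
  let ?j = "int i - 1"
  define Z where "Z v = Zs {v} (int i)" for v
  define B where "B v = Bs {v} (int i)" for v
  define B0 where "B0 = Bs {} (int i)"
  have sp: "fs.subspace (Z v)" "fs.subspace (B v)" "fs.subspace B0" "B v \<subseteq> Z v" "B v \<subseteq> B0" "Z v \<subseteq> Zs {} (int i)" for v
  proof -
    show "B v \<subseteq> B0"
      unfolding B_def B0_def Bs_def by (intro image_mono) (auto simp: Cs_def fsup_def up_def)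
  qed (auto simp: Z_def B_def B0_def subspace_Zs subspace_Bs Bs_subset_Zs Zs_vertex_subset)
  have Hv: "H_vertex \<Delta> v ?j = quot_mod (fun_mod (Z v)) (B v)" for v
    unfolding H_vertex_eq by (simp add: Z_def B_def)
  have He: "H_empty \<Delta> ?j = quot_mod (fun_mod (Zs {} (int i))) B0"
    unfolding H_empty_eq by (simp add: B0_def)
  define S where "S v = Z v \<inter> B0" for v
  define T where "T = tuples V S"
  define f where "f y = (\<lambda>v\<in>V. coset_of (B v) (y v))" for y :: "'v \<Rightarrow> 'v set \<Rightarrow> 'k"
  let ?M = "ker_f_theta t \<Delta> ?j"
  have ft: "f_theta t \<Delta> ?j (f y) = coset_of B0 (\<Sum>v\<in>V. fscale (t v) (y v))" if y: "\<And>v. v \<in> V \<Longrightarrow> y v \<in> Z v" for y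
  proof -
    have iota: "iota_star \<Delta> ?j (f y v) = coset_of B0 (y v)" if v: "v \<in> V" for v
      using iota_star_coset[OF v, of "y v" ?j] y[OF v] v by (simp add: f_def Z_def B_def B0_def)
    interpret Q: vectorspace class_ring "quot_mod (fun_mod (Zs {} (int i))) B0"
      unfolding B0_def by (rule vectorspace_quot_fun_mod[OF subspace_Zs subspace_Bs Bs_subset_Zs])
    have sc: "fscale (t v) (y v) \<in> Zs {} (int i)" if v: "v \<in> V" for v
      using y[OF v] sp(6)[of v] by (intro fs.subspace_scale[OF subspace_Zs]) blast
    have "f_theta t \<Delta> ?j (f y) =
      finsum (quot_mod (fun_mod (Zs {} (int i))) B0) (\<lambda>v. coset_of B0 (fscale (t v) (y v))) V"
      unfolding f_theta_def He
    proof (rule Q.M.finsum_cong'[OF refl])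
      show "(\<lambda>v. coset_of B0 (fscale (t v) (y v))) \<in> V \<rightarrow> carrier (quot_mod (fun_mod (Zs {} (int i))) B0)"
        unfolding quot_fun_mod_simps using sc by blast
      show "t v \<odot>\<^bsub>quot_mod (fun_mod (Zs {} (int i))) B0\<^esub> iota_star \<Delta> ?j (f y v) = coset_of B0 (fscale (t v) (y v))"
        if "v \<in> V" for v
        unfolding iota[OF that] by (rule quot_fun_mod_smult[OF sp(3)])
    qed
    also have "\<dots> = coset_of B0 (\<Sum>v\<in>V. fscale (t v) (y v))"
      unfolding B0_def by (rule finsum_quot_fun_mod[OF subspace_Zs subspace_Bs Bs_subset_Zs finite_V sc])
    finally show ?thesis .
  qed
  have f0: "f_theta t \<Delta> ?j (f y) = \<zero>\<^bsub>H_empty \<Delta> ?j\<^esub> \<longleftrightarrow> (\<forall>v\<in>V. y v \<in> B0)"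
    if y: "\<And>v. v \<in> V \<Longrightarrow> y v \<in> Z v" for y
  proof -
    have "f_theta t \<Delta> ?j (f y) = \<zero>\<^bsub>H_empty \<Delta> ?j\<^esub> \<longleftrightarrow> (\<Sum>v\<in>V. fscale (t v) (y v)) \<in> B0"
      unfolding He quot_fun_mod_simps by (subst ft[of y], erule y, rule fs.coset_eq_self_iff[OF sp(3)])
    also have "\<dots> \<longleftrightarrow> (\<forall>v\<in>V. y v \<in> B0)"
    proof
      assume s: "(\<Sum>v\<in>V. fscale (t v) (y v)) \<in> B0"
      have "\<forall>v\<in>V. fscale (t v) (y v) \<in> Bs {} (int i)"
        by (rule iso) (use s y fs.subspace_scale[OF sp(1)] in \<open>auto simp: B0_def Z_def[symmetric]\<close>)
      show "\<forall>v\<in>V. y v \<in> B0"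
      proof
        fix v assume v: "v \<in> V"
        \<comment> \<open>Isolation speaks about the scaled representatives; dividing by the nonzero
          coefficient \<open>t v\<close> recovers \<open>y v\<close>.\<close>
        have "fscale (inverse (t v)) (fscale (t v) (y v)) \<in> B0"
          unfolding B0_def
          by (rule fs.subspace_scale[OF subspace_Bs])
            (use \<open>\<forall>v\<in>V. fscale (t v) (y v) \<in> Bs {} (int i)\<close> v in blast)
        moreover have "fscale (inverse (t v)) (fscale (t v) (y v)) = y v"
          using t[OF v] by (simp add: fun_eq_iff)
        ultimately show "y v \<in> B0" by simp
      qed
    next
      assume "\<forall>v\<in>V. y v \<in> B0"
      then show "(\<Sum>v\<in>V. fscale (t v) (y v)) \<in> B0"
        by (intro fs.subspace_sum[OF sp(3)] fs.subspace_scale[OF sp(3)]) blast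
    qed
    finally show ?thesis .
  qed
  have cM: "carrier ?M = {X \<in> (\<Pi>\<^sub>E v\<in>V. coset_of (B v) ` Z v). f_theta t \<Delta> ?j X = \<zero>\<^bsub>H_empty \<Delta> ?j\<^esub>}"
    by (simp add: ker_f_theta_def Let_def direct_sum_mod_def Hv quot_fun_mod_simps)
  have zM: "\<zero>\<^bsub>?M\<^esub> = (\<lambda>v\<in>V. B v)"
    by (simp add: ker_f_theta_def Let_def direct_sum_mod_def Hv quot_fun_mod_simps)
  have aM: "add ?M X Y = (\<lambda>v\<in>V. add (quot_mod (fun_mod (Z v)) (B v)) (X v) (Y v))" for X Y
    by (simp add: ker_f_theta_def Let_def direct_sum_mod_def Hv)
  have sM: "smult ?M c X = (\<lambda>v\<in>V. smult (quot_mod (fun_mod (Z v)) (B v)) c (X v))" for c X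
    by (simp add: ker_f_theta_def Let_def direct_sum_mod_def Hv)
  have sS: "fs.subspace (S v)" for v unfolding S_def by (rule fs.subspace_inter[OF sp(1) sp(3)])
  have fZ: "fs.fdim (Z v)" for v
    by (rule fs.fdim_mono[OF fdim_Cs[of "{v}" "int i"]]) (auto simp: Z_def Zs_def)
  have fS: "fs.fdim (S v)" and fB: "fs.fdim (B v)" for v
    using fs.fdim_mono[OF fZ[of v]] sp(4)[of v] by (auto simp: S_def)
  have TZ: "y v \<in> Z v" "y v \<in> B0" if "y \<in> T" "v \<in> V" for y v
    using that by (auto simp: T_def tuples_def S_def)
  have im: "f ` T = carrier ?M"
  proof (intro subset_antisym image_subsetI subsetI)
    fix y assume y: "y \<in> T"
    have "f_theta t \<Delta> ?j (f y) = \<zero>\<^bsub>H_empty \<Delta> ?j\<^esub>" using f0[of y] TZ[OF y] by blast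
    moreover have "f y \<in> (\<Pi>\<^sub>E v\<in>V. coset_of (B v) ` Z v)"
      unfolding f_def restrict_PiE_iff using TZ[OF y] by blast
    ultimately show "f y \<in> carrier ?M" unfolding cM by blast
  next
    fix X assume "X \<in> carrier ?M"
    then have X: "X \<in> (\<Pi>\<^sub>E v\<in>V. coset_of (B v) ` Z v)" "f_theta t \<Delta> ?j X = \<zero>\<^bsub>H_empty \<Delta> ?j\<^esub>"
      unfolding cM by auto
    have "\<forall>v\<in>V. \<exists>y. y \<in> Z v \<and> X v = coset_of (B v) y" using PiE_mem[OF X(1)] by blast
    from bchoice[OF this] obtain y where y: "\<And>v. v \<in> V \<Longrightarrow> y v \<in> Z v" "\<And>v. v \<in> V \<Longrightarrow> X v = coset_of (B v) (y v)"
      by blast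
    define y' where "y' v = (if v \<in> V then y v else 0)" for v
    have fy: "X = f y'"
    proof (rule PiE_ext[OF X(1)])
      show "f y' \<in> (\<Pi>\<^sub>E v\<in>V. coset_of (B v) ` Z v)"
        unfolding f_def restrict_PiE_iff using y(1) by (auto simp: y'_def)
      show "X v = f y' v" if "v \<in> V" for v using y(2)[OF that] that by (simp add: f_def y'_def)
    qed
    have "y' v \<in> Z v" if "v \<in> V" for v using y(1)[OF that] that by (simp add: y'_def)
    then have "\<forall>v\<in>V. y' v \<in> B0" using f0[of y'] X(2) fy by blast
    then have "y' \<in> T" using y(1) by (auto simp: T_def tuples_def S_def y'_def)
    then show "X \<in> f ` T" using fy by blast
  qed
  have ker: "{y \<in> T. f y = \<zero>\<^bsub>?M\<^esub>} = tuples V B"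
  proof (intro subset_antisym subsetI)
    fix y assume "y \<in> {y \<in> T. f y = \<zero>\<^bsub>?M\<^esub>}"
    then have y: "y \<in> T" "f y = (\<lambda>v\<in>V. B v)" unfolding zM by auto
    have "y v \<in> B v" if v: "v \<in> V" for v
      using fun_cong[OF y(2), of v] v by (simp add: f_def fs.coset_eq_self_iff[OF sp(2)])
    then show "y \<in> tuples V B" using y(1) unfolding T_def tuples_def by blast
  next
    fix y assume y: "y \<in> tuples V B"
    have "y v \<in> S v" if "v \<in> V" for v
      using y that sp(4)[of v] sp(5)[of v] unfolding tuples_def S_def by blast
    then have "y \<in> T" using y unfolding T_def tuples_def by blast
    moreover have "f y = (\<lambda>v\<in>V. B v)"
      unfolding f_def using y by (intro restrict_ext) (auto simp: fs.coset_eq_self_iff[OF sp(2)] tuples_def)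
    ultimately show "y \<in> {y \<in> T. f y = \<zero>\<^bsub>?M\<^esub>}" unfolding zM by blast
  qed
  have "vdim ?M + ts.dim {y \<in> T. f y = \<zero>\<^bsub>?M\<^esub>} = ts.dim T"
  proof (rule vdim_image[OF kspace_tscale _ im])
    show "ts.subspace T" unfolding T_def by (rule subspace_tuples[OF sS])
    show "ts.fdim T" unfolding T_def by (rule dim_tuples(1)[OF finite_V sS fS])
    show "f 0 = \<zero>\<^bsub>?M\<^esub>"
      unfolding zM f_def by (intro restrict_ext) (simp only: zero_fun_apply coset_of_0)
    show "f (x + y) = add ?M (f x) (f y)" for x y
      unfolding aM f_def
      by (intro restrict_ext) (simp only: restrict_apply if_True plus_fun_apply quot_fun_mod_add[OF sp(2)])
    show "f (tscale c x) = smult ?M c (f x)" for c x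
    proof -
      have e: "tscale c x v = fscale c (x v)" for v by (simp add: fun_eq_iff)
      show ?thesis
        unfolding sM f_def e
        by (intro restrict_ext) (simp only: restrict_apply if_True quot_fun_mod_smult[OF sp(2)])
    qed
  qed
  then show ?thesis
    unfolding ker unfolding T_def dim_tuples(2)[OF finite_V sS fS] dim_tuples(2)[OF finite_V sp(2) fB]
    by (simp add: S_def Z_def B_def B0_def)
qed

lemma sing_K_eq:
  assumes iso: "\<And>c. (\<And>v. v \<in> V \<Longrightarrow> c v \<in> Zs {v} (int i)) \<Longrightarrow> (\<Sum>v\<in>V. c v) \<in> Bs {} (int i) \<Longrightarrow>
      \<forall>v\<in>V. c v \<in> Bs {} (int i)"
  shows "int (sing_K TYPE('k) \<Delta> (int i - 1)) =
    (\<Sum>v\<in>V. int (fs.dim (Zs {v} (int i) \<inter> Bs {} (int i))) - int (fs.dim (Bs {v} (int i))))"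
proof -
  let ?N = "(\<Sum>v\<in>V. fs.dim (Zs {v} (int i) \<inter> Bs {} (int i))) - (\<Sum>v\<in>V. fs.dim (Bs {v} (int i)))"
  have all: "vdim (ker_f_theta t \<Delta> (int i - 1)) = ?N" if "\<forall>v\<in>V. t v \<noteq> 0" for t :: "'v \<Rightarrow> 'k"
    using dim_ker_f_theta[OF iso, of t] that by simp
  have "sing_K TYPE('k) \<Delta> (int i - 1) = ?N"
    unfolding sing_K_def
  proof (rule the_equality)
    show "\<forall>t::'v \<Rightarrow> 'k. (\<forall>v\<in>V. t v \<noteq> 0) \<longrightarrow> vdim (ker_f_theta t \<Delta> (int i - 1)) = ?N" using all by blast
    fix n assume "\<forall>t::'v \<Rightarrow> 'k. (\<forall>v\<in>V. t v \<noteq> 0) \<longrightarrow> vdim (ker_f_theta t \<Delta> (int i - 1)) = n"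
    \<comment> \<open>The coefficients that are all 1 are admissible, so the universally quantified
      condition determines \<open>n\<close>.\<close>
    then have "vdim (ker_f_theta (\<lambda>_. 1 :: 'k) \<Delta> (int i - 1)) = n" by simp
    then show "n = ?N" using all[of "\<lambda>_. 1"] by simp
  qed
  moreover have "(\<Sum>v\<in>V. fs.dim (Bs {v} (int i))) \<le> (\<Sum>v\<in>V. fs.dim (Zs {v} (int i) \<inter> Bs {} (int i)))"
    using dim_ker_f_theta[OF iso, of "\<lambda>_. 1"] by simp
  ultimately show ?thesis by (simp add: of_nat_diff sum_subtractf)
qed

end

section \<open>The h-vector\<close>

definition fmons :: "'v set \<Rightarrow> nat \<Rightarrow> ('v \<Rightarrow>\<^sub>0 nat) set"
  where "fmons F e = {m. Poly_Mapping.keys m = F \<and> pdeg m = e}"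

lemma finite_fmons: "finite F \<Longrightarrow> finite (fmons F e)"
  by (rule finite_subset[OF _ finite_monomials[of F e]]) (auto simp: fmons_def)

text \<open>Dividing such a monomial by the variable \<open>v\<close> either removes
  \<open>v\<close> from its support or keeps the support.\<close>

lemma card_fmons_insert:
  fixes F :: "'v set"
  assumes F: "finite F" "v \<notin> F"
  shows "card (fmons (insert v F) (Suc e)) = card (fmons F e) + card (fmons (insert v F) e)"
proof -
  have inj: "inj_on (\<lambda>m. m + xv v) A" for A :: "('v \<Rightarrow>\<^sub>0 nat) set" by (rule inj_onI) simp
  have eq: "fmons (insert v F) (Suc e) = (\<lambda>m. m + xv v) ` (fmons F e \<union> fmons (insert v F) e)"
  proof (intro subset_antisym subsetI)
    fix m assume "m \<in> fmons (insert v F) (Suc e)"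
    then have m: "Poly_Mapping.keys m = insert v F" "pdeg m = Suc e" by (auto simp: fmons_def)
    have v: "v \<in> Poly_Mapping.keys m" using m by simp
    have "Poly_Mapping.keys (m - xv v) \<union> {v} = insert v F"
      using minus_xv_plus[OF v] keys_plus_nat[of "m - xv v" "xv v"] m(1) by simp
    then have "Poly_Mapping.keys (m - xv v) = F \<or> Poly_Mapping.keys (m - xv v) = insert v F"
      using F(2) by auto
    moreover have "pdeg (m - xv v) = e" using pdeg_minus_xv[OF v] m(2) by simp
    ultimately have "m - xv v \<in> fmons F e \<union> fmons (insert v F) e" by (auto simp: fmons_def)
    then show "m \<in> (\<lambda>m. m + xv v) ` (fmons F e \<union> fmons (insert v F) e)"
      using minus_xv_plus[OF v] by (metis image_eqI)
  next
    fix m assume "m \<in> (\<lambda>m. m + xv v) ` (fmons F e \<union> fmons (insert v F) e)"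
    then obtain n where n: "m = n + xv v" "n \<in> fmons F e \<or> n \<in> fmons (insert v F) e" by blast
    then have "Poly_Mapping.keys n \<union> {v} = insert v F" "pdeg n = e" by (auto simp: fmons_def)
    then show "m \<in> fmons (insert v F) (Suc e)"
      unfolding n(1) fmons_def by (simp add: keys_plus_nat pdeg_plus)
  qed
  have "fmons F e \<inter> fmons (insert v F) e = {}" using F(2) by (auto simp: fmons_def)
  then show ?thesis
    unfolding eq card_image[OF inj] using F(1) by (intro card_Un_disjoint) (auto simp: finite_fmons)
qed

text \<open>Monomials with support exactly \<open>F\<close> have the generating function
  \<open>(X / (1 - X)) ^ card F\<close>, stated without denominators.\<close>

lemma fps_fmons:
  assumes "finite F"
  shows "(1 - fps_X) ^ card F * Abs_fps (\<lambda>e. int (card (fmons F e))) = fps_X ^ card F"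
  using assms
proof (induction F rule: finite_induct)
  case empty
  have "fmons {} e = (if e = 0 then {0 :: 'a \<Rightarrow>\<^sub>0 nat} else {})" for e
    by (auto simp: fmons_def)
  then have "Abs_fps (\<lambda>e. int (card (fmons ({} :: 'a set) e))) = 1" by (intro fps_ext) simp
  then show ?case by simp
next
  case (insert v F)
  let ?A = "\<lambda>F. Abs_fps (\<lambda>e. int (card (fmons F e)))"
  have "(1 - fps_X) * ?A (insert v F) = fps_X * ?A F"
  proof (rule fps_ext)
    fix n
    have "fmons (insert v F) 0 = {}" by (auto simp: fmons_def)
    then show "fps_nth ((1 - fps_X) * ?A (insert v F)) n = fps_nth (fps_X * ?A F) n"
      using card_fmons_insert[OF insert(1,2)]
      by (cases n) (simp_all add: left_diff_distrib)
  qed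
  then have "(1 - fps_X) ^ card F * ((1 - fps_X) * ?A (insert v F)) = fps_X * ((1 - fps_X) ^ card F * ?A F)"
    by (simp only: mult.left_commute)
  then show ?case using insert by (simp add: mult_ac)
qed

lemma fps_one_minus_X_power: "fps_nth ((1 - fps_X) ^ n) p = (-1) ^ p * int (n choose p)"
proof (induction n arbitrary: p)
  case 0
  then show ?case by (cases p) simp_all
next
  case (Suc n)
  have "fps_nth ((1 - fps_X) ^ Suc n) p = fps_nth ((1 - fps_X) ^ n - fps_X * (1 - fps_X) ^ n :: int fps) p"
    by (simp add: algebra_simps)
  then show ?case using Suc by (cases p) (simp_all add: algebra_simps)
qed

text \<open>The left side is a coefficient of \<open>(1 - X) ^ d\<close> times the generating
  function for \<open>F\<close>, and this product is \<open>X ^ card F\<close> times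
  \<open>(1 - X) ^ (d - card F)\<close>.\<close>

lemma sum_fmons:
  assumes F: "finite F" "card F \<le> d"
  shows "(\<Sum>p=0..i. (-1) ^ p * int (d choose p) * int (card (fmons F (i - p)))) =
    (if card F \<le> i then (-1) ^ (i - card F) * int ((d - card F) choose (i - card F)) else 0)"
proof -
  let ?A = "Abs_fps (\<lambda>e. int (card (fmons F e)))"
  have "(\<Sum>p=0..i. (-1) ^ p * int (d choose p) * int (card (fmons F (i - p)))) = fps_nth ((1 - fps_X) ^ d * ?A) i"
    unfolding fps_mult_nth fps_one_minus_X_power by simp
  also have "(1 - fps_X) ^ d * ?A = (1 - fps_X) ^ (d - card F) * ((1 - fps_X) ^ card F * ?A)"
    using F(2) by (simp add: mult.assoc[symmetric] power_add[symmetric])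
  also have "fps_nth \<dots> i = (if card F \<le> i then (-1) ^ (i - card F) * int ((d - card F) choose (i - card F)) else 0)"
    unfolding fps_fmons[OF F(1)] fps_X_power_mult_right_nth fps_one_minus_X_power by simp
  finally show ?thesis .
qed

context complex
begin

lemma card_monomials_Delta:
  "card {m. Poly_Mapping.keys m \<in> \<Delta> \<and> pdeg m = e} = (\<Sum>F\<in>\<Delta>. card (fmons F e))"
proof -
  have "{m. Poly_Mapping.keys m \<in> \<Delta> \<and> pdeg m = e} = (\<Union>F\<in>\<Delta>. fmons F e)" by (auto simp: fmons_def)
  then show ?thesis
    by (simp only:) (intro card_UN_disjoint finite_Delta ballI finite_fmons finite_face impI, auto simp: fmons_def)
qed

lemma euler_sum_faces:
  assumes dF: "\<And>F. F \<in> \<Delta> \<Longrightarrow> card F \<le> d"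
  shows "(\<Sum>p=0..i+1. (-1) ^ p * int ((d choose p) * card {m. Poly_Mapping.keys m \<in> \<Delta> \<and> p + pdeg m = i})) =
    (\<Sum>F\<in>\<Delta>. if card F \<le> i then (-1) ^ (i - card F) * int ((d - card F) choose (i - card F)) else 0)"
proof -
  have c: "{m. Poly_Mapping.keys m \<in> \<Delta> \<and> p + pdeg m = i} = {m. Poly_Mapping.keys m \<in> \<Delta> \<and> pdeg m = i - p}"
    if "p \<le> i" for p using that by auto
  have "(\<Sum>p=0..i+1. (-1) ^ p * int ((d choose p) * card {m. Poly_Mapping.keys m \<in> \<Delta> \<and> p + pdeg m = i})) =
    (\<Sum>p=0..i. (-1) ^ p * int ((d choose p) * card {m. Poly_Mapping.keys m \<in> \<Delta> \<and> p + pdeg m = i}))"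
    by simp
  also have "\<dots> = (\<Sum>p=0..i. \<Sum>F\<in>\<Delta>. (-1) ^ p * int (d choose p) * int (card (fmons F (i - p))))"
    by (intro sum.cong) (simp_all add: c card_monomials_Delta sum_distrib_left mult.assoc)
  also have "\<dots> = (\<Sum>F\<in>\<Delta>. \<Sum>p=0..i. (-1) ^ p * int (d choose p) * int (card (fmons F (i - p))))"
    by (rule sum.swap)
  also have "\<dots> = (\<Sum>F\<in>\<Delta>. if card F \<le> i then (-1) ^ (i - card F) * int ((d - card F) choose (i - card F)) else 0)"
    by (intro sum.cong refl sum_fmons dF finite_face)
  finally show ?thesis .
qed

text \<open>Summed over the faces, the generating functions of \<open>sum_fmons\<close> give the
  polynomial that defines the h-vector. Above degree \<open>d\<close> every summand vanishes,
  whereas the subtractions in \<open>h_vec\<close> truncate there; hence the case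
  distinction.\<close>

lemma h_vec_euler:
  assumes dF: "\<And>F. F \<in> \<Delta> \<Longrightarrow> card F \<le> d" and dim: "sc_dim \<Delta> = int d - 1"
  shows "(\<Sum>p=0..i+1. (-1) ^ p * int ((d choose p) * card {m. Poly_Mapping.keys m \<in> \<Delta> \<and> p + pdeg m = i})) =
    (if i \<le> d then h_vec \<Delta> i else 0)"
proof (cases "i \<le> d")
  case False
  have "(\<Sum>F\<in>\<Delta>. if card F \<le> i then (-1) ^ (i - card F) * int ((d - card F) choose (i - card F)) else 0) = (0 :: int)"
  proof (intro sum.neutral ballI)
    fix F assume "F \<in> \<Delta>"
    then have "d - card F < i - card F" using dF[of F] False by linarith
    then show "(if card F \<le> i then (-1) ^ (i - card F) * int ((d - card F) choose (i - card F)) else 0) = 0"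
      by (simp add: binomial_eq_0)
  qed
  then show ?thesis using False euler_sum_faces[OF dF, of i] by (simp only: if_False)
next
  case True
  let ?g = "\<lambda>j. (-1) ^ (i - j) * int ((d - j) choose (i - j))"
  have "(\<Sum>F\<in>\<Delta>. if card F \<le> i then ?g (card F) else 0) = (\<Sum>F\<in>{F\<in>\<Delta>. card F \<le> i}. ?g (card F))"
    using finite_Delta by (subst sum.inter_filter) auto
  also have "\<dots> = (\<Sum>j\<in>{0..i}. \<Sum>F\<in>{F \<in> {F\<in>\<Delta>. card F \<le> i}. card F = j}. ?g (card F))"
    using finite_Delta by (intro sum.group[symmetric]) auto
  also have "\<dots> = (\<Sum>j\<in>{0..i}. ?g j * int (card {F \<in> \<Delta>. card F = j}))"
  proof (intro sum.cong refl)
    fix j assume "j \<in> {0..i}"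
    then have "{F \<in> {F\<in>\<Delta>. card F \<le> i}. card F = j} = {F \<in> \<Delta>. card F = j}" by auto
    then show "(\<Sum>F\<in>{F \<in> {F\<in>\<Delta>. card F \<le> i}. card F = j}. ?g (card F)) = ?g j * int (card {F \<in> \<Delta>. card F = j})"
      by simp
  qed
  also have "\<dots> = h_vec \<Delta> i" using dim by (simp add: h_vec_def)
  finally show ?thesis using True euler_sum_faces[OF dF, of i] by (simp only: if_True)
qed

end

section \<open>The Stanley--Reisner ring\<close>

abbreviation pscale :: "'k::field \<Rightarrow> (('v \<Rightarrow>\<^sub>0 nat) \<Rightarrow>\<^sub>0 'k) \<Rightarrow> ('v \<Rightarrow>\<^sub>0 nat) \<Rightarrow>\<^sub>0 'k"
  where "pscale c p \<equiv> Poly_Mapping.single 0 c * p"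

lemma kspace_pscale: "kspace (pscale :: 'k::field \<Rightarrow> (('v \<Rightarrow>\<^sub>0 nat) \<Rightarrow>\<^sub>0 'k) \<Rightarrow> _)"
  by unfold_locales (simp_all add: distrib_left distrib_right single_add mult_single mult.assoc[symmetric])

interpretation ps: kspace "pscale :: 'k::field \<Rightarrow> (('v \<Rightarrow>\<^sub>0 nat) \<Rightarrow>\<^sub>0 'k) \<Rightarrow> _"
  by (rule kspace_pscale)

lemma poly_mapping_sum_single:
  fixes p :: "'a \<Rightarrow>\<^sub>0 'b::comm_monoid_add"
  shows "p = (\<Sum>m\<in>Poly_Mapping.keys p. Poly_Mapping.single m (Poly_Mapping.lookup p m))"
proof (rule poly_mapping_eqI)
  fix n
  have "(\<Sum>m\<in>Poly_Mapping.keys p. Poly_Mapping.lookup (Poly_Mapping.single m (Poly_Mapping.lookup p m)) n) =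
    (\<Sum>m\<in>Poly_Mapping.keys p. if m = n then Poly_Mapping.lookup p n else 0)"
    by (intro sum.cong) (auto simp: lookup_single when_def)
  then show "Poly_Mapping.lookup p n =
    Poly_Mapping.lookup (\<Sum>m\<in>Poly_Mapping.keys p. Poly_Mapping.single m (Poly_Mapping.lookup p m)) n"
    by (simp add: lookup_sum in_keys_iff)
qed

lemma lookup_mult_single_xv:
  "Poly_Mapping.lookup (q * Poly_Mapping.single (xv v) c) m =
    (if v \<in> Poly_Mapping.keys m then Poly_Mapping.lookup q (m - xv v) * (c::'k::field) else 0)"
proof -
  have "q * Poly_Mapping.single (xv v) c =
    (\<Sum>n\<in>Poly_Mapping.keys q. Poly_Mapping.single (n + xv v) (Poly_Mapping.lookup q n * c))"
    by (subst poly_mapping_sum_single[of q]) (simp add: sum_distrib_right mult_single)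
  then have "Poly_Mapping.lookup (q * Poly_Mapping.single (xv v) c) m =
    (\<Sum>n\<in>Poly_Mapping.keys q. if n + xv v = m then Poly_Mapping.lookup q n * c else 0)"
    by (simp add: lookup_sum lookup_single when_def)
  also have "\<dots> = (if v \<in> Poly_Mapping.keys m then Poly_Mapping.lookup q (m - xv v) * c else 0)"
  proof (cases "v \<in> Poly_Mapping.keys m")
    case True
    have "n + xv v = m \<longleftrightarrow> n = m - xv v" for n using minus_xv_plus[OF True] by auto
    then show ?thesis using True by (simp add: in_keys_iff)
  next
    case False
    then have "n + xv v \<noteq> m" for n using keys_xv_mem[of v n] by blast
    then show ?thesis using False by simp
  qed
  finally show ?thesis .
qed

lemma poly_alg_simps [simp]:
  "zero (poly_alg V) = 0" "one (poly_alg V) = 1" "mult (poly_alg V) p q = p * q"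
  "add (poly_alg V) p q = p + q" "smult (poly_alg V) c p = pscale c p"
  by (simp_all add: poly_alg_def)

lemma poly_alg_carrier: "p \<in> carrier (poly_alg V) \<longleftrightarrow> (\<forall>m\<in>Poly_Mapping.keys p. Poly_Mapping.keys m \<subseteq> V)"
  by (simp add: poly_alg_def)

lemma poly_alg_mult:
  "p \<in> carrier (poly_alg V) \<Longrightarrow> q \<in> carrier (poly_alg V) \<Longrightarrow> p * q \<in> carrier (poly_alg V)"
  unfolding poly_alg_carrier using keys_mult[of p q] by (fastforce simp: keys_plus_nat)

lemma subspace_poly_alg: "ps.subspace (carrier (poly_alg V))"
  unfolding ps.subspace_def
proof (intro conjI ballI allI)
  show "0 \<in> carrier (poly_alg V)" by (simp add: poly_alg_carrier)
  show "x + y \<in> carrier (poly_alg V)" if "x \<in> carrier (poly_alg V)" "y \<in> carrier (poly_alg V)" for x y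
    using that keys_add[of x y] unfolding poly_alg_carrier by blast
  show "pscale c x \<in> carrier (poly_alg V)" if "x \<in> carrier (poly_alg V)" for c x
    by (rule poly_alg_mult[OF _ that]) (simp add: poly_alg_carrier)
qed

lemma poly_alg_one: "1 \<in> carrier (poly_alg V)" by (simp add: poly_alg_carrier)

lemma cring_poly_alg: "cring (poly_alg V :: ('k::field, ('v \<Rightarrow>\<^sub>0 nat) \<Rightarrow>\<^sub>0 'k) module)"
proof (rule cringI)
  have "vectorspace class_ring (poly_alg V :: ('k, ('v \<Rightarrow>\<^sub>0 nat) \<Rightarrow>\<^sub>0 'k) module)"
    by (rule vectorspace_image[OF kspace_pscale subspace_poly_alg, where f = id]) simp_all
  then show "abelian_group (poly_alg V :: ('k, ('v \<Rightarrow>\<^sub>0 nat) \<Rightarrow>\<^sub>0 'k) module)"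
    by (simp add: vectorspace_def module_def)
  show "Group.comm_monoid (poly_alg V :: ('k, ('v \<Rightarrow>\<^sub>0 nat) \<Rightarrow>\<^sub>0 'k) module)"
    by (rule comm_monoidI) (simp_all add: poly_alg_mult poly_alg_one mult.assoc mult.commute)
qed (simp add: distrib_right)

section \<open>The Stanley-Reisner ideal by monomials\<close>

definition nonfaces :: "'v set set \<Rightarrow> (('v \<Rightarrow>\<^sub>0 nat) \<Rightarrow>\<^sub>0 'k::field) set"
  where "nonfaces \<Delta> = {p \<in> carrier (poly_alg (\<Union>\<Delta>)). \<forall>m\<in>Poly_Mapping.keys p. Poly_Mapping.keys m \<notin> \<Delta>}"

lemma nonfaces_iff: "p \<in> carrier (poly_alg (\<Union>\<Delta>)) \<Longrightarrow>
    p \<in> nonfaces \<Delta> \<longleftrightarrow> (\<forall>m. Poly_Mapping.keys m \<in> \<Delta> \<longrightarrow> Poly_Mapping.lookup p m = 0)"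
  by (auto simp: nonfaces_def in_keys_iff)

lemma prod_PVar: "finite F \<Longrightarrow> (\<Prod>v\<in>F. PVar v) = Poly_Mapping.single (\<Sum>v\<in>F. xv v) (1::'k::field)"
  by (induction F rule: finite_induct) (simp_all add: PVar_def xv_def mult_single)

lemma lookup_sum_xv: "finite F \<Longrightarrow> Poly_Mapping.lookup (\<Sum>v\<in>F. xv v) u = (if u \<in> F then 1 else 0)"
  by (simp add: lookup_sum)

context complex
begin

abbreviation R :: "('k, ('v \<Rightarrow>\<^sub>0 nat) \<Rightarrow>\<^sub>0 'k) module" where "R \<equiv> poly_alg V"
abbreviation NF :: "(('v \<Rightarrow>\<^sub>0 nat) \<Rightarrow>\<^sub>0 'k) set" where "NF \<equiv> nonfaces \<Delta>"

lemma NF_mult: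
  assumes "p \<in> NF" "q \<in> carrier R"
  shows "p * q \<in> NF"
proof -
  have "Poly_Mapping.keys m \<notin> \<Delta>" if m: "m \<in> Poly_Mapping.keys (p * q)" for m
  proof
    assume f: "Poly_Mapping.keys m \<in> \<Delta>"
    obtain m1 m2 where "m = m1 + m2" "m1 \<in> Poly_Mapping.keys p" using keys_mult[of p q] m by blast
    then show False using face_subset[OF f, of "Poly_Mapping.keys m1"] assms(1)
      by (auto simp: keys_plus_nat nonfaces_def)
  qed
  then show ?thesis using poly_alg_mult[of p V q] assms by (auto simp: nonfaces_def)
qed

lemma subspace_NF: "ps.subspace NF"
  unfolding ps.subspace_def
proof (intro conjI ballI allI)
  show "0 \<in> NF" by (simp add: nonfaces_def poly_alg_carrier)
  show "x + y \<in> NF" if "x \<in> NF" "y \<in> NF" for x y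
    using that keys_add[of x y] by (fastforce simp: nonfaces_def poly_alg_carrier)
  show "pscale c x \<in> NF" if "x \<in> NF" for c x
    using NF_mult[OF that, of "Poly_Mapping.single 0 c"] by (simp add: poly_alg_carrier mult.commute)
qed

lemma NF_carrier: "p \<in> NF \<Longrightarrow> p \<in> carrier R" by (simp add: nonfaces_def)

text \<open>One criterion for two ideals: with \<open>f = id\<close> for the span of the nonface
  monomials in the polynomial ring, and with \<open>f\<close> the coset map for the ideal of the
  forms in the face ring.\<close>

lemma ideal_subspaceI:
  fixes M :: "('k, 'c, 'z) module_scheme" and f :: "(('v \<Rightarrow>\<^sub>0 nat) \<Rightarrow>\<^sub>0 'k) \<Rightarrow> 'c"
  assumes M: "cring M" and f: "\<And>p. p \<in> carrier R \<Longrightarrow> f p \<in> carrier M"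
    and zero: "f 0 = \<zero>\<^bsub>M\<^esub>"
    and add: "\<And>p q. p \<in> carrier R \<Longrightarrow> q \<in> carrier R \<Longrightarrow> f (p + q) = f p \<oplus>\<^bsub>M\<^esub> f q"
    and J: "ps.subspace J" "J \<subseteq> carrier R"
    and mult: "\<And>p x. p \<in> J \<Longrightarrow> x \<in> carrier M \<Longrightarrow> f p \<otimes>\<^bsub>M\<^esub> x \<in> f ` J"
  shows "ideal (f ` J) M"
proof (rule idealI)
  interpret M: cring M by fact
  show "ring M" by (rule M.ring_axioms)
  have c: "f p \<in> carrier M" if "p \<in> J" for p using that f J(2) by blast
  show "subgroup (f ` J) (add_monoid M)"
  proof
    show "f ` J \<subseteq> carrier (add_monoid M)" using c by auto
    show "x \<otimes>\<^bsub>add_monoid M\<^esub> y \<in> f ` J" if xy: "x \<in> f ` J" "y \<in> f ` J" for x y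
    proof -
      obtain p q where p: "p \<in> J" "x = f p" and q: "q \<in> J" "y = f q" using xy by blast
      have "f (p + q) = x \<oplus>\<^bsub>M\<^esub> y" using p q J(2) by (simp add: add subsetD)
      then show ?thesis using ps.subspace_add[OF J(1) p(1) q(1)] by (metis imageI monoid.simps(1))
    qed
    show "\<one>\<^bsub>add_monoid M\<^esub> \<in> f ` J" using ps.subspace_0[OF J(1)] zero by (metis imageI monoid.simps(2))
    show "inv\<^bsub>add_monoid M\<^esub> x \<in> f ` J" if xJ: "x \<in> f ` J" for x
    proof -
      obtain p where p: "p \<in> J" "x = f p" using xJ by blast
      have n: "- p \<in> J" using ps.subspace_neg[OF J(1) p(1)] .
      have "f (- p) \<oplus>\<^bsub>M\<^esub> f p = \<zero>\<^bsub>M\<^esub>" using add[of "- p" p] n p(1) J(2) zero by (simp add: subsetD)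
      then have "\<ominus>\<^bsub>M\<^esub> x = f (- p)" using M.minus_equality[OF _ c[OF p(1)] c[OF n]] p(2) by simp
      then show ?thesis using n by (simp add: a_inv_def)
    qed
  qed
  show "x \<otimes>\<^bsub>M\<^esub> y \<in> f ` J" if "x \<in> f ` J" "y \<in> carrier M" for x y using that mult by blast
  then show "y \<otimes>\<^bsub>M\<^esub> x \<in> f ` J" if "x \<in> f ` J" "y \<in> carrier M" for x y
    using that c M.m_comm[of x y] by (metis (no_types, lifting) image_iff)
qed

text \<open>A monomial whose support is not a face is divisible by the squarefree monomial of that
  support, which is one of the generators.\<close>

lemma SR_ideal_eq: "SR_ideal \<Delta> = NF"
proof (rule subset_antisym)
  interpret R: cring R by (rule cring_poly_alg)
  let ?S = "{\<Prod>v\<in>F. PVar v | F. F \<subseteq> V \<and> F \<notin> \<Delta>} :: (('v \<Rightarrow>\<^sub>0 nat) \<Rightarrow>\<^sub>0 'k) set"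
  have id: "ideal (id ` NF) R"
    by (rule ideal_subspaceI[OF cring_poly_alg _ _ _ subspace_NF]) (auto simp: NF_mult NF_carrier)
  have "?S \<subseteq> NF"
  proof
    fix p :: "('v \<Rightarrow>\<^sub>0 nat) \<Rightarrow>\<^sub>0 'k" assume "p \<in> ?S"
    then obtain F where F: "p = (\<Prod>v\<in>F. PVar v)" "F \<subseteq> V" "F \<notin> \<Delta>" by blast
    have fin: "finite F" using F(2) finite_V by (rule finite_subset)
    have "Poly_Mapping.keys (\<Sum>v\<in>F. xv v) = F" by (auto simp: in_keys_iff lookup_sum_xv[OF fin] split: if_splits)
    then show "p \<in> NF" unfolding F(1) prod_PVar[OF fin] using F by (simp add: nonfaces_def poly_alg_carrier)
  qed
  then show "SR_ideal \<Delta> \<subseteq> NF" unfolding SR_ideal_def using R.genideal_minimal[OF id] by simp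
  show "NF \<subseteq> SR_ideal \<Delta>"
    unfolding SR_ideal_def genideal_def
  proof (rule Inter_greatest)
    fix I :: "(('v \<Rightarrow>\<^sub>0 nat) \<Rightarrow>\<^sub>0 'k) set" assume "I \<in> {I. ideal I R \<and> ?S \<subseteq> I}"
    then have I: "ideal I R" "?S \<subseteq> I" by auto
    interpret I: ideal I R by (rule I(1))
    have sum: "(\<Sum>x\<in>A. f x) \<in> I" if "finite A" "\<And>x. x \<in> A \<Longrightarrow> f x \<in> I" for f and A :: "('v \<Rightarrow>\<^sub>0 nat) set"
      using that
    proof (induction A rule: finite_induct)
      case empty
      then show ?case using I.zero_closed by simp
    next
      case (insert x A)
      then show ?case using I.a_closed[of "f x" "sum f A"] by simp
    qed
    show "NF \<subseteq> I"
    proof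
      fix p assume p: "p \<in> NF"
      have "Poly_Mapping.single m (Poly_Mapping.lookup p m) \<in> I" if m: "m \<in> Poly_Mapping.keys p" for m
      proof -
        let ?F = "Poly_Mapping.keys m" and ?c = "Poly_Mapping.lookup p m"
        have F: "?F \<subseteq> V" "?F \<notin> \<Delta>" using p m by (auto simp: nonfaces_def poly_alg_carrier)
        have "(\<Prod>v\<in>?F. PVar v) \<in> ?S" using F by blast
        then have "(\<Prod>v\<in>?F. PVar v :: ('v \<Rightarrow>\<^sub>0 nat) \<Rightarrow>\<^sub>0 'k) \<in> I" using I(2) by blast
        moreover have "Poly_Mapping.single (m - (\<Sum>v\<in>?F. xv v)) ?c \<in> carrier R"
          using keys_minus_subset[of m "\<Sum>v\<in>?F. xv v"] F(1) by (auto simp: poly_alg_carrier)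
        ultimately have "Poly_Mapping.single (m - (\<Sum>v\<in>?F. xv v)) ?c * (\<Prod>v\<in>?F. PVar v) \<in> I"
          using I.I_l_closed by simp
        moreover have "m - (\<Sum>v\<in>?F. xv v) + (\<Sum>v\<in>?F. xv v) = m"
          by (rule poly_mapping_eqI) (auto simp: lookup_add lookup_minus lookup_sum_xv in_keys_iff)
        ultimately show ?thesis by (simp add: prod_PVar mult_single)
      qed
      then have "(\<Sum>m\<in>Poly_Mapping.keys p. Poly_Mapping.single m (Poly_Mapping.lookup p m)) \<in> I"
        by (intro sum) simp_all
      then show "p \<in> I" using poly_mapping_sum_single[of p] by simp
    qed
  qed
qed

section \<open>The Stanley-Reisner ring\<close>

abbreviation SR :: "('k, (('v \<Rightarrow>\<^sub>0 nat) \<Rightarrow>\<^sub>0 'k) set) module" where "SR \<equiv> SR_ring \<Delta>"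
abbreviation C :: "(('v \<Rightarrow>\<^sub>0 nat) \<Rightarrow>\<^sub>0 'k) \<Rightarrow> (('v \<Rightarrow>\<^sub>0 nat) \<Rightarrow>\<^sub>0 'k) set" where "C \<equiv> coset_of NF"

lemma a_r_coset_poly_alg: "B +>\<^bsub>R\<^esub> p = coset_of B p"
  unfolding a_r_coset_def' coset_of_def by auto

lemma SR_eq: "SR = \<lparr>carrier = C ` carrier R, mult = rcoset_mult R NF, one = C 1, zero = NF, add = set_add R,
    smult = (\<lambda>c X. \<Union>x\<in>X. C (pscale c x))\<rparr>"
  by (auto simp: SR_ring_def quot_mod_def SR_ideal_eq A_RCOSETS_def' a_r_coset_poly_alg)

lemma SR_carrier: "carrier SR = C ` carrier R" and SR_zero: "\<zero>\<^bsub>SR\<^esub> = NF" and SR_one: "\<one>\<^bsub>SR\<^esub> = C 1"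
  unfolding SR_eq by simp_all

lemma SR_add: "C p \<oplus>\<^bsub>SR\<^esub> C q = C (p + q)"
proof -
  have "set_add R (C p) (C q) = {u + w | u w. u \<in> C p \<and> w \<in> C q}" unfolding set_add_def' by auto
  then show ?thesis using ps.coset_add[OF subspace_NF] by (simp add: SR_eq)
qed

lemma SR_smult: "c \<odot>\<^bsub>SR\<^esub> C p = C (pscale c p)"
  using ps.coset_scale[OF subspace_NF] by (simp add: SR_eq)

lemma SR_mult:
  assumes "p \<in> carrier R" "q \<in> carrier R"
  shows "C p \<otimes>\<^bsub>SR\<^esub> C q = C (p * q)"
proof -
  have "ideal (id ` NF) R"
    by (rule ideal_subspaceI[OF cring_poly_alg _ _ _ subspace_NF]) (auto simp: NF_mult NF_carrier)
  then interpret ideal NF R by simp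
  show ?thesis using rcoset_mult_add[of p q] assms by (simp add: SR_eq a_r_coset_poly_alg)
qed

lemma cring_SR: "cring SR"
proof (rule cringI)
  have ex: "\<exists>p\<in>carrier R. X = C p" if "X \<in> carrier SR" for X using that by (auto simp: SR_carrier)
  have mem: "C p \<in> carrier SR" if "p \<in> carrier R" for p using that by (auto simp: SR_carrier)
  have pl: "p + q \<in> carrier R" if "p \<in> carrier R" "q \<in> carrier R" for p q :: "('v \<Rightarrow>\<^sub>0 nat) \<Rightarrow>\<^sub>0 'k"
    using ps.subspace_add[OF subspace_poly_alg] that by blast
  have "vectorspace class_ring SR"
    by (rule vectorspace_image[OF kspace_pscale subspace_poly_alg, of C])
      (simp_all add: SR_carrier SR_zero coset_of_0 SR_add SR_smult)
  then show "abelian_group SR" by (simp add: vectorspace_def module_def)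
  show "Group.comm_monoid SR"
  proof (rule comm_monoidI)
    fix x y assume "x \<in> carrier SR" "y \<in> carrier SR"
    then obtain p q where p: "p \<in> carrier R" "x = C p" and q: "q \<in> carrier R" "y = C q" using ex by metis
    show "x \<otimes>\<^bsub>SR\<^esub> y \<in> carrier SR" using p q mem[OF poly_alg_mult] by (simp add: SR_mult)
    show "x \<otimes>\<^bsub>SR\<^esub> y = y \<otimes>\<^bsub>SR\<^esub> x" using p q by (simp add: SR_mult mult.commute)
  next
    show "\<one>\<^bsub>SR\<^esub> \<in> carrier SR" unfolding SR_one by (rule mem[OF poly_alg_one])
  next
    fix x y z assume "x \<in> carrier SR" "y \<in> carrier SR" "z \<in> carrier SR"
    then obtain p q r where "p \<in> carrier R" "x = C p" "q \<in> carrier R" "y = C q" "r \<in> carrier R" "z = C r"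
      using ex by metis
    then show "x \<otimes>\<^bsub>SR\<^esub> y \<otimes>\<^bsub>SR\<^esub> z = x \<otimes>\<^bsub>SR\<^esub> (y \<otimes>\<^bsub>SR\<^esub> z)"
      by (simp add: SR_mult poly_alg_mult mult.assoc)
  next
    fix x assume "x \<in> carrier SR"
    then obtain p where "p \<in> carrier R" "x = C p" using ex by metis
    then show "\<one>\<^bsub>SR\<^esub> \<otimes>\<^bsub>SR\<^esub> x = x" by (simp add: SR_one SR_mult poly_alg_one)
  qed
  fix x y z assume "x \<in> carrier SR" "y \<in> carrier SR" "z \<in> carrier SR"
  then obtain p q r where "p \<in> carrier R" "x = C p" "q \<in> carrier R" "y = C q" "r \<in> carrier R" "z = C r"
    using ex by metis
  then show "(x \<oplus>\<^bsub>SR\<^esub> y) \<otimes>\<^bsub>SR\<^esub> z = x \<otimes>\<^bsub>SR\<^esub> z \<oplus>\<^bsub>SR\<^esub> y \<otimes>\<^bsub>SR\<^esub> z"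
    by (simp add: SR_mult SR_add pl distrib_right)
qed

end

text \<open>The \<open>pk k\<close> are representatives in the polynomial ring of the given forms,
  and \<open>a v\<close> lists the coefficients of the variable \<open>v\<close> in them. Setting
  \<open>a v k\<close> to zero beyond \<open>d\<close> puts \<open>a v\<close> into
  \<open>fsup {..<d}\<close>.\<close>

locale linear_forms = complex \<Delta> d a
  for \<Delta> :: "'v::linorder set set" and d :: nat and a :: "'v \<Rightarrow> nat \<Rightarrow> 'k::field" +
  fixes pk :: "nat \<Rightarrow> ('v \<Rightarrow>\<^sub>0 nat) \<Rightarrow>\<^sub>0 'k"
  assumes pk: "\<And>k. k < d \<Longrightarrow> pk k \<in> homogeneous V 1"
    and a_eq: "\<And>v k. a v k = (if k < d then Poly_Mapping.lookup (pk k) (xv v) else 0)"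
begin

lemma pk_carrier: "k < d \<Longrightarrow> pk k \<in> carrier R"
  using pk by (simp add: homogeneous_def)

lemma pk_sum:
  assumes k: "k < d"
  shows "pk k = (\<Sum>v\<in>V. Poly_Mapping.single (xv v) (a v k))"
proof (rule poly_mapping_eqI)
  fix m
  have e: "Poly_Mapping.lookup (\<Sum>v\<in>V. Poly_Mapping.single (xv v) (a v k)) m =
    (\<Sum>v\<in>V. if xv v = m then Poly_Mapping.lookup (pk k) m else 0)"
    unfolding lookup_sum using k by (intro sum.cong) (auto simp: lookup_single when_def a_eq)
  show "Poly_Mapping.lookup (pk k) m = Poly_Mapping.lookup (\<Sum>v\<in>V. Poly_Mapping.single (xv v) (a v k)) m"
  proof (cases "\<exists>v\<in>V. xv v = m")
    case True
    then obtain v where v: "v \<in> V" "xv v = m" by blast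
    have u: "xv u = m \<longleftrightarrow> u = v" for u
      unfolding v(2)[symmetric] by (metis keys_xv singleton_inject)
    show ?thesis unfolding e u using finite_V v(1) by (simp only: sum.delta) simp
  next
    case False
    have "Poly_Mapping.lookup (pk k) m = 0"
    proof (rule ccontr)
      assume "Poly_Mapping.lookup (pk k) m \<noteq> 0"
      then have m: "Poly_Mapping.keys m \<subseteq> V" "pdeg m = 1"
        using pk[OF k] by (auto simp: homogeneous_def poly_alg_carrier pdeg_def in_keys_iff)
      then have "m \<noteq> 0" by auto
      then obtain v where v: "v \<in> Poly_Mapping.keys m" using keys_eq_empty by blast
      then have "m - xv v = 0" using pdeg_minus_xv[OF v] m(2) by simp
      then have "m = xv v" using minus_xv_plus[OF v] by simp
      then show False using False v m(1) by blast
    qed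
    moreover have "(\<Sum>v\<in>V. if xv v = m then Poly_Mapping.lookup (pk k) m else 0) = 0"
      using False by (intro sum.neutral ballI if_not_P) blast
    ultimately show ?thesis unfolding e by simp
  qed
qed

lemma lookup_mult_pk:
  assumes k: "k < d" and m: "Poly_Mapping.keys m \<subseteq> V"
  shows "Poly_Mapping.lookup (r * pk k) m = (\<Sum>v\<in>Poly_Mapping.keys m. Poly_Mapping.lookup r (m - xv v) * a v k)"
proof -
  have "Poly_Mapping.lookup (r * pk k) m =
    (\<Sum>v\<in>V. if v \<in> Poly_Mapping.keys m then Poly_Mapping.lookup r (m - xv v) * a v k else 0)"
    unfolding pk_sum[OF k] sum_distrib_left lookup_sum lookup_mult_single_xv ..
  also have "\<dots> = (\<Sum>v\<in>V \<inter> Poly_Mapping.keys m. Poly_Mapping.lookup r (m - xv v) * a v k)"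
    by (rule sum.inter_restrict[OF finite_V, symmetric])
  also have "V \<inter> Poly_Mapping.keys m = Poly_Mapping.keys m" using m by blast
  finally show ?thesis .
qed

section \<open>The ideal of the forms, lifted to the polynomial ring, and its quotient\<close>

definition J0 :: "(('v \<Rightarrow>\<^sub>0 nat) \<Rightarrow>\<^sub>0 'k) set"
  where "J0 = {(\<Sum>k<d. r k * pk k) + n | r n. (\<forall>k<d. r k \<in> carrier R) \<and> n \<in> NF}"

lemma J0I: "(\<And>k. k < d \<Longrightarrow> r k \<in> carrier R) \<Longrightarrow> n \<in> NF \<Longrightarrow> (\<Sum>k<d. r k * pk k) + n \<in> J0"
  unfolding J0_def by blast

lemma sum_pk_carrier:
  assumes "\<And>k. k < d \<Longrightarrow> r k \<in> carrier R"
  shows "(\<Sum>k<d. r k * pk k) \<in> carrier R"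
  by (rule ps.subspace_sum[OF subspace_poly_alg], rule poly_alg_mult) (simp_all add: assms pk_carrier)

lemma J0_carrier: "J0 \<subseteq> carrier R"
proof
  fix q assume "q \<in> J0"
  then obtain r n where "\<And>k. k < d \<Longrightarrow> r k \<in> carrier R" "n \<in> NF" "q = (\<Sum>k<d. r k * pk k) + n" unfolding J0_def by blast
  then show "q \<in> carrier R"
    using ps.subspace_add[OF subspace_poly_alg sum_pk_carrier NF_carrier] by blast
qed

lemma NF_J0: "NF \<subseteq> J0"
proof
  fix n assume "n \<in> NF"
  then have "(\<Sum>k<d. 0 * pk k) + n \<in> J0" by (intro J0I ps.subspace_0[OF subspace_poly_alg])
  then show "n \<in> J0" by simp
qed

lemma pk_J0:
  assumes k: "k < d"
  shows "pk k \<in> J0"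
proof -
  have "(\<Sum>l<d. (if l = k then 1 else 0) * pk l) + 0 \<in> J0"
    by (rule J0I) (use ps.subspace_0[OF subspace_poly_alg] ps.subspace_0[OF subspace_NF] poly_alg_one in auto)
  moreover have "(\<Sum>l<d. (if l = k then 1 else 0) * pk l) = (\<Sum>l<d. if l = k then pk k else 0)"
    by (intro sum.cong) auto
  ultimately show ?thesis using k by simp
qed

lemma J0_mult:
  assumes "q \<in> J0" and s: "s \<in> carrier R"
  shows "q * s \<in> J0"
proof -
  obtain r n where r: "\<And>k. k < d \<Longrightarrow> r k \<in> carrier R" "n \<in> NF" "q = (\<Sum>k<d. r k * pk k) + n"
    using assms(1) unfolding J0_def by blast
  have "q * s = (\<Sum>k<d. (r k * s) * pk k) + n * s"
    unfolding r(3) distrib_right sum_distrib_right by (simp add: mult_ac)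
  then show ?thesis using J0I[of "\<lambda>k. r k * s" "n * s"] poly_alg_mult[OF r(1) s] NF_mult[OF r(2) s] by simp
qed

lemma subspace_J0: "ps.subspace J0"
  unfolding ps.subspace_def
proof (intro conjI ballI allI)
  show "0 \<in> J0" using NF_J0 ps.subspace_0[OF subspace_NF] by blast
  show "x + y \<in> J0" if x: "x \<in> J0" and y: "y \<in> J0" for x y
  proof -
    obtain r n where r: "\<And>k. k < d \<Longrightarrow> r k \<in> carrier R" "n \<in> NF" "x = (\<Sum>k<d. r k * pk k) + n" using x unfolding J0_def by blast
    obtain s l where s: "\<And>k. k < d \<Longrightarrow> s k \<in> carrier R" "l \<in> NF" "y = (\<Sum>k<d. s k * pk k) + l" using y unfolding J0_def by blast
    have "x + y = (\<Sum>k<d. (r k + s k) * pk k) + (n + l)"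
      unfolding r(3) s(3) by (simp add: distrib_right sum.distrib)
    then show ?thesis
      using J0I[of "\<lambda>k. r k + s k" "n + l"] ps.subspace_add[OF subspace_poly_alg r(1) s(1)]
        ps.subspace_add[OF subspace_NF r(2) s(2)] by simp
  qed
  show "pscale c x \<in> J0" if "x \<in> J0" for c x
    using J0_mult[OF that, of "Poly_Mapping.single 0 c"] by (simp add: poly_alg_carrier mult.commute)
qed

abbreviation forms :: "(('v \<Rightarrow>\<^sub>0 nat) \<Rightarrow>\<^sub>0 'k) set set" where "forms \<equiv> (\<lambda>k. C (pk k)) ` {..<d}"

lemma Idl_forms: "Idl\<^bsub>SR\<^esub> forms = C ` J0"
proof (rule subset_antisym)
  interpret SR: cring SR by (rule cring_SR)
  have "C q \<otimes>\<^bsub>SR\<^esub> x \<in> C ` J0" if q: "q \<in> J0" and x: "x \<in> carrier SR" for q x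
  proof -
    obtain s where s: "s \<in> carrier R" "x = C s" using x unfolding SR_carrier by blast
    have "C q \<otimes>\<^bsub>SR\<^esub> x = C (q * s)" unfolding s(2) by (rule SR_mult[OF subsetD[OF J0_carrier q] s(1)])
    then show ?thesis using J0_mult[OF q s(1)] by blast
  qed
  then have "ideal (C ` J0) SR"
    by (intro ideal_subspaceI[OF cring_SR _ _ _ subspace_J0 J0_carrier])
      (simp_all add: SR_carrier SR_zero SR_add coset_of_0)
  moreover have "forms \<subseteq> C ` J0" using pk_J0 by blast
  ultimately show "Idl\<^bsub>SR\<^esub> forms \<subseteq> C ` J0" by (rule SR.genideal_minimal)
  show "C ` J0 \<subseteq> Idl\<^bsub>SR\<^esub> forms"
    unfolding genideal_def
  proof (rule Inter_greatest)
    fix I assume "I \<in> {I. ideal I SR \<and> forms \<subseteq> I}"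
    then have I: "ideal I SR" "forms \<subseteq> I" by auto
    interpret I: ideal I SR by (rule I(1))
    show "C ` J0 \<subseteq> I"
    proof (rule image_subsetI)
      fix q assume "q \<in> J0"
      then obtain r n where r: "\<And>k. k < d \<Longrightarrow> r k \<in> carrier R" "n \<in> NF" "q = (\<Sum>k<d. r k * pk k) + n" unfolding J0_def by blast
      have "C (\<Sum>k<e. r k * pk k) \<in> I" if "e \<le> d" for e
        using that
      proof (induction e)
        case 0
        then show ?case using I.zero_closed by (simp add: SR_zero coset_of_0)
      next
        case (Suc e)
        then have e: "e < d" by simp
        have "C (pk e) \<in> I" using I(2) e by blast
        then have "C (r e) \<otimes>\<^bsub>SR\<^esub> C (pk e) \<in> I" using r(1)[OF e] by (intro I.I_l_closed) (auto simp: SR_carrier)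
        then have "C (r e * pk e) \<in> I" using SR_mult[OF r(1)[OF e] pk_carrier[OF e]] by simp
        then have "C (\<Sum>k<e. r k * pk k) \<oplus>\<^bsub>SR\<^esub> C (r e * pk e) \<in> I" using Suc by (intro I.a_closed) simp_all
        then show ?case by (simp add: SR_add)
      qed
      moreover have "C q = C (\<Sum>k<d. r k * pk k)" unfolding ps.coset_eq_iff[OF subspace_NF] r(3) using r(2) by simp
      ultimately show "C q \<in> I" by simp
    qed
  qed
qed

text \<open>Elements of the quotient ring are cosets of cosets. Writing the class of a polynomial
  \<open>p\<close> as an image of its coset modulo \<open>J0\<close> reduces all computations to the
  polynomial ring.\<close>

definition dcos :: "(('v \<Rightarrow>\<^sub>0 nat) \<Rightarrow>\<^sub>0 'k) \<Rightarrow> (('v \<Rightarrow>\<^sub>0 nat) \<Rightarrow>\<^sub>0 'k) set set"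
  where "dcos p = C ` coset_of J0 p"

lemma a_r_coset_SR: "(C ` J0) +>\<^bsub>SR\<^esub> C p = dcos p"
  unfolding a_r_coset_def' dcos_def coset_of_def[of J0] by (auto simp: SR_add)

lemma dcos_0: "dcos 0 = C ` J0"
  by (simp add: dcos_def coset_of_0)

lemma dcos_eq_iff: "dcos p = dcos q \<longleftrightarrow> p - q \<in> J0"
proof
  assume "dcos p = dcos q"
  moreover have "C p \<in> dcos p" unfolding dcos_def using ps.coset_mem[OF subspace_J0] by blast
  ultimately have "C p \<in> C ` coset_of J0 q" by (simp only: dcos_def)
  then obtain u where u: "C p = C u" "u \<in> coset_of J0 q" by (rule imageE)
  obtain j where j: "j \<in> J0" "u = j + q" using u(2) unfolding coset_of_def by blast
  have "p - u \<in> J0" using u(1) NF_J0 unfolding ps.coset_eq_iff[OF subspace_NF] by blast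
  then have "(p - u) + j \<in> J0" using j(1) by (rule ps.subspace_add[OF subspace_J0])
  then show "p - q \<in> J0" using j(2) by simp
next
  assume "p - q \<in> J0"
  then have "coset_of J0 p = coset_of J0 q" by (simp only: ps.coset_eq_iff[OF subspace_J0])
  then show "dcos p = dcos q" by (simp add: dcos_def)
qed

abbreviation Q where "Q \<equiv> SR_quot \<Delta> forms"

lemma Q_carrier: "carrier Q = dcos ` carrier R"
  by (auto simp: SR_quot_def quot_mod_def Idl_forms A_RCOSETS_def' SR_carrier a_r_coset_SR)

lemma Q_zero: "\<zero>\<^bsub>Q\<^esub> = dcos 0"
  by (simp add: SR_quot_def quot_mod_def Idl_forms dcos_0)

lemma Q_add: "dcos p \<oplus>\<^bsub>Q\<^esub> dcos q = dcos (p + q)"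
proof -
  have "dcos p \<oplus>\<^bsub>Q\<^esub> dcos q = C ` {u + w | u w. u \<in> coset_of J0 p \<and> w \<in> coset_of J0 q}"
    by (simp add: SR_quot_def quot_mod_def set_add_def' dcos_def SR_add) blast
  then show ?thesis unfolding ps.coset_add[OF subspace_J0] dcos_def .
qed

lemma Q_smult: "c \<odot>\<^bsub>Q\<^esub> dcos p = dcos (pscale c p)"
proof -
  have "c \<odot>\<^bsub>Q\<^esub> dcos p = (\<Union>u\<in>coset_of J0 p. dcos (pscale c u))"
    by (simp add: SR_quot_def quot_mod_def Idl_forms dcos_def[of p] SR_smult a_r_coset_SR)
  also have "\<dots> = C ` (\<Union>u\<in>coset_of J0 p. coset_of J0 (pscale c u))" unfolding dcos_def by (simp add: image_UN)
  finally show ?thesis unfolding ps.coset_scale[OF subspace_J0] dcos_def .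
qed

lemma SR_quot_part_eq: "SR_quot_part \<Delta> forms i = dcos ` homogeneous V i"
  unfolding SR_quot_part_def SR_part_def SR_ideal_eq Idl_forms a_r_coset_poly_alg image_image a_r_coset_SR ..

lemma vectorspace_Q: "vectorspace class_ring Q"
  by (rule vectorspace_image[OF kspace_pscale subspace_poly_alg, of dcos])
    (simp_all only: Q_carrier Q_zero Q_add Q_smult)

section \<open>Evaluation at a point and independence on faces\<close>

definition mono_val :: "('v \<Rightarrow> 'k) \<Rightarrow> ('v \<Rightarrow>\<^sub>0 nat) \<Rightarrow> 'k"
  where "mono_val y m = (\<Prod>v\<in>V. y v ^ Poly_Mapping.lookup m v)"

text \<open>The value at \<open>y\<close> of the homogeneous component of degree \<open>n\<close>.
  Working in one degree at a time gives infinitely many functionals from a single point, which a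
  finite-dimensional quotient cannot accommodate.\<close>

definition eval_deg :: "('v \<Rightarrow> 'k) \<Rightarrow> nat \<Rightarrow> (('v \<Rightarrow>\<^sub>0 nat) \<Rightarrow>\<^sub>0 'k) \<Rightarrow> 'k"
  where "eval_deg y n p = (\<Sum>m\<in>{m. Poly_Mapping.keys m \<subseteq> V \<and> pdeg m = n}. Poly_Mapping.lookup p m * mono_val y m)"

lemma finite_degree: "finite {m :: 'v \<Rightarrow>\<^sub>0 nat. Poly_Mapping.keys m \<subseteq> V \<and> pdeg m = n}"
  by (rule finite_subset[OF _ finite_monomials[OF finite_V, of n]]) auto

lemma eval_deg_add: "eval_deg y n (p + q) = eval_deg y n p + eval_deg y n q"
  by (simp add: eval_deg_def lookup_add distrib_right sum.distrib)

lemma eval_deg_diff: "eval_deg y n (p - q) = eval_deg y n p - eval_deg y n q"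
  by (simp add: eval_deg_def lookup_minus left_diff_distrib sum_subtractf)

lemma eval_deg_sum: "eval_deg y n (\<Sum>i\<in>A. f i) = (\<Sum>i\<in>A. eval_deg y n (f i))"
proof (cases "finite A")
  case True
  then show ?thesis
    by (induction A rule: finite_induct) (simp_all add: eval_deg_add, simp add: eval_deg_def)
qed (simp add: eval_deg_def)

lemma eval_deg_pscale: "eval_deg y n (pscale c p) = c * eval_deg y n p"
proof -
  have "Poly_Mapping.lookup (pscale c p) m = c * Poly_Mapping.lookup p m" for m
    by (simp add: mult_map_scale_conv_mult[symmetric] Poly_Mapping.map.rep_eq when_def)
  then show ?thesis by (simp add: eval_deg_def sum_distrib_left mult.assoc)
qed

lemma eval_deg_single: "eval_deg y n (Poly_Mapping.single m c) =
    (if Poly_Mapping.keys m \<subseteq> V \<and> pdeg m = n then c * mono_val y m else 0)"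
proof -
  have "eval_deg y n (Poly_Mapping.single m c) =
    (\<Sum>m'\<in>{m. Poly_Mapping.keys m \<subseteq> V \<and> pdeg m = n}. if m' = m then c * mono_val y m else 0)"
    unfolding eval_deg_def by (intro sum.cong) (auto simp: lookup_single when_def)
  then show ?thesis using finite_degree[of n] by (simp only: sum.delta mem_Collect_eq)
qed

lemma mono_val_plus_xv:
  assumes "v \<in> V"
  shows "mono_val y (m + xv v) = mono_val y m * y v"
proof -
  have "mono_val y (m + xv v) = (\<Prod>u\<in>V. y u ^ Poly_Mapping.lookup m u * (if u = v then y v else 1))"
    unfolding mono_val_def by (intro prod.cong) (auto simp: lookup_add)
  then show ?thesis
    unfolding mono_val_def prod.distrib using prod.delta[OF finite_V, of v "\<lambda>_. y v"] assms by (simp only: if_True)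
qed

text \<open>A monomial that is not supported in the face \<open>G\<close> contains a variable at
  which \<open>y\<close> vanishes, which disposes of the nonface monomials; multiples of a form
  vanish in every degree because the form vanishes at \<open>y\<close>.\<close>

lemma eval_deg_J0:
  assumes G: "G \<in> \<Delta>" and y0: "\<And>v. v \<notin> G \<Longrightarrow> y v = 0"
    and y: "\<And>k. k < d \<Longrightarrow> (\<Sum>v\<in>V. a v k * y v) = 0" and q: "q \<in> J0"
  shows "eval_deg y n q = 0"
proof -
  obtain r p where r: "\<And>k. k < d \<Longrightarrow> r k \<in> carrier R" "p \<in> NF" "q = (\<Sum>k<d. r k * pk k) + p"
    using q unfolding J0_def by blast
  have "eval_deg y n p = 0"
    unfolding eval_deg_def
  proof (intro sum.neutral ballI)
    fix m :: "'v \<Rightarrow>\<^sub>0 nat" assume m: "m \<in> {m. Poly_Mapping.keys m \<subseteq> V \<and> pdeg m = n}"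
    show "Poly_Mapping.lookup p m * mono_val y m = 0"
    proof (cases "Poly_Mapping.lookup p m = 0")
      case False
      then have "Poly_Mapping.keys m \<notin> \<Delta>" using r(2) by (auto simp: nonfaces_def in_keys_iff)
      then have "\<not> Poly_Mapping.keys m \<subseteq> G" using face_subset[OF G] by blast
      then obtain v where v: "v \<in> Poly_Mapping.keys m" "v \<notin> G" by blast
      have "v \<in> V" using v m by blast
      moreover have "y v ^ Poly_Mapping.lookup m v = 0" using y0[OF v(2)] v(1) by (simp add: in_keys_iff)
      ultimately have "mono_val y m = 0" unfolding mono_val_def by (rule prod_zero[OF finite_V bexI[rotated]])
      then show ?thesis by simp
    qed simp
  qed
  moreover have "eval_deg y n (r k * pk k) = 0" if k: "k < d" for k
  proof -
    have "r k * pk k = (\<Sum>m\<in>Poly_Mapping.keys (r k). \<Sum>v\<in>V.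
        Poly_Mapping.single (m + xv v) (Poly_Mapping.lookup (r k) m * a v k))"
      by (subst poly_mapping_sum_single[of "r k"], subst pk_sum[OF k])
        (simp only: sum_distrib_left sum_distrib_right mult_single, rule sum.swap)
    then have "eval_deg y n (r k * pk k) = (\<Sum>m\<in>Poly_Mapping.keys (r k). \<Sum>v\<in>V.
        eval_deg y n (Poly_Mapping.single (m + xv v) (Poly_Mapping.lookup (r k) m * a v k)))"
      by (simp only: eval_deg_sum)
    also have "\<dots> = 0"
    proof (rule sum.neutral, rule ballI)
      fix m assume "m \<in> Poly_Mapping.keys (r k)"
      let ?c = "if Poly_Mapping.keys m \<subseteq> V \<and> Suc (pdeg m) = n then Poly_Mapping.lookup (r k) m * mono_val y m else 0"
      have "(\<Sum>v\<in>V. eval_deg y n (Poly_Mapping.single (m + xv v) (Poly_Mapping.lookup (r k) m * a v k))) =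
        (\<Sum>v\<in>V. ?c * (a v k * y v))"
      proof (rule sum.cong[OF refl])
        fix v assume v: "v \<in> V"
        then have "Poly_Mapping.keys (m + xv v) \<subseteq> V \<longleftrightarrow> Poly_Mapping.keys m \<subseteq> V"
          unfolding keys_plus_nat keys_xv by blast
        then show "eval_deg y n (Poly_Mapping.single (m + xv v) (Poly_Mapping.lookup (r k) m * a v k)) = ?c * (a v k * y v)"
          unfolding eval_deg_single mono_val_plus_xv[OF v] pdeg_plus by (simp add: mult_ac)
      qed
      also have "\<dots> = 0" unfolding sum_distrib_left[symmetric] y[OF k] by simp
      finally show "(\<Sum>v\<in>V. eval_deg y n (Poly_Mapping.single (m + xv v) (Poly_Mapping.lookup (r k) m * a v k))) = 0" .
    qed
    finally show ?thesis .
  qed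
  ultimately show ?thesis unfolding r(3) eval_deg_add eval_deg_sum by simp
qed

text \<open>
  A nonzero common zero \<open>y\<close> of the linear forms with support in a face defines, in each degree \<open>n\<close>, a
  functional that vanishes on the ideal but not on \<open>x\<^sub>g\<^sup>n\<close> for \<open>y g \<noteq> 0\<close>.
\<close>

lemma faces_independent:
  assumes fin: "vectorspace.fin_dim class_ring Q" and G: "G \<in> \<Delta>" and g: "g \<in> G"
    and z: "\<And>k. k < d \<Longrightarrow> (\<Sum>v\<in>G. z v * a v k) = 0"
  shows "z g = 0"
proof (rule ccontr)
  assume nz: "z g \<noteq> 0"
  interpret Q: vectorspace class_ring Q by (rule vectorspace_Q)
  define y where "y v = (if v \<in> G then z v else 0)" for v
  have GV: "G \<subseteq> V" using G by blast
  have "(\<Sum>v\<in>V. a v k * y v) = (\<Sum>v\<in>G. z v * a v k)" for k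
    using finite_V GV by (intro sum.mono_neutral_cong_right) (auto simp: y_def)
  then have y: "eval_deg y n q = 0" if "q \<in> J0" for n q
    using z by (intro eval_deg_J0[OF G _ _ that]) (auto simp: y_def)
  obtain A where A: "finite A" "A \<subseteq> carrier Q" "Q.span A = carrier Q"
    using fin unfolding Q.fin_dim_def by blast
  have "\<forall>X\<in>A. \<exists>p. p \<in> carrier R \<and> dcos p = X" using A(2) unfolding Q_carrier by blast
  from bchoice[OF this] obtain b where b: "\<And>X. X \<in> A \<Longrightarrow> b X \<in> carrier R" "\<And>X. X \<in> A \<Longrightarrow> dcos (b X) = X"
    by blast
  \<comment> \<open>Choose a degree \<open>N\<close> above all monomials in representatives of a
    finite spanning set: evaluation in degree \<open>N\<close> kills the representatives and the
    ideal, hence everything.\<close>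
  have "finite (\<Union>X\<in>A. pdeg ` Poly_Mapping.keys (b X))" using A(1) by simp
  then obtain N where N: "\<And>X m. X \<in> A \<Longrightarrow> m \<in> Poly_Mapping.keys (b X) \<Longrightarrow> pdeg m < N"
    unfolding finite_nat_set_iff_bounded by blast
  have bN: "eval_deg y N (b X) = 0" if "X \<in> A" for X
    unfolding eval_deg_def
    by (intro sum.neutral ballI) (use N[OF that] in \<open>auto simp: in_keys_iff\<close>)
  define e where "e = Poly_Mapping.single (Poly_Mapping.single g N) (1::'k)"
  have kg: "Poly_Mapping.keys (Poly_Mapping.single g N) \<subseteq> V" using g GV by (cases "N = 0") auto
  have "e \<in> carrier R" unfolding e_def poly_alg_carrier using kg by simp
  then have "dcos e \<in> Q.span A" unfolding A(3) Q_carrier by blast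
  then obtain c where c: "dcos e = Q.lincomb c A" unfolding Q.finite_span[OF A(1,2)] by blast
  have "Q.lincomb c A = finsum Q (\<lambda>X. dcos (pscale (c X) (b X))) A"
    unfolding Q.lincomb_def
  proof (rule Q.M.finsum_cong'[OF refl])
    show "(\<lambda>X. dcos (pscale (c X) (b X))) \<in> A \<rightarrow> carrier Q"
      unfolding Q_carrier using b(1) ps.subspace_scale[OF subspace_poly_alg] by blast
    show "c X \<odot>\<^bsub>Q\<^esub> X = dcos (pscale (c X) (b X))" if "X \<in> A" for X
      unfolding Q_smult[symmetric] b(2)[OF that] ..
  qed
  also have "\<dots> = dcos (\<Sum>X\<in>A. pscale (c X) (b X))"
    by (rule finsum_image[OF kspace_pscale subspace_poly_alg])
      (simp_all only: Q_carrier Q_zero Q_add Q_smult A(1), intro ps.subspace_scale[OF subspace_poly_alg] b(1))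
  finally have "e - (\<Sum>X\<in>A. pscale (c X) (b X)) \<in> J0" using c dcos_eq_iff by simp
  from y[OF this, of N] have "eval_deg y N e = (\<Sum>X\<in>A. c X * eval_deg y N (b X))"
    by (simp add: eval_deg_diff eval_deg_sum eval_deg_pscale)
  also have "\<dots> = 0" using bN by simp
  finally have 0: "mono_val y (Poly_Mapping.single g N) = 0"
    unfolding e_def eval_deg_single using kg by simp
  then obtain v where "v \<in> V" "y v ^ Poly_Mapping.lookup (Poly_Mapping.single g N) v = 0"
    unfolding mono_val_def prod_zero_iff[OF finite_V] by blast
  then show False using nz g by (auto simp: lookup_single when_def y_def split: if_splits)
qed

text \<open>A linear relation between the coefficient vectors of the vertices of \<open>G\<close> is
  a common zero of the forms supported in \<open>G\<close>, so \<open>faces_independent\<close>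
  makes the vectors independent and a dual family exists.\<close>

lemma dual_on_face:
  assumes fin: "vectorspace.fin_dim class_ring Q" and G: "G \<in> \<Delta>"
  shows "dual_on G"
proof -
  have finG: "finite G" by (rule finite_face[OF G])
  have inj: "inj_on a G"
  proof (rule inj_onI, rule ccontr)
    fix u v assume uv: "u \<in> G" "v \<in> G" "a u = a v" "u \<noteq> v"
    define z :: "'v \<Rightarrow> 'k" where "z w = (if w = u then 1 else 0) - (if w = v then 1 else 0)" for w
    have zs: "z w * a w k = (if w = u then a u k else 0) - (if w = v then a v k else 0)" for w k
      by (simp add: z_def)
    have "(\<Sum>w\<in>G. z w * a w k) = 0" for k
      unfolding zs sum_subtractf using finG uv by simp
    then have "z u = 0" by (rule faces_independent[OF fin G uv(1)])
    then show False using uv(4) by (simp add: z_def)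
  qed
  have "fs.independent (a ` G)"
  proof
    assume "fs.dependent (a ` G)"
    then obtain u where u: "\<exists>x\<in>a ` G. u x \<noteq> 0" "(\<Sum>x\<in>a ` G. fscale (u x) x) = 0"
      unfolding fs.dependent_finite[OF finite_imageI[OF finG]] by blast
    have "(\<Sum>g\<in>G. u (a g) * a g k) = 0" for k
      using fun_cong[OF u(2), of k] by (simp add: sum.reindex[OF inj])
    then have "u (a g) = 0" if "g \<in> G" for g
      by (rule faces_independent[OF fin G that, of "\<lambda>g. u (a g)"])
    then show False using u(1) by blast
  qed
  moreover have "a ` G \<subseteq> fsup {..<d}" by (auto simp: fsup_def a_eq split: if_splits)
  ultimately obtain c where c: "\<And>b b'. b \<in> a ` G \<Longrightarrow> b' \<in> a ` G \<Longrightarrow>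
      (\<Sum>z\<in>{..<d}. c b z * b' z) = (if b = b' then 1 else 0)"
    using dual_family_exists[of "{..<d}" "a ` G"] by blast
  show ?thesis
    unfolding dual_on_def
  proof (intro exI conjI ballI allI)
    show "(\<lambda>k. if k < d then c (a g) k else 0) \<in> fsup {..<d}" for g by (simp add: fsup_def)
    show "(\<Sum>k<d. a g k * (if k < d then c (a g') k else 0)) = (if g = g' then 1 else 0)" if "g \<in> G" "g' \<in> G" for g g'
    proof -
      have "(\<Sum>k<d. a g k * (if k < d then c (a g') k else 0)) = (\<Sum>k<d. c (a g') k * a g k)"
        by (intro sum.cong) (auto simp: mult.commute)
      also have "\<dots> = (if a g' = a g then 1 else 0)" using that by (intro c) auto
      finally show ?thesis using inj_on_eq_iff[OF inj that] by auto
    qed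
  qed
qed

end

section \<open>The Hilbert function\<close>

context complex
begin

definition pol :: "nat \<Rightarrow> (('v \<Rightarrow>\<^sub>0 nat) \<Rightarrow> 'k) \<Rightarrow> ('v \<Rightarrow>\<^sub>0 nat) \<Rightarrow>\<^sub>0 'k"
  where "pol i f = (\<Sum>m\<in>{m. Poly_Mapping.keys m \<in> \<Delta> \<and> pdeg m = i}. Poly_Mapping.single m (f m))"

lemma finite_face_monomials: "finite {m. Poly_Mapping.keys m \<in> \<Delta> \<and> pdeg m = i}"
  by (rule finite_subset[OF _ finite_monomials[OF finite_V, of i]]) auto

lemma lookup_pol: "Poly_Mapping.lookup (pol i f) m = (if Poly_Mapping.keys m \<in> \<Delta> \<and> pdeg m = i then f m else 0)"
proof -
  have "Poly_Mapping.lookup (pol i f) m =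
    (\<Sum>m'\<in>{m. Poly_Mapping.keys m \<in> \<Delta> \<and> pdeg m = i}. if m' = m then f m else 0)"
    unfolding pol_def lookup_sum by (intro sum.cong) (auto simp: lookup_single when_def)
  then show ?thesis by (simp only: sum.delta[OF finite_face_monomials] mem_Collect_eq)
qed

lemma pol_homogeneous: "pol i f \<in> homogeneous V i"
  by (auto simp: homogeneous_def poly_alg_carrier in_keys_iff[of _ "pol i f"] lookup_pol pdeg_def[symmetric] split: if_splits)

lemma pol_carrier: "pol i f \<in> carrier R"
  using pol_homogeneous by (simp add: homogeneous_def)

lemma pol_add: "pol i (\<lambda>m. f m + g m) = pol i f + pol i g"
  by (rule poly_mapping_eqI) (simp add: lookup_add lookup_pol)

lemma pol_scale: "pol i (\<lambda>m. c * f m) = pscale c (pol i f)"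
  unfolding pol_def sum_distrib_left mult_single by simp

text \<open>The empty face receives nothing from the simplicial coboundary, and from exterior degree
  1 to 0 the Koszul differential is a sum of multiples of the forms. So its image is the ideal
  generated by them.\<close>

lemma D_column_empty:
  assumes "Poly_Mapping.keys m \<in> \<Delta>"
  shows "D If y ({}, m) {} = (\<Sum>k<d. \<Sum>v\<in>Poly_Mapping.keys m. y ({}, m - xv v) {k} * a v k)"
proof -
  have o: "orient {k} k = (1::'k)" for k :: nat
  proof -
    have "{u \<in> {k}. u < k} = {}" by auto
    then show ?thesis unfolding orient_def by (simp only: card.empty power_0)
  qed
  have "D If y ({}, m) {} = (\<Sum>v\<in>Poly_Mapping.keys m. \<Sum>k<d. y ({}, m - xv v) {k} * a v k)"
    using assms by (simp add: DI_apply If_def wdg_def kap_apply ctr_def o mult.commute)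
  then show ?thesis by (simp only: sum.swap[of _ "Poly_Mapping.keys m"])
qed

section \<open>Vanishing of cohomology in the lowest degrees\<close>

lemma dim_Zs_0:
  assumes "Zs G j \<subseteq> {0}"
  shows "int (fs.dim (Zs G j)) - int (fs.dim (Bs G j)) = 0"
proof -
  have "fs.dim (Zs G j) \<le> card ({} :: ('v set \<Rightarrow> 'k) set)" "fs.dim (Bs G j) \<le> card ({} :: ('v set \<Rightarrow> 'k) set)"
    by (rule fs.dim_le_card; use assms Bs_subset_Zs[of G j] in auto)+
  then show ?thesis by simp
qed

lemma Zs_below:
  assumes "j < int (card G)"
  shows "Zs G j \<subseteq> {0}"
proof -
  have "{F \<in> up G. int (card F) = j} = {}"
  proof (rule ccontr)
    assume "{F \<in> up G. int (card F) = j} \<noteq> {}"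
    then obtain F where F: "F \<in> up G" "int (card F) = j" by blast
    have "card G \<le> card F" using F(1) finite_face[of F] by (intro card_mono) (simp_all add: up_def)
    then show False using assms F(2) by simp
  qed
  then have "Cs G j = fsup {}" unfolding Cs_def by (simp only:)
  then show ?thesis by (auto simp: Zs_def fsup_def)
qed

text \<open>The only face with \<open>card G\<close> vertices containing \<open>G\<close> is
  \<open>G\<close> itself, and its cochain has a nonzero coboundary at \<open>insert w G\<close>. In
  terms of the link: a nonempty complex has no reduced cohomology in degree -1.\<close>

lemma Zs_at_card:
  assumes F: "insert w G \<in> \<Delta>" "w \<notin> G"
  shows "Zs G (int (card G)) \<subseteq> {0}"
proof
  fix c assume "c \<in> Zs G (int (card G))"
  then have c: "c \<in> fsup {F \<in> up G. int (card F) = int (card G)}" "coboundary \<Delta> c = 0"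
    by (auto simp: Zs_def Cs_def)
  have c0: "c F = 0" if "F \<noteq> G" for F
  proof (rule ccontr)
    assume "c F \<noteq> 0"
    then have "F \<in> \<Delta>" "G \<subseteq> F" "card F = card G" using c(1) by (auto simp: fsup_def up_def)
    then show False using that card_subset_eq[OF finite_face[of F]] by metis
  qed
  have fin: "finite (insert w G)" by (rule finite_face[OF F(1)])
  have "0 = coboundary \<Delta> c (insert w G)" using c(2) by simp
  also have "\<dots> = (\<Sum>v\<in>insert w G. orient (insert w G) v * c (insert w G - {v}))"
    using F(1) by (simp add: coboundary_def)
  also have "\<dots> = (\<Sum>v\<in>insert w G. if v = w then orient (insert w G) w * c G else 0)"
  proof (rule sum.cong[OF refl])
    fix v assume "v \<in> insert w G"
    show "orient (insert w G) v * c (insert w G - {v}) = (if v = w then orient (insert w G) w * c G else 0)"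
    proof (cases "v = w")
      case True
      then show ?thesis using F(2) by simp
    next
      case False
      then have "insert w G - {v} \<noteq> G" using F(2) by blast
      then show ?thesis using c0 False by simp
    qed
  qed
  also have "\<dots> = orient (insert w G) w * c G" using fin by simp
  finally have "c G = 0" by (simp add: orient_def)
  then have "c F = 0" for F using c0 by (cases "F = G") auto
  then show "c \<in> {0}" by (auto simp: fun_eq_iff)
qed

end

text \<open>Substitute \<open>j = i - p\<close>. The terms with \<open>p = i\<close> and
  \<open>p = i + 1\<close> have the arguments 0 and -1; the argument 0 occurs only if
  \<open>i \<ge> 1\<close>.\<close>

lemma alternating_reindex:
  fixes f :: "int \<Rightarrow> int"
  assumes "f (- 1) = 0" "i \<ge> 1 \<Longrightarrow> f 0 = 0"
  shows "(\<Sum>p=1..i+1. (-1) ^ (p - 1) * f (int i - int p)) = (\<Sum>j=1..i-1. (-1) ^ (i - j - 1) * f (int j))"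
proof -
  have "(\<Sum>p=1..i+1. (-1) ^ (p - 1) * f (int i - int p)) = (\<Sum>p=1..i-1. (-1) ^ (p - 1) * f (int i - int p))"
  proof (rule sum.mono_neutral_right)
    show "\<forall>p\<in>{1..i + 1} - {1..i - 1}. (-1) ^ (p - 1) * f (int i - int p) = 0"
    proof
      fix p assume "p \<in> {1..i + 1} - {1..i - 1}"
      then have "p = i + 1 \<or> (p = i \<and> i \<ge> 1)" by auto
      then show "(-1) ^ (p - 1) * f (int i - int p) = 0" using assms by auto
    qed
  qed auto
  also have "\<dots> = (\<Sum>j=1..i-1. (-1) ^ (i - j - 1) * f (int j))"
    by (rule sum.reindex_bij_witness[of _ "\<lambda>j. i - j" "\<lambda>p. i - p"]) (auto simp: of_nat_diff)
  finally show ?thesis .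
qed

text \<open>In the application the argument of \<open>f\<close> counts vertices including
  \<open>v\<close>, so the sum over the link is indexed by \<open>j + 1\<close>; the value
  \<open>f 1\<close> is then the Betti number of the link in degree -1.\<close>

lemma alternating_reindex_shift:
  fixes f :: "int \<Rightarrow> int"
  assumes f: "f (- 1) = 0" "f 0 = 0" "i \<ge> 2 \<Longrightarrow> f 1 = 0"
  shows "(\<Sum>p=1..i+1. (-1) ^ p * f (int i - int p)) = - (\<Sum>j=1..i-2. (-1) ^ (i - j) * f (int j + 1))"
proof -
  have "(\<Sum>p=1..i+1. (-1) ^ p * f (int i - int p)) = - (\<Sum>p=1..i+1. (-1) ^ (p - 1) * f (int i - int p))"
    unfolding sum_negf[symmetric]
  proof (rule sum.cong[OF refl])
    fix p assume "p \<in> {1..i+1}"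
    then show "(-1) ^ p * f (int i - int p) = - ((-1) ^ (p - 1) * f (int i - int p))" by (cases p) auto
  qed
  also have "(\<Sum>p=1..i+1. (-1) ^ (p - 1) * f (int i - int p)) = (\<Sum>j=1..i-1. (-1) ^ (i - j - 1) * f (int j))"
    using f by (intro alternating_reindex) auto
  also have "\<dots> = (\<Sum>j=2..i-1. (-1) ^ (i - j - 1) * f (int j))"
  proof (rule sum.mono_neutral_right)
    show "\<forall>j\<in>{1..i - 1} - {2..i - 1}. (-1) ^ (i - j - 1) * f (int j) = 0"
    proof
      fix j assume "j \<in> {1..i - 1} - {2..i - 1}"
      then have "j = 1" "i \<ge> 2" by auto
      then show "(-1) ^ (i - j - 1) * f (int j) = 0" using f(3) by simp
    qed
  qed auto
  also have "\<dots> = (\<Sum>j=1..i-2. (-1) ^ (i - j) * f (int j + 1))"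
  proof (rule sum.reindex_bij_witness[of _ Suc "\<lambda>j. j - 1"])
    fix j assume "j \<in> {2..i-1}"
    then have "i - (j - 1) = Suc (Suc (i - j - 1))" "int (j - 1) + 1 = int j" by auto
    then show "(-1) ^ (i - (j - 1)) * f (int (j - 1) + 1) = (-1) ^ (i - j - 1) * f (int j)" by simp
  qed auto
  finally show ?thesis .
qed

section \<open>Hilbert function of the quotient by the forms\<close>

locale isolated_forms = isolated_complex \<Delta> d a + linear_forms \<Delta> d a pk
  for \<Delta> :: "'v::linorder set set" and d :: nat and a :: "'v \<Rightarrow> nat \<Rightarrow> 'k::field"
    and pk :: "nat \<Rightarrow> ('v \<Rightarrow>\<^sub>0 nat) \<Rightarrow>\<^sub>0 'k"
begin

lemma Tsp_empty_eqI:
  fixes x y :: "'v set \<times> ('v \<Rightarrow>\<^sub>0 nat) \<Rightarrow> nat set \<Rightarrow> 'k"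
  assumes x: "x \<in> Tsp d If {{}} 0 i" and y: "y \<in> Tsp d If {{}} 0 i"
    and eq: "\<And>m. Poly_Mapping.keys m \<in> \<Delta> \<Longrightarrow> pdeg m = i \<Longrightarrow> x ({}, m) {} = y ({}, m) {}"
  shows "x = y"
proof (rule ext, rule ext)
  fix Gm :: "'v set \<times> ('v \<Rightarrow>\<^sub>0 nat)" and \<sigma> :: "nat set"
  obtain G m where Gm: "Gm = (G, m)" by (cases Gm)
  show "x Gm \<sigma> = y Gm \<sigma>"
  proof (cases "x Gm \<sigma> = 0 \<and> y Gm \<sigma> = 0")
    case False
    then have "x (G, m) \<sigma> \<noteq> 0 \<or> y (G, m) \<sigma> \<noteq> 0" unfolding Gm by blast
    then have t: "G = {}" "(G, Poly_Mapping.keys m) \<in> If" "\<sigma> \<subseteq> {..<d}" "card \<sigma> + pdeg m = i" "int (card G) = 0 + int (card \<sigma>)"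
      using TspD[OF x, of G m \<sigma>] TspD[OF y, of G m \<sigma>] by blast+
    have "finite \<sigma>" using t(3) finite_subset by blast
    then have "\<sigma> = {}" using t(1,5) by simp
    then show ?thesis using eq[of m] t unfolding Gm by (simp add: If_def)
  qed simp
qed

lemma D_If_Tsp:
  assumes "y \<in> Tsp d If \<Delta> (0 - 1) i"
  shows "D If y \<in> Tsp d If \<Delta> 0 i"
  using D_Tsp[OF okI_If upc_Delta assms] by simp

lemma BK_subset: "BK i \<subseteq> Tsp d If {{}} 0 i"
  unfolding BK_def Bt_def at_empty_image[symmetric] using D_If_Tsp by blast

lemma lookup_sum_pk:
  fixes m :: "'v \<Rightarrow>\<^sub>0 nat"
  assumes "Poly_Mapping.keys m \<in> \<Delta>"
  shows "Poly_Mapping.lookup (\<Sum>k<d. r k * pk k) m =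
    (\<Sum>k<d. \<Sum>v\<in>Poly_Mapping.keys m. Poly_Mapping.lookup (r k) (m - xv v) * a v k)"
proof -
  have "Poly_Mapping.keys m \<subseteq> V" using assms by blast
  then show ?thesis unfolding lookup_sum by (intro sum.cong refl lookup_mult_pk) auto
qed

lemma pol_J0_imp_BK:
  assumes x: "x \<in> Tsp d If {{}} 0 i" and J: "pol i (\<lambda>m. x ({}, m) {}) \<in> J0"
  shows "x \<in> BK i"
proof -
  obtain r n where r: "\<And>k. k < d \<Longrightarrow> r k \<in> carrier R" "n \<in> NF"
    "pol i (\<lambda>m. x ({}, m) {}) = (\<Sum>k<d. r k * pk k) + n"
    using J unfolding J0_def by blast
  \<comment> \<open>The multipliers \<open>r k\<close> become the entries in exterior degree 1.
    Cutting them down to face monomials of degree \<open>i - 1\<close> is harmless: a face monomial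
    of degree \<open>i\<close> in the product is reached only from such monomials.\<close>
  define y :: "'v set \<times> ('v \<Rightarrow>\<^sub>0 nat) \<Rightarrow> nat set \<Rightarrow> 'k" where
    "y = (\<lambda>(G, m) \<sigma>. if G = {} \<and> (\<exists>k<d. \<sigma> = {k}) \<and> Poly_Mapping.keys m \<in> \<Delta> \<and> Suc (pdeg m) = i
      then Poly_Mapping.lookup (r (the_elem \<sigma>)) m else 0)"
  have yT: "y \<in> Tsp d If \<Delta> (0 - 1) i"
    by (rule TspI) (auto simp: y_def If_def empty_face split: if_splits)
  have "x = at_empty (D If y)"
  proof (rule Tsp_empty_eqI[OF x])
    show "at_empty (D If y) \<in> Tsp d If {{}} 0 i"
      unfolding at_empty_image[symmetric] using D_If_Tsp[OF yT] by blast
    fix m assume m: "Poly_Mapping.keys m \<in> \<Delta>" "pdeg m = i"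
    have yv: "y ({}, m - xv v) {k} = Poly_Mapping.lookup (r k) (m - xv v)"
      if "v \<in> Poly_Mapping.keys m" "k < d" for v k
      using that pdeg_minus_xv[OF that(1)] m face_subset[OF m(1) keys_minus_subset] by (simp add: y_def)
    have "x ({}, m) {} = Poly_Mapping.lookup ((\<Sum>k<d. r k * pk k) + n) m"
      unfolding r(3)[symmetric] lookup_pol using m by simp
    also have "\<dots> = Poly_Mapping.lookup (\<Sum>k<d. r k * pk k) m"
      using r(2) m(1) nonfaces_iff[OF NF_carrier[OF r(2)]] by (simp add: lookup_add)
    also have "\<dots> = at_empty (D If y) ({}, m) {}"
      unfolding lookup_sum_pk[OF m(1)] at_empty_apply D_column_empty[OF m(1)] using yv by simp
    finally show "x ({}, m) {} = at_empty (D If y) ({}, m) {}" .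
  qed
  then show ?thesis unfolding BK_def Bt_def using yT by blast
qed

lemma BK_imp_pol_J0:
  assumes "x \<in> BK i"
  shows "pol i (\<lambda>m. x ({}, m) {}) \<in> J0"
proof -
  obtain y where y: "y \<in> Tsp d If \<Delta> (0 - 1) i" "x = at_empty (D If y)"
    using assms unfolding BK_def Bt_def by blast
  define r where "r k = pol (i - 1) (\<lambda>m. y ({}, m) {k})" for k
  have r: "Poly_Mapping.lookup (r k) m = y ({}, m) {k}" if "k < d" for k m
  proof (cases "y ({}, m) {k} = 0")
    case False
    from TspD(2,4)[OF y(1) this] show ?thesis by (auto simp: r_def lookup_pol If_def)
  qed (simp add: r_def lookup_pol)
  have "pol i (\<lambda>m. x ({}, m) {}) - (\<Sum>k<d. r k * pk k) \<in> NF"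
  proof (subst nonfaces_iff)
    show "pol i (\<lambda>m. x ({}, m) {}) - (\<Sum>k<d. r k * pk k) \<in> carrier R"
      by (intro ps.subspace_diff[OF subspace_poly_alg] pol_carrier sum_pk_carrier) (simp add: r_def pol_carrier)
    show "\<forall>m. Poly_Mapping.keys m \<in> \<Delta> \<longrightarrow>
      Poly_Mapping.lookup (pol i (\<lambda>m. x ({}, m) {}) - (\<Sum>k<d. r k * pk k)) m = 0"
    proof (intro allI impI)
      fix m :: "'v \<Rightarrow>\<^sub>0 nat" assume m: "Poly_Mapping.keys m \<in> \<Delta>"
      have "Poly_Mapping.lookup (\<Sum>k<d. r k * pk k) m = D If y ({}, m) {}"
        unfolding lookup_sum_pk[OF m] D_column_empty[OF m] using r by simp
      moreover have "Poly_Mapping.lookup (pol i (\<lambda>m. x ({}, m) {})) m = D If y ({}, m) {}"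
        using TspD(4)[OF D_If_Tsp[OF y(1)], of "{}" m "{}"] m
        unfolding lookup_pol y(2) at_empty_apply by auto
      ultimately show "Poly_Mapping.lookup (pol i (\<lambda>m. x ({}, m) {}) - (\<Sum>k<d. r k * pk k)) m = 0"
        by (simp add: lookup_minus)
    qed
  qed
  then have "(\<Sum>k<d. r k * pk k) + (pol i (\<lambda>m. x ({}, m) {}) - (\<Sum>k<d. r k * pk k)) \<in> J0"
    by (intro J0I) (simp add: r_def pol_carrier)
  then show ?thesis by simp
qed

text \<open>In total degree 0 the column at the empty face consists of coefficient functions on the
  face monomials of degree \<open>i\<close>, a copy of the degree \<open>i\<close> part of the face
  ring. The polynomial \<open>pol\<close> of such a function dies in the quotient exactly for the
  elements of \<open>BK i\<close>.\<close>

lemma vdim_SR_quot_part: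
  "int (vdim (Q\<lparr>carrier := SR_quot_part \<Delta> forms i\<rparr>)) =
    int (ts.dim (Tsp d If {{}} 0 i :: ('v set \<times> ('v \<Rightarrow>\<^sub>0 nat) \<Rightarrow> nat set \<Rightarrow> 'k) set)) - int (ts.dim (BK i))"
proof -
  let ?M = "Q\<lparr>carrier := SR_quot_part \<Delta> forms i\<rparr>"
  let ?T = "Tsp d If {{}} 0 i :: ('v set \<times> ('v \<Rightarrow>\<^sub>0 nat) \<Rightarrow> nat set \<Rightarrow> 'k) set"
  define f where "f x = dcos (pol i (\<lambda>m. x ({}, m) {}))" for x :: "'v set \<times> ('v \<Rightarrow>\<^sub>0 nat) \<Rightarrow> nat set \<Rightarrow> 'k"
  have im: "f ` ?T = carrier ?M"
  proof (intro subset_antisym subsetI)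
    fix X assume "X \<in> f ` ?T"
    then show "X \<in> carrier ?M" using pol_homogeneous by (auto simp: f_def SR_quot_part_eq)
  next
    fix X assume "X \<in> carrier ?M"
    then obtain p where p: "p \<in> homogeneous V i" "X = dcos p" by (auto simp: SR_quot_part_eq)
    define x :: "'v set \<times> ('v \<Rightarrow>\<^sub>0 nat) \<Rightarrow> nat set \<Rightarrow> 'k" where
      "x = (\<lambda>(G, m) \<sigma>. if G = {} \<and> \<sigma> = {} \<and> Poly_Mapping.keys m \<in> \<Delta> \<and> pdeg m = i then Poly_Mapping.lookup p m else 0)"
    have xT: "x \<in> ?T" by (rule TspI) (auto simp: x_def If_def split: if_splits)
    have c: "p \<in> carrier R" using p(1) by (simp add: homogeneous_def)
    have "p - pol i (\<lambda>m. x ({}, m) {}) \<in> NF"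
    proof (subst nonfaces_iff)
      show "p - pol i (\<lambda>m. x ({}, m) {}) \<in> carrier R" by (rule ps.subspace_diff[OF subspace_poly_alg c pol_carrier])
      show "\<forall>m. Poly_Mapping.keys m \<in> \<Delta> \<longrightarrow> Poly_Mapping.lookup (p - pol i (\<lambda>m. x ({}, m) {})) m = 0"
        using p(1) by (auto simp: lookup_minus lookup_pol x_def homogeneous_def pdeg_def[symmetric] in_keys_iff)
    qed
    then have "p - pol i (\<lambda>m. x ({}, m) {}) \<in> J0" using NF_J0 by blast
    then have "X = f x" unfolding p(2) f_def dcos_eq_iff .
    then show "X \<in> f ` ?T" using xT by blast
  qed
  have "vdim ?M + ts.dim {x \<in> ?T. f x = \<zero>\<^bsub>?M\<^esub>} = ts.dim ?T"
  proof (rule vdim_image[OF kspace_tscale subspace_Tsp im])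
    show "f 0 = \<zero>\<^bsub>?M\<^esub>" by (simp add: f_def pol_def Q_zero)
    show "f (x + y) = f x \<oplus>\<^bsub>?M\<^esub> f y" for x y by (simp add: f_def pol_add Q_add)
    show "f (tscale c x) = c \<odot>\<^bsub>?M\<^esub> f x" for c x by (simp add: f_def pol_scale Q_smult)
    show "ts.fdim ?T" by (rule fdim_Tsp[OF okI_If])
  qed
  moreover have "{x \<in> ?T. f x = \<zero>\<^bsub>?M\<^esub>} = BK i"
  proof (intro subset_antisym subsetI)
    fix x assume "x \<in> {x \<in> ?T. f x = \<zero>\<^bsub>?M\<^esub>}"
    then have "x \<in> ?T" "dcos (pol i (\<lambda>m. x ({}, m) {})) = dcos 0" by (simp_all add: f_def Q_zero)
    then show "x \<in> BK i" using pol_J0_imp_BK by (simp add: dcos_eq_iff)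
  next
    fix x assume x: "x \<in> BK i"
    then have "dcos (pol i (\<lambda>m. x ({}, m) {})) = dcos 0" using BK_imp_pol_J0 by (simp add: dcos_eq_iff)
    then show "x \<in> {x \<in> ?T. f x = \<zero>\<^bsub>?M\<^esub>}" using x BK_subset by (auto simp: f_def Q_zero)
  qed
  ultimately show ?thesis by simp
qed

lemma hilbert_coefficient:
  assumes hom: "hom_isolated_singularities TYPE('k) \<Delta>" and dim: "sc_dim \<Delta> = int d - 1"
  shows "int (vdim (Q\<lparr>carrier := SR_quot_part \<Delta> forms i\<rparr>)) = (if i \<le> d then h_vec \<Delta> i else 0)
      + int (d choose i) *
          (\<Sum>j=1..i - 1. (-1) ^ (i - j - 1) * int (betti TYPE('k) \<Delta> (int j - 1)))
      + int ((d - 1) choose i) *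
          (int (sing_K TYPE('k) \<Delta> (int i - 1))
           - (\<Sum>v\<in>V. \<Sum>j=1..i - 2.
                (-1) ^ (i - j) * int (betti TYPE('k) (vlink \<Delta> v) (int j - 1))))"
proof -
  define hP where "hP j = int (fs.dim (Zs {} j)) - int (fs.dim (Bs {} j))" for j
  define hV where "hV v j = int (fs.dim (Zs {v} j)) - int (fs.dim (Bs {v} j))" for v j
  define K where "K = (\<Sum>v\<in>V. int (fs.dim (Zs {v} (int i) \<inter> Bs {} (int i))) - int (fs.dim (Bs {v} (int i))))"
  have iso: "isolated_singularities TYPE('k) \<Delta>" and pure: "pure_complex \<Delta>"
    using hom by (simp_all add: hom_isolated_singularities_def isolated_singularities_def)
  note indep = hom_isolated_indep[OF hom dim]
  have main: "int (vdim (Q\<lparr>carrier := SR_quot_part \<Delta> forms i\<rparr>)) =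
    (\<Sum>p=0..i+1. (-1) ^ p * int (kdim i p))
    + int (d choose i) * (\<Sum>p=1..i+1. (-1) ^ (p - 1) * hP (int i - int p))
    + int ((d - 1) choose i) * ((\<Sum>v\<in>V. \<Sum>p=1..i+1. (-1) ^ p * hV v (int i - int p)) + K)"
    unfolding vdim_SR_quot_part hP_def hV_def K_def by (rule quotient_dimension[OF indep])
  have E: "(\<Sum>p=0..i+1. (-1) ^ p * int (kdim i p)) = (if i \<le> d then h_vec \<Delta> i else 0)"
    unfolding kdim_def by (rule h_vec_euler[OF card_le dim])
  have bP: "hP j = int (betti TYPE('k) \<Delta> (j - 1))" for j
    using betti_link[OF empty_face, of j] unfolding link_empty hP_def by simp
  have bV: "hV v (j + 1) = int (betti TYPE('k) (vlink \<Delta> v) (j - 1))" if "v \<in> V" for v j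
  proof -
    have "{v} \<in> \<Delta>" using that face_subset by blast
    from betti_link[OF this, of j] show ?thesis unfolding hV_def by simp
  qed
  have ext: "\<exists>w. insert w G \<in> \<Delta> \<and> w \<notin> G" if G: "G \<in> \<Delta>" "card G < d" for G
  proof -
    obtain F where F: "F \<in> \<Delta>" "G \<subseteq> F" "card F = d" using face_in_facet[OF pure dim G(1)] by blast
    then obtain w where w: "w \<in> F" "w \<notin> G" using G(2) by (metis less_irrefl subsetI subset_antisym)
    then have "insert w G \<in> \<Delta>" using F by (intro face_subset[OF F(1)]) auto
    then show ?thesis using w by blast
  qed
  have hPb: "hP (-1) = 0" unfolding hP_def by (rule dim_Zs_0[OF Zs_below]) simp
  have P: "int (d choose i) * (\<Sum>p=1..i+1. (-1) ^ (p - 1) * hP (int i - int p)) =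
    int (d choose i) * (\<Sum>j=1..i - 1. (-1) ^ (i - j - 1) * int (betti TYPE('k) \<Delta> (int j - 1)))"
  \<comment> \<open>Beyond \<open>d\<close> the binomial coefficient is zero. Otherwise
    \<open>i \<ge> 1\<close> gives \<open>d \<ge> 1\<close>, so by purity the empty face is not a
    facet and the Betti number in degree -1 vanishes.\<close>
  proof (cases "i \<le> d")
    case True
    have "hP 0 = 0" if i: "i \<ge> 1"
    proof -
      obtain w where "insert w {} \<in> \<Delta>" using ext[OF empty_face] i True by auto
      from Zs_at_card[OF this] show ?thesis unfolding hP_def by (intro dim_Zs_0) simp
    qed
    then show ?thesis using alternating_reindex[of hP i, OF hPb] by (simp add: bP)
  qed (simp add: binomial_eq_0)
  have W: "int ((d - 1) choose i) * ((\<Sum>v\<in>V. \<Sum>p=1..i+1. (-1) ^ p * hV v (int i - int p)) + K) =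
    int ((d - 1) choose i) * (int (sing_K TYPE('k) \<Delta> (int i - 1))
      - (\<Sum>v\<in>V. \<Sum>j=1..i - 2. (-1) ^ (i - j) * int (betti TYPE('k) (vlink \<Delta> v) (int j - 1))))"
  proof (cases "i \<le> d - 1")
    case True
    have "K = int (sing_K TYPE('k) \<Delta> (int i - 1))"
      unfolding K_def
    proof (rule sing_K_eq[symmetric])
      fix c assume c: "\<And>v. v \<in> V \<Longrightarrow> c v \<in> Zs {v} (int i)" "(\<Sum>v\<in>V. c v) \<in> Bs {} (int i)"
      show "\<forall>v\<in>V. c v \<in> Bs {} (int i)"
      \<comment> \<open>The bound \<open>i \<le> d - 1\<close> implies \<open>i < d\<close> only for
        positive \<open>d\<close>, since the subtraction truncates; for \<open>d = 0\<close> there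
        are no vertices.\<close>
      proof (cases "d = 0")
        case True
        then have "F = {}" if "F \<in> \<Delta>" for F using card_le[OF that] finite_face[OF that] by simp
        then show ?thesis by blast
      next
        case False
        then show ?thesis using True by (intro indep c) simp_all
      qed
    qed
    moreover have "(\<Sum>p=1..i+1. (-1) ^ p * hV v (int i - int p)) =
      - (\<Sum>j=1..i - 2. (-1) ^ (i - j) * int (betti TYPE('k) (vlink \<Delta> v) (int j - 1)))" if v: "v \<in> V" for v
    proof -
      have "hV v (-1) = 0" "hV v 0 = 0" unfolding hV_def by (rule dim_Zs_0[OF Zs_below], simp)+
      \<comment> \<open>From \<open>2 \<le> i \<le> d - 1\<close> follows \<open>d \<ge> 3\<close>,
        so by purity a single vertex is not a facet and its link is nonempty beyond the empty
        face.\<close>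
      moreover have "hV v 1 = 0" if i: "i \<ge> 2"
      proof -
        have "{v} \<in> \<Delta>" using v face_subset by blast
        moreover have "card {v} < d" using i True by simp
        ultimately obtain w where "insert w {v} \<in> \<Delta>" "w \<notin> {v}" using ext[of "{v}"] by blast
        from Zs_at_card[OF this] show ?thesis unfolding hV_def by (intro dim_Zs_0) simp
      qed
      ultimately show ?thesis using alternating_reindex_shift[of "hV v" i] by (simp add: bV[OF v])
    qed
    ultimately show ?thesis by (simp add: sum_negf)
  qed (simp add: binomial_eq_0)
  show ?thesis unfolding main E P W ..
qed

end

theorem theorem4p2:
  fixes \<Delta> :: "'v::linorder set set"
    and \<Theta> :: "(('v \<Rightarrow>\<^sub>0 nat) \<Rightarrow>\<^sub>0 'k::field) set set"
    and d :: nat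
  assumes "infinite (UNIV :: 'k set)"
    and "simplicial_complex \<Delta>"
    and "sc_dim \<Delta> = int d - 1"
    and "hom_isolated_singularities TYPE('k) \<Delta>"
    and "lsop \<Delta> \<Theta>"
  defines "h' \<equiv> \<lambda>i::nat.
      h_vec \<Delta> i
      + int (d choose i) *
          (\<Sum>j=1..i - 1. (-1) ^ (i - j - 1) * int (betti TYPE('k) \<Delta> (int j - 1)))
      + int ((d - 1) choose i) *
          (int (sing_K TYPE('k) \<Delta> (int i - 1))
           - (\<Sum>v\<in>\<Union>\<Delta>. \<Sum>j=1..i - 2.
                (-1) ^ (i - j) * int (betti TYPE('k) (vlink \<Delta> v) (int j - 1))))"
  shows "hilbert_series \<Delta> \<Theta> = (\<Sum>i=0..d. fps_const (h' i) * fps_X ^ i)"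
proof -
  have hom: "hom_isolated_singularities TYPE('k) \<Delta>" and dim: "sc_dim \<Delta> = int d - 1" by fact+
  have T: "\<Theta> \<subseteq> SR_part \<Delta> 1" "finite \<Theta>" "card \<Theta> = d" "vectorspace.fin_dim class_ring (SR_quot \<Delta> \<Theta>)"
    using \<open>lsop \<Delta> \<Theta>\<close> dim by (auto simp: lsop_def)
  \<comment> \<open>An enumeration of the l.s.o.p. makes the exterior indices numbers below
    \<open>d\<close>, with the linear order that the signs use.\<close>
  obtain t where "bij_betw t {0..<d} \<Theta>" using ex_bij_betw_nat_finite[OF T(2)] T(3) by blast
  then have t: "t ` {..<d} = \<Theta>" by (auto simp: bij_betw_def atLeast0LessThan)
  have "\<forall>k\<in>{..<d}. \<exists>p. p \<in> homogeneous (\<Union>\<Delta>) 1 \<and> t k = SR_ideal \<Delta> +>\<^bsub>poly_alg (\<Union>\<Delta>)\<^esub> p"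
  proof
    fix k assume "k \<in> {..<d}"
    then have "t k \<in> SR_part \<Delta> 1" using t T(1) by blast
    then show "\<exists>p. p \<in> homogeneous (\<Union>\<Delta>) 1 \<and> t k = SR_ideal \<Delta> +>\<^bsub>poly_alg (\<Union>\<Delta>)\<^esub> p"
      by (auto simp: SR_part_def)
  qed
  from bchoice[OF this] obtain pk where
    pk: "\<And>k. k < d \<Longrightarrow> pk k \<in> homogeneous (\<Union>\<Delta>) 1"
      "\<And>k. k < d \<Longrightarrow> t k = SR_ideal \<Delta> +>\<^bsub>poly_alg (\<Union>\<Delta>)\<^esub> pk k"
    by blast
  define a where "a v k = (if k < d then Poly_Mapping.lookup (pk k) (xv v) else 0)" for v k
  interpret F: linear_forms \<Delta> d a pk
    by unfold_locales (rule \<open>simplicial_complex \<Delta>\<close>, erule pk(1), rule a_def)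
  have forms: "F.forms = \<Theta>"
    unfolding t[symmetric] using pk(2) by (intro image_cong) (simp_all add: F.SR_ideal_eq F.a_r_coset_poly_alg)
  have fin: "vectorspace.fin_dim class_ring F.Q" using T(4) unfolding forms .
  have iso: "isolated_singularities TYPE('k) \<Delta>" using hom by (simp add: hom_isolated_singularities_def)
  \<comment> \<open>The finite-dimensional quotient yields the dual families on faces, and the
    isolated singularities yield exactness over faces with at least two vertices.\<close>
  interpret I: isolated_forms \<Delta> d a pk
    by unfold_locales
      (use F.dual_on_face[OF fin] F.isolated_exact[OF iso dim] F.card_face_dim[OF dim] in auto)
  show ?thesis
  proof (rule fps_ext)
    fix i
    \<comment> \<open>For \<open>i > d\<close> both binomial coefficients vanish as well, so the
      coefficient is zero and the series is the stated polynomial.\<close>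
    have "fps_nth (hilbert_series \<Delta> \<Theta>) i = (if i \<le> d then h' i else 0)"
      unfolding hilbert_series_def fps_nth_Abs_fps h'_def
      using I.hilbert_coefficient[OF hom dim, of i] unfolding forms by (auto simp: binomial_eq_0)
    also have "\<dots> = (\<Sum>j=0..d. if i = j then h' j else 0)" by simp
    also have "\<dots> = fps_nth (\<Sum>i=0..d. fps_const (h' i) * fps_X ^ i) i"
      unfolding fps_sum_nth by (intro sum.cong) (simp_all add: fps_X_power_nth)
    finally show "fps_nth (hilbert_series \<Delta> \<Theta>) i = fps_nth (\<Sum>i=0..d. fps_const (h' i) * fps_X ^ i) i" .
  qed
qed

end
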